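(* Let $\alpha\in(0,1)$ and $a=\frac{1}{\Gamma(1+\alpha)2^\alpha}$. For a $\mathrm{BESQ}(-2\alpha)$-marked spectrally positive stable process $X_a$ with Laplace exponent $\psi_a(\eta)=\frac{\eta^{1+\alpha}}{\Gamma(1+\alpha)2^\alpha}$, we have almost surely $$\lim_{h\downarrow 0}\ \sup_{0\le t\le T}\ \sup_{y\in\mathbb{R}}\left|\Gamma(1-\alpha)h^{\alpha}m_{h,a}(y,t)-\ell^y_a(t)\right|=0\qquad\text{for all }T>0,$$ where the local times $\ell^y_a(t)$ and mass counts $m_{h,a}(y,t)$ are associated with $X_a$ for $y\in\mathbb{R}$, $t\ge0$, $h>0$.
   Context: $X_a=(X_a(t),t\ge0)$ is a Lévy process with $X_a(0)=0$, no negative jumps and $\mathbb{E}(e^{-\eta X_a(t)})=e^{t\psi_a(\eta)}$, $\eta\ge0$; $\Delta X_a(t)=X_a(t)-X_a(t-)$. $\mathrm{BESQ}$ denotes squared Bessel processes. A standard $\mathrm{BESQ}(-2\alpha)$ excursion (of length 1) is a random continuous nonnegative path $Z=(Z(s),0\le s\le1)$ with the law of a standard $\mathrm{BESQ}(4+2\alpha)$ bridge from $0$ to $0$. $\mathrm{BESQ}(-2\alpha)$-marking: given $X_a$, each jump $(t,\Delta X_a(t))$ with $x=\Delta X_a(t)>0$ is marked, independently over the jumps, by a path $Z_t$ distributed as $(xZ(s/x),0\le s\le x)$, i.e. a $\mathrm{BESQ}(-2\alpha)$ excursion of length $x$. Convention: $Z_t(s)=0$ for $s\notin(0,\Delta X_a(t))$,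 and $Z_t\equiv0$ if $\Delta X_a(t)=0$. $m_{h,a}(y,T)=\#\{0\le t\le T:Z_t(y-X_a(t-))\ge h\}$. $(\ell_a^y(t))$ are the jointly continuous local times of $X_a$, normalised by $\int_0^Tf(X_a(t))\,dt=\int_{-\infty}^\infty f(y)\ell_a^y(T)\,dy$ a.s. for all bounded measurable $f:\mathbb{R}\to\mathbb{R}$ and $T\ge0$. *)

theory Defs
  imports "HOL-Probability.Probability"
begin

text \<open>
  Stochastic processes indexed by time \<open>t \<ge> 0\<close> are functions \<open>real \<Rightarrow> 'w \<Rightarrow> real\<close>; their values at
  negative times are irrelevant.
\<close>

definition process_algebra :: "'w measure \<Rightarrow> 'i set \<Rightarrow> ('i \<Rightarrow> 'w \<Rightarrow> real) \<Rightarrow> 'w measure" where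
  "process_algebra M I Y =
     vimage_algebra (space M) (\<lambda>\<omega>. \<lambda>i\<in>I. Y i \<omega>) (\<Pi>\<^sub>M i\<in>I. borel)"


section \<open>Spectrally positive Levy processes\<close>

definition left_limit :: "(real \<Rightarrow> real) \<Rightarrow> real \<Rightarrow> real" where
  "left_limit f t = (if t \<le> 0 then f 0 else Lim (at_left t) f)"

definition jump :: "(real \<Rightarrow> real) \<Rightarrow> real \<Rightarrow> real" where
  "jump f t = f t - left_limit f t"

definition cadlag :: "(real \<Rightarrow> real) \<Rightarrow> bool" where
  "cadlag f \<longleftrightarrow> (\<forall>t\<ge>0. continuous (at_right t) f) \<and> (\<forall>t>0. \<exists>l. (f \<longlongrightarrow> l) (at_left t))"

definition levy_process :: "'w measure \<Rightarrow> (real \<Rightarrow> 'w \<Rightarrow> real) \<Rightarrow> bool" where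
  "levy_process M X \<longleftrightarrow>
     (\<forall>t\<ge>0. X t \<in> borel_measurable M) \<and>
     (AE \<omega> in M. X 0 \<omega> = 0) \<and>
     (AE \<omega> in M. cadlag (\<lambda>t. X t \<omega>)) \<and>
     (\<forall>(t :: nat \<Rightarrow> real) n. 0 \<le> t 0 \<and> mono t \<longrightarrow>
        prob_space.indep_vars M (\<lambda>_. borel) (\<lambda>i \<omega>. X (t (Suc i)) \<omega> - X (t i) \<omega>) {..<n}) \<and>
     (\<forall>s\<ge>0. \<forall>t\<ge>0. distr M borel (\<lambda>\<omega>. X (s + t) \<omega> - X s \<omega>) = distr M borel (X t))"

definition no_negative_jumps :: "'w measure \<Rightarrow> (real \<Rightarrow> 'w \<Rightarrow> real) \<Rightarrow> bool" where
  "no_negative_jumps M X \<longleftrightarrow> (AE \<omega> in M. \<forall>t\<ge>0. 0 \<le> jump (\<lambda>u. X u \<omega>) t)"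

definition has_laplace_exponent ::
    "'w measure \<Rightarrow> (real \<Rightarrow> 'w \<Rightarrow> real) \<Rightarrow> (real \<Rightarrow> real) \<Rightarrow> bool" where
  "has_laplace_exponent M X \<psi> \<longleftrightarrow>
     (\<forall>t\<ge>0. \<forall>\<eta>\<ge>0. has_bochner_integral M (\<lambda>\<omega>. exp (- \<eta> * X t \<omega>)) (exp (t * \<psi> \<eta>)))"


section \<open>Squared Bessel bridges and excursions\<close>

text \<open>
  For \<open>\<delta> > 0\<close> the transition law of \<open>BESQ(\<delta>)\<close> started from \<open>x\<close> at time \<open>t > 0\<close> has Lebesgue density
  \<open>1/(2t) (y/x)^(\<nu>/2) exp(-(x+y)/(2t)) I\<^sub>\<nu>(sqrt(x y)/t)\<close> on \<open>y > 0\<close>, where \<open>\<nu> = \<delta>/2 - 1\<close> and \<open>I\<^sub>\<nu>\<close> is the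
  modified Bessel function. Inserting the power series of \<open>I\<^sub>\<nu>\<close> and splitting off the factor \<open>y^\<nu>\<close>
  gives the density below with respect to \<open>y^\<nu> dy\<close>. Unlike the Lebesgue density, it is symmetric,
  continuous and strictly positive on all of \<open>x, y \<ge> 0\<close>, so that bridges ending at \<open>0\<close> need no
  limiting procedure. The lemma \<open>besq_density_laplace\<close> is the familiar formula for the Laplace
  transform of the transition law.
\<close>

definition besq_reference :: "real \<Rightarrow> real measure" where
  "besq_reference \<delta> = density lborel (\<lambda>y. ennreal (indicator {0<..} y * y powr (\<delta>/2 - 1)))"

definition besq_density :: "real \<Rightarrow> real \<Rightarrow> real \<Rightarrow> real \<Rightarrow> real" where
  "besq_density \<delta> t x y =
     (2 * t) powr (- (\<delta>/2)) * exp (- (x + y) / (2 * t)) *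
     (\<Sum>k. (x * y / (4 * t^2)) ^ k / (fact k * Gamma (real k + \<delta>/2)))"

text \<open>
  A standard bridge from \<open>0\<close> to \<open>0\<close> has, at times \<open>0 = t\<^sub>0 < t\<^sub>1 < \<dots> < t\<^sub>n < t\<^sub>n\<^sub>+\<^sub>1 = 1\<close>, the joint density
  \<open>p(t\<^sub>1 - t\<^sub>0, 0, x\<^sub>1) p(t\<^sub>2 - t\<^sub>1, x\<^sub>1, x\<^sub>2) \<cdots> p(t\<^sub>n\<^sub>+\<^sub>1 - t\<^sub>n, x\<^sub>n, 0) / p(1, 0, 0)\<close> with respect to the product
  of the reference measures, \<open>p\<close> being the transition density.
\<close>

definition besq_bridge_density :: "real \<Rightarrow> nat \<Rightarrow> (nat \<Rightarrow> real) \<Rightarrow> (nat \<Rightarrow> real) \<Rightarrow> real" where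
  "besq_bridge_density \<delta> n t x =
     (let x' = (\<lambda>i. if i \<in> {1..n} then x i else 0)
      in (\<Prod>i\<le>n. besq_density \<delta> (t (Suc i) - t i) (x' i) (x' (Suc i))) / besq_density \<delta> 1 0 0)"

definition standard_besq_bridge :: "'w measure \<Rightarrow> real \<Rightarrow> (real \<Rightarrow> 'w \<Rightarrow> real) \<Rightarrow> bool" where
  "standard_besq_bridge M \<delta> Y \<longleftrightarrow>
     (\<forall>s\<in>{0..1}. Y s \<in> borel_measurable M) \<and>
     (AE \<omega> in M. continuous_on {0..1} (\<lambda>s. Y s \<omega>) \<and> (\<forall>s\<in>{0..1}. 0 \<le> Y s \<omega>) \<and>
        Y 0 \<omega> = 0 \<and> Y 1 \<omega> = 0) \<and>
     (\<forall>n t. t 0 = 0 \<and> t (Suc n) = 1 \<and> strict_mono_on {..Suc n} t \<longrightarrow>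
        distr M (\<Pi>\<^sub>M i\<in>{1..n}. borel) (\<lambda>\<omega>. \<lambda>i\<in>{1..n}. Y (t i) \<omega>) =
        density (\<Pi>\<^sub>M i\<in>{1..n}. besq_reference \<delta>) (\<lambda>x. ennreal (besq_bridge_density \<delta> n t x)))"

text \<open>The standard \<open>BESQ(-2\<alpha>)\<close> excursion is by definition the standard \<open>BESQ(4+2\<alpha>)\<close> bridge.\<close>

definition standard_besq_excursion :: "'w measure \<Rightarrow> real \<Rightarrow> (real \<Rightarrow> 'w \<Rightarrow> real) \<Rightarrow> bool" where
  "standard_besq_excursion M \<alpha> Y \<longleftrightarrow> standard_besq_bridge M (4 + 2 * \<alpha>) Y"


section \<open>Marked processes, mass counts and local times\<close>

text \<open>
  In \<open>besq_marking M \<alpha> X Z\<close> the value of the mark \<open>Z\<^sub>t\<close> at level \<open>s\<close> is \<open>Z t s \<omega>\<close>. The conditional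
  independence of the marks given \<open>X\<close> is expressed by listing the countably many jump times as
  \<open>\<tau> 0, \<tau> 1, \<dots>\<close>, each of them exactly once and each \<open>\<tau> n\<close> a function of the path of \<open>X\<close>, such that the
  marks, rescaled to unit length, are i.i.d. standard excursions independent of \<open>X\<close>. Some of the
  \<open>\<tau> n\<close> need not be jump times; the excursions attached to these are not used.
\<close>

definition besq_marking ::
    "'w measure \<Rightarrow> real \<Rightarrow> (real \<Rightarrow> 'w \<Rightarrow> real) \<Rightarrow> (real \<Rightarrow> real \<Rightarrow> 'w \<Rightarrow> real) \<Rightarrow> bool" where
  "besq_marking M \<alpha> X Z \<longleftrightarrow>
     (\<exists>(\<tau> :: nat \<Rightarrow> 'w \<Rightarrow> real) (e :: nat \<Rightarrow> real \<Rightarrow> 'w \<Rightarrow> real).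
        (\<forall>n. \<tau> n \<in> borel_measurable (process_algebra M {0..} X)) \<and>
        (AE \<omega> in M. \<forall>t\<ge>0. 0 < jump (\<lambda>u. X u \<omega>) t \<longrightarrow> (\<exists>!n. \<tau> n \<omega> = t)) \<and>
        (\<forall>n. standard_besq_excursion M \<alpha> (e n)) \<and>
        prob_space.indep_vars M (\<lambda>_. \<Pi>\<^sub>M s\<in>{0..1}. borel) (\<lambda>n \<omega>. \<lambda>s\<in>{0..1}. e n s \<omega>) UNIV \<and>
        prob_space.indep_set M
          (sets (process_algebra M {0..} X))
          (sets (process_algebra M (UNIV \<times> {0..1}) (\<lambda>(n, s). e n s))) \<and>
        (AE \<omega> in M. \<forall>t\<ge>0. \<forall>s. let x = jump (\<lambda>u. X u \<omega>) t in
           (s \<notin> {0<..<x} \<longrightarrow> Z t s \<omega> = 0) \<and>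
           (s \<in> {0<..<x} \<longrightarrow> (\<forall>n. \<tau> n \<omega> = t \<longrightarrow> Z t s \<omega> = x * e n (s / x) \<omega>))))"

text \<open>
  The count takes values in \<open>[0, \<infinity>]\<close>, because \<open>card\<close> would silently be \<open>0\<close> on infinite sets.
\<close>

definition mass_count ::
    "(real \<Rightarrow> 'w \<Rightarrow> real) \<Rightarrow> (real \<Rightarrow> real \<Rightarrow> 'w \<Rightarrow> real) \<Rightarrow> real \<Rightarrow> real \<Rightarrow> real \<Rightarrow> 'w \<Rightarrow> ereal" where
  "mass_count X Z h y T \<omega> =
     enn2ereal (emeasure (count_space UNIV)
       {t \<in> {0..T}. h \<le> Z t (y - left_limit (\<lambda>u. X u \<omega>) t) \<omega>})"

definition jointly_continuous_local_times ::
    "'w measure \<Rightarrow> (real \<Rightarrow> 'w \<Rightarrow> real) \<Rightarrow> (real \<Rightarrow> real \<Rightarrow> 'w \<Rightarrow> real) \<Rightarrow> bool" where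
  "jointly_continuous_local_times M X L \<longleftrightarrow>
     (\<forall>y. \<forall>t\<ge>0. L y t \<in> borel_measurable M) \<and>
     (AE \<omega> in M. continuous_on (UNIV \<times> {0..}) (\<lambda>(y, t). L y t \<omega>)) \<and>
     (AE \<omega> in M. \<forall>f \<in> borel_measurable borel. bounded (range f) \<longrightarrow> (\<forall>T\<ge>0.
        has_bochner_integral lborel (\<lambda>y. f y * L y T \<omega>) (LINT t:{0..T}|lborel. f (X t \<omega>))))"


subsection \<open>Laplace transform of the squared Bessel transition law\<close>

lemma nn_integral_powr_exp:
  fixes s c :: real
  assumes s: "s > 0" and c: "c > 0"
  shows "(\<integral>\<^sup>+y. ennreal (indicator {0<..} y * y powr (s - 1) * exp (- c * y)) \<partial>lborel)
           = ennreal (Gamma s / c powr s)"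
proof -
  let ?f = "\<lambda>y. ennreal (indicator {0<..} y * y powr (s - 1) * exp (- c * y))"
  have "(\<integral>\<^sup>+y. ?f y \<partial>lborel) = ennreal \<bar>1 / c\<bar> * (\<integral>\<^sup>+y. ?f (0 + (1 / c) * y) \<partial>lborel)"
    by (rule nn_integral_real_affine) (use c in auto)
  also have "(\<integral>\<^sup>+y. ?f (0 + (1 / c) * y) \<partial>lborel)
      = (\<integral>\<^sup>+y. ennreal (c powr (1 - s)) * ennreal (indicator {0..} y * y powr (s - 1) / exp y) \<partial>lborel)"
  proof (rule nn_integral_cong_AE, rule AE_mp[OF AE_lborel_singleton[of 0]], rule AE_I2, rule impI)
    fix y :: real assume "y \<noteq> 0"
    moreover have "(y / c) powr (s - 1) = c powr (1 - s) * y powr (s - 1)" if "y > 0"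
      using that c by (simp add: powr_divide powr_diff field_simps)
    ultimately show "?f (0 + (1 / c) * y)
        = ennreal (c powr (1 - s)) * ennreal (indicator {0..} y * y powr (s - 1) / exp y)"
      using c by (auto simp: indicator_def ennreal_mult' [symmetric] exp_minus field_simps)
  qed
  also have "\<dots> = ennreal (c powr (1 - s)) * ennreal (Gamma s)"
    by (subst nn_integral_cmult) (simp_all add: Gamma_conv_nn_integral_real[OF s])
  also have "ennreal \<bar>1 / c\<bar> * \<dots> = ennreal (1 / c * (c powr (1 - s) * Gamma s))"
    using c s by (simp add: ennreal_mult' [symmetric] Gamma_real_pos less_imp_le)
  also have "1 / c * (c powr (1 - s) * Gamma s) = Gamma s / c powr s"
    using c by (simp add: powr_diff)
  finally show ?thesis .
qed

lemma summable_besq_series: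
  fixes \<delta> z :: real
  assumes \<delta>: "\<delta> > 0" and z: "z \<ge> 0"
  shows "summable (\<lambda>k. z ^ k / (fact k * Gamma (real k + \<delta>/2)))"
proof (rule summable_ratio_test[where c = "1/2" and N = "nat \<lceil>2 * z\<rceil> + 1"])
  fix k assume k: "nat \<lceil>2 * z\<rceil> + 1 \<le> k"
  then have k1: "real k \<ge> 1" "real k \<ge> 2 * z" by linarith+
  have G: "Gamma (real k + \<delta>/2) > 0"
    using \<delta> by (intro Gamma_real_pos) auto
  have "Gamma (real (Suc k) + \<delta>/2) = (real k + \<delta>/2) * Gamma (real k + \<delta>/2)"
    using Gamma_plus1[of "real k + \<delta>/2"] \<delta> by (auto simp: algebra_simps nonpos_Ints_def)
  then have "norm (z ^ Suc k / (fact (Suc k) * Gamma (real (Suc k) + \<delta>/2)))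
      = norm (z * z ^ k / (real (Suc k) * fact k * ((real k + \<delta>/2) * Gamma (real k + \<delta>/2))))"
    by (simp only: fact_Suc power_Suc of_nat_mult of_nat_fact)
  also have "\<dots> = norm ((z / (real (Suc k) * (real k + \<delta>/2))) * (z ^ k / (fact k * Gamma (real k + \<delta>/2))))"
    by (simp only: times_divide_times_eq mult.assoc mult.left_commute mult.commute)
  also have "\<dots> = (z / (real (Suc k) * (real k + \<delta>/2))) * norm (z ^ k / (fact k * Gamma (real k + \<delta>/2)))"
    unfolding norm_mult using z \<delta> by simp
  finally have eq: "norm (z ^ Suc k / (fact (Suc k) * Gamma (real (Suc k) + \<delta>/2)))
      = (z / (real (Suc k) * (real k + \<delta>/2))) * norm (z ^ k / (fact k * Gamma (real k + \<delta>/2)))" .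
  have "2 * z * 1 \<le> real (Suc k) * (real k + \<delta>/2)"
    using k1 \<delta> z by (intro mult_mono) auto
  moreover have "0 < real (Suc k) * (real k + \<delta>/2)"
    using k1 \<delta> by (intro mult_pos_pos) auto
  ultimately have "z / (real (Suc k) * (real k + \<delta>/2)) \<le> 1/2"
    by (simp add: divide_le_eq)
  then show "norm (z ^ Suc k / (fact (Suc k) * Gamma (real (Suc k) + \<delta>/2)))
      \<le> 1/2 * norm (z ^ k / (fact k * Gamma (real k + \<delta>/2)))"
    unfolding eq by (rule mult_right_mono) simp
qed simp

lemma besq_density_laplace:
  fixes \<delta> t x r :: real
  assumes \<delta>: "\<delta> > 0" and t: "t > 0" and x: "x \<ge> 0" and r: "r \<ge> 0"
  shows "(\<integral>\<^sup>+y. ennreal (exp (- r * y) * besq_density \<delta> t x y) \<partial>besq_reference \<delta>)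
           = ennreal ((1 + 2 * r * t) powr (- (\<delta>/2)) * exp (- r * x / (1 + 2 * r * t)))"
proof -
  define c where "c = r + 1 / (2 * t)"
  have c: "c > 0" using t r by (simp add: c_def add_nonneg_pos)
  define C where "C = (2 * t) powr (- (\<delta>/2)) * exp (- x / (2 * t))"
  have C: "C \<ge> 0" by (simp add: C_def)
  define b where "b k = C * (x / (4 * t^2)) ^ k / (fact k * Gamma (real k + \<delta>/2))" for k
  have G: "Gamma (real k + \<delta>/2) > 0" for k
    using \<delta> by (intro Gamma_real_pos) auto
  have b: "b k \<ge> 0" for k
    using x C less_imp_le[OF G] by (simp add: b_def)
  let ?g = "\<lambda>k y. indicator {0<..} y * y powr (real k + \<delta>/2 - 1) * exp (- c * y)"
  have series: "ennreal (indicator {0<..} y * y powr (\<delta>/2 - 1))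
        * ennreal (exp (- r * y) * besq_density \<delta> t x y)
      = (\<Sum>k. ennreal (b k) * ennreal (?g k y))" for y
  proof (cases "y > 0")
    case y: True
    have "(\<lambda>k. (x * y / (4 * t^2)) ^ k / (fact k * Gamma (real k + \<delta>/2))) sums
        (\<Sum>k. (x * y / (4 * t^2)) ^ k / (fact k * Gamma (real k + \<delta>/2)))"
      using summable_besq_series[OF \<delta>, of "x * y / (4 * t^2)"] x y by (intro summable_sums) auto
    from sums_mult[OF this, of "C * exp (- c * y) * y powr (\<delta>/2 - 1)"]
    have "(\<lambda>k. b k * ?g k y) sums (C * exp (- c * y) * y powr (\<delta>/2 - 1) *
        (\<Sum>k. (x * y / (4 * t^2)) ^ k / (fact k * Gamma (real k + \<delta>/2))))"
    proof (rule back_subst[of "\<lambda>f. f sums _"], intro ext)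
      fix k
      have "y powr (real k + \<delta>/2 - 1) = y ^ k * y powr (\<delta>/2 - 1)"
        using y by (simp add: powr_realpow [symmetric] powr_add [symmetric] add_diff_eq)
      then show "C * exp (- c * y) * y powr (\<delta>/2 - 1) *
          ((x * y / (4 * t^2)) ^ k / (fact k * Gamma (real k + \<delta>/2))) = b k * ?g k y"
        using y by (simp add: b_def power_mult_distrib power_divide mult_ac)
    qed
    also have "C * exp (- c * y) * y powr (\<delta>/2 - 1) *
        (\<Sum>k. (x * y / (4 * t^2)) ^ k / (fact k * Gamma (real k + \<delta>/2)))
      = y powr (\<delta>/2 - 1) * (exp (- r * y) * besq_density \<delta> t x y)"
    proof -
      have "exp (- x / (2 * t)) * exp (- c * y) = exp (- r * y) * exp (- (x + y) / (2 * t))"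
        using t by (simp add: c_def exp_add [symmetric] field_simps)
      then show ?thesis by (simp add: C_def besq_density_def mult.assoc mult.left_commute)
    qed
    finally have "(\<Sum>k. ennreal (b k * ?g k y))
        = ennreal (y powr (\<delta>/2 - 1) * (exp (- r * y) * besq_density \<delta> t x y))"
      by (rule suminf_ennreal_eq[rotated]) (simp add: b)
    then show ?thesis
      using y b by (simp add: ennreal_mult' [symmetric])
  qed simp
  have "(\<lambda>y. besq_density \<delta> t x y) \<in> borel_measurable borel"
    unfolding besq_density_def by measurable
  then have "(\<integral>\<^sup>+y. ennreal (exp (- r * y) * besq_density \<delta> t x y) \<partial>besq_reference \<delta>)
      = (\<integral>\<^sup>+y. (\<Sum>k. ennreal (b k) * ennreal (?g k y)) \<partial>lborel)"
    unfolding besq_reference_def by (subst nn_integral_density) (simp_all only: series, measurable)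
  also have "\<dots> = (\<Sum>k. \<integral>\<^sup>+y. ennreal (b k) * ennreal (?g k y) \<partial>lborel)"
    by (rule nn_integral_suminf) measurable
  also have "\<dots> = (\<Sum>k. ennreal (b k * (Gamma (real k + \<delta>/2) / c powr (real k + \<delta>/2))))"
  proof (rule arg_cong[where f = suminf], rule ext)
    fix k
    have "(\<integral>\<^sup>+y. ennreal (b k) * ennreal (?g k y) \<partial>lborel)
        = ennreal (b k) * (\<integral>\<^sup>+y. ennreal (?g k y) \<partial>lborel)"
      by (rule nn_integral_cmult) measurable
    also have "(\<integral>\<^sup>+y. ennreal (?g k y) \<partial>lborel) = ennreal (Gamma (real k + \<delta>/2) / c powr (real k + \<delta>/2))"
      using nn_integral_powr_exp[of "real k + \<delta>/2" c] \<delta> c by simp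
    finally show "(\<integral>\<^sup>+y. ennreal (b k) * ennreal (?g k y) \<partial>lborel)
        = ennreal (b k * (Gamma (real k + \<delta>/2) / c powr (real k + \<delta>/2)))"
      by (simp only: ennreal_mult'[OF b])
  qed
  also have "\<dots> = ennreal (C * c powr (- (\<delta>/2)) * exp (x / (4 * t^2 * c)))"
  proof -
    have "(\<lambda>k. (x / (4 * t^2 * c)) ^ k / fact k) sums exp (x / (4 * t^2 * c))"
      using exp_converges[of "x / (4 * t^2 * c)"] by (simp add: field_simps)
    from sums_mult[OF this, of "C * c powr (- (\<delta>/2))"]
    have "(\<lambda>k. b k * (Gamma (real k + \<delta>/2) / c powr (real k + \<delta>/2))) sums
        (C * c powr (- (\<delta>/2)) * exp (x / (4 * t^2 * c)))"
    proof (rule back_subst[of "\<lambda>f. f sums _"], intro ext)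
      fix k
      have "c powr (real k + \<delta>/2) = c ^ k * c powr (\<delta>/2)"
        using c by (simp add: powr_realpow [symmetric] powr_add [symmetric])
      then show "C * c powr (- (\<delta>/2)) * ((x / (4 * t^2 * c)) ^ k / fact k)
          = b k * (Gamma (real k + \<delta>/2) / c powr (real k + \<delta>/2))"
        using G[of k] by (simp add: b_def power_mult_distrib power_divide powr_minus_divide mult_ac)
    qed
    moreover have "b k * (Gamma (real k + \<delta>/2) / c powr (real k + \<delta>/2)) \<ge> 0" for k
      using b[of k] less_imp_le[OF G[of k]] by simp
    ultimately show ?thesis by (intro suminf_ennreal_eq)
  qed
  also have "C * c powr (- (\<delta>/2)) * exp (x / (4 * t^2 * c))
      = (1 + 2 * r * t) powr (- (\<delta>/2)) * exp (- r * x / (1 + 2 * r * t))"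
  proof -
    have tc: "2 * t * c = 1 + 2 * r * t" using t by (simp add: c_def field_simps)
    have "(2 * t) powr (- (\<delta>/2)) * c powr (- (\<delta>/2)) = (1 + 2 * r * t) powr (- (\<delta>/2))"
      using t c by (simp add: powr_mult [symmetric] tc)
    moreover have "- x / (2 * t) + x / (4 * t^2 * c) = - r * x / (1 + 2 * r * t)"
    proof -
      have pos: "1 + 2 * r * t > 0" using t r by (simp add: add_pos_nonneg)
      have "- x / (2 * t) + x / (4 * t^2 * c) = - x / (2 * t) + x / (2 * t * (1 + 2 * r * t))"
        unfolding tc [symmetric] by (simp add: power2_eq_square mult_ac)
      also have "\<dots> = (x - (1 + 2 * r * t) * x) / (2 * t * (1 + 2 * r * t))"
        using t pos by (simp add: diff_divide_distrib)
      also have "\<dots> = 2 * t * (- r * x) / (2 * t * (1 + 2 * r * t))"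
        by (simp add: algebra_simps)
      also have "\<dots> = - r * x / (1 + 2 * r * t)"
        using t by (subst mult_divide_mult_cancel_left) auto
      finally show ?thesis .
    qed
    ultimately show ?thesis
      by (simp add: C_def exp_add [symmetric] mult.assoc mult.left_commute)
  qed
  finally show ?thesis .
qed

end

theory Submission
  imports Defs
begin

text \<open>
  The count \<open>m(y, t)\<close> at height \<open>h\<close> is a sum, over the marked jumps up to time \<open>t\<close>, of the indicator of
  \<open>h \<le> x p(r / x)\<close>, where \<open>x\<close> is the size of the jump, \<open>r = y - X(s-)\<close> the level at which its mark is read
  and \<open>p\<close> the unit excursion of the mark. Its compensator is the integral of \<open>g\<^sub>h(y - X(s))\<close> over \<open>0 \<le> s \<le> t\<close>,
  \<open>g\<^sub>h(r)\<close> being the integral of the indicator with respect to the Levy measure and the law of \<open>p\<close>.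
  Since the Levy density is homogeneous of degree \<open>-2 - \<alpha>\<close>, the kernels \<open>h powr \<alpha> * g\<^sub>h(r) = g\<^sub>1(r / h) / h\<close>
  form an approximate identity, and their mass, the integral of \<open>g\<^sub>1\<close>, is \<open>1 / Gamma (1 - \<alpha>)\<close>: after the
  substitution \<open>r = x u\<close> it is a multiple of the \<open>\<alpha>\<close>-th moment of a bridge, integrated over \<open>u\<close>
  (\<open>total_intensity\<close>). By the occupation formula \<open>Gamma (1 - \<alpha>) * h powr \<alpha>\<close> times the compensator is thus an
  average of local times over levels at distance of order \<open>h\<close>, and it converges to the local time uniformly,
  because the local time is uniformly continuous (\<open>approximate_identity\<close>).

  It remains to see that the count stays close to its compensator. For a sum \<open>S\<close> of weights of marked
  jumps and its compensator \<open>A\<close>, the expectation of \<open>exp (\<theta> S - (exp \<theta> - 1) A)\<close> is at most \<open>1\<close>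
  (\<open>exponential_inequality\<close>). This is proved by discretisation. On a time grid, stationary and
  independent increments give a product whose factors have conditional mean at most \<open>1\<close>; as the mesh
  tends to \<open>0\<close>, the product tends path by path to one over the jumps, the normalisation tends
  to the compensator because the laws of small increments converge vaguely to the Levy density
  (\<open>levy_vague_convergence\<close>), and Fatou's lemma applies. The marks are integrated out given \<open>X\<close>
  (\<open>integrate_marks\<close>).

  The limits above need weights that are continuous, and uniformity in \<open>y\<close> needs weights that do not
  notice small changes of \<open>y\<close>. The indicator is therefore enclosed between \<open>lower_weight j\<close> and
  \<open>upper_weight j\<close>, which control it for all levels within \<open>h / j\<close> of a given one and whose total intensities
  both tend to \<open>1 / Gamma (1 - \<alpha>)\<close> as \<open>j\<close> grows (\<open>limsup_upper_intensity\<close>, \<open>liminf_lower_intensity\<close>); for the upper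
  bound the tail of the maximum of a bridge provides integrability (\<open>bridge_maximal_inequality\<close>).
  At height \<open>h = 1 / k\<close> the levels \<open>i / (j k)\<close> represent all levels in a bounded interval. There are of order
  \<open>k\<close> of them, each is bad with probability at most \<open>2 / k\<^sup>3\<close> when deviations of order \<open>ln k\<close> are
  allowed, and these are negligible compared with \<open>k powr \<alpha>\<close>; so the Borel-Cantelli lemma yields convergence
  along \<open>h = 1 / k\<close>, uniformly in \<open>y\<close>, for every rational \<open>t\<close>. The count is monotone in \<open>h\<close> and in \<open>t\<close>,
  which extends the convergence to all \<open>h\<close> and, uniformly, to all \<open>t \<le> T\<close>.
\<close>


section \<open>Cadlag paths sampled on fine grids\<close>

lemma cadlag_left_limit:
  assumes "cadlag f" "0 < t"
  shows "(f \<longlongrightarrow> left_limit f t) (at_left t)"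
proof -
  obtain l where l: "(f \<longlongrightarrow> l) (at_left t)" using assms by (auto simp: cadlag_def)
  then have "Lim (at_left t) f = l" by (intro tendsto_Lim) auto
  with l assms(2) show ?thesis by (simp add: left_limit_def)
qed

lemma cadlag_right_limit:
  assumes "cadlag f" "0 \<le> t"
  shows "(f \<longlongrightarrow> f t) (at_right t)"
  using assms by (auto simp: cadlag_def continuous_within)

lemma cadlag_locally_near:
  assumes f: "cadlag f" and e: "0 < e" and s: "0 \<le> s"
  obtains d where "0 < d" "\<And>x. s \<le> x \<Longrightarrow> x < s + d \<Longrightarrow> \<bar>f x - f s\<bar> < e"
    "\<And>x. 0 \<le> x \<Longrightarrow> s - d < x \<Longrightarrow> x < s \<Longrightarrow> \<bar>f x - left_limit f s\<bar> < e"
proof -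
  have "\<forall>\<^sub>F x in at_right s. dist (f x) (f s) < e"
    using cadlag_right_limit[OF f s] e by (rule tendstoD)
  then obtain d1 where d1: "0 < d1" "\<And>x. s < x \<Longrightarrow> x < s + d1 \<Longrightarrow> \<bar>f x - f s\<bar> < e"
    unfolding eventually_at_right_field dist_real_def
    by (metis add.commute diff_add_cancel diff_gt_0_iff_gt)
  have "\<exists>d2>0. \<forall>x. 0 \<le> x \<longrightarrow> s - d2 < x \<longrightarrow> x < s \<longrightarrow> \<bar>f x - left_limit f s\<bar> < e"
  proof (cases "s = 0")
    case False
    then have "0 < s" using s by simp
    from tendstoD[OF cadlag_left_limit[OF f this] e]
    have "\<forall>\<^sub>F x in at_left s. dist (f x) (left_limit f s) < e" .
    then obtain b where b: "b < s" "\<And>x. b < x \<Longrightarrow> x < s \<Longrightarrow> \<bar>f x - left_limit f s\<bar> < e"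
      unfolding eventually_at_left_field dist_real_def by blast
    then show ?thesis by (intro exI[of _ "s - b"]) auto
  qed (auto intro: exI[of _ 1])
  then obtain d2 where d2: "0 < d2"
    "\<And>x. 0 \<le> x \<Longrightarrow> s - d2 < x \<Longrightarrow> x < s \<Longrightarrow> \<bar>f x - left_limit f s\<bar> < e" by blast
  show ?thesis
    using d1 d2 e by (intro that[of "min d1 d2"]) (auto simp: le_less)
qed

text \<open>
  Finitely many one-sided neighbourhoods on which the path is nearly constant cover \<open>[0, T]\<close>; a
  short interval on which the path moves by \<open>e\<close> is not contained in one of them, so it straddles one
  of their centres.
\<close>

lemma cadlag_finitely_many_large_moves:
  assumes f: "cadlag f" and e: "0 < e"
  obtains S \<delta> where "finite S" "0 < \<delta>"
    "\<And>u v. 0 \<le> u \<Longrightarrow> u < v \<Longrightarrow> v \<le> T \<Longrightarrow> v - u < \<delta> \<Longrightarrow> e \<le> \<bar>f v - f u\<bar> \<Longrightarrow> \<exists>s\<in>S. u < s \<and> s \<le> v"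
proof -
  have "\<exists>d>0. (\<forall>x. s \<le> x \<longrightarrow> x < s + d \<longrightarrow> \<bar>f x - f s\<bar> < e/2) \<and>
      (\<forall>x. 0 \<le> x \<longrightarrow> s - d < x \<longrightarrow> x < s \<longrightarrow> \<bar>f x - left_limit f s\<bar> < e/2)" if "0 \<le> s" for s
    using e by (rule_tac cadlag_locally_near[OF f _ that, of "e/2"]) auto
  then obtain d where d: "\<And>s. 0 \<le> s \<Longrightarrow> 0 < d s"
    "\<And>s x. 0 \<le> s \<Longrightarrow> s \<le> x \<Longrightarrow> x < s + d s \<Longrightarrow> \<bar>f x - f s\<bar> < e/2"
    "\<And>s x. 0 \<le> s \<Longrightarrow> 0 \<le> x \<Longrightarrow> s - d s < x \<Longrightarrow> x < s \<Longrightarrow> \<bar>f x - left_limit f s\<bar> < e/2"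
    by metis
  have "{0..T} \<subseteq> (\<Union>s\<in>{0..T}. ball s (d s / 2))"
    using d(1) by force
  from compactE_image[OF compact_Icc _ this]
  obtain S where S: "S \<subseteq> {0..T}" "finite S" "{0..T} \<subseteq> (\<Union>s\<in>S. ball s (d s / 2))"
    by (metis open_ball)
  define \<delta> where "\<delta> = Min (insert 1 ((\<lambda>s. d s / 2) ` S))"
  have pos: "0 < \<delta>" unfolding \<delta>_def using S d(1) by (subst Min_gr_iff) auto
  have le: "\<delta> \<le> d s / 2" if "s \<in> S" for s
    unfolding \<delta>_def using S that by (intro Min_le) auto
  show ?thesis
  proof (rule that[OF S(2) pos])
    fix u v assume uv: "0 \<le> u" "u < v" "v \<le> T" "v - u < \<delta>" "e \<le> \<bar>f v - f u\<bar>"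
    then obtain s where s: "s \<in> S" "u \<in> ball s (d s / 2)" using S(3) by force
    then have s0: "0 \<le> s" using S by auto
    have near: "\<bar>s - u\<bar> < d s / 2" using s(2) by (simp add: dist_real_def)
    have dl: "\<delta> \<le> d s / 2" using le[OF s(1)] .
    \<comment> \<open>If \<open>u\<close> and \<open>v\<close> were on the same side of \<open>s\<close>, both values would be within \<open>e / 2\<close> of
      the same one-sided limit.\<close>
    consider "s \<le> u" | "v < s" | "u < s \<and> s \<le> v" by linarith
    then have "u < s \<and> s \<le> v"
    proof cases
      case 1
      with near dl uv d(2)[OF s0, of u] d(2)[OF s0, of v] show ?thesis by linarith
    next
      case 2
      with near dl uv d(3)[OF s0, of u] d(3)[OF s0, of v] show ?thesis by linarith
    qed
    with s(1) show "\<exists>s\<in>S. u < s \<and> s \<le> v" by blast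
  qed
qed

lemma cadlag_bounded:
  assumes f: "cadlag f"
  obtains K where "\<And>s. s \<in> {0..T} \<Longrightarrow> \<bar>f s\<bar> \<le> K"
proof -
  have "\<exists>d>0. (\<forall>x. s \<le> x \<longrightarrow> x < s + d \<longrightarrow> \<bar>f x - f s\<bar> < 1) \<and>
      (\<forall>x. 0 \<le> x \<longrightarrow> s - d < x \<longrightarrow> x < s \<longrightarrow> \<bar>f x - left_limit f s\<bar> < 1)" if "0 \<le> s" for s
    by (rule cadlag_locally_near[OF f _ that, of "1"]) auto
  then obtain d where d: "\<And>s. 0 \<le> s \<Longrightarrow> 0 < d s"
    "\<And>s x. 0 \<le> s \<Longrightarrow> s \<le> x \<Longrightarrow> x < s + d s \<Longrightarrow> \<bar>f x - f s\<bar> < 1"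
    "\<And>s x. 0 \<le> s \<Longrightarrow> 0 \<le> x \<Longrightarrow> s - d s < x \<Longrightarrow> x < s \<Longrightarrow> \<bar>f x - left_limit f s\<bar> < 1"
    by metis
  have "{0..T} \<subseteq> (\<Union>s\<in>{0..T}. ball s (d s))"
    using d(1) by force
  from compactE_image[OF compact_Icc _ this]
  obtain S where S: "S \<subseteq> {0..T}" "finite S" "{0..T} \<subseteq> (\<Union>s\<in>S. ball s (d s))"
    by (metis open_ball)
  let ?K = "\<Sum>s\<in>S. \<bar>f s\<bar> + \<bar>left_limit f s\<bar> + 1"
  show ?thesis
  proof (rule that)
    fix x assume x: "x \<in> {0..T}"
    then obtain s where s: "s \<in> S" "x \<in> ball s (d s)" using S(3) by force
    then have s0: "0 \<le> s" using S by auto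
    have near: "\<bar>s - x\<bar> < d s" using s(2) by (simp add: dist_real_def)
    have "\<bar>f x\<bar> \<le> \<bar>f s\<bar> + \<bar>left_limit f s\<bar> + 1"
    proof (cases "s \<le> x")
      case True
      with near d(2)[OF s0, of x] show ?thesis by linarith
    next
      case False
      with near d(3)[OF s0, of x] x show ?thesis by auto
    qed
    also have "\<dots> \<le> ?K" by (rule member_le_sum[OF s(1)]) (use S in auto)
    finally show "\<bar>f x\<bar> \<le> ?K" .
  qed
qed

lemma cadlag_large_jumps_at_large_moves:
  assumes f: "cadlag f" and t: "0 < t" and e: "0 < e" "e < \<bar>jump f t\<bar>" and d: "0 < d"
  obtains u where "0 \<le> u" "u < t" "t - u < d" "e \<le> \<bar>f t - f u\<bar>"
proof -
  have "((\<lambda>u. \<bar>f t - f u\<bar>) \<longlongrightarrow> \<bar>f t - left_limit f t\<bar>) (at_left t)"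
    by (intro tendsto_intros cadlag_left_limit[OF f t])
  then have "\<forall>\<^sub>F u in at_left t. e < \<bar>f t - f u\<bar>"
    using e by (intro order_tendstoD) (auto simp: jump_def)
  moreover have "\<forall>\<^sub>F u in at_left t. max 0 (t - d) < u \<and> u < t"
    using t d by (intro eventually_conj eventually_at_leftI[of "max 0 (t - d)"]) auto
  ultimately have "\<forall>\<^sub>F u in at_left t. 0 \<le> u \<and> u < t \<and> t - u < d \<and> e \<le> \<bar>f t - f u\<bar>"
    by eventually_elim auto
  then show ?thesis using that eventually_happens'[OF trivial_limit_at_left_real] by blast
qed

lemma cadlag_finite_large_jumps:
  assumes f: "cadlag f" and e: "0 < e"
  shows "finite {s \<in> {0<..T}. e \<le> \<bar>jump f s\<bar>}"
proof -
  obtain S \<delta> where S: "finite S" "0 < \<delta>"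
    "\<And>u v. 0 \<le> u \<Longrightarrow> u < v \<Longrightarrow> v \<le> T \<Longrightarrow> v - u < \<delta> \<Longrightarrow> e/2 \<le> \<bar>f v - f u\<bar> \<Longrightarrow> \<exists>s\<in>S. u < s \<and> s \<le> v"
    using cadlag_finitely_many_large_moves[OF f, of "e/2" T] e by auto
  have "s \<in> S" if s: "s \<in> {0<..T}" "e \<le> \<bar>jump f s\<bar>" for s
  proof (rule ccontr)
    assume "s \<notin> S"
    define d where "d = Min (insert \<delta> ((\<lambda>r. \<bar>r - s\<bar>) ` S))"
    have d: "0 < d" "d \<le> \<delta>" "\<And>r. r \<in> S \<Longrightarrow> d \<le> \<bar>r - s\<bar>"
      unfolding d_def using S(1,2) \<open>s \<notin> S\<close> by (auto simp: Min_gr_iff intro!: Min_le)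
    obtain u where u: "0 \<le> u" "u < s" "s - u < d" "e/2 \<le> \<bar>f s - f u\<bar>"
      using cadlag_large_jumps_at_large_moves[OF f, of s "e/2" d] s e d by auto
    then obtain r where "r \<in> S" "u < r" "r \<le> s" using S(3)[of u s] s d by auto
    with d(3)[of r] u \<open>s \<notin> S\<close> show False by auto
  qed
  then show ?thesis by (intro finite_subset[OF _ S(1)]) auto
qed

text \<open>A path differs from its left limits only at its jumps, and these are countable.\<close>

lemma cadlag_AE_left_limit:
  assumes f: "cadlag f"
  shows "AE s in lborel. 0 < s \<longrightarrow> left_limit f s = f s"
proof -
  define J where "J = (\<Union>n::nat. \<Union>N::nat. {s \<in> {0<..real N}. 1 / Suc n \<le> \<bar>jump f s\<bar>})"
  have "finite {s \<in> {0<..real N}. 1 / Suc n \<le> \<bar>jump f s\<bar>}" for n N :: nat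
    by (rule cadlag_finite_large_jumps[OF f]) simp
  then have "countable J" unfolding J_def by (auto intro!: countable_UN intro: countable_finite)
  then have AE: "AE s in lborel. s \<notin> J"
    by (intro AE_not_in countable_imp_null_set_lborel)
  have J: "s \<in> J" if "0 < s" "left_limit f s \<noteq> f s" for s
  proof -
    have "0 < \<bar>jump f s\<bar>" using that by (simp add: jump_def)
    then obtain n where "1 / Suc n < \<bar>jump f s\<bar>" using nat_approx_posE by metis
    moreover obtain N :: nat where "s \<le> N" using real_arch_simple by blast
    ultimately show ?thesis using that unfolding J_def by (intro UN_I[of n] UN_I[of N]) auto
  qed
  show ?thesis by (rule eventually_mono[OF AE]) (use J in blast)
qed

lemma grid_le:
  assumes "k < m" "0 < t"
  shows "real (Suc k) * t / m \<le> t"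
proof -
  have "real (Suc k) * t \<le> real m * t" using assms by (intro mult_right_mono) auto
  then show ?thesis using assms by (simp add: divide_le_eq mult.commute)
qed

text \<open>
  The cells \<open>(k t / m, (k + 1) t / m]\<close> contain their right ends, so that the jump at \<open>s\<close> is part of
  the increment over the cell of \<open>s\<close>.
\<close>

definition cell :: "real \<Rightarrow> nat \<Rightarrow> real \<Rightarrow> nat" where
  "cell t m s = nat (\<lceil>real m * (s / t)\<rceil> - 1)"

lemma cell_bounds:
  assumes t: "0 < t" and m: "0 < m" and s: "0 < s"
  shows "real (cell t m s) * t / m < s" "s \<le> real (Suc (cell t m s)) * t / m"
proof -
  have p: "0 < real m * (s / t)" using assms by simp
  then have c: "real (cell t m s) = of_int \<lceil>real m * (s / t)\<rceil> - 1"
    unfolding cell_def by (subst of_nat_nat) (auto simp: le_diff_eq)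
  have "real (cell t m s) < real m * (s / t)" "real m * (s / t) \<le> real (cell t m s) + 1"
    unfolding c by linarith+
  then show "real (cell t m s) * t / m < s" "s \<le> real (Suc (cell t m s)) * t / m"
    using t m by (auto simp: field_simps)
qed

lemma cell_less:
  assumes t: "0 < t" and m: "0 < m" and s: "0 < s" "s \<le> t"
  shows "cell t m s < m"
proof -
  have "real (cell t m s) * t / m < t" using cell_bounds[OF t m s(1)] s by simp
  then show ?thesis using t m by (simp add: field_simps)
qed

lemma cell_eqI:
  assumes t: "0 < t" and m: "0 < m" and s: "real k * t / m < s" "s \<le> real (Suc k) * t / m"
  shows "cell t m s = k"
proof -
  have "0 \<le> real k * t / m" using t by simp
  then have s0: "0 < s" using s by linarith
  note b = cell_bounds[OF t m s0]
  have "real (cell t m s) * t / m < real (Suc k) * t / m" "real k * t / m < real (Suc (cell t m s)) * t / m"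
    using b s by linarith+
  then have "real (cell t m s) < real (Suc k)" "real k < real (Suc (cell t m s))"
    using t m by (auto simp: divide_less_cancel)
  then show ?thesis by linarith
qed

lemma cell_left:
  assumes t: "0 < t" and s: "0 < s"
  shows "filterlim (\<lambda>m. real (cell t m s) * t / m) (at_left s) sequentially"
    and "(\<lambda>m. real (Suc (cell t m s)) * t / m) \<longlonglongrightarrow> s"
proof -
  have tm: "(\<lambda>m. t / real m) \<longlonglongrightarrow> 0"
    using tendsto_divide_0[OF tendsto_const filterlim_real_sequentially[THEN filterlim_mono[OF _ at_top_le_at_infinity order_refl]]]
    by simp
  have ev: "\<forall>\<^sub>F m in sequentially. s - t / real m \<le> real (cell t m s) * t / m \<and> real (cell t m s) * t / m < s
     \<and> s \<le> real (Suc (cell t m s)) * t / m \<and> real (Suc (cell t m s)) * t / m \<le> s + t / real m"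
    using eventually_gt_at_top[of 0]
  proof eventually_elim
    case (elim m)
    have "real (Suc (cell t m s)) * t / m = real (cell t m s) * t / m + t / m"
      by (simp add: distrib_right add_divide_distrib)
    with cell_bounds[OF t elim s] show ?case by linarith
  qed
  have lim: "(\<lambda>m. real (cell t m s) * t / m) \<longlonglongrightarrow> s"
  proof (rule tendsto_sandwich[where h = "\<lambda>_. s"])
    show "(\<lambda>m. s - t / real m) \<longlonglongrightarrow> s" using tendsto_diff[OF tendsto_const tm, of s] by simp
  qed (auto intro: eventually_mono[OF ev])
  then show "filterlim (\<lambda>m. real (cell t m s) * t / m) (at_left s) sequentially"
    unfolding at_within_def filterlim_inf filterlim_principal
    by (intro conjI lim eventually_mono[OF ev]) auto
  show "(\<lambda>m. real (Suc (cell t m s)) * t / m) \<longlonglongrightarrow> s"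
  proof (rule tendsto_sandwich[where f = "\<lambda>_. s"])
    show "(\<lambda>m. s + t / real m) \<longlonglongrightarrow> s" using tendsto_add[OF tendsto_const tm, of s] by simp
  qed (auto intro: eventually_mono[OF ev])
qed

lemma cadlag_cell_limits:
  assumes f: "cadlag f" and t: "0 < t" and s: "0 < s"
  shows "(\<lambda>m. f (real (cell t m s) * t / m)) \<longlonglongrightarrow> left_limit f s"
    and "(\<lambda>m. f (real (Suc (cell t m s)) * t / m)) \<longlonglongrightarrow> f s"
proof -
  show "(\<lambda>m. f (real (cell t m s) * t / m)) \<longlonglongrightarrow> left_limit f s"
    using filterlim_compose[OF cadlag_left_limit[OF f s] cell_left(1)[OF t s]] .
  have "continuous (at s within {s..}) f"
    using f s unfolding cadlag_def by (simp add: at_within_Ici_at_right)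
  moreover have "\<forall>\<^sub>F m in sequentially. real (Suc (cell t m s)) * t / m \<in> {s..}"
    using eventually_gt_at_top[of 0] by eventually_elim (use cell_bounds[OF t _ s] in auto)
  ultimately show "(\<lambda>m. f (real (Suc (cell t m s)) * t / m)) \<longlonglongrightarrow> f s"
    using continuous_within_tendsto_compose[OF _ _ cell_left(2)[OF t s]] by blast
qed

text \<open>
  On a fine grid an increment that reaches the size \<open>a\<close> sits at one of finitely many times.
  Eventually these times lie in different cells, and the increment over each of these cells tends to
  the jump.
\<close>

lemma cadlag_prod_over_grid:
  fixes \<Psi> :: "real \<Rightarrow> real \<Rightarrow> real"
  assumes f: "cadlag f" and t: "0 < t" and a: "0 < a"
    and cont: "\<And>x z X Z. X \<longlonglongrightarrow> x \<Longrightarrow> Z \<longlonglongrightarrow> z \<Longrightarrow> (\<lambda>n. \<Psi> (X n) (Z n)) \<longlonglongrightarrow> \<Psi> x z"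
    and one: "\<And>x z. x < a \<Longrightarrow> \<Psi> x z = 1"
  shows "(\<lambda>m. \<Prod>k<m. \<Psi> (f (real (Suc k) * t / m) - f (real k * t / m)) (f (real k * t / m)))
     \<longlonglongrightarrow> (\<Prod>s | s \<in> {0<..t} \<and> a \<le> jump f s. \<Psi> (jump f s) (left_limit f s))"
proof -
  obtain S \<delta> where S: "finite S" "0 < \<delta>"
    "\<And>u v. 0 \<le> u \<Longrightarrow> u < v \<Longrightarrow> v \<le> t \<Longrightarrow> v - u < \<delta> \<Longrightarrow> a \<le> \<bar>f v - f u\<bar> \<Longrightarrow> \<exists>s\<in>S. u < s \<and> s \<le> v"
    using cadlag_finitely_many_large_moves[OF f a, of t] by auto
  define J where "J = {s \<in> {0<..t}. a \<le> jump f s}"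
  have "finite J"
    unfolding J_def by (rule finite_subset[OF _ cadlag_finite_large_jumps[OF f a, of t]]) auto
  \<comment> \<open>At a time in \<open>S\<close> that is not a large jump the grid increments may reach \<open>a\<close>, but they
    tend to a jump smaller than \<open>a\<close>, where \<open>\<Psi>\<close> is \<open>1\<close>.\<close>
  define R where "R = (S \<inter> {0<..t}) \<union> J"
  have R: "finite R" "R \<subseteq> {0<..t}" unfolding R_def J_def using S(1) \<open>finite J\<close> by (auto simp: J_def)
  define \<gamma> where "\<gamma> = Min (insert \<delta> ((\<lambda>(r, s). \<bar>r - s\<bar>) ` {(r, s) \<in> R \<times> R. r \<noteq> s}))"
  have fin: "finite {(r, s) \<in> R \<times> R. r \<noteq> s}" using R(1) by (auto intro: finite_subset[of _ "R \<times> R"])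
  have \<gamma>: "0 < \<gamma>" "\<gamma> \<le> \<delta>" "\<And>r s. r \<in> R \<Longrightarrow> s \<in> R \<Longrightarrow> r \<noteq> s \<Longrightarrow> \<gamma> \<le> \<bar>r - s\<bar>"
    unfolding \<gamma>_def using fin S(2) by (auto intro!: Min_le)
  let ?G = "\<lambda>m k. \<Psi> (f (real (Suc k) * t / m) - f (real k * t / m)) (f (real k * t / m))"
  have tm: "(\<lambda>m. t / real m) \<longlonglongrightarrow> 0"
    using tendsto_divide_0[OF tendsto_const filterlim_real_sequentially[THEN filterlim_mono[OF _ at_top_le_at_infinity order_refl]]]
    by simp
  have "\<forall>\<^sub>F m in sequentially. (\<Prod>s\<in>R. ?G m (cell t m s)) = (\<Prod>k<m. ?G m k)"
    using order_tendstoD(2)[OF tm \<gamma>(1)] eventually_gt_at_top[of 0]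
  proof eventually_elim
    case (elim m)
    have step: "real (Suc k) * t / m = real k * t / m + t / m" for k
      by (simp add: distrib_right add_divide_distrib)
    have inj: "inj_on (cell t m) R"
    proof (rule inj_onI, rule ccontr)
      fix r s assume rs: "r \<in> R" "s \<in> R" "cell t m r = cell t m s" "r \<noteq> s"
      have "\<bar>r - s\<bar> < t / m"
        using cell_bounds[OF t elim(2), of r] cell_bounds[OF t elim(2), of s] rs R(2)
        unfolding step by (auto simp: subset_iff abs_less_iff)
      with \<gamma>(3)[OF rs(1,2,4)] elim show False by simp
    qed
    have "?G m k = 1" if k: "k < m" "k \<notin> cell t m ` R" for k
    proof -
      have "\<bar>f (real (Suc k) * t / m) - f (real k * t / m)\<bar> < a"
      proof (rule ccontr)
        assume "\<not> ?thesis"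
        moreover have "real (Suc k) * t / m \<le> t"
          using k t by (intro grid_le)
        moreover have "0 \<le> real k * t / m" "0 < t / m" using t elim by auto
        ultimately obtain s where s: "s \<in> S" "real k * t / m < s" "s \<le> real (Suc k) * t / m"
          using S(3)[of "real k * t / m" "real (Suc k) * t / m"] elim \<gamma>(2) unfolding step by auto
        then have "cell t m s = k" using cell_eqI[OF t elim(2)] by simp
        moreover have "s \<in> R"
          using s \<open>real (Suc k) * t / m \<le> t\<close> \<open>0 \<le> real k * t / m\<close> unfolding R_def by auto
        ultimately show False using k by blast
      qed
      then show ?thesis by (intro one) auto
    qed
    moreover have "cell t m ` R \<subseteq> {..<m}" using cell_less[OF t elim(2)] R(2) by auto
    ultimately have "(\<Prod>k<m. ?G m k) = (\<Prod>k\<in>cell t m ` R. ?G m k)"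
      by (intro prod.mono_neutral_right) auto
    also have "\<dots> = (\<Prod>s\<in>R. ?G m (cell t m s))"
      using inj by (simp add: prod.reindex)
    finally show ?case ..
  qed
  moreover have "(\<lambda>m. \<Prod>s\<in>R. ?G m (cell t m s)) \<longlonglongrightarrow> (\<Prod>s\<in>R. \<Psi> (jump f s) (left_limit f s))"
  proof (rule tendsto_prod)
    fix s assume "s \<in> R"
    then have "0 < s" using R by auto
    from cadlag_cell_limits[OF f t this]
    show "(\<lambda>m. ?G m (cell t m s)) \<longlonglongrightarrow> \<Psi> (jump f s) (left_limit f s)"
      unfolding jump_def by (intro cont tendsto_diff)
  qed
  ultimately have "(\<lambda>m. \<Prod>k<m. ?G m k) \<longlonglongrightarrow> (\<Prod>s\<in>R. \<Psi> (jump f s) (left_limit f s))"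
    by (rule Lim_transform_eventually[rotated])
  also have "(\<Prod>s\<in>R. \<Psi> (jump f s) (left_limit f s)) = (\<Prod>s\<in>J. \<Psi> (jump f s) (left_limit f s))"
    using R one by (intro prod.mono_neutral_right) (auto simp: R_def J_def not_le)
  finally show ?thesis unfolding J_def by simp
qed

lemma emeasure_lborel_Ioc_finite: "emeasure lborel {a<..b::real} < top"
  using emeasure_bounded_finite[of "{a<..b}"] by (simp add: infinity_ennreal_def)

lemma grid_step_integral:
  assumes t: "0 < t" and m: "0 < m"
  shows "(LINT s|lborel. indicator {0<..t} s * h (cell t m s)) = (\<Sum>k<m. t / m * h k :: real)"
    and "(\<lambda>s. indicator {0<..t} s * (h (cell t m s) :: real)) \<in> borel_measurable lborel"
proof -
  let ?I = "\<lambda>k. {real k * t / m <.. real (Suc k) * t / m}"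
  have eq: "indicator {0<..t} s * h (cell t m s) = (\<Sum>k<m. indicator (?I k) s * h k)" for s
  proof (cases "s \<in> {0<..t}")
    case True
    then have b: "s \<in> ?I (cell t m s)" "cell t m s < m"
      using cell_bounds[OF t m, of s] cell_less[OF t m, of s] by auto
    have "(\<Sum>k<m. indicator (?I k) s * h k) = (\<Sum>k<m. if k = cell t m s then h k else 0)"
      using b cell_eqI[OF t m, of _ s] by (intro sum.cong) (auto simp: indicator_def)
    then show ?thesis using True b by simp
  next
    case False
    have "s \<notin> ?I k" if "k < m" for k
    proof
      assume s: "s \<in> ?I k"
      have "0 \<le> real k * t / m" using t by simp
      moreover have "real (Suc k) * t / m \<le> t" using that t by (intro grid_le)
      ultimately show False using s False by auto
    qed
    then show ?thesis using False by auto
  qed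
  show "(\<lambda>s. indicator {0<..t} s * h (cell t m s)) \<in> borel_measurable lborel"
    unfolding eq by measurable
  have "has_bochner_integral lborel (\<lambda>s. indicator (?I k) s *\<^sub>R h k) (measure lborel (?I k) *\<^sub>R h k)" for k
    by (intro has_bochner_integral_indicator) (auto intro!: emeasure_lborel_Ioc_finite)
  then have "has_bochner_integral lborel (\<lambda>s. indicator (?I k) s * h k) (t / m * h k)" for k
    using t m by (simp add: field_simps)
  then show "(LINT s|lborel. indicator {0<..t} s * h (cell t m s)) = (\<Sum>k<m. t / m * h k :: real)"
    unfolding eq by (intro has_bochner_integral_integral_eq has_bochner_integral_sum)
qed

text \<open>
  The Riemann sums evaluate the path at the left ends of the cells, hence in the limit at its left
  limits, which agree with the path almost everywhere. The path itself is the limit of its values at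
  the right ends, which gives measurability.
\<close>

lemma cadlag_step_integral_limit:
  assumes f: "cadlag f" and t: "0 < t"
    and lim: "\<And>z Z. Z \<longlonglongrightarrow> z \<Longrightarrow> (\<lambda>m. F m (Z m)) \<longlonglongrightarrow> F' z"
    and contF: "continuous_on UNIV F'"
    and bd: "\<And>m z. \<bar>F m z\<bar> \<le> C"
  shows "(\<lambda>m. \<Sum>k<m. t / m * F m (f (real k * t / m))) \<longlonglongrightarrow> (LINT s|lborel. indicator {0<..t} s * F' (f s))"
    and "(\<lambda>s. indicator {0<..t} s * F' (f s)) \<in> borel_measurable lborel"
proof -
  define u where "u m s = indicator {0<..t} s * F m (f (real (cell t m s) * t / m))" for m s
  define v where "v m s = indicator {0<..t} s * F' (f (real (Suc (cell t m s)) * t / m))" for m s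
  have um: "u (Suc m) \<in> borel_measurable lborel" for m
    unfolding u_def using grid_step_integral(2)[OF t, of "Suc m" "\<lambda>k. F (Suc m) (f (real k * t / Suc m))"] by simp
  have vm: "v (Suc m) \<in> borel_measurable lborel" for m
    unfolding v_def using grid_step_integral(2)[OF t, of "Suc m" "\<lambda>k. F' (f (real (Suc k) * t / Suc m))"] by simp
  have vlim: "(\<lambda>m. v m s) \<longlonglongrightarrow> indicator {0<..t} s * F' (f s)" for s
  proof (cases "s \<in> {0<..t}")
    case True
    then have "(\<lambda>m. F' (f (real (Suc (cell t m s)) * t / m))) \<longlonglongrightarrow> F' (f s)"
      by (intro continuous_on_tendsto_compose[OF contF] cadlag_cell_limits[OF f t]) auto
    then show ?thesis unfolding v_def by (intro tendsto_mult_left)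
  qed (simp add: v_def)
  show meas: "(\<lambda>s. indicator {0<..t} s * F' (f s)) \<in> borel_measurable lborel"
    by (rule borel_measurable_LIMSEQ_real[OF _ vm]) (use LIMSEQ_Suc[OF vlim] in auto)
  have "AE s in lborel. (\<lambda>m. u (Suc m) s) \<longlonglongrightarrow> indicator {0<..t} s * F' (f s)"
    using cadlag_AE_left_limit[OF f]
  proof eventually_elim
    case (elim s)
    show ?case
    proof (cases "s \<in> {0<..t}")
      case True
      with elim cadlag_cell_limits(1)[OF f t, of s]
      have "(\<lambda>m. F m (f (real (cell t m s) * t / m))) \<longlonglongrightarrow> F' (f s)"
        by (intro lim) auto
      then have "(\<lambda>m. u m s) \<longlonglongrightarrow> indicator {0<..t} s * F' (f s)"
        unfolding u_def by (intro tendsto_mult_left)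
      then show ?thesis by (rule LIMSEQ_Suc)
    qed (simp add: u_def)
  qed
  then have "(\<lambda>m. LINT s|lborel. u (Suc m) s) \<longlonglongrightarrow> (LINT s|lborel. indicator {0<..t} s * F' (f s))"
  proof (intro integral_dominated_convergence[where w = "\<lambda>s. indicator {0<..t} s * C"] meas um)
    show "integrable lborel (\<lambda>s. indicator {0<..t} s * C)"
      by (intro integrable_mult_left integrable_real_indicator) (auto intro!: emeasure_lborel_Ioc_finite)
    show "AE s in lborel. norm (u (Suc m) s) \<le> indicator {0<..t} s * C" for m
      using bd by (auto simp: u_def indicator_def)
  qed
  moreover have "(LINT s|lborel. u (Suc m) s) = (\<Sum>k<Suc m. t / Suc m * F (Suc m) (f (real k * t / Suc m)))" for m
    unfolding u_def by (subst grid_step_integral(1)[OF t, symmetric]) auto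
  ultimately show "(\<lambda>m. \<Sum>k<m. t / m * F m (f (real k * t / m))) \<longlonglongrightarrow> (LINT s|lborel. indicator {0<..t} s * F' (f s))"
    by (subst filterlim_sequentially_Suc[symmetric]) simp
qed


section \<open>Small increments of the stable process and its Levy density\<close>

lemma nn_integral_exp_unit:
  fixes c x :: real
  assumes "0 \<le> x"
  shows "(\<integral>\<^sup>+a. ennreal (x * exp (- (c + a) * x)) * indicator {0..1} a \<partial>lborel) = ennreal (exp (- c * x) * (1 - exp (- x)))"

proof -
  have "(\<integral>\<^sup>+a. ennreal (x * exp (- (c + a) * x)) * indicator {0..1} a \<partial>lborel) =
      ennreal (- exp (- (c + 1) * x) - (- exp (- (c + 0) * x)))"
    by (rule nn_integral_FTC_Icc) (use assms in \<open>auto intro!: derivative_eq_intros\<close>)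
  also have "- exp (- (c + 1) * x) - (- exp (- (c + 0) * x)) = exp (- c * x) * (1 - exp (- x))"
    by (simp add: algebra_simps exp_add [symmetric])
  finally show ?thesis .
qed

lemma nn_integral_powr_unit:
  fixes c \<beta> :: real
  assumes "0 < c" "0 < \<beta>"
  shows "(\<integral>\<^sup>+a. ennreal ((c + a) powr (\<beta> - 1)) * indicator {0..1} a \<partial>lborel) = ennreal (((c + 1) powr \<beta> - c powr \<beta>) / \<beta>)"
proof -
  have "(\<integral>\<^sup>+a. ennreal ((c + a) powr (\<beta> - 1)) * indicator {0..1} a \<partial>lborel) = ennreal ((c + 1) powr \<beta> / \<beta> - (c + 0) powr \<beta> / \<beta>)"
    by (rule nn_integral_FTC_Icc) (use assms in \<open>auto intro!: derivative_eq_intros simp: powr_diff\<close>)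
  then show ?thesis by (simp add: diff_divide_distrib)
qed

text \<open>
  The jump measure of the process. The constant is the one for which \<open>stable_exponent \<alpha> \<eta>\<close> is the
  integral of \<open>exp (- \<eta> x) - 1 + \<eta> x\<close>; below this relation enters through second differences in \<open>\<eta>\<close>,
  which do away with the compensating terms.
\<close>

definition levy_density :: "real \<Rightarrow> real \<Rightarrow> real" where
  "levy_density \<alpha> x = indicator {0<..} x * (\<alpha> * (1 + \<alpha>) / (Gamma (1 - \<alpha>) * Gamma (1 + \<alpha>) * 2 powr \<alpha>)) * x powr (- 2 - \<alpha>)"

lemma levy_density_measurable [measurable]: "levy_density \<alpha> \<in> borel_measurable borel"
  unfolding levy_density_def[abs_def] by measurable

abbreviation (input) stable_exponent :: "real \<Rightarrow> real \<Rightarrow> real" where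
  "stable_exponent \<alpha> \<eta> \<equiv> \<eta> powr (1 + \<alpha>) / (Gamma (1 + \<alpha>) * 2 powr \<alpha>)"

lemma levy_density_nonneg: "0 < \<alpha> \<Longrightarrow> \<alpha> < 1 \<Longrightarrow> 0 \<le> levy_density \<alpha> x"
  unfolding levy_density_def
  by (intro mult_nonneg_nonneg divide_nonneg_nonneg less_imp_le[OF Gamma_real_pos]) auto

text \<open>
  Writing \<open>(1 - exp (- x))\<^sup>2\<close> as \<open>x\<^sup>2\<close> times the integral of \<open>exp (- (a + b) x)\<close> over
  the unit square turns the left side into an integral of \<open>Gamma\<close>-integrals, that is of
  \<open>(\<eta> + a + b) powr (\<alpha> - 1)\<close>, which is integrated twice.
\<close>

lemma second_difference_integral:
  fixes \<alpha> \<eta> :: real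
  assumes \<alpha>: "0 < \<alpha>" "\<alpha> < 1" and \<eta>: "0 < \<eta>"
  shows "(\<integral>\<^sup>+x. ennreal ((1 - exp (- x))^2 * exp (- \<eta> * x) * levy_density \<alpha> x) \<partial>lborel) =
     ennreal (stable_exponent \<alpha> (\<eta> + 2) - 2 * stable_exponent \<alpha> (\<eta> + 1) + stable_exponent \<alpha> \<eta>)"
proof -
  have G: "0 < Gamma (1 - \<alpha>)" "0 < Gamma (1 + \<alpha>)" using \<alpha> by (auto intro!: Gamma_real_pos)
  define c where "c = \<alpha> * (1 + \<alpha>) / (Gamma (1 - \<alpha>) * Gamma (1 + \<alpha>) * 2 powr \<alpha>)"
  have c: "0 < c" unfolding c_def using G \<alpha> by simp
  let ?h = "\<lambda>a b x. ennreal c * ennreal (indicator {0<..} x * x powr (1 - \<alpha> - 1) * exp (- (\<eta> + a + b) * x)) * indicator {0..1} a * indicator {0..1} b"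
  have ftc: "(\<integral>\<^sup>+b. ennreal ((\<eta> + b + 1) powr \<alpha> - (\<eta> + b) powr \<alpha>) * indicator {0..1} b \<partial>lborel) =
     ennreal ((((\<eta> + 1) + 1) powr (1 + \<alpha>) / (1 + \<alpha>) - (\<eta> + 1) powr (1 + \<alpha>) / (1 + \<alpha>)) - (((\<eta> + 1) + 0) powr (1 + \<alpha>) / (1 + \<alpha>) - (\<eta> + 0) powr (1 + \<alpha>) / (1 + \<alpha>)))"
  proof (rule nn_integral_FTC_Icc[where F = "\<lambda>b. ((\<eta> + 1) + b) powr (1 + \<alpha>) / (1 + \<alpha>) - (\<eta> + b) powr (1 + \<alpha>) / (1 + \<alpha>)"])
    fix b :: real assume b: "b \<in> {0..1}"
    then have p: "0 < \<eta> + b" using \<eta> by auto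
    show "((\<lambda>b. ((\<eta> + 1) + b) powr (1 + \<alpha>) / (1 + \<alpha>) - (\<eta> + b) powr (1 + \<alpha>) / (1 + \<alpha>)) has_real_derivative
        (\<eta> + b + 1) powr \<alpha> - (\<eta> + b) powr \<alpha>) (at b)"
      using p \<alpha> by (auto intro!: derivative_eq_intros simp: add_ac)
    show "0 \<le> (\<eta> + b + 1) powr \<alpha> - (\<eta> + b) powr \<alpha>" using p \<alpha> by (simp add: powr_mono2)
  qed auto
  have pt: "ennreal ((1 - exp (- x))^2 * exp (- \<eta> * x) * levy_density \<alpha> x) = (\<integral>\<^sup>+b. (\<integral>\<^sup>+a. ?h a b x \<partial>lborel) \<partial>lborel)" for x
  proof (cases "0 < x")
    case x: True
    have ld: "levy_density \<alpha> x = c * x powr (- 2 - \<alpha>)"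
      using x unfolding levy_density_def c_def by simp
    have e: "ennreal c * ennreal (indicator {0<..} x * x powr (1 - \<alpha> - 1) * exp (- (\<eta> + a + b) * x)) =
        ennreal (c * x powr (- 2 - \<alpha>) * x) * ennreal (x * exp (- (\<eta> + b + a) * x))" for a b
    proof -
      have "x powr (- \<alpha>) = x powr (- 2 - \<alpha>) * x ^ 2"
        using x powr_add[of x "- 2 - \<alpha>" 2] by simp
      then have "c * (x powr (1 - \<alpha> - 1) * exp (- (\<eta> + a + b) * x)) = (c * x powr (- 2 - \<alpha>) * x) * (x * exp (- (\<eta> + b + a) * x))"
        by (simp add: power2_eq_square ac_simps)
      then show ?thesis using x c by (simp add: ennreal_mult' [symmetric])
    qed
    have inner: "(\<integral>\<^sup>+a. ?h a b x \<partial>lborel) = ennreal (c * x powr (- 2 - \<alpha>) * (1 - exp (- x))) * (ennreal (x * exp (- (\<eta> + b) * x)) * indicator {0..1} b)" for b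
    proof -
      have "(\<integral>\<^sup>+a. ?h a b x \<partial>lborel) = (\<integral>\<^sup>+a. (ennreal (c * x powr (- 2 - \<alpha>) * x) * indicator {0..1} b) * (ennreal (x * exp (- (\<eta> + b + a) * x)) * indicator {0..1} a) \<partial>lborel)"
        unfolding e by (simp add: mult_ac)
      also have "\<dots> = (ennreal (c * x powr (- 2 - \<alpha>) * x) * indicator {0..1} b) * ennreal (exp (- (\<eta> + b) * x) * (1 - exp (- x)))"
        by (subst nn_integral_cmult, measurable, subst nn_integral_exp_unit[OF less_imp_le[OF x]], rule refl)
      also have "\<dots> = ennreal (c * x powr (- 2 - \<alpha>) * (1 - exp (- x))) * (ennreal (x * exp (- (\<eta> + b) * x)) * indicator {0..1} b)"
        using x c by (auto simp: indicator_def ennreal_mult' [symmetric] mult_ac)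
      finally show ?thesis .
    qed
    have "(\<integral>\<^sup>+b. (\<integral>\<^sup>+a. ?h a b x \<partial>lborel) \<partial>lborel) =
       ennreal (c * x powr (- 2 - \<alpha>) * (1 - exp (- x))) * ennreal (exp (- \<eta> * x) * (1 - exp (- x)))"
      unfolding inner by (subst nn_integral_cmult, measurable, subst nn_integral_exp_unit[OF less_imp_le[OF x]], rule refl)
    also have "\<dots> = ennreal ((1 - exp (- x))^2 * exp (- \<eta> * x) * levy_density \<alpha> x)"
      using x c by (simp add: ennreal_mult' [symmetric] ld power2_eq_square mult_ac)
    finally show ?thesis ..
  qed (simp add: levy_density_def)
  have "(\<integral>\<^sup>+x. ennreal ((1 - exp (- x))^2 * exp (- \<eta> * x) * levy_density \<alpha> x) \<partial>lborel) =
     (\<integral>\<^sup>+x. (\<integral>\<^sup>+b. (\<integral>\<^sup>+a. ?h a b x \<partial>lborel) \<partial>lborel) \<partial>lborel)"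
    by (simp only: pt)
  also have "\<dots> = (\<integral>\<^sup>+b. (\<integral>\<^sup>+x. (\<integral>\<^sup>+a. ?h a b x \<partial>lborel) \<partial>lborel) \<partial>lborel)"
    by (rule lborel_pair.Fubini') measurable
  also have "\<dots> = (\<integral>\<^sup>+b. (\<integral>\<^sup>+a. (\<integral>\<^sup>+x. ?h a b x \<partial>lborel) \<partial>lborel) \<partial>lborel)"
    by (intro nn_integral_cong lborel_pair.Fubini') measurable
  also have "\<dots> = (\<integral>\<^sup>+b. (\<integral>\<^sup>+a. ennreal (c * Gamma (1 - \<alpha>)) * indicator {0..1} b * (ennreal ((\<eta> + b + a) powr (\<alpha> - 1)) * indicator {0..1} a) \<partial>lborel) \<partial>lborel)"
  proof (intro nn_integral_cong)
    fix a b :: real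
    show "(\<integral>\<^sup>+x. ?h a b x \<partial>lborel) = ennreal (c * Gamma (1 - \<alpha>)) * indicator {0..1} b * (ennreal ((\<eta> + b + a) powr (\<alpha> - 1)) * indicator {0..1} a)"
    proof (cases "a \<in> {0..1} \<and> b \<in> {0..1}")
      case True
      then have p: "0 < \<eta> + a + b" using \<eta> by auto
      have "(\<integral>\<^sup>+x. ?h a b x \<partial>lborel) = ennreal c * ennreal (Gamma (1 - \<alpha>) / (\<eta> + a + b) powr (1 - \<alpha>))"
        using True by (subst nn_integral_powr_exp[symmetric, OF _ p]) (use \<alpha> in \<open>auto simp: nn_integral_cmult\<close>)
      also have "\<dots> = ennreal (c * Gamma (1 - \<alpha>)) * ennreal ((\<eta> + b + a) powr (\<alpha> - 1))"
        using c G p by (simp add: ennreal_mult' [symmetric] powr_diff add_ac)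
      finally show ?thesis using True by simp
    qed auto
  qed
  also have "\<dots> = (\<integral>\<^sup>+b. ennreal (c * Gamma (1 - \<alpha>) / \<alpha>) * (ennreal ((\<eta> + b + 1) powr \<alpha> - (\<eta> + b) powr \<alpha>) * indicator {0..1} b) \<partial>lborel)"
  proof (intro nn_integral_cong)
    fix b :: real
    show "(\<integral>\<^sup>+a. ennreal (c * Gamma (1 - \<alpha>)) * indicator {0..1} b * (ennreal ((\<eta> + b + a) powr (\<alpha> - 1)) * indicator {0..1} a) \<partial>lborel)
      = ennreal (c * Gamma (1 - \<alpha>) / \<alpha>) * (ennreal ((\<eta> + b + 1) powr \<alpha> - (\<eta> + b) powr \<alpha>) * indicator {0..1} b)"
    proof (cases "b \<in> {0..1}")
      case True
      then have "0 < \<eta> + b" using \<eta> by auto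
      then show ?thesis using True \<alpha> c G
        by (simp add: nn_integral_cmult nn_integral_powr_unit ennreal_mult' [symmetric])
    qed simp
  qed
  also have "\<dots> = ennreal (c * Gamma (1 - \<alpha>) / \<alpha>) *
     ennreal ((((\<eta> + 1) + 1) powr (1 + \<alpha>) / (1 + \<alpha>) - (\<eta> + 1) powr (1 + \<alpha>) / (1 + \<alpha>)) - (((\<eta> + 1) + 0) powr (1 + \<alpha>) / (1 + \<alpha>) - (\<eta> + 0) powr (1 + \<alpha>) / (1 + \<alpha>)))"
    by (subst nn_integral_cmult, measurable, subst ftc, rule refl)
  also have "\<dots> = ennreal (stable_exponent \<alpha> (\<eta> + 2) - 2 * stable_exponent \<alpha> (\<eta> + 1) + stable_exponent \<alpha> \<eta>)"
  proof -
    define K where "K = Gamma (1 + \<alpha>) * 2 powr \<alpha>"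
    have K: "0 < K" unfolding K_def using G by simp
    have "Gamma (1 - \<alpha>) \<noteq> 0" "Gamma (1 + \<alpha>) \<noteq> 0" using G by linarith+
    then have *: "c * Gamma (1 - \<alpha>) / \<alpha> = (1 + \<alpha>) / K"
      unfolding c_def K_def using \<alpha> by simp
    have **: "(1 + \<alpha>) / K * (A / (1 + \<alpha>) - B / (1 + \<alpha>) - (B / (1 + \<alpha>) - D / (1 + \<alpha>))) = A / K - 2 * (B / K) + D / K" for A B D
      using K \<alpha> by (simp add: diff_divide_distrib [symmetric] add_divide_distrib [symmetric])
    have nn: "0 \<le> (1 + \<alpha>) / K" using K \<alpha> by simp
    show ?thesis
      unfolding * ennreal_mult'[OF nn, symmetric] add_0_right ** by (simp add: K_def add.assoc)
  qed
  finally show ?thesis .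
qed

text \<open>
  Without the restriction to \<open>x > 0\<close> the integral is a second difference of
  \<open>exp (s * stable_exponent \<alpha> \<eta>)\<close>, whose derivative at \<open>s = 0\<close> is the claimed limit. Increments
  \<open>x \<le> 0\<close> contribute only \<open>o(s)\<close>: the weight vanishes to second order at \<open>0\<close>, and exponential
  moments show that negative increments are of size \<open>s powr (1 / (1 + \<alpha>))\<close>, where \<open>2 / (1 + \<alpha>) > 1\<close>.
\<close>

lemma levy_laplace_second_difference:
  fixes \<mu> :: "real \<Rightarrow> real measure"
  assumes \<alpha>: "0 < \<alpha>" "\<alpha> < 1"
    and [simp]: "\<And>s. sets (\<mu> s) = sets borel"
    and lap: "\<And>s \<eta>. 0 < s \<Longrightarrow> 0 \<le> \<eta> \<Longrightarrow> has_bochner_integral (\<mu> s) (\<lambda>x. exp (- \<eta> * x)) (exp (s * stable_exponent \<alpha> \<eta>))"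
    and \<eta>: "0 \<le> \<eta>"
  shows "((\<lambda>s. (LINT x|\<mu> s. indicator {0<..} x * ((1 - exp (- x))^2 * exp (- \<eta> * x))) / s) \<longlongrightarrow>
     stable_exponent \<alpha> (\<eta> + 2) - 2 * stable_exponent \<alpha> (\<eta> + 1) + stable_exponent \<alpha> \<eta>) (at_right 0)"
    and "0 < s \<Longrightarrow> integrable (\<mu> s) (\<lambda>x. indicator {0<..} x * ((1 - exp (- x))^2 * exp (- \<eta> * x)))"
proof -
  define C where "C = Gamma (1 + \<alpha>) * 2 powr \<alpha>"
  have C: "0 < C" unfolding C_def using \<alpha> by (intro mult_pos_pos Gamma_real_pos) auto
  define w where "w x = (1 - exp (- x))^2 * exp (- \<eta> * x)" for x :: real
  have [measurable]: "w \<in> borel_measurable borel" unfolding w_def[abs_def] by measurable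
  have w0: "0 \<le> w x" for x unfolding w_def by simp
  have w_eq: "w x = exp (- \<eta> * x) - 2 * exp (- (\<eta> + 1) * x) + exp (- (\<eta> + 2) * x)" for x
    unfolding w_def by (simp add: power2_eq_square algebra_simps exp_add exp_diff exp_minus) (simp add: exp_minus exp_double[symmetric] field_simps power2_eq_square exp_add[symmetric])
  have full: "has_bochner_integral (\<mu> s) w (exp (s * stable_exponent \<alpha> \<eta>) - 2 * exp (s * stable_exponent \<alpha> (\<eta> + 1)) + exp (s * stable_exponent \<alpha> (\<eta> + 2)))"
    if "0 < s" for s
    unfolding w_eq[abs_def] using \<eta> that
    by (intro has_bochner_integral_add has_bochner_integral_diff has_bochner_integral_mult_right lap) auto
  have int: "integrable (\<mu> s) (\<lambda>x. indicator A x * w x)" if "0 < s" "A \<in> sets borel" for s A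
    using integrable_real_mult_indicator[of A "\<mu> s" w] has_bochner_integral_iff full[OF that(1)] that(2)
    by (auto simp: mult.commute)
  show "0 < s \<Longrightarrow> integrable (\<mu> s) (\<lambda>x. indicator {0<..} x * ((1 - exp (- x))^2 * exp (- \<eta> * x)))"
    using int[of s "{0<..}"] by (simp add: w_def)
  have split: "(LINT x|\<mu> s. indicator {0<..} x * w x) = (LINT x|\<mu> s. w x) - (LINT x|\<mu> s. indicator {..0} x * w x)" if "0 < s" for s
  proof -
    have "indicator {0<..} x * w x = w x - indicator {..0} x * w x" for x by (simp add: indicator_def)
    then show ?thesis
      using full[OF that] int[OF that, of "{..0}"]
      by (simp add: has_bochner_integral_iff)
  qed
  define p where "p = 1 / (1 + \<alpha>)"
  have p: "0 < p" "p < 1" "1 < 2 * p" "p * (1 + \<alpha>) = 1" unfolding p_def using \<alpha> by (auto simp: field_simps)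
  have bound: "(LINT x|\<mu> s. indicator {..0} x * w x) / s \<le> 2 * s powr (2 * p - 1) * exp ((1 + (\<eta> + 2) * s powr p) powr (1 + \<alpha>) / C)"
    if s: "0 < s" for s
  proof -
    \<comment> \<open>This choice of the Laplace parameter keeps \<open>s * stable_exponent \<alpha> l\<close> bounded.\<close>
    define l where "l = s powr (- p)"
    have l: "0 < l" unfolding l_def using s by simp
    have lp: "has_bochner_integral (\<mu> s) (\<lambda>x. 2 / l^2 * exp (- (l + \<eta> + 2) * x)) (2 / l^2 * exp (s * stable_exponent \<alpha> (l + \<eta> + 2)))"
      using l \<eta> s by (intro has_bochner_integral_mult_right lap) auto
    have pt: "indicator {..0} x * w x \<le> 2 / l^2 * exp (- (l + \<eta> + 2) * x)" for x
    proof (cases "x \<le> 0")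
      case True
      define y where "y = - x"
      have y: "0 \<le> y" using True by (simp add: y_def)
      have "exp y - 1 \<le> y * exp y"
        using exp_ge_add_one_self[of "- y"] by (simp add: exp_minus field_simps)
      then have "(exp y - 1)^2 \<le> (y * exp y)^2" using y by (intro power_mono) auto
      also have "\<dots> = y^2 * exp (2 * y)" by (simp add: power_mult_distrib exp_double)
      also have "y^2 \<le> 2 / l^2 * exp (l * y)"
      proof -
        have "(l * y)^2 / 2 \<le> exp (l * y)"
          using exp_lower_Taylor_quadratic[of "l * y"] mult_nonneg_nonneg[OF less_imp_le[OF l] y] by linarith
        then show ?thesis using l by (simp add: field_simps power_mult_distrib)
      qed
      finally have "(exp y - 1)^2 \<le> 2 / l^2 * exp (l * y) * exp (2 * y)" by simp
      from mult_right_mono[OF this, of "exp (\<eta> * y)"]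
      have "(exp y - 1)^2 * exp (\<eta> * y) \<le> 2 / l^2 * exp (l * y) * exp (2 * y) * exp (\<eta> * y)" by simp
      also have "\<dots> = 2 / l^2 * exp ((l + \<eta> + 2) * y)"
        by (simp add: exp_add[symmetric] algebra_simps)
      also have "(l + \<eta> + 2) * y = - (l + \<eta> + 2) * x" by (simp add: y_def algebra_simps)
      also have "(exp y - 1)^2 * exp (\<eta> * y) = indicator {..0} x * w x"
        using True by (simp add: w_def y_def power2_commute)
      finally show ?thesis .
    qed (use l in auto)
    have "(LINT x|\<mu> s. indicator {..0} x * w x) \<le> (LINT x|\<mu> s. 2 / l^2 * exp (- (l + \<eta> + 2) * x))"
      using lp by (intro integral_mono int s pt) (auto simp: has_bochner_integral_iff)
    also have "\<dots> = 2 / l^2 * exp (s * stable_exponent \<alpha> (l + \<eta> + 2))"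
      using lp by (rule has_bochner_integral_integral_eq)
    also have "s * stable_exponent \<alpha> (l + \<eta> + 2) = (1 + (\<eta> + 2) * s powr p) powr (1 + \<alpha>) / C"
    proof -
      have "s powr p * l = 1" unfolding l_def using s by (simp add: powr_minus)
      have "s * (l + \<eta> + 2) powr (1 + \<alpha>) = (s powr p) powr (1 + \<alpha>) * (l + \<eta> + 2) powr (1 + \<alpha>)"
        using s by (simp add: powr_powr p)
      also have "\<dots> = (s powr p * (l + \<eta> + 2)) powr (1 + \<alpha>)"
        using l \<eta> by (simp add: powr_mult)
      also have "s powr p * (l + \<eta> + 2) = 1 + (\<eta> + 2) * s powr p"
        using \<open>s powr p * l = 1\<close> by (simp add: algebra_simps)
      finally show ?thesis by (simp add: C_def)
    qed
    also have "2 / l^2 = 2 * s powr (2 * p - 1) * s"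
    proof -
      have "1 / l^2 = s powr (2 * p)" unfolding l_def using s by (simp add: powr_minus power2_eq_square powr_add[symmetric] field_simps)
      also have "\<dots> = s powr (2 * p - 1) * s" using s by (simp add: powr_diff)
      finally show ?thesis by simp
    qed
    finally show ?thesis using s by (simp add: divide_le_eq mult_ac)
  qed
  have pw: "((\<lambda>s::real. s powr q) \<longlongrightarrow> 0) (at_right 0)" if "0 < q" for q
    by (rule tendsto_zero_powrI[OF _ tendsto_const _ that]) (auto simp: eventually_at_right_less intro: tendsto_ident_at eventually_mono[OF eventually_at_right_less])
  have "((\<lambda>s. 2 * s powr (2 * p - 1) * exp ((1 + (\<eta> + 2) * s powr p) powr (1 + \<alpha>) / C)) \<longlongrightarrow> 2 * 0 * exp ((1 + (\<eta> + 2) * 0) powr (1 + \<alpha>) / C)) (at_right 0)"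
    using p C by (intro tendsto_intros pw) auto
  then have up: "((\<lambda>s. 2 * s powr (2 * p - 1) * exp ((1 + (\<eta> + 2) * s powr p) powr (1 + \<alpha>) / C)) \<longlongrightarrow> 0) (at_right 0)" by simp
  have neg: "((\<lambda>s. (LINT x|\<mu> s. indicator {..0} x * w x) / s) \<longlongrightarrow> 0) (at_right 0)"
  proof (rule tendsto_sandwich[OF _ _ tendsto_const up])
    show "\<forall>\<^sub>F s in at_right 0. 0 \<le> (LINT x|\<mu> s. indicator {..0} x * w x) / s"
      using eventually_at_right_less[of "0::real"]
      by eventually_elim (auto intro!: divide_nonneg_pos integral_nonneg_AE w0 mult_nonneg_nonneg)
    show "\<forall>\<^sub>F s in at_right 0. (LINT x|\<mu> s. indicator {..0} x * w x) / s \<le> 2 * s powr (2 * p - 1) * exp ((1 + (\<eta> + 2) * s powr p) powr (1 + \<alpha>) / C)"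
      using eventually_at_right_less[of "0::real"] by eventually_elim (rule bound)
  qed
  have ex: "((\<lambda>s. (exp (s * c) - 1) / s) \<longlongrightarrow> c) (at_right 0)" for c :: real
  proof -
    have "((\<lambda>s. exp (s * c)) has_real_derivative c) (at 0)" by (auto intro!: derivative_eq_intros)
    then have "((\<lambda>s. (exp (s * c) - 1) / s) \<longlongrightarrow> c) (at 0)"
      by (simp add: DERIV_def)
    then show ?thesis by (rule tendsto_mono[OF at_le, rotated]) simp
  qed
  have "((\<lambda>s. (exp (s * stable_exponent \<alpha> (\<eta> + 2)) - 1) / s - 2 * ((exp (s * stable_exponent \<alpha> (\<eta> + 1)) - 1) / s) + (exp (s * stable_exponent \<alpha> \<eta>) - 1) / s
      - (LINT x|\<mu> s. indicator {..0} x * w x) / s) \<longlongrightarrow>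
     stable_exponent \<alpha> (\<eta> + 2) - 2 * stable_exponent \<alpha> (\<eta> + 1) + stable_exponent \<alpha> \<eta> - 0) (at_right 0)"
    by (intro tendsto_intros ex neg)
  then show "((\<lambda>s. (LINT x|\<mu> s. indicator {0<..} x * ((1 - exp (- x))^2 * exp (- \<eta> * x))) / s) \<longlongrightarrow>
     stable_exponent \<alpha> (\<eta> + 2) - 2 * stable_exponent \<alpha> (\<eta> + 1) + stable_exponent \<alpha> \<eta>) (at_right 0)"
    unfolding w_def[symmetric] diff_zero
  proof (rule Lim_transform_eventually)
    show "\<forall>\<^sub>F s in at_right 0. (exp (s * stable_exponent \<alpha> (\<eta> + 2)) - 1) / s - 2 * ((exp (s * stable_exponent \<alpha> (\<eta> + 1)) - 1) / s) + (exp (s * stable_exponent \<alpha> \<eta>) - 1) / s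
      - (LINT x|\<mu> s. indicator {..0} x * w x) / s = (LINT x|\<mu> s. indicator {0<..} x * w x) / s"
      using eventually_at_right_less[of "0::real"]
    proof eventually_elim
      case (elim s)
      show ?case
        unfolding split[OF elim] has_bochner_integral_integral_eq[OF full[OF elim]]
        using elim by (simp add: diff_divide_distrib add_divide_distrib)
    qed
  qed
qed

text \<open>
  In the variable \<open>u = exp (- x)\<close> the preceding limits are the moments of the measures with density
  \<open>(1 - exp (- x))\<^sup>2 exp (- x)\<close> with respect to the law of the increment, divided by the time.
  Moments determine the limits of integrals of continuous functions of \<open>u\<close> by the Weierstrass
  theorem.
\<close>

lemma levy_vague_convergence:
  fixes \<mu> :: "real \<Rightarrow> real measure" and f :: "real \<Rightarrow> real"
  assumes \<alpha>: "0 < \<alpha>" "\<alpha> < 1"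
    and [simp]: "\<And>s. sets (\<mu> s) = sets borel"
    and lap: "\<And>s \<eta>. 0 < s \<Longrightarrow> 0 \<le> \<eta> \<Longrightarrow> has_bochner_integral (\<mu> s) (\<lambda>x. exp (- \<eta> * x)) (exp (s * stable_exponent \<alpha> \<eta>))"
    and f: "continuous_on UNIV f" and a: "0 < a" and supp: "\<And>x. x \<notin> {a..b} \<Longrightarrow> f x = 0"
  shows "((\<lambda>s. (LINT x|\<mu> s. f x) / s) \<longlongrightarrow> (LINT x|lborel. f x * levy_density \<alpha> x)) (at_right 0)"
proof -
  define k where "k x = indicator {0<..} x * ((1 - exp (- x))^2 * exp (- x))" for x :: real
  have [measurable]: "k \<in> borel_measurable borel" unfolding k_def[abs_def] by measurable
  have k0: "0 \<le> k x" for x unfolding k_def by simp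
  have kpow: "k x * exp (- x) ^ i = indicator {0<..} x * ((1 - exp (- x))^2 * exp (- (real i + 1) * x))" for x i
    by (simp add: k_def exp_of_nat_mult[symmetric] mult_exp_exp algebra_simps)
  have klev: "k x * exp (- x) ^ i * levy_density \<alpha> x = (1 - exp (- x))^2 * exp (- (real i + 1) * x) * levy_density \<alpha> x" for x i
    unfolding kpow by (simp add: levy_density_def split: split_indicator)
  define \<Lambda> where "\<Lambda> i = stable_exponent \<alpha> (real i + 1 + 2) - 2 * stable_exponent \<alpha> (real i + 1 + 1) + stable_exponent \<alpha> (real i + 1)" for i :: nat
  have mon: "((\<lambda>s. (LINT x|\<mu> s. k x * exp (- x) ^ i) / s) \<longlongrightarrow> \<Lambda> i) (at_right 0)" for i
    unfolding kpow \<Lambda>_def by (rule levy_laplace_second_difference(1)[OF \<alpha> _ lap]) auto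
  have mon_int: "integrable (\<mu> s) (\<lambda>x. k x * exp (- x) ^ i)" if "0 < s" for s i
    unfolding kpow by (rule levy_laplace_second_difference(2)[OF \<alpha> _ lap _ that]) auto
  have \<Lambda>: "has_bochner_integral lborel (\<lambda>x. k x * exp (- x) ^ i * levy_density \<alpha> x) (\<Lambda> i)" for i
  proof (rule has_bochner_integral_nn_integral)
    have "0 \<le> (LINT x|\<mu> s. k x * exp (- x) ^ i) / s" if "0 < s" for s
      using that k0 by (intro divide_nonneg_pos integral_nonneg_AE) auto
    then show "0 \<le> \<Lambda> i"
      by (intro tendsto_lowerbound[OF mon] eventually_mono[OF eventually_at_right_less]) auto
    show "(\<integral>\<^sup>+x. ennreal (k x * exp (- x) ^ i * levy_density \<alpha> x) \<partial>lborel) = ennreal (\<Lambda> i)"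
      unfolding klev \<Lambda>_def by (rule second_difference_integral[OF \<alpha>]) simp
  qed (use k0 levy_density_nonneg[OF \<alpha>] in auto)
  \<comment> \<open>\<open>F\<close> is \<open>f / k\<close> in the variable \<open>u = exp (- x)\<close>. It vanishes near both ends of the unit
    interval since \<open>f\<close> has compact support in \<open>x > 0\<close>.\<close>
  define F where "F u = (if 0 < u \<and> u < 1 then f (- ln u) / ((1 - u)^2 * u) else 0)" for u :: real
  have fF: "f x = k x * F (exp (- x))" for x
    using supp[of x] a by (auto simp: k_def F_def)
  have "continuous_on ({..<exp (- b)} \<union> {exp (- a)<..} \<union> {0<..<1}) F"
  proof (intro continuous_on_open_Un open_Un)
    have z: "F u = 0" if "u < exp (- b) \<or> exp (- a) < u" for u
    proof (cases "0 < u \<and> u < 1")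
      case True
      have "- ln u \<notin> {a..b}"
      proof
        assume "- ln u \<in> {a..b}"
        then have "exp (- b) \<le> exp (ln u)" "exp (ln u) \<le> exp (- a)" by auto
        then show False using that True by auto
      qed
      then show ?thesis using supp by (simp add: F_def)
    qed (auto simp: F_def)
    show "continuous_on {..<exp (- b)} F" by (rule continuous_on_eq[OF continuous_on_const[of _ 0]]) (auto simp: z)
    show "continuous_on {exp (- a)<..} F" by (rule continuous_on_eq[OF continuous_on_const[of _ 0]]) (auto simp: z)
    show "continuous_on {0<..<1} F"
    proof (rule continuous_on_eq)
      show "continuous_on {0<..<1} (\<lambda>u. f (- ln u) / ((1 - u)^2 * u))"
        by (intro continuous_intros continuous_on_compose2[OF f]) auto
    qed (auto simp: F_def)
  qed auto
  moreover have "{0..1} \<subseteq> {..<exp (- b)} \<union> {exp (- a)<..} \<union> {0<..<1}"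
  proof
    fix x :: real assume x: "x \<in> {0..1}"
    have "exp (- a) < 1" "0 < exp (- b)" using a by auto
    then show "x \<in> {..<exp (- b)} \<union> {exp (- a)<..} \<union> {0<..<1}" using x by (cases "x = 0"; cases "x = 1") auto
  qed
  ultimately have contF: "continuous_on {0..1} F" by (rule continuous_on_subset)
  have [measurable_cong]: "sets (\<mu> s) = sets borel" for s by simp
  have [measurable]: "f \<in> borel_measurable borel" using f by (rule borel_measurable_continuous_onI)
  show ?thesis
  proof (rule tendstoI)
    fix e :: real assume e: "0 < e"
    have \<Lambda>0: "0 \<le> \<Lambda> 0" using has_bochner_integral_integral_eq[OF \<Lambda>[of 0]] k0 levy_density_nonneg[OF \<alpha>]
      by (auto intro!: integral_nonneg_AE simp flip: has_bochner_integral_integral_eq[OF \<Lambda>[of 0]])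
    define d where "d = e / (3 * (\<Lambda> 0 + 1))"
    have d: "0 < d" "d * (\<Lambda> 0 + 1) = e / 3" unfolding d_def using e \<Lambda>0 by (auto simp: field_simps)
    obtain q where q: "real_polynomial_function q" "\<And>u. u \<in> {0..1} \<Longrightarrow> \<bar>F u - q u\<bar> < d"
      using Stone_Weierstrass_real_polynomial_function[OF compact_Icc contF d(1)] by blast
    then obtain c n where qs: "q = (\<lambda>u. \<Sum>i\<le>n. c i * u ^ i)"
      unfolding real_polynomial_function_iff_sum by blast
    define Q where "Q x = (\<Sum>i\<le>n. c i * (k x * exp (- x) ^ i))" for x
    have [measurable]: "Q \<in> borel_measurable borel" unfolding Q_def[abs_def] by measurable
    have Qq: "Q x = k x * q (exp (- x))" for x
      unfolding Q_def qs by (simp add: sum_distrib_left mult_ac)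
    have diff: "\<bar>f x - Q x\<bar> \<le> d * k x" for x
    proof (cases "0 < x")
      case True
      then have "\<bar>F (exp (- x)) - q (exp (- x))\<bar> < d" by (intro q) auto
      then have "k x * \<bar>F (exp (- x)) - q (exp (- x))\<bar> \<le> k x * d" by (intro mult_left_mono k0) auto
      moreover have "\<bar>f x - Q x\<bar> = k x * \<bar>F (exp (- x)) - q (exp (- x))\<bar>"
        unfolding fF[of x] Qq using k0[of x] by (simp add: abs_mult flip: right_diff_distrib)
      ultimately show ?thesis by (simp add: mult.commute)
    qed (simp add: fF Qq k_def)
    have k_int: "integrable (\<mu> s) k" if "0 < s" for s using mon_int[OF that, of 0] by simp
    have Q_int: "integrable (\<mu> s) Q" if "0 < s" for s
      unfolding Q_def[abs_def] by (intro Bochner_Integration.integrable_sum integrable_mult_right mon_int that)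
    have f_int: "integrable (\<mu> s) f" if "0 < s" for s
    proof -
      have "integrable (\<mu> s) (\<lambda>x. f x - Q x)"
      proof (rule Bochner_Integration.integrable_bound[OF integrable_mult_right[OF k_int[OF that], of d]])
        show "AE x in \<mu> s. norm (f x - Q x) \<le> norm (d * k x)"
          using diff k0 d by auto
      qed simp
      from Bochner_Integration.integrable_add[OF this Q_int[OF that]] show ?thesis by simp
    qed
    have Q_lev: "has_bochner_integral lborel (\<lambda>x. Q x * levy_density \<alpha> x) (\<Sum>i\<le>n. c i * \<Lambda> i)"
      unfolding Q_def sum_distrib_right mult.assoc
      by (intro has_bochner_integral_sum has_bochner_integral_mult_right) (use \<Lambda> in \<open>simp add: mult.assoc\<close>)
    have k_lev: "has_bochner_integral lborel (\<lambda>x. k x * levy_density \<alpha> x) (\<Lambda> 0)"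
      using \<Lambda>[of 0] by simp
    have diff_lev: "\<bar>f x * levy_density \<alpha> x - Q x * levy_density \<alpha> x\<bar> \<le> d * (k x * levy_density \<alpha> x)" for x
      using mult_right_mono[OF diff[of x] levy_density_nonneg[OF \<alpha>, of x]] levy_density_nonneg[OF \<alpha>, of x]
      by (simp add: abs_mult mult.assoc flip: left_diff_distrib)
    have fl_int: "integrable lborel (\<lambda>x. f x * levy_density \<alpha> x)"
    proof -
      have "integrable lborel (\<lambda>x. f x * levy_density \<alpha> x - Q x * levy_density \<alpha> x)"
      proof (rule Bochner_Integration.integrable_bound)
        show "integrable lborel (\<lambda>x. d * (k x * levy_density \<alpha> x))"
          using k_lev by (auto simp: has_bochner_integral_iff)
        show "AE x in lborel. norm (f x * levy_density \<alpha> x - Q x * levy_density \<alpha> x) \<le> norm (d * (k x * levy_density \<alpha> x))"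
          using diff_lev k0 d levy_density_nonneg[OF \<alpha>] by auto
      qed simp
      moreover have "integrable lborel (\<lambda>x. Q x * levy_density \<alpha> x)" using Q_lev by (simp add: has_bochner_integral_iff)
      ultimately have "integrable lborel (\<lambda>x. (f x * levy_density \<alpha> x - Q x * levy_density \<alpha> x) + Q x * levy_density \<alpha> x)"
        by (rule Bochner_Integration.integrable_add)
      then show ?thesis by simp
    qed
    have lim_err: "\<bar>(LINT x|lborel. f x * levy_density \<alpha> x) - (\<Sum>i\<le>n. c i * \<Lambda> i)\<bar> \<le> d * \<Lambda> 0"
    proof -
      have "(LINT x|lborel. f x * levy_density \<alpha> x) - (\<Sum>i\<le>n. c i * \<Lambda> i) = (LINT x|lborel. f x * levy_density \<alpha> x - Q x * levy_density \<alpha> x)"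
        using fl_int Q_lev by (subst Bochner_Integration.integral_diff) (auto simp: has_bochner_integral_iff)
      also have "\<bar>\<dots>\<bar> \<le> (LINT x|lborel. d * (k x * levy_density \<alpha> x))"
        by (rule order_trans[OF integral_abs_bound], rule integral_mono) (use fl_int Q_lev k_lev diff_lev in \<open>auto simp: has_bochner_integral_iff\<close>)
      also have "\<dots> = d * \<Lambda> 0" using k_lev by (simp add: has_bochner_integral_iff)
      finally show ?thesis .
    qed
    have "((\<lambda>s. \<Sum>i\<le>n. c i * ((LINT x|\<mu> s. k x * exp (- x) ^ i) / s)) \<longlongrightarrow> (\<Sum>i\<le>n. c i * \<Lambda> i)) (at_right 0)"
      by (intro tendsto_intros mon)
    from tendstoD[OF this, of "e/3"] have ev1: "\<forall>\<^sub>F s in at_right 0. \<bar>(\<Sum>i\<le>n. c i * ((LINT x|\<mu> s. k x * exp (- x) ^ i) / s)) - (\<Sum>i\<le>n. c i * \<Lambda> i)\<bar> < e/3"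
      using e by (simp add: dist_real_def)
    have "\<forall>\<^sub>F s in at_right 0. (LINT x|\<mu> s. k x * exp (- x) ^ 0) / s < \<Lambda> 0 + 1"
      by (rule order_tendstoD(2)[OF mon]) simp
    then have ev2: "\<forall>\<^sub>F s in at_right 0. (LINT x|\<mu> s. k x) / s < \<Lambda> 0 + 1" by simp
    show "\<forall>\<^sub>F s in at_right 0. dist ((LINT x|\<mu> s. f x) / s) (LINT x|lborel. f x * levy_density \<alpha> x) < e"
      using ev1 ev2 eventually_at_right_less[of "0::real"]
    proof eventually_elim
      case (elim s)
      have "(LINT x|\<mu> s. f x) - (LINT x|\<mu> s. Q x) = (LINT x|\<mu> s. f x - Q x)"
        using elim by (subst Bochner_Integration.integral_diff) (auto intro: f_int Q_int)
      also have "\<bar>\<dots>\<bar> \<le> (LINT x|\<mu> s. d * k x)"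
        by (rule order_trans[OF integral_abs_bound], rule integral_mono) (use elim diff in \<open>auto intro!: f_int Q_int k_int\<close>)
      also have "\<dots> = d * (LINT x|\<mu> s. k x)" by simp
      finally have "\<bar>(LINT x|\<mu> s. f x) - (LINT x|\<mu> s. Q x)\<bar> / s \<le> d * (LINT x|\<mu> s. k x) / s"
        using elim by (intro divide_right_mono) auto
      then have "\<bar>(LINT x|\<mu> s. f x) / s - (LINT x|\<mu> s. Q x) / s\<bar> \<le> d * ((LINT x|\<mu> s. k x) / s)"
        using elim by (simp add: abs_divide diff_divide_distrib[symmetric])
      also have "\<dots> \<le> d * (\<Lambda> 0 + 1)" using elim d by (intro mult_left_mono) auto
      finally have 1: "\<bar>(LINT x|\<mu> s. f x) / s - (LINT x|\<mu> s. Q x) / s\<bar> \<le> e / 3" unfolding d .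
      have 2: "(LINT x|\<mu> s. Q x) / s = (\<Sum>i\<le>n. c i * ((LINT x|\<mu> s. k x * exp (- x) ^ i) / s))"
        unfolding Q_def using elim by (subst Bochner_Integration.integral_sum) (auto intro!: mon_int simp: sum_divide_distrib)
      have "d * \<Lambda> 0 < e / 3" using d by (simp add: algebra_simps)
      then show ?case using 1 elim lim_err unfolding 2 dist_real_def by linarith
    qed
  qed
qed


section \<open>Moments and maxima of squared Bessel bridges\<close>

lemma sets_besq_reference [measurable_cong, simp]: "sets (besq_reference \<delta>) = sets borel"
  by (simp add: besq_reference_def)

lemma space_besq_reference [simp]: "space (besq_reference \<delta>) = UNIV"
  by (simp add: besq_reference_def)

lemma sigma_finite_besq_reference: "sigma_finite_measure (besq_reference \<delta>)"
  unfolding besq_reference_def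
  by (subst sigma_finite_measure.sigma_finite_iff_density_finite[OF sigma_finite_lborel]) auto

lemma AE_besq_reference_pos: "AE x in besq_reference \<delta>. 0 < x"
  unfolding besq_reference_def by (subst AE_density) (auto simp: indicator_def split: if_splits)

lemma besq_density_measurable [measurable]:
  "(\<lambda>(x, y). besq_density \<delta> t x y) \<in> borel_measurable (borel \<Otimes>\<^sub>M borel)"
  unfolding besq_density_def by measurable

lemma besq_density_measurable' [measurable (raw)]:
  assumes [measurable]: "f \<in> borel_measurable M" "g \<in> borel_measurable M"
  shows "(\<lambda>\<omega>. besq_density \<delta> t (f \<omega>) (g \<omega>)) \<in> borel_measurable M"
  using measurable_compose[OF measurable_Pair[OF assms] besq_density_measurable] by simp

lemma besq_density_commute: "besq_density \<delta> t x y = besq_density \<delta> t y x"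
  by (simp add: besq_density_def mult.commute add.commute)

lemma besq_density_nonneg:
  assumes "0 < \<delta>" "0 \<le> x" "0 \<le> y"
  shows "0 \<le> besq_density \<delta> t x y"
  unfolding besq_density_def using assms summable_besq_series[OF assms(1), of "x * y / (4 * t^2)"]
  by (intro mult_nonneg_nonneg suminf_nonneg divide_nonneg_nonneg) (auto intro!: less_imp_le[OF Gamma_real_pos])

lemma besq_density_from_0:
  assumes "0 < \<delta>" "0 < t"
  shows "besq_density \<delta> t 0 y = (2 * t) powr (- (\<delta>/2)) * exp (- y / (2 * t)) / Gamma (\<delta>/2)"
proof -
  have "(\<Sum>k. (0 * y / (4 * t^2)) ^ k / (fact k * Gamma (real k + \<delta>/2))) = (\<Sum>k. if k = 0 then 1 / Gamma (\<delta>/2) else 0)"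
    by (intro arg_cong[where f = suminf] ext) auto
  also have "\<dots> = 1 / Gamma (\<delta>/2)" by (subst suminf_finite[of "{0}"]) auto
  finally show ?thesis unfolding besq_density_def by simp
qed

lemma besq_moment_from_0:
  assumes \<delta>: "0 < \<delta>" and c: "0 < c" and \<beta>: "0 \<le> \<beta>"
  shows "(\<integral>\<^sup>+x. ennreal (x powr \<beta> * exp (- c * x)) \<partial>besq_reference \<delta>) = ennreal (Gamma (\<delta>/2 + \<beta>) / c powr (\<delta>/2 + \<beta>))"
proof -
  have "(\<integral>\<^sup>+x. ennreal (x powr \<beta> * exp (- c * x)) \<partial>besq_reference \<delta>) =
      (\<integral>\<^sup>+x. ennreal (indicator {0<..} x * x powr (\<delta>/2 + \<beta> - 1) * exp (- c * x)) \<partial>lborel)"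
    unfolding besq_reference_def
    by (subst nn_integral_density) (auto intro!: nn_integral_cong simp: indicator_def ennreal_mult'[symmetric] powr_add[symmetric] mult.assoc[symmetric] add_ac add_diff_eq)
  also have "\<dots> = ennreal (Gamma (\<delta>/2 + \<beta>) / c powr (\<delta>/2 + \<beta>))"
    by (rule nn_integral_powr_exp) (use \<delta> \<beta> c in auto)
  finally show ?thesis .
qed

text \<open>
  Multiplication by \<open>exp (\<rho> y)\<close> turns the density at time \<open>t\<close> from \<open>x\<close> into a multiple of the
  density at time \<open>2 t\<close> from \<open>4 x\<close>, weighted by \<open>exp (- r y)\<close> with \<open>r \<ge> 0\<close>. This reduces positive
  exponential moments to the Laplace transform.
\<close>

lemma besq_density_positive_exponential_moment:
  fixes \<delta> t x \<rho> :: real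
  assumes \<delta>: "0 < \<delta>" and t: "0 < t" and x: "0 \<le> x" and \<rho>: "0 \<le> \<rho>" "4 * \<rho> * t \<le> 1"
  shows "(\<integral>\<^sup>+y. ennreal (exp (\<rho> * y) * besq_density \<delta> t x y) \<partial>besq_reference \<delta>)
     = ennreal ((1 - 2 * \<rho> * t) powr (- (\<delta>/2)) * exp (\<rho> * x / (1 - 2 * \<rho> * t)))"
proof -
  define r where "r = 1 / (4 * t) - \<rho>"
  have r: "0 \<le> r" using \<rho> t by (simp add: r_def field_simps)
  define K where "K = 2 powr (\<delta>/2) * exp (x / (2 * t))"
  have K: "0 \<le> K" by (simp add: K_def)
  have tilt: "exp (\<rho> * y) * besq_density \<delta> t x y = K * (exp (- r * y) * besq_density \<delta> (2 * t) (4 * x) y)" for y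
  proof -
    have s: "4 * x * y / (4 * (2 * t)^2) = x * y / (4 * t^2)" by (simp add: power2_eq_square)
    have p: "(2 * t) powr (- (\<delta>/2)) = 2 powr (\<delta>/2) * (2 * (2 * t)) powr (- (\<delta>/2))"
      using t powr_mult[of 2 "2 * t" "- (\<delta>/2)"] powr_add[of 2 "\<delta>/2" "- (\<delta>/2)"] by (simp add: mult.assoc[symmetric])
    have e: "exp (\<rho> * y) * exp (- (x + y) / (2 * t)) = exp (x / (2 * t)) * (exp (- r * y) * exp (- (4 * x + y) / (2 * (2 * t))))"
      using t by (simp add: mult_exp_exp r_def field_simps)
    let ?S = "\<Sum>k. (x * y / (4 * t^2)) ^ k / (fact k * Gamma (real k + \<delta>/2))"
    have "exp (\<rho> * y) * besq_density \<delta> t x y = (2 * t) powr (- (\<delta>/2)) * ?S * (exp (\<rho> * y) * exp (- (x + y) / (2 * t)))"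
      unfolding besq_density_def by (simp only: mult_ac)
    also have "\<dots> = K * (exp (- r * y) * besq_density \<delta> (2 * t) (4 * x) y)"
      unfolding besq_density_def K_def s p e by (simp only: mult_ac)
    finally show ?thesis .
  qed
  have u: "0 < 1 - 2 * \<rho> * t" using \<rho> by linarith
  have e1: "1 + 2 * r * (2 * t) = 2 * (1 - 2 * \<rho> * t)" using t by (simp add: r_def field_simps)
  have "(\<integral>\<^sup>+y. ennreal (exp (\<rho> * y) * besq_density \<delta> t x y) \<partial>besq_reference \<delta>) =
      ennreal K * (\<integral>\<^sup>+y. ennreal (exp (- r * y) * besq_density \<delta> (2 * t) (4 * x) y) \<partial>besq_reference \<delta>)"
    unfolding tilt ennreal_mult'[OF K] by (rule nn_integral_cmult) measurable
  also have "\<dots> = ennreal K * ennreal ((1 + 2 * r * (2 * t)) powr (- (\<delta>/2)) * exp (- r * (4 * x) / (1 + 2 * r * (2 * t))))"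
    by (subst besq_density_laplace) (use \<delta> t x r in auto)
  also have "\<dots> = ennreal (K * ((1 + 2 * r * (2 * t)) powr (- (\<delta>/2)) * exp (- r * (4 * x) / (1 + 2 * r * (2 * t)))))"
    by (rule ennreal_mult'[OF K, symmetric])
  also have "K * ((1 + 2 * r * (2 * t)) powr (- (\<delta>/2)) * exp (- r * (4 * x) / (1 + 2 * r * (2 * t)))) =
      (1 - 2 * \<rho> * t) powr (- (\<delta>/2)) * exp (\<rho> * x / (1 - 2 * \<rho> * t))"
  proof -
    have "(2 * (1 - 2 * \<rho> * t)) powr (- (\<delta>/2)) = 2 powr (- (\<delta>/2)) * (1 - 2 * \<rho> * t) powr (- (\<delta>/2))"
      by (subst powr_mult) (use u in auto)
    moreover have "2 powr (\<delta>/2) * 2 powr (- (\<delta>/2)) = (1::real)" by (simp flip: powr_add)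
    ultimately have pa: "2 powr (\<delta>/2) * (2 * (1 - 2 * \<rho> * t)) powr (- (\<delta>/2)) = (1 - 2 * \<rho> * t) powr (- (\<delta>/2))"
      by (metis mult.assoc mult_1)
    have pe: "x / (2 * t) + (- r * (4 * x) / (2 * (1 - 2 * \<rho> * t))) = \<rho> * x / (1 - 2 * \<rho> * t)"
    proof -
      have rt: "4 * (r * t) = 1 - 4 * (\<rho> * t)" using t by (simp add: r_def field_simps)
      have "x / (2 * t) + (- r * (4 * x) / (2 * (1 - 2 * \<rho> * t))) = (x * (1 - 2 * \<rho> * t) - 4 * (r * t) * x) / (2 * t * (1 - 2 * \<rho> * t))"
        using t u by (simp add: field_simps)
      also have "x * (1 - 2 * \<rho> * t) - 4 * (r * t) * x = 2 * t * (\<rho> * x)"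
        unfolding rt by (simp add: algebra_simps)
      finally show ?thesis using t by simp
    qed
    have "K * ((2 * (1 - 2 * \<rho> * t)) powr (- (\<delta>/2)) * exp (- r * (4 * x) / (2 * (1 - 2 * \<rho> * t)))) =
      (2 powr (\<delta>/2) * (2 * (1 - 2 * \<rho> * t)) powr (- (\<delta>/2))) * (exp (x / (2 * t)) * exp (- r * (4 * x) / (2 * (1 - 2 * \<rho> * t))))"
      unfolding K_def by (simp only: mult_ac)
    then show ?thesis unfolding e1 pa mult_exp_exp pe .
  qed
  finally show ?thesis .
qed

lemma fourth_power_le_exp: "(u::real) ^ 4 \<le> 64 * (exp u + exp (- u))"
proof -
  have *: "v ^ 4 \<le> 64 * exp v" if "0 \<le> v" for v :: real
  proof -
    have "v^2 / 8 \<le> exp (v / 2)"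
      using exp_lower_Taylor_quadratic[of "v / 2"] that by (simp add: power2_eq_square)
    then have "(v^2 / 8)^2 \<le> exp (v / 2) ^ 2" by (intro power_mono) auto
    then show ?thesis by (simp add: power_divide exp_double[symmetric] flip: power_mult)
  qed
  show ?thesis
  proof (cases "0 \<le> u")
    case True
    then show ?thesis using *[of u] by (smt (verit) exp_gt_zero)
  next
    case False
    then show ?thesis using *[of "- u"] by (simp add: add_increasing)
  qed
qed

definition besq_const :: "real \<Rightarrow> real" where
  "besq_const \<delta> = 131072 * (2 powr (\<delta>/2) + 1) * exp 1"

lemma besq_const_nonneg: "0 \<le> besq_const \<delta>" by (simp add: besq_const_def)

text \<open>
  The fourth power is bounded by exponentials at the scale \<open>1 / \<rho>\<close> of a typical displacement, which
  is of order \<open>t + sqrt (t x)\<close>.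
\<close>

lemma besq_fourth_moment:
  fixes \<delta> t x :: real
  assumes \<delta>: "0 < \<delta>" and t: "0 < t" "t \<le> 1" and x: "0 \<le> x"
  shows "(\<integral>\<^sup>+y. ennreal ((y - x)^4 * besq_density \<delta> t x y) \<partial>besq_reference \<delta>) \<le> ennreal (besq_const \<delta> * t^2 * (1 + x^2))"
proof -
  \<comment> \<open>The summand \<open>4 t\<close> ensures \<open>4 \<rho> t \<le> 1\<close>, the other one keeps the exponents below
    bounded.\<close>
  define R where "R = 4 * t + 2 * sqrt (t * x)"
  define \<rho> where "\<rho> = 1 / R"
  have sq: "0 \<le> sqrt (t * x)" "sqrt (t * x) ^ 2 = t * x" using t x by auto
  have R: "0 < R" "4 * t \<le> R" "4 * (t * x) \<le> R^2"
    using t sq by (auto simp: R_def add_pos_nonneg power2_sum) (simp add: power_mult_distrib power2_eq_square)?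
  have \<rho>: "0 < \<rho>" "4 * \<rho> * t \<le> 1" "4 * \<rho>^2 * (t * x) \<le> 1"
    using R by (auto simp: \<rho>_def power_divide divide_le_eq)
  have u: "1/2 \<le> 1 - 2 * \<rho> * t" using \<rho> by linarith
  have q0: "0 \<le> besq_density \<delta> t x y" if "0 < y" for y using besq_density_nonneg[OF \<delta> x] that by simp
  have up: "exp (- \<rho> * x) * ((1 - 2 * \<rho> * t) powr (- (\<delta>/2)) * exp (\<rho> * x / (1 - 2 * \<rho> * t))) \<le> 2 powr (\<delta>/2) * exp 1"
  proof -
    have "(1 - 2 * \<rho> * t) powr (- (\<delta>/2)) \<le> (1/2) powr (- (\<delta>/2))"
      using u \<delta> by (intro powr_mono2') auto
    also have "\<dots> = 2 powr (\<delta>/2)" by (simp add: powr_divide powr_minus_divide)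
    finally have 1: "(1 - 2 * \<rho> * t) powr (- (\<delta>/2)) \<le> 2 powr (\<delta>/2)" .
    have "- \<rho> * x + \<rho> * x / (1 - 2 * \<rho> * t) = 2 * \<rho>^2 * (t * x) / (1 - 2 * \<rho> * t)"
      using u by (simp add: field_simps power2_eq_square)
    also have "\<dots> \<le> 2 * \<rho>^2 * (t * x) / (1/2)" using u t x by (intro divide_left_mono) auto
    also have "\<dots> \<le> 1" using \<rho> by simp
    finally have "exp (- \<rho> * x) * exp (\<rho> * x / (1 - 2 * \<rho> * t)) \<le> exp 1" by (simp add: mult_exp_exp)
    from mult_mono[OF 1 this] show ?thesis by (simp add: mult_ac)
  qed
  have dn: "exp (\<rho> * x) * ((1 + 2 * \<rho> * t) powr (- (\<delta>/2)) * exp (- \<rho> * x / (1 + 2 * \<rho> * t))) \<le> 1 * exp 1"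
  proof -
    have "(1 + 2 * \<rho> * t) powr (- (\<delta>/2)) \<le> 1 powr (- (\<delta>/2))"
      using \<rho> t \<delta> by (intro powr_mono2') auto
    then have 1: "(1 + 2 * \<rho> * t) powr (- (\<delta>/2)) \<le> 1" by simp
    have p: "1 \<le> 1 + 2 * \<rho> * t" using \<rho> t by simp
    have "\<rho> * x + (- \<rho> * x / (1 + 2 * \<rho> * t)) = 2 * \<rho>^2 * (t * x) / (1 + 2 * \<rho> * t)"
      using p by (simp add: field_simps power2_eq_square)
    also have "\<dots> \<le> 2 * \<rho>^2 * (t * x) / 1" using p t x by (intro divide_left_mono) auto
    also have "\<dots> \<le> 1" using \<rho> t x by simp
    finally have "exp (\<rho> * x) * exp (- \<rho> * x / (1 + 2 * \<rho> * t)) \<le> exp 1" by (simp add: mult_exp_exp)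
    from mult_mono[OF 1 this] show ?thesis by (simp add: mult_ac)
  qed
  let ?U = "\<lambda>y. ennreal (64 * R^4 * exp (- \<rho> * x)) * ennreal (exp (\<rho> * y) * besq_density \<delta> t x y)"
  let ?D = "\<lambda>y. ennreal (64 * R^4 * exp (\<rho> * x)) * ennreal (exp (- \<rho> * y) * besq_density \<delta> t x y)"
  have "(\<integral>\<^sup>+y. ennreal ((y - x)^4 * besq_density \<delta> t x y) \<partial>besq_reference \<delta>) \<le> (\<integral>\<^sup>+y. ?U y + ?D y \<partial>besq_reference \<delta>)"
  proof (rule nn_integral_mono_AE, rule eventually_mono[OF AE_besq_reference_pos])
    fix y :: real assume y: "0 < y"
    have "(\<rho> * (y - x))^4 \<le> 64 * (exp (\<rho> * (y - x)) + exp (- (\<rho> * (y - x))))" by (rule fourth_power_le_exp)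
    then have "(y - x)^4 \<le> 64 * R^4 * (exp (\<rho> * (y - x)) + exp (- (\<rho> * (y - x))))"
      using R by (simp add: \<rho>_def power_mult_distrib power_divide divide_le_eq mult_ac)
    also have "exp (\<rho> * (y - x)) = exp (- \<rho> * x) * exp (\<rho> * y)" by (simp add: mult_exp_exp algebra_simps)
    also have "exp (- (\<rho> * (y - x))) = exp (\<rho> * x) * exp (- \<rho> * y)" by (simp add: mult_exp_exp algebra_simps)
    finally have "(y - x)^4 * besq_density \<delta> t x y \<le> 64 * R^4 * (exp (- \<rho> * x) * exp (\<rho> * y) + exp (\<rho> * x) * exp (- \<rho> * y)) * besq_density \<delta> t x y"
      by (rule mult_right_mono) (rule q0[OF y])
    also have "\<dots> = 64 * R^4 * exp (- \<rho> * x) * (exp (\<rho> * y) * besq_density \<delta> t x y) + 64 * R^4 * exp (\<rho> * x) * (exp (- \<rho> * y) * besq_density \<delta> t x y)"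
      by (simp add: algebra_simps)
    finally show "ennreal ((y - x)^4 * besq_density \<delta> t x y) \<le> ?U y + ?D y"
      using q0[OF y] R by (simp add: ennreal_mult'[symmetric] ennreal_plus[symmetric] del: ennreal_plus)
  qed
  also have "\<dots> = ennreal (64 * R^4 * exp (- \<rho> * x)) * ennreal ((1 - 2 * \<rho> * t) powr (- (\<delta>/2)) * exp (\<rho> * x / (1 - 2 * \<rho> * t))) +
      ennreal (64 * R^4 * exp (\<rho> * x)) * ennreal ((1 + 2 * \<rho> * t) powr (- (\<delta>/2)) * exp (- \<rho> * x / (1 + 2 * \<rho> * t)))"
  proof (subst nn_integral_add)
    show "(\<integral>\<^sup>+y. ?U y \<partial>besq_reference \<delta>) + (\<integral>\<^sup>+y. ?D y \<partial>besq_reference \<delta>) = ennreal (64 * R^4 * exp (- \<rho> * x)) * ennreal ((1 - 2 * \<rho> * t) powr (- (\<delta>/2)) * exp (\<rho> * x / (1 - 2 * \<rho> * t))) +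
      ennreal (64 * R^4 * exp (\<rho> * x)) * ennreal ((1 + 2 * \<rho> * t) powr (- (\<delta>/2)) * exp (- \<rho> * x / (1 + 2 * \<rho> * t)))"
      using besq_density_positive_exponential_moment[OF \<delta> t(1) x, of \<rho>] besq_density_laplace[OF \<delta> t(1) x, of \<rho>] \<rho>
      by (simp add: nn_integral_cmult)
  qed measurable
  also have "\<dots> = ennreal (64 * R^4 * (exp (- \<rho> * x) * ((1 - 2 * \<rho> * t) powr (- (\<delta>/2)) * exp (\<rho> * x / (1 - 2 * \<rho> * t))) +
      exp (\<rho> * x) * ((1 + 2 * \<rho> * t) powr (- (\<delta>/2)) * exp (- \<rho> * x / (1 + 2 * \<rho> * t)))))"
    using R by (simp add: ennreal_mult'[symmetric] ennreal_plus[symmetric] distrib_left mult.assoc del: ennreal_plus)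
  also have "\<dots> \<le> ennreal (64 * R^4 * (2 powr (\<delta>/2) * exp 1 + 1 * exp 1))"
    using up dn R by (intro ennreal_leI mult_left_mono add_mono) auto
  also have "\<dots> \<le> ennreal (besq_const \<delta> * t^2 * (1 + x^2))"
  proof (rule ennreal_leI)
    have "(a + b)^4 \<le> 8 * (a^4 + b^4)" for a b :: real
    proof -
      have "(a + b)^2 \<le> 2 * (a^2 + b^2)" using sum_squares_bound[of a b] by (simp add: power2_sum)
      then have "((a + b)^2)^2 \<le> (2 * (a^2 + b^2))^2" by (intro power_mono) auto
      also have "\<dots> = 4 * (a^2 + b^2)^2" using power_mult_distrib[of 2 "a^2 + b^2" 2] by simp
      also have "(a^2 + b^2)^2 \<le> 2 * ((a^2)^2 + (b^2)^2)" using sum_squares_bound[of "a^2" "b^2"] by (simp add: power2_sum)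
      finally show ?thesis by (simp flip: power_mult)
    qed
    then have "R^4 \<le> 8 * ((4 * t)^4 + (2 * sqrt (t * x))^4)" unfolding R_def .
    also have "(2 * sqrt (t * x))^4 = 16 * (sqrt (t * x)^2)^2" by (simp add: power_mult_distrib flip: power_mult)
    also have "\<dots> = 16 * t^2 * x^2" unfolding sq by (simp add: power_mult_distrib)
    also have "(4 * t)^4 = 256 * (t^2 * t^2)" by (simp add: power_mult_distrib flip: power_add)
    also have "\<dots> \<le> 256 * (t^2 * 1)" using t by (intro mult_left_mono power_le_one) auto
    finally have "R^4 \<le> 8 * (256 * (t^2 * 1) + 16 * t^2 * x^2)" by simp
    moreover have "8 * (256 * (t^2 * 1) + 16 * t^2 * x^2) = 2048 * t^2 + 128 * (t^2 * x^2)" by simp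
    moreover have "2048 * t^2 * (1 + x^2) = 2048 * t^2 + 2048 * (t^2 * x^2)" by (simp add: algebra_simps)
    moreover have "0 \<le> t^2 * x^2" by simp
    ultimately have "R^4 \<le> 2048 * t^2 * (1 + x^2)" by linarith
    then have "R^4 * (64 * ((2 powr (\<delta>/2) + 1) * exp 1)) \<le> 2048 * t^2 * (1 + x^2) * (64 * ((2 powr (\<delta>/2) + 1) * exp 1))"
      by (rule mult_right_mono) auto
    then show "64 * R^4 * (2 powr (\<delta>/2) * exp 1 + 1 * exp 1) \<le> besq_const \<delta> * t^2 * (1 + x^2)"
      by (simp add: besq_const_def algebra_simps)
  qed
  finally show ?thesis .
qed


lemma bridge_marginal_density:
  assumes \<delta>: "0 < \<delta>" and u: "0 < u" "u < 1"
  shows "besq_density \<delta> u 0 x * besq_density \<delta> (1 - u) x 0 / besq_density \<delta> 1 0 0 =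
     (2 * u * (1 - u)) powr (- (\<delta>/2)) / Gamma (\<delta>/2) * exp (- (1 / (2 * u * (1 - u))) * x)"
proof -
  have G: "0 < Gamma (\<delta>/2)" using \<delta> by (intro Gamma_real_pos) auto
  have e: "exp (- x / (2 * u)) * exp (- x / (2 * (1 - u))) = exp (- (1 / (2 * u * (1 - u))) * x)"
    using u by (simp add: mult_exp_exp field_simps)
  have p: "(2 * u) powr (- (\<delta>/2)) * (2 * (1 - u)) powr (- (\<delta>/2)) = (2 * u * (1 - u)) powr (- (\<delta>/2)) * 2 powr (- (\<delta>/2))"
    using u by (subst (1 2) powr_mult[symmetric]) (auto simp: mult_ac)
  have "besq_density \<delta> u 0 x * besq_density \<delta> (1 - u) x 0 / besq_density \<delta> 1 0 0 =
      ((2 * u) powr (- (\<delta>/2)) * (2 * (1 - u)) powr (- (\<delta>/2))) * (exp (- x / (2 * u)) * exp (- x / (2 * (1 - u)))) / (Gamma (\<delta>/2) * 2 powr (- (\<delta>/2)))"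
    unfolding besq_density_commute[of \<delta> "1 - u" x 0] using \<delta> u G by (simp add: besq_density_from_0 field_simps)
  then show ?thesis unfolding e p using G by simp
qed

lemma bridge_one_dim:
  fixes f :: "real \<Rightarrow> ennreal"
  assumes Y: "standard_besq_bridge M \<delta> Y" and \<delta>: "0 < \<delta>" and u: "0 < u" "u < 1"
    and [measurable]: "f \<in> borel_measurable borel"
  shows "(\<integral>\<^sup>+\<omega>. f (Y u \<omega>) \<partial>M) = (\<integral>\<^sup>+x. f x * ennreal (besq_density \<delta> u 0 x * besq_density \<delta> (1 - u) x 0 / besq_density \<delta> 1 0 0) \<partial>besq_reference \<delta>)"
proof -
  define t where "t = (\<lambda>i::nat. if i = 0 then 0 else if i = 1 then u else 1)"
  have t: "t 0 = 0" "t (Suc 0) = u" "t (Suc (Suc 0)) = 1" "strict_mono_on {..Suc 1} t"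
    using u by (auto simp: t_def strict_mono_on_def)
  have meas: "(\<lambda>\<omega>. \<lambda>i\<in>{1..1}. Y (t i) \<omega>) \<in> M \<rightarrow>\<^sub>M (\<Pi>\<^sub>M i\<in>{1..1::nat}. borel)"
    using Y u by (intro measurable_restrict) (auto simp: standard_besq_bridge_def t_def)
  have D: "besq_bridge_density \<delta> 1 t x = besq_density \<delta> u 0 (x 1) * besq_density \<delta> (1 - u) (x 1) 0 / besq_density \<delta> 1 0 0" for x
    by (simp add: besq_bridge_density_def Let_def t atMost_Suc)
  have distr: "distr M (\<Pi>\<^sub>M i\<in>{1..1::nat}. borel) (\<lambda>\<omega>. \<lambda>i\<in>{1..1}. Y (t i) \<omega>) =
      density (\<Pi>\<^sub>M i\<in>{1..1}. besq_reference \<delta>) (\<lambda>x. ennreal (besq_bridge_density \<delta> 1 t x))"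
    using Y unfolding standard_besq_bridge_def by (elim conjE allE[of _ "1::nat"] allE[of _ t] impE) (use t in auto)
  interpret product_sigma_finite "\<lambda>_::nat. besq_reference \<delta>"
    by (rule product_sigma_finite.intro) (rule sigma_finite_besq_reference)
  have [measurable_cong]: "sets (\<Pi>\<^sub>M i\<in>{1..1::nat}. besq_reference \<delta>) = sets (\<Pi>\<^sub>M i\<in>{1..1::nat}. borel)"
    by (intro sets_PiM_cong) auto
  have "(\<integral>\<^sup>+\<omega>. f (Y u \<omega>) \<partial>M) = (\<integral>\<^sup>+x. f (x 1) \<partial>distr M (\<Pi>\<^sub>M i\<in>{1..1::nat}. borel) (\<lambda>\<omega>. \<lambda>i\<in>{1..1}. Y (t i) \<omega>))"
    by (subst nn_integral_distr[OF meas]) (auto simp: t)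
  also have "\<dots> = (\<integral>\<^sup>+x. ennreal (besq_density \<delta> u 0 (x 1) * besq_density \<delta> (1 - u) (x 1) 0 / besq_density \<delta> 1 0 0) * f (x 1) \<partial>(\<Pi>\<^sub>M i\<in>{1..1::nat}. besq_reference \<delta>))"
    unfolding distr D by (subst nn_integral_density) auto
  also have "{1..1::nat} = {1}" by auto
  also have "(\<integral>\<^sup>+x. ennreal (besq_density \<delta> u 0 (x 1) * besq_density \<delta> (1 - u) (x 1) 0 / besq_density \<delta> 1 0 0) * f (x 1) \<partial>(\<Pi>\<^sub>M i\<in>{1::nat}. besq_reference \<delta>)) =
     (\<integral>\<^sup>+x. ennreal (besq_density \<delta> u 0 x * besq_density \<delta> (1 - u) x 0 / besq_density \<delta> 1 0 0) * f x \<partial>besq_reference \<delta>)"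
    by (subst product_nn_integral_singleton[symmetric]) auto
  finally show ?thesis by (simp add: mult.commute)
qed

lemma bridge_two_dim:
  fixes f :: "real \<Rightarrow> real \<Rightarrow> ennreal"
  assumes Y: "standard_besq_bridge M \<delta> Y" and \<delta>: "0 < \<delta>" and u: "0 < s" "s < u" "u < 1"
    and f [measurable]: "(\<lambda>(x, y). f x y) \<in> borel_measurable (borel \<Otimes>\<^sub>M borel)"
  shows "(\<integral>\<^sup>+\<omega>. f (Y s \<omega>) (Y u \<omega>) \<partial>M) = (\<integral>\<^sup>+x. (\<integral>\<^sup>+y. f x y *
    ennreal (besq_density \<delta> s 0 x * besq_density \<delta> (u - s) x y * besq_density \<delta> (1 - u) y 0 / besq_density \<delta> 1 0 0) \<partial>besq_reference \<delta>) \<partial>besq_reference \<delta>)"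
proof -
  define t where "t = (\<lambda>i::nat. if i = 0 then 0 else if i = 1 then s else if i = 2 then u else 1)"
  have t: "t 0 = 0" "t (Suc 0) = s" "t (Suc (Suc 0)) = u" "t (Suc (Suc (Suc 0))) = 1" "strict_mono_on {..Suc 2} t"
    using u by (auto simp: t_def strict_mono_on_def)
  have meas: "(\<lambda>\<omega>. \<lambda>i\<in>{1..2}. Y (t i) \<omega>) \<in> M \<rightarrow>\<^sub>M (\<Pi>\<^sub>M i\<in>{1..2::nat}. borel)"
    using Y u by (intro measurable_restrict) (auto simp: standard_besq_bridge_def t_def)
  have D: "besq_bridge_density \<delta> 2 t x = besq_density \<delta> s 0 (x 1) * besq_density \<delta> (u - s) (x 1) (x 2) * besq_density \<delta> (1 - u) (x 2) 0 / besq_density \<delta> 1 0 0" for x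
    by (simp add: besq_bridge_density_def Let_def t atMost_Suc numeral_2_eq_2 mult_ac)
  have distr: "distr M (\<Pi>\<^sub>M i\<in>{1..2::nat}. borel) (\<lambda>\<omega>. \<lambda>i\<in>{1..2}. Y (t i) \<omega>) =
      density (\<Pi>\<^sub>M i\<in>{1..2}. besq_reference \<delta>) (\<lambda>x. ennreal (besq_bridge_density \<delta> 2 t x))"
    using Y unfolding standard_besq_bridge_def by (elim conjE allE[of _ "2::nat"] allE[of _ t] impE) (use t in \<open>auto simp: numeral_2_eq_2\<close>)
  interpret product_sigma_finite "\<lambda>_::nat. besq_reference \<delta>"
    by (rule product_sigma_finite.intro) (rule sigma_finite_besq_reference)
  have [measurable_cong]: "sets (\<Pi>\<^sub>M i\<in>{1..2::nat}. besq_reference \<delta>) = sets (\<Pi>\<^sub>M i\<in>{1..2::nat}. borel)"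
    by (intro sets_PiM_cong) auto
  have [measurable_cong]: "sets (\<Pi>\<^sub>M i\<in>insert 2 {1::nat}. besq_reference \<delta>) = sets (\<Pi>\<^sub>M i\<in>insert 2 {1::nat}. borel)"
    by (intro sets_PiM_cong) auto
  let ?D = "\<lambda>x y. ennreal (besq_density \<delta> s 0 x * besq_density \<delta> (u - s) x y * besq_density \<delta> (1 - u) y 0 / besq_density \<delta> 1 0 0)"
  have "(\<integral>\<^sup>+\<omega>. f (Y s \<omega>) (Y u \<omega>) \<partial>M) = (\<integral>\<^sup>+x. f (x 1) (x 2) \<partial>distr M (\<Pi>\<^sub>M i\<in>{1..2::nat}. borel) (\<lambda>\<omega>. \<lambda>i\<in>{1..2}. Y (t i) \<omega>))"
    by (subst nn_integral_distr[OF meas]) (auto simp: t t_def)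
  also have "\<dots> = (\<integral>\<^sup>+x. ?D (x 1) (x 2) * f (x 1) (x 2) \<partial>(\<Pi>\<^sub>M i\<in>{1..2::nat}. besq_reference \<delta>))"
    unfolding distr D by (subst nn_integral_density) auto
  also have "{1..2::nat} = insert 2 {1}" by auto
  also have "(\<integral>\<^sup>+x. ?D (x 1) (x 2) * f (x 1) (x 2) \<partial>(\<Pi>\<^sub>M i\<in>insert 2 {1::nat}. besq_reference \<delta>)) =
     (\<integral>\<^sup>+x. (\<integral>\<^sup>+y. ?D (x 1) y * f (x 1) y \<partial>besq_reference \<delta>) \<partial>(\<Pi>\<^sub>M i\<in>{1::nat}. besq_reference \<delta>))"
    by (subst product_nn_integral_insert) auto
  also have "\<dots> = (\<integral>\<^sup>+x. (\<integral>\<^sup>+y. ?D x y * f x y \<partial>besq_reference \<delta>) \<partial>besq_reference \<delta>)"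
    by (subst product_nn_integral_singleton[symmetric]) (auto intro!: sigma_finite_measure.borel_measurable_nn_integral[OF sigma_finite_besq_reference])
  finally show ?thesis by (simp add: mult.commute)
qed

lemma bridge_marginal_moment:
  assumes Y: "standard_besq_bridge M \<delta> Y" and \<delta>: "0 < \<delta>" and u: "0 < u" "u < 1" and \<beta>: "0 \<le> \<beta>"
  shows "(\<integral>\<^sup>+\<omega>. ennreal (Y u \<omega> powr \<beta>) \<partial>M) = ennreal (Gamma (\<delta>/2 + \<beta>) / Gamma (\<delta>/2) * (2 * u * (1 - u)) powr \<beta>)"
proof -
  have G: "0 < Gamma (\<delta>/2)" "0 < Gamma (\<delta>/2 + \<beta>)" using \<delta> \<beta> by (auto intro!: Gamma_real_pos)
  define v where "v = 2 * u * (1 - u)"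
  have v: "0 < v" unfolding v_def using u by simp
  have "(\<integral>\<^sup>+\<omega>. ennreal (Y u \<omega> powr \<beta>) \<partial>M) = (\<integral>\<^sup>+x. ennreal (x powr \<beta>) * ennreal (v powr (- (\<delta>/2)) / Gamma (\<delta>/2) * exp (- (1 / v) * x)) \<partial>besq_reference \<delta>)"
    by (subst bridge_one_dim[OF Y \<delta> u]) (auto simp: bridge_marginal_density[OF \<delta> u] v_def)
  also have "\<dots> = (\<integral>\<^sup>+x. ennreal (v powr (- (\<delta>/2)) / Gamma (\<delta>/2)) * ennreal (x powr \<beta> * exp (- (1 / v) * x)) \<partial>besq_reference \<delta>)"
    using G by (intro nn_integral_cong) (simp add: ennreal_mult'[symmetric] mult_ac)
  also have "\<dots> = ennreal (v powr (- (\<delta>/2)) / Gamma (\<delta>/2)) * ennreal (Gamma (\<delta>/2 + \<beta>) / (1 / v) powr (\<delta>/2 + \<beta>))"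
    using v \<delta> \<beta> by (subst nn_integral_cmult, measurable, subst besq_moment_from_0) auto
  also have "\<dots> = ennreal (v powr (- (\<delta>/2)) / Gamma (\<delta>/2) * (Gamma (\<delta>/2 + \<beta>) / (1 / v) powr (\<delta>/2 + \<beta>)))"
    using G by (intro ennreal_mult'[symmetric]) auto
  also have "v powr (- (\<delta>/2)) / Gamma (\<delta>/2) * (Gamma (\<delta>/2 + \<beta>) / (1 / v) powr (\<delta>/2 + \<beta>)) = Gamma (\<delta>/2 + \<beta>) / Gamma (\<delta>/2) * v powr \<beta>"
  proof -
    have "(1 / v) powr (\<delta>/2 + \<beta>) = v powr (- (\<delta>/2)) / v powr \<beta>"
      using v by (simp add: powr_divide powr_add powr_minus_divide)
    then show ?thesis using v G by simp
  qed
  finally show ?thesis unfolding v_def .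
qed

definition bridge_const :: "real \<Rightarrow> real" where
  "bridge_const \<delta> = 2 powr (\<delta>/2) * (besq_const \<delta> * (1 + Gamma (\<delta>/2 + 2) / Gamma (\<delta>/2))) + 16 * (Gamma (\<delta>/2 + 4) / Gamma (\<delta>/2))"

lemma bridge_const_bounds:
  assumes \<delta>: "0 < \<delta>"
  shows "0 \<le> 16 * (Gamma (\<delta>/2 + 4) / Gamma (\<delta>/2))"
    "0 \<le> 2 powr (\<delta>/2) * (besq_const \<delta> * (1 + Gamma (\<delta>/2 + 2) / Gamma (\<delta>/2)))"
    "16 * (Gamma (\<delta>/2 + 4) / Gamma (\<delta>/2)) \<le> bridge_const \<delta>"
    "2 powr (\<delta>/2) * (besq_const \<delta> * (1 + Gamma (\<delta>/2 + 2) / Gamma (\<delta>/2))) \<le> bridge_const \<delta>"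
    "0 \<le> bridge_const \<delta>"
proof -
  have G: "0 < Gamma (\<delta>/2)" "0 < Gamma (\<delta>/2 + 2)" "0 < Gamma (\<delta>/2 + 4)" using \<delta> by (auto intro!: Gamma_real_pos)
  show 1: "0 \<le> 16 * (Gamma (\<delta>/2 + 4) / Gamma (\<delta>/2))" using G by simp
  show 2: "0 \<le> 2 powr (\<delta>/2) * (besq_const \<delta> * (1 + Gamma (\<delta>/2 + 2) / Gamma (\<delta>/2)))"
    using G besq_const_nonneg[of \<delta>] by (intro mult_nonneg_nonneg add_nonneg_nonneg) auto
  show "16 * (Gamma (\<delta>/2 + 4) / Gamma (\<delta>/2)) \<le> bridge_const \<delta>"
    "2 powr (\<delta>/2) * (besq_const \<delta> * (1 + Gamma (\<delta>/2 + 2) / Gamma (\<delta>/2))) \<le> bridge_const \<delta>"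
    "0 \<le> bridge_const \<delta>"
    unfolding bridge_const_def using 1 2 by linarith+
qed

lemma bridge_marginal_fourth_moment:
  assumes Y: "standard_besq_bridge M \<delta> Y" and \<delta>: "0 < \<delta>" and u: "0 < u" "u < 1"
  shows "(\<integral>\<^sup>+\<omega>. ennreal (Y u \<omega> ^ 4) \<partial>M) \<le> ennreal (bridge_const \<delta> * u^2)"
    and "(\<integral>\<^sup>+\<omega>. ennreal (Y u \<omega> ^ 4) \<partial>M) \<le> ennreal (bridge_const \<delta> * (1 - u)^2)"
proof -
  have "AE \<omega> in M. 0 \<le> Y u \<omega>"
    using Y u unfolding standard_besq_bridge_def by (auto elim: eventually_mono)
  then have "(\<integral>\<^sup>+\<omega>. ennreal (Y u \<omega> ^ 4) \<partial>M) \<le> (\<integral>\<^sup>+\<omega>. ennreal (Y u \<omega> powr 4) \<partial>M)"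
    by (intro nn_integral_mono_AE) (auto elim!: eventually_mono simp: le_less)
  also have "\<dots> = ennreal (Gamma (\<delta>/2 + 4) / Gamma (\<delta>/2) * (2 * u * (1 - u)) powr 4)"
    by (rule bridge_marginal_moment[OF Y \<delta> u]) simp
  finally have le: "(\<integral>\<^sup>+\<omega>. ennreal (Y u \<omega> ^ 4) \<partial>M) \<le> ennreal (Gamma (\<delta>/2 + 4) / Gamma (\<delta>/2) * (2 * u * (1 - u)) powr 4)" .
  have *: "(2 * u * (1 - u)) powr 4 \<le> 16 * v^2" if "v = u \<or> v = 1 - u" for v
  proof -
    have v: "0 < v" "v < 1" "u * (1 - u) \<le> v" using that u by (auto simp: mult_le_cancel_left1 mult_le_cancel_right1)
    have "(2 * u * (1 - u)) powr 4 = (2 * (u * (1 - u)))^4" using u by (simp add: mult.assoc)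
    also have "\<dots> \<le> (2 * v)^4" using v u by (intro power_mono mult_left_mono) auto
    also have "\<dots> = 16 * (v^2 * v^2)" by (simp add: power_mult_distrib flip: power_add)
    also have "\<dots> \<le> 16 * (v^2 * 1)" using v by (intro mult_left_mono power_le_one) auto
    finally show ?thesis by simp
  qed
  have **: "(\<integral>\<^sup>+\<omega>. ennreal (Y u \<omega> ^ 4) \<partial>M) \<le> ennreal (bridge_const \<delta> * v^2)" if "v = u \<or> v = 1 - u" for v
  proof (rule order_trans[OF le], rule ennreal_leI)
    have "Gamma (\<delta>/2 + 4) / Gamma (\<delta>/2) * (2 * u * (1 - u)) powr 4 \<le> Gamma (\<delta>/2 + 4) / Gamma (\<delta>/2) * (16 * v^2)"
      using * that bridge_const_bounds(1)[OF \<delta>] by (intro mult_left_mono) auto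
    also have "\<dots> = 16 * (Gamma (\<delta>/2 + 4) / Gamma (\<delta>/2)) * v^2" by simp
    also have "\<dots> \<le> bridge_const \<delta> * v^2" by (intro mult_right_mono bridge_const_bounds[OF \<delta>]) auto
    finally show "Gamma (\<delta>/2 + 4) / Gamma (\<delta>/2) * (2 * u * (1 - u)) powr 4 \<le> bridge_const \<delta> * v^2" .
  qed
  show "(\<integral>\<^sup>+\<omega>. ennreal (Y u \<omega> ^ 4) \<partial>M) \<le> ennreal (bridge_const \<delta> * u^2)"
    "(\<integral>\<^sup>+\<omega>. ennreal (Y u \<omega> ^ 4) \<partial>M) \<le> ennreal (bridge_const \<delta> * (1 - u)^2)"
    using ** by auto
qed

lemma besq_two_step_fourth_moment:
  assumes \<delta>: "0 < \<delta>" and s: "0 < s" "s \<le> 1/2" and t: "0 < t" "t \<le> 1"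
  shows "(\<integral>\<^sup>+x. (\<integral>\<^sup>+y. ennreal (besq_density \<delta> s 0 x * ((y - x)^4 * besq_density \<delta> t x y)) \<partial>besq_reference \<delta>) \<partial>besq_reference \<delta>)
     \<le> ennreal (besq_const \<delta> * (1 + Gamma (\<delta>/2 + 2) / Gamma (\<delta>/2)) * t^2)"
proof -
  have G: "0 < Gamma (\<delta>/2)" "0 < Gamma (\<delta>/2 + 2)" using \<delta> by (auto intro!: Gamma_real_pos)
  define c where "c = (2 * s) powr (- (\<delta>/2)) / Gamma (\<delta>/2)"
  have c: "0 \<le> c" unfolding c_def using G by simp
  have q: "besq_density \<delta> s 0 x = c * exp (- (1 / (2 * s)) * x)" for x
    using besq_density_from_0[OF \<delta> s(1)] by (simp add: c_def)
  have mom: "ennreal c * (\<integral>\<^sup>+x. ennreal (x powr \<beta> * exp (- (1 / (2 * s)) * x)) \<partial>besq_reference \<delta>) = ennreal (Gamma (\<delta>/2 + \<beta>) / Gamma (\<delta>/2) * (2 * s) powr \<beta>)"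
    if "0 \<le> \<beta>" for \<beta>
  proof -
    have "c * (Gamma (\<delta>/2 + \<beta>) / (1 / (2 * s)) powr (\<delta>/2 + \<beta>)) = Gamma (\<delta>/2 + \<beta>) / Gamma (\<delta>/2) * (2 * s) powr \<beta>"
    proof -
      have "(1 / (2 * s)) powr (\<delta>/2 + \<beta>) = (2 * s) powr (- (\<delta>/2)) / (2 * s) powr \<beta>"
        using s by (simp add: powr_divide powr_add powr_minus_divide)
      then show ?thesis unfolding c_def using s G by simp
    qed
    then show ?thesis using s \<delta> that c by (subst besq_moment_from_0) (auto simp: ennreal_mult'[symmetric])
  qed
  have "(\<integral>\<^sup>+x. (\<integral>\<^sup>+y. ennreal (besq_density \<delta> s 0 x * ((y - x)^4 * besq_density \<delta> t x y)) \<partial>besq_reference \<delta>) \<partial>besq_reference \<delta>)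
     \<le> (\<integral>\<^sup>+x. ennreal (besq_const \<delta> * t^2) * (ennreal c * ennreal (x powr 0 * exp (- (1 / (2 * s)) * x)) + ennreal c * ennreal (x powr 2 * exp (- (1 / (2 * s)) * x))) \<partial>besq_reference \<delta>)"
  proof (rule nn_integral_mono_AE, rule eventually_mono[OF AE_besq_reference_pos])
    fix x :: real assume x: "0 < x"
    have q0: "0 \<le> besq_density \<delta> s 0 x" unfolding q using c by simp
    have "(\<integral>\<^sup>+y. ennreal (besq_density \<delta> s 0 x * ((y - x)^4 * besq_density \<delta> t x y)) \<partial>besq_reference \<delta>)
      = ennreal (besq_density \<delta> s 0 x) * (\<integral>\<^sup>+y. ennreal ((y - x)^4 * besq_density \<delta> t x y) \<partial>besq_reference \<delta>)"
      unfolding ennreal_mult'[OF q0] by (rule nn_integral_cmult) measurable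
    also have "\<dots> \<le> ennreal (besq_density \<delta> s 0 x) * ennreal (besq_const \<delta> * t^2 * (1 + x^2))"
      using x by (intro mult_left_mono besq_fourth_moment \<delta> t) auto
    also have "\<dots> = ennreal (besq_const \<delta> * t^2) * (ennreal c * ennreal (x powr 0 * exp (- (1 / (2 * s)) * x)) + ennreal c * ennreal (x powr 2 * exp (- (1 / (2 * s)) * x)))"
      using x c besq_const_nonneg[of \<delta>] unfolding q
      by (simp add: ennreal_mult'[symmetric] ennreal_plus[symmetric] algebra_simps del: ennreal_plus)
    finally show "(\<integral>\<^sup>+y. ennreal (besq_density \<delta> s 0 x * ((y - x)^4 * besq_density \<delta> t x y)) \<partial>besq_reference \<delta>) \<le>
      ennreal (besq_const \<delta> * t^2) * (ennreal c * ennreal (x powr 0 * exp (- (1 / (2 * s)) * x)) + ennreal c * ennreal (x powr 2 * exp (- (1 / (2 * s)) * x)))" .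
  qed
  also have "\<dots> = ennreal (besq_const \<delta> * t^2) * (ennreal (Gamma (\<delta>/2 + 0) / Gamma (\<delta>/2) * (2 * s) powr 0) + ennreal (Gamma (\<delta>/2 + 2) / Gamma (\<delta>/2) * (2 * s) powr 2))"
    using mom[of 0] mom[of 2] by (simp add: nn_integral_cmult nn_integral_add)
  also have "\<dots> = ennreal (besq_const \<delta> * t^2 * (1 + Gamma (\<delta>/2 + 2) / Gamma (\<delta>/2) * (2 * s) powr 2))"
    using s G besq_const_nonneg[of \<delta>] by (simp add: ennreal_mult'[symmetric] ennreal_plus[symmetric] ennreal_1[symmetric] del: ennreal_plus ennreal_1)
  also have "\<dots> \<le> ennreal (besq_const \<delta> * (1 + Gamma (\<delta>/2 + 2) / Gamma (\<delta>/2)) * t^2)"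
  proof (rule ennreal_leI)
    have "(2 * s) powr 2 \<le> 1" using s powr_mono2[of 2 "2 * s" 1] by simp
    then have "Gamma (\<delta>/2 + 2) / Gamma (\<delta>/2) * (2 * s) powr 2 \<le> Gamma (\<delta>/2 + 2) / Gamma (\<delta>/2) * 1"
      using G by (intro mult_left_mono) auto
    then have "besq_const \<delta> * t^2 * (1 + Gamma (\<delta>/2 + 2) / Gamma (\<delta>/2) * (2 * s) powr 2) \<le> besq_const \<delta> * t^2 * (1 + Gamma (\<delta>/2 + 2) / Gamma (\<delta>/2))"
      using besq_const_nonneg[of \<delta>] by (intro mult_left_mono) auto
    then show "besq_const \<delta> * t^2 * (1 + Gamma (\<delta>/2 + 2) / Gamma (\<delta>/2) * (2 * s) powr 2) \<le> besq_const \<delta> * (1 + Gamma (\<delta>/2 + 2) / Gamma (\<delta>/2)) * t^2"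
      by (simp add: mult_ac)
  qed
  finally show ?thesis .
qed


text \<open>
  The density of the bridge up to time \<open>t \<le> 1/2\<close> is that of the free process times a bounded factor.
  In the second half of the time interval the symmetry of the density reverses time.
\<close>

lemma bridge_increment_fourth_moment:
  assumes Y: "standard_besq_bridge M \<delta> Y" and \<delta>: "0 < \<delta>"
    and st: "0 \<le> s" "s < t" "t \<le> 1" and half: "t \<le> 1/2 \<or> 1/2 \<le> s"
  shows "(\<integral>\<^sup>+\<omega>. ennreal ((Y t \<omega> - Y s \<omega>)^4) \<partial>M) \<le> ennreal (bridge_const \<delta> * (t - s)^2)"
proof -
  have G: "0 < Gamma (\<delta>/2)" using \<delta> by (intro Gamma_real_pos) auto
  have ends: "AE \<omega> in M. Y 0 \<omega> = 0 \<and> Y 1 \<omega> = 0"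
    using Y unfolding standard_besq_bridge_def by (auto elim: eventually_mono)
  consider "s = 0" "t \<le> 1/2" | "t = 1" "1/2 \<le> s" | "0 < s" "t < 1" using st half by fastforce
  then show ?thesis
  proof cases
    case 1
    have "(\<integral>\<^sup>+\<omega>. ennreal ((Y t \<omega> - Y s \<omega>)^4) \<partial>M) = (\<integral>\<^sup>+\<omega>. ennreal (Y t \<omega> ^4) \<partial>M)"
      by (rule nn_integral_cong_AE, rule eventually_mono[OF ends]) (simp add: 1)
    also have "\<dots> \<le> ennreal (bridge_const \<delta> * (t - s)^2)"
      using bridge_marginal_fourth_moment(1)[OF Y \<delta>, of t] 1 st by simp
    finally show ?thesis .
  next
    case 2
    have "(\<integral>\<^sup>+\<omega>. ennreal ((Y t \<omega> - Y s \<omega>)^4) \<partial>M) = (\<integral>\<^sup>+\<omega>. ennreal (Y s \<omega> ^4) \<partial>M)"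
      by (rule nn_integral_cong_AE, rule eventually_mono[OF ends]) (simp add: 2)
    also have "\<dots> \<le> ennreal (bridge_const \<delta> * (t - s)^2)"
      using bridge_marginal_fourth_moment(2)[OF Y \<delta>, of s] 2 st by simp
    finally show ?thesis .
  next
    case 3
    let ?q = "besq_density \<delta>"
    define B where "B = besq_const \<delta> * (1 + Gamma (\<delta>/2 + 2) / Gamma (\<delta>/2)) * (t - s)^2"
    have ratio: "0 \<le> ?q r 0 y / ?q 1 0 0 \<and> ?q r 0 y / ?q 1 0 0 \<le> 2 powr (\<delta>/2)" if "1/2 \<le> r" "0 < y" for r y
    proof -
      have "?q r 0 y / ?q 1 0 0 = (2 * r) powr (- (\<delta>/2)) / 2 powr (- (\<delta>/2)) * exp (- y / (2 * r))"
        using that \<delta> less_imp_neq[OF G] by (simp add: besq_density_from_0)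
      moreover have "(2 * r) powr (- (\<delta>/2)) \<le> 1 powr (- (\<delta>/2))"
        using that \<delta> by (intro powr_mono2') auto
      then have "(2 * r) powr (- (\<delta>/2)) / 2 powr (- (\<delta>/2)) * exp (- y / (2 * r)) \<le> 1 / 2 powr (- (\<delta>/2)) * 1"
        using that by (intro mult_mono divide_right_mono) auto
      moreover have "1 / 2 powr (- (\<delta>/2)) = 2 powr (\<delta>/2)" by (simp add: powr_minus_divide)
      ultimately show ?thesis by simp
    qed
    have q0: "0 \<le> ?q r x y" if "0 \<le> x" "0 \<le> y" for r x y using besq_density_nonneg[OF \<delta>] that by simp
    interpret sigma_finite_measure "besq_reference \<delta>" by (rule sigma_finite_besq_reference)
    interpret PR: pair_sigma_finite "besq_reference \<delta>" "besq_reference \<delta>" by standard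
    have "(\<integral>\<^sup>+\<omega>. ennreal ((Y t \<omega> - Y s \<omega>)^4) \<partial>M) = (\<integral>\<^sup>+x. (\<integral>\<^sup>+y. ennreal ((y - x)^4) *
      ennreal (?q s 0 x * ?q (t - s) x y * ?q (1 - t) y 0 / ?q 1 0 0) \<partial>besq_reference \<delta>) \<partial>besq_reference \<delta>)"
      by (rule bridge_two_dim[OF Y \<delta>]) (use 3 st in auto)
    also have "\<dots> \<le> ennreal (2 powr (\<delta>/2)) * ennreal B"
    proof (cases "t \<le> 1/2")
      case True
      have "(\<integral>\<^sup>+x. (\<integral>\<^sup>+y. ennreal ((y - x)^4) * ennreal (?q s 0 x * ?q (t - s) x y * ?q (1 - t) y 0 / ?q 1 0 0) \<partial>besq_reference \<delta>) \<partial>besq_reference \<delta>)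
        \<le> (\<integral>\<^sup>+x. (\<integral>\<^sup>+y. ennreal (2 powr (\<delta>/2)) * ennreal (?q s 0 x * ((y - x)^4 * ?q (t - s) x y)) \<partial>besq_reference \<delta>) \<partial>besq_reference \<delta>)"
      proof (intro nn_integral_mono_AE eventually_mono[OF AE_besq_reference_pos])
        fix x y :: real assume xy: "0 < x" "0 < y"
        have "(y - x)^4 * (?q s 0 x * ?q (t - s) x y * ?q (1 - t) y 0 / ?q 1 0 0) = (?q (1 - t) 0 y / ?q 1 0 0) * (?q s 0 x * ((y - x)^4 * ?q (t - s) x y))"
          by (simp add: besq_density_commute[of \<delta> "1 - t" y 0])
        also have "\<dots> \<le> 2 powr (\<delta>/2) * (?q s 0 x * ((y - x)^4 * ?q (t - s) x y))"
          using ratio[of "1 - t" y] True xy q0 by (intro mult_right_mono) auto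
        finally show "ennreal ((y - x)^4) * ennreal (?q s 0 x * ?q (t - s) x y * ?q (1 - t) y 0 / ?q 1 0 0) \<le> ennreal (2 powr (\<delta>/2)) * ennreal (?q s 0 x * ((y - x)^4 * ?q (t - s) x y))"
          using ennreal_leI by (simp add: ennreal_mult'[symmetric])
      qed
      also have "\<dots> = ennreal (2 powr (\<delta>/2)) * (\<integral>\<^sup>+x. (\<integral>\<^sup>+y. ennreal (?q s 0 x * ((y - x)^4 * ?q (t - s) x y)) \<partial>besq_reference \<delta>) \<partial>besq_reference \<delta>)"
        by (simp add: nn_integral_cmult)
      also have "\<dots> \<le> ennreal (2 powr (\<delta>/2)) * ennreal B"
        unfolding B_def using 3 st True by (intro mult_left_mono besq_two_step_fourth_moment \<delta>) auto
      finally show ?thesis .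
    next
      case False
      then have s: "1/2 \<le> s" using half by simp
      have "(\<integral>\<^sup>+x. (\<integral>\<^sup>+y. ennreal ((y - x)^4) * ennreal (?q s 0 x * ?q (t - s) x y * ?q (1 - t) y 0 / ?q 1 0 0) \<partial>besq_reference \<delta>) \<partial>besq_reference \<delta>)
        \<le> (\<integral>\<^sup>+x. (\<integral>\<^sup>+y. ennreal (2 powr (\<delta>/2)) * ennreal (?q (1 - t) 0 y * ((x - y)^4 * ?q (t - s) y x)) \<partial>besq_reference \<delta>) \<partial>besq_reference \<delta>)"
      proof (intro nn_integral_mono_AE eventually_mono[OF AE_besq_reference_pos])
        fix x y :: real assume xy: "0 < x" "0 < y"
        have "(y - x)^4 = (x - y)^4" by (simp add: power4_eq_xxxx algebra_simps)
        then have "(y - x)^4 * (?q s 0 x * ?q (t - s) x y * ?q (1 - t) y 0 / ?q 1 0 0) = (?q s 0 x / ?q 1 0 0) * (?q (1 - t) 0 y * ((x - y)^4 * ?q (t - s) y x))"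
          by (simp add: besq_density_commute[of \<delta> "1 - t" y 0] besq_density_commute[of \<delta> "t - s" y x])
        also have "\<dots> \<le> 2 powr (\<delta>/2) * (?q (1 - t) 0 y * ((x - y)^4 * ?q (t - s) y x))"
          using ratio[of s x] s xy q0 by (intro mult_right_mono) auto
        finally show "ennreal ((y - x)^4) * ennreal (?q s 0 x * ?q (t - s) x y * ?q (1 - t) y 0 / ?q 1 0 0) \<le> ennreal (2 powr (\<delta>/2)) * ennreal (?q (1 - t) 0 y * ((x - y)^4 * ?q (t - s) y x))"
          using ennreal_leI by (simp add: ennreal_mult'[symmetric])
      qed
      also have "\<dots> = ennreal (2 powr (\<delta>/2)) * (\<integral>\<^sup>+x. (\<integral>\<^sup>+y. ennreal (?q (1 - t) 0 y * ((x - y)^4 * ?q (t - s) y x)) \<partial>besq_reference \<delta>) \<partial>besq_reference \<delta>)"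
        by (simp add: nn_integral_cmult)
      also have "(\<integral>\<^sup>+x. (\<integral>\<^sup>+y. ennreal (?q (1 - t) 0 y * ((x - y)^4 * ?q (t - s) y x)) \<partial>besq_reference \<delta>) \<partial>besq_reference \<delta>)
         = (\<integral>\<^sup>+y. (\<integral>\<^sup>+x. ennreal (?q (1 - t) 0 y * ((x - y)^4 * ?q (t - s) y x)) \<partial>besq_reference \<delta>) \<partial>besq_reference \<delta>)"
        by (rule PR.Fubini') measurable
      also have "ennreal (2 powr (\<delta>/2)) * \<dots> \<le> ennreal (2 powr (\<delta>/2)) * ennreal B"
        unfolding B_def using 3 st s by (intro mult_left_mono besq_two_step_fourth_moment \<delta>) auto
      finally show ?thesis .
    qed
    also have "\<dots> = ennreal (2 powr (\<delta>/2) * B)" by (simp add: ennreal_mult'[symmetric])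
    also have "\<dots> \<le> ennreal (bridge_const \<delta> * (t - s)^2)"
      unfolding B_def using mult_right_mono[OF bridge_const_bounds(4)[OF \<delta>], of "(t - s)^2"]
      by (intro ennreal_leI) (simp add: mult.assoc)
    finally show ?thesis .
  qed
qed

definition unit_dyadics :: "real set" where
  "unit_dyadics = (\<Union>n::nat. (\<lambda>k. real k / 2 ^ n) ` {..2 ^ n})"

lemma countable_unit_dyadics: "countable unit_dyadics"
  unfolding unit_dyadics_def by (intro countable_UN countable_image) auto

lemma dyadic_point: "k \<le> 2 ^ n \<Longrightarrow> real k / 2 ^ n \<in> {0..1}"
  using of_nat_le_iff[of k "2 ^ n", where 'a = real] by (simp add: divide_le_eq)

lemma unit_dyadics_subset: "unit_dyadics \<subseteq> {0..1}"
  unfolding unit_dyadics_def using dyadic_point by blast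

lemma unit_dyadics_0 [simp]: "0 \<in> unit_dyadics" unfolding unit_dyadics_def by (auto intro!: exI[of _ 0])

text \<open>
  A dyadic point of level \<open>n + 1\<close> belongs to level \<open>n\<close> or is the right neighbour, at level \<open>n + 1\<close>,
  of such a point.
\<close>

lemma chaining_bound:
  fixes p :: "real \<Rightarrow> real" and c :: "nat \<Rightarrow> real"
  assumes p0: "p 0 = 0" "p 1 = 0" and c0: "\<And>n. 0 \<le> c n"
    and inc: "\<And>n k. 1 \<le> n \<Longrightarrow> k < 2 ^ n \<Longrightarrow> \<bar>p (real (Suc k) / 2 ^ n) - p (real k / 2 ^ n)\<bar> \<le> c n"
  shows "k \<le> 2 ^ n \<Longrightarrow> \<bar>p (real k / 2 ^ n)\<bar> \<le> (\<Sum>m\<le>n. c m)"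
proof (induction n arbitrary: k)
  case 0
  then have "k = 0 \<or> k = 1" by auto
  then show ?case using p0 c0[of 0] by auto
next
  case (Suc n)
  have dbl: "real (2 * j) / 2 ^ Suc n = real j / 2 ^ n" for j by simp
  show ?case
  proof (cases "even k")
    case True
    obtain j where "k = 2 * j" using True by (rule evenE)
    then show ?thesis using Suc.IH[of j] Suc.prems dbl[of j] c0[of "Suc n"] by simp
  next
    case False
    obtain j where j: "k = Suc (2 * j)" using oddE[OF False] by auto
    then have "\<bar>p (real k / 2 ^ Suc n) - p (real j / 2 ^ n)\<bar> \<le> c (Suc n)"
      using inc[of "Suc n" "2 * j"] Suc.prems unfolding dbl by simp
    moreover have "\<bar>p (real j / 2 ^ n)\<bar> \<le> (\<Sum>m\<le>n. c m)" using Suc.IH[of j] Suc.prems j by simp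
    ultimately show ?thesis by simp
  qed
qed

text \<open>
  Chaining: if the path exceeds \<open>u\<close> somewhere, then one of the \<open>2 ^ n\<close> increments of some level \<open>n\<close>
  exceeds its share of \<open>u\<close>. The fourth moment of an increment of level \<open>n\<close> is of order \<open>4 ^ (- n)\<close>,
  which leaves room for shares that decay geometrically.
\<close>

lemma bridge_maximal_inequality:
  assumes M: "prob_space M" and \<delta>: "0 < \<delta>" and Y: "standard_besq_bridge M \<delta> Y"
  shows "\<exists>C\<ge>0. \<forall>u>0. emeasure M {\<omega> \<in> space M. \<exists>d\<in>unit_dyadics. u \<le> Y d \<omega>} \<le> ennreal (C / u^4)"
proof -
  \<comment> \<open>With shares proportional to \<open>(9/10) ^ n\<close>, the bounds for the levels form a geometric
    series with this ratio.\<close>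
  define r :: real where "r = (10/9)^4 / 2"
  have r: "0 < r" "r < 1" by (auto simp: r_def power4_eq_xxxx)
  define C where "C = bridge_const \<delta> * 10^4 / (1 - r)"
  show ?thesis
  proof (intro exI[of _ C] conjI allI impI)
    show "0 \<le> C" unfolding C_def using bridge_const_bounds(5)[OF \<delta>] r by simp
    fix u :: real assume u: "0 < u"
    interpret prob_space M by fact
    define c where "c n = u / 10 * (9/10)^n" for n :: nat
    have c: "0 < c n" for n using u by (simp add: c_def)
    have sumc: "(\<Sum>m\<le>n. c m) < u" for n
    proof -
      have "(\<Sum>m\<le>n. c m) = u / 10 * (\<Sum>m<Suc n. (9/10)^m)" by (simp add: c_def sum_distrib_left lessThan_Suc_atMost)
      also have "(\<Sum>m<Suc n. (9/10::real)^m) = 10 * (1 - (9/10)^Suc n)" by (subst sum_gp_strict) simp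
      also have "u / 10 * (10 * (1 - (9/10)^Suc n)) = u - u * (9/10)^Suc n" by (simp add: algebra_simps)
      also have "\<dots> < u" using u by simp
      finally show ?thesis .
    qed
    have Ym [measurable]: "Y s \<in> borel_measurable M" if "s \<in> {0..1}" for s
      using Y that unfolding standard_besq_bridge_def by auto
    note g1 = dyadic_point
    define A where "A n k = {\<omega> \<in> space M. c n ^ 4 \<le> (Y (real (Suc k) / 2 ^ n) \<omega> - Y (real k / 2 ^ n) \<omega>)^4}" for n k :: nat
    have Am [measurable]: "A n k \<in> sets M" if "k < 2 ^ n" for n k
    proof -
      have [measurable]: "Y (real (Suc k) / 2 ^ n) \<in> borel_measurable M" "Y (real k / 2 ^ n) \<in> borel_measurable M"
        using that by (auto intro!: Ym g1 simp del: of_nat_Suc)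
      show ?thesis unfolding A_def by measurable
    qed
    have PA: "emeasure M (A n k) \<le> ennreal (bridge_const \<delta> * (1 / 2^n)^2 / c n ^ 4)" if n: "1 \<le> n" "k < 2 ^ n" for n k
    proof -
      let ?s = "real k / 2 ^ n" and ?t = "real (Suc k) / 2 ^ n"
      have [measurable]: "Y ?t \<in> borel_measurable M" "Y ?s \<in> borel_measurable M"
        using that by (auto intro!: Ym g1 simp del: of_nat_Suc)
      have "?t - ?s = 1 / 2^n" by (simp add: diff_divide_distrib[symmetric])
      obtain m where m: "n = Suc m" using n by (cases n) auto
      have "?t \<le> 1/2 \<or> 1/2 \<le> ?s"
      proof (cases "Suc k \<le> 2 ^ m")
        case True
        then have "real (Suc k) \<le> 2 ^ m" by (metis of_nat_le_iff of_nat_numeral of_nat_power)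
        then show ?thesis by (simp add: m divide_le_eq)
      next
        case False
        then have "2 ^ m \<le> k" by simp
        then have "2 ^ m \<le> real k" by (metis of_nat_le_iff of_nat_numeral of_nat_power)
        then show ?thesis by (simp add: m le_divide_eq)
      qed
      then have "(\<integral>\<^sup>+\<omega>. ennreal ((Y ?t \<omega> - Y ?s \<omega>)^4) \<partial>M) \<le> ennreal (bridge_const \<delta> * (?t - ?s)^2)"
        using g1[of "Suc k" n] n by (intro bridge_increment_fourth_moment[OF Y \<delta>]) (auto simp: divide_strict_right_mono)
      also have "?t - ?s = 1 / 2^n" by fact
      finally have E: "(\<integral>\<^sup>+\<omega>. ennreal ((Y ?t \<omega> - Y ?s \<omega>)^4) \<partial>M) \<le> ennreal (bridge_const \<delta> * (1 / 2^n)^2)" .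
      have "emeasure M (A n k) = (\<integral>\<^sup>+\<omega>. indicator (A n k) \<omega> \<partial>M)" using n by simp
      also have "\<dots> \<le> (\<integral>\<^sup>+\<omega>. ennreal (1 / c n ^ 4) * ennreal ((Y ?t \<omega> - Y ?s \<omega>)^4) \<partial>M)"
      proof (rule nn_integral_mono)
        fix \<omega> assume "\<omega> \<in> space M"
        have "1 \<le> 1 / c n ^ 4 * (Y ?t \<omega> - Y ?s \<omega>)^4" if "\<omega> \<in> A n k"
          using that c[of n] by (simp add: A_def le_divide_eq)
        then show "indicator (A n k) \<omega> \<le> ennreal (1 / c n ^ 4) * ennreal ((Y ?t \<omega> - Y ?s \<omega>)^4)"
          using c[of n] by (auto simp: indicator_def ennreal_mult'[symmetric] simp flip: ennreal_1)
      qed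
      also have "\<dots> = ennreal (1 / c n ^ 4) * (\<integral>\<^sup>+\<omega>. ennreal ((Y ?t \<omega> - Y ?s \<omega>)^4) \<partial>M)"
        by (rule nn_integral_cmult) measurable
      also have "\<dots> \<le> ennreal (1 / c n ^ 4) * ennreal (bridge_const \<delta> * (1 / 2^n)^2)"
        using E by (rule mult_left_mono) simp
      also have "\<dots> = ennreal (bridge_const \<delta> * (1 / 2^n)^2 / c n ^ 4)"
        using c[of n] by (subst ennreal_mult'[symmetric]) auto
      finally show ?thesis .
    qed
    define U where "U n = (\<Union>k<2 ^ n. A n k)" for n
    have Um [measurable]: "U n \<in> sets M" for n unfolding U_def by (intro sets.finite_UN) auto
    have PU: "emeasure M (U (Suc n)) \<le> ennreal (bridge_const \<delta> * 10^4 / u^4 * r ^ n)" for n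
    proof -
      have "emeasure M (U (Suc n)) \<le> (\<Sum>k<2 ^ Suc n. emeasure M (A (Suc n) k))"
        unfolding U_def by (intro emeasure_subadditive_finite) auto
      also have "\<dots> \<le> (\<Sum>k<(2::nat) ^ Suc n. ennreal (bridge_const \<delta> * (1 / 2^Suc n)^2 / c (Suc n) ^ 4))"
        by (intro sum_mono PA) auto
      also have "\<dots> = ennreal (2 ^ Suc n * (bridge_const \<delta> * (1 / 2^Suc n)^2 / c (Suc n) ^ 4))"
        using bridge_const_bounds(5)[OF \<delta>] c[of "Suc n"] by (subst sum_ennreal) auto
      also have "2 ^ Suc n * (bridge_const \<delta> * (1 / 2^Suc n)^2 / c (Suc n) ^ 4) = bridge_const \<delta> * 10^4 / u^4 * r ^ Suc n"
      proof -
        have "c (Suc n) ^ 4 = u^4 / 10^4 * ((9/10)^4) ^ Suc n"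
          unfolding c_def power_mult_distrib power_divide by (simp only: power_mult[symmetric] mult.commute)
        moreover have "r ^ Suc n = 1 / (2 ^ Suc n * ((9/10)^4) ^ Suc n)"
        proof -
          have "r = 1 / (2 * (9/10)^4)" by (simp add: r_def power_divide)
          then show ?thesis by (simp only: power_divide power_one power_mult_distrib)
        qed
        ultimately show ?thesis using u by (simp only: power2_eq_square) (simp add: field_simps)
      qed
      also have "\<dots> \<le> bridge_const \<delta> * 10^4 / u^4 * r ^ n"
        using r u bridge_const_bounds(5)[OF \<delta>] by (intro mult_left_mono) (auto intro: mult_left_le_one_le)
      finally show ?thesis by (simp add: ennreal_leI)
    qed
    have good: "AE \<omega> in M. Y 0 \<omega> = 0 \<and> Y 1 \<omega> = 0"
      using Y unfolding standard_besq_bridge_def by (auto elim: eventually_mono)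
    have "emeasure M {\<omega> \<in> space M. \<exists>d\<in>unit_dyadics. u \<le> Y d \<omega>} \<le> emeasure M (\<Union>n. U (Suc n))"
    proof (rule emeasure_mono_AE)
      show "AE \<omega> in M. \<omega> \<in> {\<omega> \<in> space M. \<exists>d\<in>unit_dyadics. u \<le> Y d \<omega>} \<longrightarrow> \<omega> \<in> (\<Union>n. U (Suc n))"
        using good AE_space
      proof eventually_elim
        case (elim \<omega>)
        show ?case
        proof (rule impI, rule ccontr)
          assume ex: "\<omega> \<in> {\<omega> \<in> space M. \<exists>d\<in>unit_dyadics. u \<le> Y d \<omega>}" and not: "\<omega> \<notin> (\<Union>n. U (Suc n))"
          have "\<bar>Y (real (Suc k) / 2 ^ n) \<omega> - Y (real k / 2 ^ n) \<omega>\<bar> \<le> c n" if n: "1 \<le> n" "k < 2 ^ n" for n k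
          proof (rule ccontr)
            assume "\<not> ?thesis"
            then have "c n ^ 4 \<le> \<bar>Y (real (Suc k) / 2 ^ n) \<omega> - Y (real k / 2 ^ n) \<omega>\<bar> ^ 4"
              using c[of n] by (intro power_mono) auto
            then have "\<omega> \<in> U n" unfolding U_def A_def using elim n by (auto simp: power_even_abs)
            moreover obtain m where "n = Suc m" using n by (cases n) auto
            ultimately show False using not by auto
          qed
          then have "\<bar>Y (real k / 2 ^ n) \<omega>\<bar> \<le> (\<Sum>m\<le>n. c m)" if "k \<le> 2 ^ n" for n k
            using elim less_imp_le[OF c] that by (intro chaining_bound[of "\<lambda>s. Y s \<omega>"]) auto
          then have "\<bar>Y (real k / 2 ^ n) \<omega>\<bar> < u" if "k \<le> 2 ^ n" for n k
            using that sumc[of n] by (meson le_less_trans)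
          then show False using ex unfolding unit_dyadics_def by force
        qed
      qed
    qed measurable
    also have "\<dots> \<le> (\<Sum>n. emeasure M (U (Suc n)))"
      by (intro emeasure_subadditive_countably) auto
    also have "\<dots> \<le> (\<Sum>n. ennreal (bridge_const \<delta> * 10^4 / u^4 * r ^ n))"
      by (intro suminf_le PU) auto
    also have "\<dots> = ennreal (bridge_const \<delta> * 10^4 / u^4 * (1 / (1 - r)))"
      using r bridge_const_bounds(5)[OF \<delta>] u by (intro suminf_ennreal_eq sums_mult geometric_sums) auto
    also have "bridge_const \<delta> * 10^4 / u^4 * (1 / (1 - r)) = C / u^4" by (simp add: C_def)
    finally show "emeasure M {\<omega> \<in> space M. \<exists>d\<in>unit_dyadics. u \<le> Y d \<omega>} \<le> ennreal (C / u^4)" .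
  qed
qed


section \<open>Continuous weights around the indicator of a high mark\<close>

definition clip :: "real \<Rightarrow> real" where "clip z = max 0 (min 1 z)"

definition window :: "real \<Rightarrow> real" where "window z = clip (2 - \<bar>z\<bar>)"

lemma clip_bounds [simp]: "0 \<le> clip z" "clip z \<le> 1" by (auto simp: clip_def)
lemma window_bounds [simp]: "0 \<le> window z" "window z \<le> 1" by (auto simp: window_def)
lemma clip_lipschitz: "\<bar>clip a - clip b\<bar> \<le> \<bar>a - b\<bar>" by (auto simp: clip_def max_def min_def)
lemma window_lipschitz: "\<bar>window a - window b\<bar> \<le> \<bar>a - b\<bar>"
  unfolding window_def using clip_lipschitz[of "2 - \<bar>a\<bar>" "2 - \<bar>b\<bar>"] by linarith
lemma clip_eq_0: "z \<le> 0 \<Longrightarrow> clip z = 0" and clip_eq_1: "1 \<le> z \<Longrightarrow> clip z = 1" and clip_pos: "0 < clip z \<longleftrightarrow> 0 < z"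
  by (auto simp: clip_def)
lemma window_eq_0: "2 \<le> \<bar>z\<bar> \<Longrightarrow> window z = 0" and window_eq_1: "\<bar>z\<bar> \<le> 1 \<Longrightarrow> window z = 1"
  by (auto simp: window_def clip_def)
lemma clip_measurable [measurable]: "clip \<in> borel_measurable borel"
  unfolding clip_def[abs_def] by measurable
lemma window_measurable [measurable]: "window \<in> borel_measurable borel"
  unfolding window_def[abs_def] by measurable
lemma continuous_on_clip: "continuous_on UNIV clip"
  unfolding clip_def[abs_def] by (intro continuous_intros)
lemma tendsto_clip: "(f \<longlongrightarrow> l) F \<Longrightarrow> ((\<lambda>x. clip (f x)) \<longlongrightarrow> clip l) F"
  unfolding clip_def by (intro tendsto_intros)

text \<open>
  The supremum over a window of width of order \<open>1 / j\<close> around the level \<open>r\<close> makes a weight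
  insensitive to changes of the level by \<open>1 / j\<close>. For continuous paths the dyadic points suffice,
  and with them the supremum is measurable.
\<close>

definition sweep :: "(real \<Rightarrow> real) \<Rightarrow> real \<Rightarrow> real \<Rightarrow> real \<Rightarrow> (real \<Rightarrow> real) \<Rightarrow> real" where
  "sweep f j x r p = (SUP v\<in>unit_dyadics. f (x * p v) * window (j * (x * v - r)))"

locale unit_lipschitz =
  fixes f :: "real \<Rightarrow> real" and j :: real
  assumes j: "0 < j" and f_bounds [simp]: "\<And>z. 0 \<le> f z" "\<And>z. f z \<le> 1"
    and f_lipschitz: "\<And>a b. \<bar>f a - f b\<bar> \<le> j * \<bar>a - b\<bar>"
begin

lemma summand_bounds: "0 \<le> f (x * p v) * window z" "f (x * p v) * window z \<le> 1"
  by (auto intro!: mult_le_one)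

lemma sweep_bdd: "bdd_above ((\<lambda>v. f (x * p v) * window (j * (x * v - r))) ` unit_dyadics)"
  by (intro bdd_aboveI[of _ 1]) (auto simp: mult_le_one)

lemma sweep_ge: "v \<in> unit_dyadics \<Longrightarrow> f (x * p v) * window (j * (x * v - r)) \<le> sweep f j x r p"
  unfolding sweep_def by (rule cSUP_upper[OF _ sweep_bdd])

lemma sweep_bounds: "0 \<le> sweep f j x r p" "sweep f j x r p \<le> 1"
proof -
  show "0 \<le> sweep f j x r p" by (rule order_trans[OF summand_bounds(1) sweep_ge[OF unit_dyadics_0]])
  show "sweep f j x r p \<le> 1"
    unfolding sweep_def using unit_dyadics_0 by (intro cSUP_least summand_bounds) blast
qed

lemma f_measurable [measurable]: "f \<in> borel_measurable borel"
proof (rule borel_measurable_continuous_onI)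
  show "continuous_on UNIV f"
    unfolding continuous_on_iff dist_real_def
  proof (intro ballI allI impI)
    fix x e :: real assume "0 < e"
    then show "\<exists>d>0. \<forall>x'\<in>UNIV. \<bar>x' - x\<bar> < d \<longrightarrow> \<bar>f x' - f x\<bar> < e"
      using j f_lipschitz by (intro exI[of _ "e / j"]) (auto simp: field_simps intro: le_less_trans)
  qed
qed

text \<open>
  Continuity in the size of the jump and in the level, for a fixed path: each member of the supremum
  has these Lipschitz constants.
\<close>

lemma sweep_lipschitz:
  assumes B: "\<And>v. v \<in> unit_dyadics \<Longrightarrow> \<bar>p v\<bar> \<le> B"
  shows "\<bar>sweep f j x r p - sweep f j x' r' p\<bar> \<le> j * (B + 1) * \<bar>x - x'\<bar> + j * \<bar>r - r'\<bar>"
proof -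
  have one: "sweep f j x r p \<le> sweep f j x' r' p + (j * (B + 1) * \<bar>x - x'\<bar> + j * \<bar>r - r'\<bar>)" for x r x' r'
    unfolding sweep_def[of f j x r]
  proof (rule cSUP_least)
    show "unit_dyadics \<noteq> {}" using unit_dyadics_0 by blast
    fix v assume v: "v \<in> unit_dyadics"
    have v1: "\<bar>v\<bar> \<le> 1" using v unit_dyadics_subset by auto
    let ?a = "f (x * p v)" and ?b = "window (j * (x * v - r))" and ?a' = "f (x' * p v)" and ?b' = "window (j * (x' * v - r'))"
    have "?a * ?b - ?a' * ?b' = (?a - ?a') * ?b + ?a' * (?b - ?b')" by (simp add: algebra_simps)
    also have "\<dots> \<le> \<bar>?a - ?a'\<bar> * 1 + 1 * \<bar>?b - ?b'\<bar>"
    proof (rule add_mono)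
      show "(?a - ?a') * ?b \<le> \<bar>?a - ?a'\<bar> * 1"
        by (rule order_trans[OF abs_ge_self]) (simp add: abs_mult mult_left_le)
      show "?a' * (?b - ?b') \<le> 1 * \<bar>?b - ?b'\<bar>"
        by (rule order_trans[OF abs_ge_self]) (simp add: abs_mult mult_left_le_one_le)
    qed
    also have "\<bar>?a - ?a'\<bar> \<le> j * \<bar>x * p v - x' * p v\<bar>" by (rule f_lipschitz)
    also have "x * p v - x' * p v = (x - x') * p v" by (simp add: algebra_simps)
    also have "j * \<bar>(x - x') * p v\<bar> \<le> j * (\<bar>x - x'\<bar> * B)"
      unfolding abs_mult using j B[OF v] by (intro mult_left_mono) auto
    also have "\<bar>?b - ?b'\<bar> \<le> \<bar>j * (x * v - r) - j * (x' * v - r')\<bar>" by (rule window_lipschitz)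
    also have "j * (x * v - r) - j * (x' * v - r') = j * ((x - x') * v - (r - r'))" by (simp add: algebra_simps)
    also have "\<bar>j * ((x - x') * v - (r - r'))\<bar> \<le> j * (\<bar>x - x'\<bar> * 1 + \<bar>r - r'\<bar>)"
    proof -
      have "\<bar>(x - x') * v - (r - r')\<bar> \<le> \<bar>(x - x') * v\<bar> + \<bar>r - r'\<bar>" by (rule abs_triangle_ineq4)
      also have "\<bar>(x - x') * v\<bar> \<le> \<bar>x - x'\<bar> * 1" unfolding abs_mult using v1 by (intro mult_left_mono) auto
      finally show ?thesis using j by (simp add: abs_mult)
    qed
    finally have "?a * ?b \<le> ?a' * ?b' + (j * (B + 1) * \<bar>x - x'\<bar> + j * \<bar>r - r'\<bar>)" by (simp add: algebra_simps)
    also have "?a' * ?b' \<le> sweep f j x' r' p" by (rule sweep_ge[OF v])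
    finally show "?a * ?b \<le> sweep f j x' r' p + (j * (B + 1) * \<bar>x - x'\<bar> + j * \<bar>r - r'\<bar>)" by simp
  qed
  show ?thesis using one[of x r x' r'] one[of x' r' x r] by (simp add: abs_le_iff abs_minus_commute)
qed

lemma sweep_tendsto:
  assumes B: "\<And>v. v \<in> unit_dyadics \<Longrightarrow> \<bar>p v\<bar> \<le> B" and X: "X \<longlonglongrightarrow> x" and R: "R \<longlonglongrightarrow> r"
  shows "(\<lambda>n. sweep f j (X n) (R n) p) \<longlonglongrightarrow> sweep f j x r p"
proof (rule LIM_zero_cancel, rule tendsto_rabs_zero_cancel, rule tendsto_sandwich[OF _ _ tendsto_const])
  have "(\<lambda>n. j * (B + 1) * \<bar>X n - x\<bar> + j * \<bar>R n - r\<bar>) \<longlonglongrightarrow> j * (B + 1) * \<bar>x - x\<bar> + j * \<bar>r - r\<bar>"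
    by (intro tendsto_intros X R)
  then show "(\<lambda>n. j * (B + 1) * \<bar>X n - x\<bar> + j * \<bar>R n - r\<bar>) \<longlonglongrightarrow> 0" by simp
qed (use sweep_lipschitz[OF B] in auto)

lemma sweep_measurable [measurable (raw)]:
  assumes [measurable]: "X \<in> borel_measurable M" "R \<in> borel_measurable M" "P \<in> M \<rightarrow>\<^sub>M (\<Pi>\<^sub>M s\<in>{0..1::real}. borel)"
  shows "(\<lambda>\<omega>. sweep f j (X \<omega>) (R \<omega>) (P \<omega>)) \<in> borel_measurable M"
  unfolding sweep_def
proof (rule borel_measurable_cSUP[OF countable_unit_dyadics])
  fix v assume "v \<in> unit_dyadics"
  then have [measurable]: "(\<lambda>\<omega>. P \<omega> v) \<in> borel_measurable M"
    using unit_dyadics_subset by (intro measurable_compose[OF assms(3) measurable_component_singleton]) auto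
  show "(\<lambda>\<omega>. f (X \<omega> * P \<omega> v) * window (j * (X \<omega> * v - R \<omega>))) \<in> borel_measurable M" by measurable
qed (rule sweep_bdd)

end

definition excursion_path :: "(real \<Rightarrow> real) \<Rightarrow> bool" where
  "excursion_path p \<longleftrightarrow> continuous_on {0..1} p \<and> (\<forall>s\<in>{0..1}. 0 \<le> p s) \<and> p 0 = 0 \<and> p 1 = 0"

lemma excursion_path_bounded:
  assumes "excursion_path p"
  shows "\<exists>B. \<forall>v\<in>{0..1}. \<bar>p v\<bar> \<le> B"
proof -
  have "bounded (p ` {0..1})"
    using assms by (intro compact_imp_bounded compact_continuous_image) (auto simp: excursion_path_def)
  then obtain B where "\<forall>y\<in>p ` {0..1}. norm y \<le> B" unfolding bounded_iff by blast
  then show ?thesis by auto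
qed

definition dyadic_floor :: "nat \<Rightarrow> real \<Rightarrow> real" where
  "dyadic_floor n u = real (min (2 ^ n) (nat \<lfloor>2 ^ n * u\<rfloor>)) / 2 ^ n"

lemma dyadic_floor_in: "dyadic_floor n u \<in> unit_dyadics"
  unfolding unit_dyadics_def dyadic_floor_def by (intro UN_I[of n]) auto

lemma dyadic_floor_tendsto:
  assumes "u \<in> {0..1}"
  shows "(\<lambda>n. dyadic_floor n u) \<longlonglongrightarrow> u"
proof (rule tendsto_sandwich[OF _ _ _ tendsto_const])
  have b: "dyadic_floor n u \<le> u \<and> u - (1/2) ^ n \<le> dyadic_floor n u" for n
  proof -
    have "2 ^ n * u \<le> 2 ^ n" using assms by simp
    then have le: "\<lfloor>2 ^ n * u\<rfloor> \<le> 2 ^ n" unfolding floor_le_iff of_int_power of_int_numeral by linarith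
    have ge: "0 \<le> \<lfloor>2 ^ n * u\<rfloor>" using assms by simp
    have "min (2 ^ n) (nat \<lfloor>2 ^ n * u\<rfloor>) = nat \<lfloor>2 ^ n * u\<rfloor>" using le ge by (simp add: nat_le_iff)
    then have d: "dyadic_floor n u = of_int \<lfloor>2 ^ n * u\<rfloor> / 2 ^ n" unfolding dyadic_floor_def using ge by simp
    have "of_int \<lfloor>2 ^ n * u\<rfloor> \<le> 2 ^ n * u" "2 ^ n * u - 1 \<le> of_int \<lfloor>2 ^ n * u\<rfloor>" by linarith+
    then have "of_int \<lfloor>2 ^ n * u\<rfloor> / 2 ^ n \<le> 2 ^ n * u / 2 ^ n" "(2 ^ n * u - 1) / 2 ^ n \<le> of_int \<lfloor>2 ^ n * u\<rfloor> / 2 ^ n"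
      by (intro divide_right_mono; simp)+
    then show ?thesis unfolding d by (simp add: diff_divide_distrib power_divide)
  qed
  show "(\<lambda>n. u - (1/2) ^ n) \<longlonglongrightarrow> u"
    using tendsto_diff[OF tendsto_const LIMSEQ_power_zero[of "1/2::real"], of u] by simp
  show "\<forall>\<^sub>F n in sequentially. u - (1/2) ^ n \<le> dyadic_floor n u" "\<forall>\<^sub>F n in sequentially. dyadic_floor n u \<le> u"
    using b by auto
qed

lemma excursion_path_dyadic_floor:
  assumes "excursion_path p" "u \<in> {0..1}"
  shows "(\<lambda>n. p (dyadic_floor n u)) \<longlonglongrightarrow> p u"
proof (rule continuous_on_tendsto_compose[OF _ dyadic_floor_tendsto[OF assms(2)] assms(2)])
  show "continuous_on {0..1} p" using assms unfolding excursion_path_def by blast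
  show "\<forall>\<^sub>F n in sequentially. dyadic_floor n u \<in> {0..1}"
    using dyadic_floor_in unit_dyadics_subset by (intro always_eventually) blast
qed

text \<open>
  With \<open>lower_weight\<close>, continuous substitutes for the indicator of \<open>1 \<le> x p(r / x)\<close>. The upper
  weight is \<open>1\<close> if the path reaches height \<open>1\<close> at a level within \<open>1 / j\<close> of \<open>r\<close>. The lower weight is
  positive only if the path is at least \<open>1\<close> at all levels within \<open>1 / j\<close> of \<open>r\<close>; its other factors
  keep the size of the jump and the level away from the ends of their ranges.
\<close>

definition upper_weight :: "real \<Rightarrow> real \<Rightarrow> real \<Rightarrow> (real \<Rightarrow> real) \<Rightarrow> real" where
  "upper_weight j x r p = sweep (\<lambda>z. clip (j * (z - 1) + 1)) j x r p"

definition lower_weight :: "real \<Rightarrow> real \<Rightarrow> real \<Rightarrow> (real \<Rightarrow> real) \<Rightarrow> real" where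
  "lower_weight j x r p = clip (j * x - 1) * clip (j + 1 - x) * clip (j * r) * clip (j * (x - r)) *
     (1 - sweep (\<lambda>z. 1 - clip (j * (z - 1))) j x r p)"

lemma unit_lipschitz_upper: "0 < j \<Longrightarrow> unit_lipschitz (\<lambda>z. clip (j * (z - 1) + 1)) j"
  and unit_lipschitz_lower: "0 < j \<Longrightarrow> unit_lipschitz (\<lambda>z. 1 - clip (j * (z - 1))) j"
proof -
  assume j: "0 < j"
  have *: "\<bar>(j * (a - 1) + 1) - (j * (b - 1) + 1)\<bar> = j * \<bar>a - b\<bar>" "\<bar>j * (a - 1) - j * (b - 1)\<bar> = j * \<bar>a - b\<bar>" for a b
    using j by (auto simp: abs_mult simp flip: right_diff_distrib)
  have "\<bar>clip (j * (a - 1) + 1) - clip (j * (b - 1) + 1)\<bar> \<le> j * \<bar>a - b\<bar>" for a b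
    using clip_lipschitz[of "j * (a - 1) + 1" "j * (b - 1) + 1"] unfolding * .
  then show "unit_lipschitz (\<lambda>z. clip (j * (z - 1) + 1)) j" by (intro unit_lipschitz.intro j) auto
  have "\<bar>(1 - clip (j * (a - 1))) - (1 - clip (j * (b - 1)))\<bar> \<le> j * \<bar>a - b\<bar>" for a b
    using clip_lipschitz[of "j * (a - 1)" "j * (b - 1)"] unfolding * by linarith
  then show "unit_lipschitz (\<lambda>z. 1 - clip (j * (z - 1))) j" by (intro unit_lipschitz.intro j) auto
qed

lemma upper_weight_bounds: "0 < j \<Longrightarrow> 0 \<le> upper_weight j x r p" "0 < j \<Longrightarrow> upper_weight j x r p \<le> 1"
  unfolding upper_weight_def using unit_lipschitz.sweep_bounds[OF unit_lipschitz_upper] by auto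

lemma lower_weight_bounds: "0 < j \<Longrightarrow> 0 \<le> lower_weight j x r p" "0 < j \<Longrightarrow> lower_weight j x r p \<le> 1"
  unfolding lower_weight_def using unit_lipschitz.sweep_bounds[OF unit_lipschitz_lower, of j x r p]
  by (auto intro!: mult_le_one mult_nonneg_nonneg)

lemma upper_weight_measurable [measurable (raw)]:
  assumes "0 < j" "X \<in> borel_measurable M" "R \<in> borel_measurable M" "P \<in> M \<rightarrow>\<^sub>M (\<Pi>\<^sub>M s\<in>{0..1::real}. borel)"
  shows "(\<lambda>\<omega>. upper_weight j (X \<omega>) (R \<omega>) (P \<omega>)) \<in> borel_measurable M"
  unfolding upper_weight_def by (rule unit_lipschitz.sweep_measurable[OF unit_lipschitz_upper]) fact+

lemma lower_weight_measurable [measurable (raw)]: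
  assumes "0 < j" and [measurable]: "X \<in> borel_measurable M" "R \<in> borel_measurable M" "P \<in> M \<rightarrow>\<^sub>M (\<Pi>\<^sub>M s\<in>{0..1::real}. borel)"
  shows "(\<lambda>\<omega>. lower_weight j (X \<omega>) (R \<omega>) (P \<omega>)) \<in> borel_measurable M"
proof -
  have [measurable]: "(\<lambda>\<omega>. sweep (\<lambda>z. 1 - clip (j * (z - 1))) j (X \<omega>) (R \<omega>) (P \<omega>)) \<in> borel_measurable M"
    by (rule unit_lipschitz.sweep_measurable[OF unit_lipschitz_lower]) fact+
  show ?thesis unfolding lower_weight_def by measurable
qed

lemma upper_weight_tendsto:
  assumes "0 < j" "excursion_path p" "X \<longlonglongrightarrow> x" "R \<longlonglongrightarrow> r"
  shows "(\<lambda>n. upper_weight j (X n) (R n) p) \<longlonglongrightarrow> upper_weight j x r p"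
proof -
  obtain B where "\<forall>v\<in>{0..1}. \<bar>p v\<bar> \<le> B" using excursion_path_bounded[OF assms(2)] by blast
  then show ?thesis unfolding upper_weight_def using unit_dyadics_subset
    by (intro unit_lipschitz.sweep_tendsto[OF unit_lipschitz_upper, where B = B] assms) auto
qed

lemma lower_weight_tendsto:
  assumes "0 < j" "excursion_path p" "X \<longlonglongrightarrow> x" "R \<longlonglongrightarrow> r"
  shows "(\<lambda>n. lower_weight j (X n) (R n) p) \<longlonglongrightarrow> lower_weight j x r p"
proof -
  obtain B where "\<forall>v\<in>{0..1}. \<bar>p v\<bar> \<le> B" using excursion_path_bounded[OF assms(2)] by blast
  then have "(\<lambda>n. sweep (\<lambda>z. 1 - clip (j * (z - 1))) j (X n) (R n) p) \<longlonglongrightarrow> sweep (\<lambda>z. 1 - clip (j * (z - 1))) j x r p"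
    using unit_dyadics_subset by (intro unit_lipschitz.sweep_tendsto[OF unit_lipschitz_lower, where B = B] assms) auto
  then show ?thesis unfolding lower_weight_def by (intro tendsto_intros tendsto_clip assms)
qed

lemma upper_weight_eq_1:
  assumes j: "0 < j" and p: "excursion_path p" and v: "v \<in> {0..1}" "\<bar>x * v - r\<bar> \<le> 1 / j" "1 \<le> x * p v"
  shows "upper_weight j x r p = 1"
proof (rule antisym[OF upper_weight_bounds(2)[OF j]])
  interpret unit_lipschitz "\<lambda>z. clip (j * (z - 1) + 1)" j by (rule unit_lipschitz_upper[OF j])
  have lim: "(\<lambda>n. clip (j * (x * p (dyadic_floor n v) - 1) + 1) * window (j * (x * dyadic_floor n v - r)))
      \<longlonglongrightarrow> clip (j * (x * p v - 1) + 1) * window (j * (x * v - r))"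
    unfolding window_def
    by (intro tendsto_intros tendsto_clip excursion_path_dyadic_floor[OF p v(1)] dyadic_floor_tendsto[OF v(1)])
  have "\<bar>j * (x * v - r)\<bar> \<le> 1" using mult_left_mono[OF v(2), of j] j by (simp add: abs_mult)
  then have "clip (j * (x * p v - 1) + 1) * window (j * (x * v - r)) = 1"
    using v j by (simp add: clip_eq_1 window_eq_1)
  with lim have "(\<lambda>n. clip (j * (x * p (dyadic_floor n v) - 1) + 1) * window (j * (x * dyadic_floor n v - r))) \<longlonglongrightarrow> 1"
    by simp
  then show "1 \<le> upper_weight j x r p"
    unfolding upper_weight_def by (rule LIMSEQ_le_const2) (use sweep_ge[OF dyadic_floor_in] in blast)
qed

lemma lower_weight_pos:
  assumes j: "0 < j" and p: "excursion_path p" and w: "0 < lower_weight j x r p" and r': "\<bar>r' - r\<bar> < 1 / j"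
  shows "1 / j < x" "x < j + 1" "0 < r'" "r' < x" "1 \<le> x * p (r' / x)"
proof -
  interpret unit_lipschitz "\<lambda>z. 1 - clip (j * (z - 1))" j by (rule unit_lipschitz_lower[OF j])
  have c: "0 < clip (j * x - 1)" "0 < clip (j + 1 - x)" "0 < clip (j * r)" "0 < clip (j * (x - r))"
    and s: "sweep (\<lambda>z. 1 - clip (j * (z - 1))) j x r p < 1"
    using w sweep_bounds(2)[of x r p] unfolding lower_weight_def
    by (auto simp: less_le)
  then have x: "1 / j < x" "0 < r" "r < x" using j by (auto simp: clip_pos field_simps zero_less_mult_iff)
  show "1 / j < x" by fact
  show "x < j + 1" using c by (simp add: clip_pos)
  have x0: "0 < x" using x by linarith
  have dy: "1 \<le> x * p v" if "v \<in> unit_dyadics" "\<bar>x * v - r\<bar> \<le> 1 / j" for v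
  proof -
    have "\<bar>j * (x * v - r)\<bar> \<le> 1" using mult_left_mono[OF that(2), of j] j by (simp add: abs_mult)
    then have "1 - clip (j * (x * p v - 1)) < 1"
      using sweep_ge[OF that(1), of x p r] s by (simp add: window_eq_1)
    then show ?thesis using j by (simp add: clip_pos zero_less_mult_iff)
  qed
  have re: "1 \<le> x * p v" if v: "v \<in> {0..1}" "\<bar>x * v - r\<bar> < 1 / j" for v
  proof (rule tendsto_lowerbound)
    show "(\<lambda>n. x * p (dyadic_floor n v)) \<longlonglongrightarrow> x * p v"
      by (intro tendsto_intros excursion_path_dyadic_floor[OF p v(1)])
    have "(\<lambda>n. \<bar>x * dyadic_floor n v - r\<bar>) \<longlonglongrightarrow> \<bar>x * v - r\<bar>"
      by (intro tendsto_intros dyadic_floor_tendsto[OF v(1)])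
    from order_tendstoD(2)[OF this v(2)] show "\<forall>\<^sub>F n in sequentially. 1 \<le> x * p (dyadic_floor n v)"
      by eventually_elim (auto intro: dy dyadic_floor_in)
  qed simp
  have p01: "p 0 = 0" "p 1 = 0" using p by (auto simp: excursion_path_def)
  show r0: "0 < r'"
  proof (rule ccontr)
    assume "\<not> 0 < r'"
    then have "\<bar>x * 0 - r\<bar> < 1 / j" using r' x by simp
    from re[OF _ this] p01 show False by simp
  qed
  show rx: "r' < x"
  proof (rule ccontr)
    assume "\<not> r' < x"
    then have "\<bar>x * 1 - r\<bar> < 1 / j" using r' x by simp
    from re[OF _ this] p01 show False by simp
  qed
  show "1 \<le> x * p (r' / x)" using re[of "r' / x"] r0 rx x0 r' by simp
qed

lemma upper_weight_eq_0:
  assumes j: "2 \<le> j" and "r \<notin> {-1..x+1} \<or> (\<forall>d\<in>unit_dyadics. x * p d < 1/2)" and x: "0 \<le> x"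
  shows "upper_weight j x r p = 0"
proof -
  have "clip (j * (x * p v - 1) + 1) * window (j * (x * v - r)) = 0" if v: "v \<in> unit_dyadics" for v
    using assms(2)
  proof
    assume r: "r \<notin> {-1..x+1}"
    have "0 \<le> v" "v \<le> 1" using v unit_dyadics_subset by auto
    then have "0 \<le> x * v" "x * v \<le> x" using x by (auto simp: mult_left_le)
    then have "1 \<le> \<bar>x * v - r\<bar>" using r by auto
    then have "2 * 1 \<le> j * \<bar>x * v - r\<bar>" using j by (intro mult_mono) auto
    then show ?thesis using j by (simp add: window_eq_0 abs_mult)
  next
    assume "\<forall>d\<in>unit_dyadics. x * p d < 1/2"
    then have "x * p v - 1 \<le> - 1/2" using v by force
    then have "j * (x * p v - 1) \<le> j * (- 1/2)" using j by (intro mult_left_mono) auto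
    then have "j * (x * p v - 1) + 1 \<le> 0" using j by simp
    then show ?thesis by (simp add: clip_eq_0)
  qed
  then have "upper_weight j x r p = (SUP v\<in>unit_dyadics. 0)"
    unfolding upper_weight_def sweep_def by (intro SUP_cong) auto
  then show ?thesis using unit_dyadics_0 by (metis cSUP_const empty_iff)
qed

text \<open>
  Off the set \<open>1 \<le> x p(r / x)\<close> the path stays below \<open>1\<close>, with a gap, on a whole neighbourhood of the
  level, and a narrow window sees nothing else.
\<close>

lemma upper_weight_vanishes:
  assumes p: "excursion_path p" and x: "0 < x" and n: "\<not> (r \<in> {0..x} \<and> 1 \<le> x * p (r / x))"
  shows "\<forall>\<^sub>F j in at_top. upper_weight j x r p = 0"
proof -
  obtain d e where d: "0 < d" and e: "0 < e"
    and *: "\<And>v. v \<in> unit_dyadics \<Longrightarrow> \<bar>x * v - r\<bar> < d \<Longrightarrow> x * p v \<le> 1 - e"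
  proof (cases "r \<in> {0..x}")
    case True
    then have v0: "r / x \<in> {0..1}" and lt: "x * p (r / x) < 1" using n x by auto
    define e where "e = (1 - x * p (r / x)) / 2"
    have e: "0 < e" unfolding e_def using lt by simp
    have "continuous_on {0..1} (\<lambda>v. x * p v)"
      using p by (auto simp: excursion_path_def intro!: continuous_intros)
    then obtain d where d: "0 < d" "\<And>v. v \<in> {0..1} \<Longrightarrow> \<bar>v - r / x\<bar> < d \<Longrightarrow> \<bar>x * p v - x * p (r / x)\<bar> < e"
      using v0 e unfolding continuous_on_iff dist_real_def by meson
    show ?thesis
    proof (rule that[of "d * x" e])
      fix v assume v: "v \<in> unit_dyadics" "\<bar>x * v - r\<bar> < d * x"
      have "x * v - r = x * (v - r / x)" using x by (simp add: right_diff_distrib)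
      then have "\<bar>v - r / x\<bar> < d" using v(2) x by (simp add: abs_mult mult.commute)
      then have "\<bar>x * p v - x * p (r / x)\<bar> < e" using d v unit_dyadics_subset by auto
      moreover have "x * p (r / x) = 1 - 2 * e" by (simp add: e_def field_simps)
      ultimately show "x * p v \<le> 1 - e" by linarith
    qed (use d e x in auto)
  next
    case False
    define d where "d = (if r < 0 then - r else r - x)"
    show ?thesis
    proof (rule that[of d 1])
      show "0 < d" using False by (auto simp: d_def)
      fix v assume v: "v \<in> unit_dyadics" "\<bar>x * v - r\<bar> < d"
      have "0 \<le> v" "v \<le> 1" using v unit_dyadics_subset by auto
      then have "0 \<le> x * v" "x * v \<le> x" using x by (auto simp: mult_left_le)
      then show "x * p v \<le> 1 - 1" using v(2) False by (auto simp: d_def split: if_splits)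
    qed simp
  qed
  show ?thesis
    using eventually_ge_at_top[of "max (2 / d) (1 / e)"]
  proof eventually_elim
    case (elim j)
    then have j: "2 / d \<le> j" "1 / e \<le> j" by auto
    then have j0: "0 < j" using e by (meson divide_pos_pos less_le_trans zero_less_one)
    have "clip (j * (x * p v - 1) + 1) * window (j * (x * v - r)) = 0" if v: "v \<in> unit_dyadics" for v
    proof (cases "\<bar>x * v - r\<bar> < d")
      case True
      then have "j * (x * p v - 1) \<le> j * (- e)" using *[OF v] j0 by (intro mult_left_mono) auto
      also have "\<dots> \<le> - 1" using j e by (simp add: field_simps)
      finally show ?thesis by (simp add: clip_eq_0)
    next
      case False
      then have "j * d \<le> \<bar>j * (x * v - r)\<bar>" using j0 by (simp add: abs_mult)
      moreover have "2 \<le> j * d" using j d by (simp add: divide_le_eq)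
      ultimately have "2 \<le> \<bar>j * (x * v - r)\<bar>" by linarith
      then show ?thesis by (simp add: window_eq_0)
    qed
    then have "upper_weight j x r p = (SUP v\<in>unit_dyadics. 0)"
      unfolding upper_weight_def sweep_def by (intro SUP_cong) auto
    then show ?case using unit_dyadics_0 by (metis cSUP_const empty_iff)
  qed
qed

text \<open>
  If \<open>1 < x p(r / x)\<close>, the path stays above \<open>1\<close>, with a gap, on a whole neighbourhood of the level.
\<close>

lemma lower_weight_saturates:
  assumes p: "excursion_path p" and r: "0 < r" "r < x" "1 < x * p (r / x)"
  shows "\<forall>\<^sub>F j in at_top. lower_weight j x r p = 1"
proof -
  have x: "0 < x" using r by simp
  have v0: "r / x \<in> {0..1}" using r by auto
  define e where "e = (x * p (r / x) - 1) / 2"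
  have e: "0 < e" unfolding e_def using r by simp
  have "continuous_on {0..1} (\<lambda>v. x * p v)"
    using p by (auto simp: excursion_path_def intro!: continuous_intros)
  then obtain d where d: "0 < d" "\<And>v. v \<in> {0..1} \<Longrightarrow> \<bar>v - r / x\<bar> < d \<Longrightarrow> \<bar>x * p v - x * p (r / x)\<bar> < e"
    using v0 e unfolding continuous_on_iff dist_real_def by meson
  show ?thesis
    using eventually_ge_at_top[of "Max {2 / (d * x), 1 / e, 2 / x, x, 1 / r, 1 / (x - r)}"]
  proof eventually_elim
    case (elim j)
    then have j: "2 / (d * x) \<le> j" "1 / e \<le> j" "2 / x \<le> j" "x \<le> j" "1 / r \<le> j" "1 / (x - r) \<le> j" by auto
    then have j0: "0 < j" using x by simp
    have "(1 - clip (j * (x * p v - 1))) * window (j * (x * v - r)) = 0" if v: "v \<in> unit_dyadics" for v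
    proof (cases "\<bar>v - r / x\<bar> < d")
      case True
      then have "\<bar>x * p v - x * p (r / x)\<bar> < e" using d v unit_dyadics_subset by auto
      moreover have "x * p (r / x) = 1 + 2 * e" by (simp add: e_def field_simps)
      ultimately have "e \<le> x * p v - 1" by linarith
      then have "j * e \<le> j * (x * p v - 1)" using j0 by (intro mult_left_mono) auto
      moreover have "1 \<le> j * e" using j e by (simp add: field_simps)
      ultimately show ?thesis by (simp add: clip_eq_1)
    next
      case False
      have "x * v - r = x * (v - r / x)" using x by (simp add: right_diff_distrib)
      then have "\<bar>j * (x * v - r)\<bar> = j * x * \<bar>v - r / x\<bar>" using x j0 by (simp add: abs_mult)
      also have "\<dots> \<ge> j * x * d" using False x j0 by (intro mult_left_mono) auto
      also have "j * x * d \<ge> 2" using j d x by (simp add: field_simps)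
      finally show ?thesis by (simp add: window_eq_0)
    qed
    then have "sweep (\<lambda>z. 1 - clip (j * (z - 1))) j x r p = (SUP v\<in>unit_dyadics. 0)"
      unfolding sweep_def by (intro SUP_cong) auto
    also have "\<dots> = 0" using unit_dyadics_0 by (metis cSUP_const empty_iff)
    finally have s: "sweep (\<lambda>z. 1 - clip (j * (z - 1))) j x r p = 0" .
    have "1 \<le> j * x - 1" "1 \<le> j + 1 - x" "1 \<le> j * r" "1 \<le> j * (x - r)"
      using j r x by (auto simp: field_simps)
    then show ?case unfolding lower_weight_def s by (simp add: clip_eq_1)
  qed
qed


section \<open>The total intensity of high marks\<close>

abbreviation path_space :: "(real \<Rightarrow> real) measure" where
  "path_space \<equiv> \<Pi>\<^sub>M s\<in>{0..1::real}. (borel :: real measure)"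

abbreviation weight_space :: "(real \<times> real \<times> (real \<Rightarrow> real)) measure" where
  "weight_space \<equiv> borel \<Otimes>\<^sub>M (borel \<Otimes>\<^sub>M path_space)"

definition levy_const :: "real \<Rightarrow> real" where
  "levy_const \<alpha> = \<alpha> * (1 + \<alpha>) / (Gamma (1 - \<alpha>) * Gamma (1 + \<alpha>) * 2 powr \<alpha>)"

lemma levy_density_eq: "levy_density \<alpha> x = indicator {0<..} x * levy_const \<alpha> * x powr (- 2 - \<alpha>)"
  by (simp add: levy_density_def levy_const_def)

lemma levy_const_pos: "0 < \<alpha> \<Longrightarrow> \<alpha> < 1 \<Longrightarrow> 0 < levy_const \<alpha>"
  unfolding levy_const_def by (intro divide_pos_pos mult_pos_pos Gamma_real_pos) auto

lemma levy_tail_first_moment: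
  assumes \<alpha>: "0 < \<alpha>" "\<alpha> < 1" and q: "0 \<le> q" and A: "A = {1::real..} \<or> A = {1<..}"
  shows "(\<integral>\<^sup>+x. ennreal (x * levy_density \<alpha> x) * indicator A (x * q) \<partial>lborel) = ennreal (levy_const \<alpha> / \<alpha> * q powr \<alpha>)"
proof (cases "q = 0")
  case True
  then show ?thesis using A by auto
next
  case False
  then have q: "0 < q" using q by simp
  let ?c = "levy_const \<alpha>"
  have "AE x in lborel. ennreal (x * levy_density \<alpha> x) * indicator A (x * q) = ennreal (?c * x powr (- 1 - \<alpha>)) * indicator {1 / q..} x"
    using AE_lborel_singleton[of "1 / q"]
  proof eventually_elim
    case (elim x)
    have "x * levy_density \<alpha> x = ?c * x powr (- 1 - \<alpha>)" if "0 < x"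
      using that powr_add[of x 1 "- 2 - \<alpha>"] by (simp add: levy_density_eq)
    moreover have "indicator A (x * q) = (indicator {1 / q..} x :: ennreal)"
      using A elim q by (auto simp: indicator_def field_simps)
    moreover have "0 < x" if "1 / q \<le> x" using that q by (meson divide_pos_pos less_le_trans zero_less_one)
    ultimately show ?case by (auto simp: indicator_def)
  qed
  then have "(\<integral>\<^sup>+x. ennreal (x * levy_density \<alpha> x) * indicator A (x * q) \<partial>lborel) = (\<integral>\<^sup>+x. ennreal (?c * x powr (- 1 - \<alpha>)) * indicator {1 / q..} x \<partial>lborel)"
    by (rule nn_integral_cong_AE)
  also have "\<dots> = ennreal (0 - (- (?c / \<alpha>) * (1 / q) powr (- \<alpha>)))"
  proof (rule nn_integral_FTC_atLeast)
    show "((\<lambda>x. - (?c / \<alpha>) * x powr (- \<alpha>)) \<longlongrightarrow> 0) at_top"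
      using tendsto_mult_right_zero[OF tendsto_neg_powr[OF _ filterlim_ident], of "- \<alpha>" "- (?c / \<alpha>)"] \<alpha> by simp
    fix x assume "1 / q \<le> x"
    then have "0 < x" using q by (meson divide_pos_pos less_le_trans zero_less_one)
    then show "((\<lambda>x. - (?c / \<alpha>) * x powr (- \<alpha>)) has_real_derivative ?c * x powr (- 1 - \<alpha>)) (at x)"
      using \<alpha> by (auto intro!: derivative_eq_intros simp: powr_diff powr_minus_divide)
  qed (use levy_const_pos[OF \<alpha>] in auto)
  also have "0 - (- (?c / \<alpha>) * (1 / q) powr (- \<alpha>)) = ?c / \<alpha> * q powr \<alpha>"
    using q by (simp add: powr_divide powr_minus_divide)
  finally show ?thesis .
qed

text \<open>
  What is needed of a standard excursion. It is a random path on a probability space and not a law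
  on \<open>path_space\<close>, because continuity of the path is not an event of the product \<open>\<sigma>\<close>-algebra.
\<close>

locale excursion_law = prob_space E for E :: "'e measure" +
  fixes \<alpha> :: real and Y :: "'e \<Rightarrow> real \<Rightarrow> real"
  assumes \<alpha>: "0 < \<alpha>" "\<alpha> < 1"
    and Y_measurable [measurable]: "Y \<in> E \<rightarrow>\<^sub>M path_space"
    and AE_path: "AE p in E. excursion_path (Y p)"
    and marginal_moment: "\<And>u. 0 < u \<Longrightarrow> u < 1 \<Longrightarrow>
      (\<integral>\<^sup>+p. ennreal (Y p u powr \<alpha>) \<partial>E) = ennreal (Gamma (2 + 2 * \<alpha>) / Gamma (2 + \<alpha>) * (2 * u * (1 - u)) powr \<alpha>)"
    and maximal: "\<exists>C\<ge>0. \<forall>u>0. emeasure E {p \<in> space E. \<exists>d\<in>unit_dyadics. u \<le> Y p d} \<le> ennreal (C / u^4)"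
begin

text \<open>
  A version of the path that is jointly measurable in the path and the time: it only involves dyadic
  times.
\<close>

definition pbar :: "(real \<Rightarrow> real) \<Rightarrow> real \<Rightarrow> real" where
  "pbar p u = indicator {0..1} u * lim (\<lambda>n. p (dyadic_floor n u))"

lemma pbar_eq: "excursion_path p \<Longrightarrow> pbar p u = indicator {0..1} u * p u"
  unfolding pbar_def using limI[OF excursion_path_dyadic_floor] by (cases "u \<in> {0..1}") auto

lemma pbar_nonneg: "excursion_path p \<Longrightarrow> 0 \<le> pbar p u"
  by (auto simp: pbar_eq excursion_path_def indicator_def)

lemma coordinate_measurable: "d \<in> {0..1} \<Longrightarrow> (\<lambda>p. Y p d) \<in> borel_measurable E"
  by (rule measurable_compose[OF Y_measurable measurable_component_singleton])

lemma pbar_measurable [measurable]: "(\<lambda>(p, u). pbar (Y p) u) \<in> borel_measurable (E \<Otimes>\<^sub>M (borel :: real measure))"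
proof -
  have "(\<lambda>z. Y (fst z) (real (min (2 ^ n) k) / 2 ^ n)) \<in> borel_measurable (E \<Otimes>\<^sub>M (borel :: real measure))" for n k
  proof -
    have "real (min (2 ^ n) k) / 2 ^ n \<in> {0..1}" by (rule dyadic_point) simp
    from measurable_compose[OF measurable_fst coordinate_measurable[OF this]] show ?thesis .
  qed
  then have "(\<lambda>z. Y (fst z) (real (min (2 ^ n) (nat \<lfloor>2 ^ n * snd z\<rfloor>)) / 2 ^ n)) \<in> borel_measurable (E \<Otimes>\<^sub>M (borel :: real measure))" for n
    by (rule measurable_compose_countable[where f = "\<lambda>k z. Y (fst z) (real (min (2 ^ n) k) / 2 ^ n)"]) measurable
  then have [measurable]: "(\<lambda>z. Y (fst z) (dyadic_floor n (snd z))) \<in> borel_measurable (E \<Otimes>\<^sub>M (borel :: real measure))" for n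
    unfolding dyadic_floor_def .
  show ?thesis unfolding pbar_def case_prod_beta by measurable
qed

lemma pbar_measurable' [measurable (raw)]:
  assumes [measurable]: "P \<in> M \<rightarrow>\<^sub>M E" "U \<in> borel_measurable M"
  shows "(\<lambda>\<omega>. pbar (Y (P \<omega>)) (U \<omega>)) \<in> borel_measurable M"
  using measurable_compose[OF measurable_Pair[OF assms] pbar_measurable] by simp

text \<open>
  Substituting \<open>r = x u\<close> and integrating over \<open>x\<close> first gives a multiple of the \<open>\<alpha>\<close>-th power of the
  path at \<open>u\<close>. Its mean is proportional to \<open>(u (1 - u)) powr \<alpha>\<close>, and in the remaining Beta integral
  all constants cancel except \<open>Gamma (1 - \<alpha>)\<close>. The closed half-line bounds the limits of the upper
  weights and the open one those of the lower weights; both have the same total.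
\<close>

lemma total_intensity:
  assumes A: "A = {1::real..} \<or> A = {1<..}"
  shows "(\<integral>\<^sup>+p. (\<integral>\<^sup>+x. (\<integral>\<^sup>+r. ennreal (levy_density \<alpha> x) * indicator A (x * pbar (Y p) (r / x)) \<partial>lborel) \<partial>lborel) \<partial>E) = ennreal (1 / Gamma (1 - \<alpha>))"
proof -
  have Am [measurable]: "A \<in> sets borel" using A by auto
  let ?c = "levy_const \<alpha>"
  have pm: "pbar (Y p) \<in> borel_measurable borel" if "p \<in> space E" for p
    using measurable_compose[OF measurable_Pair1'[OF that] pbar_measurable] by simp
  interpret pair_sigma_finite E lborel by standard
  have "(\<integral>\<^sup>+p. (\<integral>\<^sup>+x. (\<integral>\<^sup>+r. ennreal (levy_density \<alpha> x) * indicator A (x * pbar (Y p) (r / x)) \<partial>lborel) \<partial>lborel) \<partial>E)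
     = (\<integral>\<^sup>+p. (\<integral>\<^sup>+u. ennreal (?c / \<alpha> * pbar (Y p) u powr \<alpha>) \<partial>lborel) \<partial>E)"
  proof (rule nn_integral_cong_AE)
    show "AE p in E. (\<integral>\<^sup>+x. (\<integral>\<^sup>+r. ennreal (levy_density \<alpha> x) * indicator A (x * pbar (Y p) (r / x)) \<partial>lborel) \<partial>lborel)
      = (\<integral>\<^sup>+u. ennreal (?c / \<alpha> * pbar (Y p) u powr \<alpha>) \<partial>lborel)"
      using AE_path AE_space
    proof eventually_elim
      case (elim p)
      note [measurable] = pm[OF elim(2)]
      have "(\<integral>\<^sup>+r. ennreal (levy_density \<alpha> x) * indicator A (x * pbar (Y p) (r / x)) \<partial>lborel)
         = (\<integral>\<^sup>+u. ennreal (x * levy_density \<alpha> x) * indicator A (x * pbar (Y p) u) \<partial>lborel)" for x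
      proof (cases "0 < x")
        case True
        have "(\<integral>\<^sup>+r. ennreal (levy_density \<alpha> x) * indicator A (x * pbar (Y p) (r / x)) \<partial>lborel)
          = ennreal \<bar>x\<bar> * (\<integral>\<^sup>+u. ennreal (levy_density \<alpha> x) * indicator A (x * pbar (Y p) ((0 + x * u) / x)) \<partial>lborel)"
          using True by (intro nn_integral_real_affine) auto
        also have "\<dots> = (\<integral>\<^sup>+u. ennreal (x * levy_density \<alpha> x) * indicator A (x * pbar (Y p) u) \<partial>lborel)"
          using True by (subst nn_integral_cmult[symmetric]) (auto simp: ennreal_mult' mult.assoc)
        finally show ?thesis .
      qed (simp add: levy_density_def)
      then have "(\<integral>\<^sup>+x. (\<integral>\<^sup>+r. ennreal (levy_density \<alpha> x) * indicator A (x * pbar (Y p) (r / x)) \<partial>lborel) \<partial>lborel)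
         = (\<integral>\<^sup>+x. (\<integral>\<^sup>+u. ennreal (x * levy_density \<alpha> x) * indicator A (x * pbar (Y p) u) \<partial>lborel) \<partial>lborel)" by simp
      also have "\<dots> = (\<integral>\<^sup>+u. (\<integral>\<^sup>+x. ennreal (x * levy_density \<alpha> x) * indicator A (x * pbar (Y p) u) \<partial>lborel) \<partial>lborel)"
        by (rule lborel_pair.Fubini') measurable
      also have "\<dots> = (\<integral>\<^sup>+u. ennreal (?c / \<alpha> * pbar (Y p) u powr \<alpha>) \<partial>lborel)"
        using pbar_nonneg[OF elim(1)] by (simp add: levy_tail_first_moment[OF \<alpha> _ A])
      finally show ?case .
    qed
  qed
  also have "\<dots> = (\<integral>\<^sup>+u. (\<integral>\<^sup>+p. ennreal (?c / \<alpha> * pbar (Y p) u powr \<alpha>) \<partial>E) \<partial>lborel)"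
    by (rule Fubini'[symmetric]) measurable
  also have "\<dots> = (\<integral>\<^sup>+u. ennreal (?c / \<alpha> * (Gamma (2 + 2 * \<alpha>) / Gamma (2 + \<alpha>) * 2 powr \<alpha>)) * (ennreal (u powr (1 + \<alpha> - 1) * (1 - u) powr (1 + \<alpha> - 1)) * indicator {0..1} u) \<partial>lborel)"
  proof (rule nn_integral_cong_AE)
    have "AE u in lborel. u \<noteq> 0 \<and> u \<noteq> (1::real)" using AE_lborel_singleton[of "0::real"] AE_lborel_singleton[of "1::real"] by eventually_elim auto
    then show "AE u in lborel. (\<integral>\<^sup>+p. ennreal (?c / \<alpha> * pbar (Y p) u powr \<alpha>) \<partial>E)
      = ennreal (?c / \<alpha> * (Gamma (2 + 2 * \<alpha>) / Gamma (2 + \<alpha>) * 2 powr \<alpha>)) * (ennreal (u powr (1 + \<alpha> - 1) * (1 - u) powr (1 + \<alpha> - 1)) * indicator {0..1} u)"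
    proof eventually_elim
      case (elim u)
      show ?case
      proof (cases "u \<in> {0..1}")
        case True
        then have u: "0 < u" "u < 1" using elim by auto
        have c: "0 \<le> ?c / \<alpha>" using levy_const_pos[OF \<alpha>] \<alpha> by simp
        have G: "0 < Gamma (2 + 2 * \<alpha>)" "0 < Gamma (2 + \<alpha>)" using \<alpha> by (auto intro!: Gamma_real_pos)
        have [measurable]: "(\<lambda>p. Y p u) \<in> borel_measurable E" using True by (rule coordinate_measurable)
        have "(\<integral>\<^sup>+p. ennreal (?c / \<alpha> * pbar (Y p) u powr \<alpha>) \<partial>E) = (\<integral>\<^sup>+p. ennreal (?c / \<alpha>) * ennreal (Y p u powr \<alpha>) \<partial>E)"
          by (rule nn_integral_cong_AE, rule eventually_mono[OF AE_path]) (use True in \<open>simp add: pbar_eq ennreal_mult'[OF c, symmetric]\<close>)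
        also have "\<dots> = ennreal (?c / \<alpha>) * ennreal (Gamma (2 + 2 * \<alpha>) / Gamma (2 + \<alpha>) * (2 * u * (1 - u)) powr \<alpha>)"
          by (subst nn_integral_cmult) (simp_all add: marginal_moment[OF u])
        also have "\<dots> = ennreal (?c / \<alpha> * (Gamma (2 + 2 * \<alpha>) / Gamma (2 + \<alpha>) * (2 * u * (1 - u)) powr \<alpha>))"
          using c by (rule ennreal_mult'[symmetric])
        also have "(2 * u * (1 - u)) powr \<alpha> = 2 powr \<alpha> * (u powr \<alpha> * (1 - u) powr \<alpha>)"
          using u by (simp add: powr_mult)
        also have "ennreal (?c / \<alpha> * (Gamma (2 + 2 * \<alpha>) / Gamma (2 + \<alpha>) * (2 powr \<alpha> * (u powr \<alpha> * (1 - u) powr \<alpha>))))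
          = ennreal (?c / \<alpha> * (Gamma (2 + 2 * \<alpha>) / Gamma (2 + \<alpha>) * 2 powr \<alpha>)) * ennreal (u powr \<alpha> * (1 - u) powr \<alpha>)"
        proof -
          have "0 \<le> ?c / \<alpha> * (Gamma (2 + 2 * \<alpha>) / Gamma (2 + \<alpha>) * 2 powr \<alpha>)"
            using G by (intro mult_nonneg_nonneg[OF c]) auto
          then show ?thesis by (subst ennreal_mult'[symmetric]) (simp_all only: mult.assoc)
        qed
        finally show ?thesis using True by simp
      qed (simp add: pbar_def)
    qed
  qed
  also have "\<dots> = ennreal (?c / \<alpha> * (Gamma (2 + 2 * \<alpha>) / Gamma (2 + \<alpha>) * 2 powr \<alpha>)) * ennreal (Beta (1 + \<alpha>) (1 + \<alpha>))"
    using \<alpha> by (subst nn_integral_cmult, measurable, subst nn_integral_has_integral_lebesgue'[OF _ has_integral_Beta_real]) auto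
  also have "\<dots> = ennreal (1 / Gamma (1 - \<alpha>))"
  proof -
    have G: "0 < Gamma (2 + 2 * \<alpha>)" "0 < Gamma (2 + \<alpha>)" "0 < Gamma (1 + \<alpha>)" "0 < Gamma (1 - \<alpha>)"
      using \<alpha> by (auto intro!: Gamma_real_pos)
    have g2: "Gamma (2 + \<alpha>) = (1 + \<alpha>) * Gamma (1 + \<alpha>)"
      using Gamma_plus1[of "1 + \<alpha>"] \<alpha> by (auto simp: add_ac nonpos_Ints_def)
    have B: "Beta (1 + \<alpha>) (1 + \<alpha>) = Gamma (1 + \<alpha>) * Gamma (1 + \<alpha>) / Gamma (2 + 2 * \<alpha>)"
    proof -
      have "1 + \<alpha> + (1 + \<alpha>) = 2 + 2 * \<alpha>" by simp
      then show ?thesis unfolding Beta_def by (simp only:)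
    qed
    have "?c / \<alpha> * (Gamma (2 + 2 * \<alpha>) / Gamma (2 + \<alpha>) * 2 powr \<alpha>) * Beta (1 + \<alpha>) (1 + \<alpha>) = 1 / Gamma (1 - \<alpha>)"
    proof -
      define g1 g22 gm where "g1 = Gamma (1 + \<alpha>)" and "g22 = Gamma (2 + 2 * \<alpha>)" and "gm = Gamma (1 - \<alpha>)"
      have *: "0 < g1" "0 < g22" "0 < gm" "0 < (2::real) powr \<alpha>" unfolding g1_def g22_def gm_def using G by auto
      show ?thesis unfolding B g2 levy_const_def g1_def[symmetric] g22_def[symmetric] gm_def[symmetric]
        using * \<alpha> by (simp add: divide_simps)
    qed
    then show ?thesis using levy_const_pos[OF \<alpha>] \<alpha> G by (subst ennreal_mult'[symmetric]) auto
  qed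
  finally show ?thesis .
qed

text \<open>
  Expected weight, per unit of time, of the jumps of a process that stays at distance \<open>r\<close> below the
  level.
\<close>

definition intensity :: "(real \<Rightarrow> real \<Rightarrow> (real \<Rightarrow> real) \<Rightarrow> real) \<Rightarrow> real \<Rightarrow> ennreal" where
  "intensity w r = (\<integral>\<^sup>+x. (\<integral>\<^sup>+p. ennreal (levy_density \<alpha> x * w x r (Y p)) \<partial>E) \<partial>lborel)"

text \<open>
  An envelope for the upper weights with \<open>j \<ge> 2\<close>, which vanish unless the path reaches height \<open>1/2\<close>.
\<close>

definition tall :: "real \<Rightarrow> (real \<Rightarrow> real) \<Rightarrow> real" where
  "tall x p = (if \<exists>d\<in>unit_dyadics. 1/2 \<le> x * p d then 1 else 0)"

lemma tall_measurable [measurable (raw)]: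
  assumes [measurable]: "X \<in> borel_measurable M" "P \<in> M \<rightarrow>\<^sub>M E"
  shows "(\<lambda>\<omega>. tall (X \<omega>) (Y (P \<omega>))) \<in> borel_measurable M"
proof -
  have "{\<omega> \<in> space M. 1/2 \<le> X \<omega> * Y (P \<omega>) d} \<in> sets M" if "d \<in> unit_dyadics" for d
  proof -
    have "d \<in> {0..1}" using that unit_dyadics_subset by blast
    from measurable_compose[OF assms(2) coordinate_measurable[OF this]]
    have [measurable]: "(\<lambda>\<omega>. Y (P \<omega>) d) \<in> borel_measurable M" .
    show ?thesis by measurable
  qed
  then have "(\<Union>d\<in>unit_dyadics. {\<omega> \<in> space M. 1/2 \<le> X \<omega> * Y (P \<omega>) d}) \<in> sets M"
    by (intro sets.countable_UN' countable_unit_dyadics) auto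
  also have "(\<Union>d\<in>unit_dyadics. {\<omega> \<in> space M. 1/2 \<le> X \<omega> * Y (P \<omega>) d}) = {\<omega> \<in> space M. \<exists>d\<in>unit_dyadics. 1/2 \<le> X \<omega> * Y (P \<omega>) d}" by auto
  finally have [measurable]: "{\<omega> \<in> space M. \<exists>d\<in>unit_dyadics. 1/2 \<le> X \<omega> * Y (P \<omega>) d} \<in> sets M" .
  show ?thesis unfolding tall_def by measurable
qed

text \<open>
  A mark of a jump of size \<open>x < 1\<close> reaches height \<open>1/2\<close> with probability of order \<open>x\<^sup>4\<close>, by
  the maximal inequality. This dominates the singularity \<open>x powr (- 2 - \<alpha>)\<close> of the Levy density.
\<close>

lemma tall_integral: "(\<integral>\<^sup>+x. (\<integral>\<^sup>+p. ennreal (levy_density \<alpha> x * (x + 2) * tall x (Y p)) \<partial>E) \<partial>lborel) < \<infinity>"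
proof -
  obtain C where C: "0 \<le> C" "\<And>u. 0 < u \<Longrightarrow> emeasure E {p \<in> space E. \<exists>d\<in>unit_dyadics. u \<le> Y p d} \<le> ennreal (C / u^4)"
    using maximal by blast
  let ?c = "levy_const \<alpha>"
  have c: "0 < ?c" by (rule levy_const_pos[OF \<alpha>])
  have "(\<integral>\<^sup>+x. (\<integral>\<^sup>+p. ennreal (levy_density \<alpha> x * (x + 2) * tall x (Y p)) \<partial>E) \<partial>lborel)
      \<le> (\<integral>\<^sup>+x. ennreal (48 * C * ?c) * indicator {0..1} x + ennreal (3 * ?c * x powr (- 1 - \<alpha>)) * indicator {1..} x \<partial>lborel)"
  proof (rule nn_integral_mono)
    fix x :: real
    show "(\<integral>\<^sup>+p. ennreal (levy_density \<alpha> x * (x + 2) * tall x (Y p)) \<partial>E) \<le> ennreal (48 * C * ?c) * indicator {0..1} x + ennreal (3 * ?c * x powr (- 1 - \<alpha>)) * indicator {1..} x"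
    proof (cases "0 < x")
      case x: True
      have l0: "0 \<le> levy_density \<alpha> x * (x + 2)" using levy_density_nonneg[OF \<alpha>] x by simp
      have eq: "(\<integral>\<^sup>+p. ennreal (levy_density \<alpha> x * (x + 2) * tall x (Y p)) \<partial>E) = ennreal (levy_density \<alpha> x * (x + 2)) * (\<integral>\<^sup>+p. ennreal (tall x (Y p)) \<partial>E)"
        unfolding ennreal_mult'[OF l0] by (rule nn_integral_cmult) measurable
      show ?thesis
      proof (cases "x \<le> 1")
        case True
        have "(\<integral>\<^sup>+p. ennreal (tall x (Y p)) \<partial>E) = (\<integral>\<^sup>+p. indicator {p \<in> space E. \<exists>d\<in>unit_dyadics. 1 / (2 * x) \<le> Y p d} p \<partial>E)"
          using x by (intro nn_integral_cong) (auto simp: tall_def indicator_def divide_le_eq mult_ac)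
        also have "\<dots> = emeasure E {p \<in> space E. \<exists>d\<in>unit_dyadics. 1 / (2 * x) \<le> Y p d}"
        proof (rule nn_integral_indicator)
          have "{p \<in> space E. tall x (Y p) = 1} \<in> sets E" by measurable
          also have "{p \<in> space E. tall x (Y p) = 1} = {p \<in> space E. \<exists>d\<in>unit_dyadics. 1 / (2 * x) \<le> Y p d}"
            using x by (auto simp: tall_def divide_le_eq mult_ac)
          finally show "{p \<in> space E. \<exists>d\<in>unit_dyadics. 1 / (2 * x) \<le> Y p d} \<in> sets E" .
        qed
        also have "\<dots> \<le> ennreal (C / (1 / (2 * x))^4)" using x by (intro C) simp
        also have "C / (1 / (2 * x))^4 = 16 * C * x^4" using x by (simp add: power_divide power_mult_distrib)
        finally have "ennreal (levy_density \<alpha> x * (x + 2)) * (\<integral>\<^sup>+p. ennreal (tall x (Y p)) \<partial>E) \<le> ennreal (levy_density \<alpha> x * (x + 2)) * ennreal (16 * C * x^4)"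
          by (rule mult_left_mono) simp
        also have "\<dots> = ennreal (levy_density \<alpha> x * (x + 2) * (16 * C * x^4))" using l0 by (rule ennreal_mult'[symmetric])
        also have "\<dots> \<le> ennreal (48 * C * ?c)"
        proof (rule ennreal_leI)
          have "x powr (- 2 - \<alpha>) * x^4 = x powr (2 - \<alpha>)"
            using x powr_add[of x "- 2 - \<alpha>" 4] by simp
          also have "\<dots> \<le> 1 powr (2 - \<alpha>)" using x True \<alpha> by (intro powr_mono2) auto
          finally have le1: "x powr (- 2 - \<alpha>) * x^4 \<le> 1" by simp
          have "levy_density \<alpha> x * (x + 2) * (16 * C * x^4) = (16 * C * ?c) * ((x + 2) * (x powr (- 2 - \<alpha>) * x^4))"
            using x by (simp add: levy_density_eq)
          also have "\<dots> \<le> (16 * C * ?c) * (3 * 1)"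
            using le1 x True C(1) c by (intro mult_left_mono mult_mono) auto
          finally show "levy_density \<alpha> x * (x + 2) * (16 * C * x^4) \<le> 48 * C * ?c" by simp
        qed
        finally show ?thesis unfolding eq using x True by (simp add: add_increasing2)
      next
        case False
        have "(\<integral>\<^sup>+p. ennreal (tall x (Y p)) \<partial>E) \<le> (\<integral>\<^sup>+p. 1 \<partial>E)"
          by (intro nn_integral_mono) (auto simp: tall_def)
        then have "(\<integral>\<^sup>+p. ennreal (tall x (Y p)) \<partial>E) \<le> 1" by (simp add: emeasure_space_1)
        from mult_left_mono[OF this, of "ennreal (levy_density \<alpha> x * (x + 2))"]
        have "ennreal (levy_density \<alpha> x * (x + 2)) * (\<integral>\<^sup>+p. ennreal (tall x (Y p)) \<partial>E) \<le> ennreal (levy_density \<alpha> x * (x + 2))" by simp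
        also have "\<dots> \<le> ennreal (3 * ?c * x powr (- 1 - \<alpha>))"
        proof (rule ennreal_leI)
          have "x powr (- 1 - \<alpha>) = x powr (- 2 - \<alpha>) * x" using x powr_add[of x "- 2 - \<alpha>" 1] by simp
          moreover have "levy_density \<alpha> x * (x + 2) \<le> levy_density \<alpha> x * (3 * x)"
            using False levy_density_nonneg[OF \<alpha>] by (intro mult_left_mono) auto
          ultimately show "levy_density \<alpha> x * (x + 2) \<le> 3 * ?c * x powr (- 1 - \<alpha>)"
            using x by (simp add: levy_density_eq mult_ac)
        qed
        finally show ?thesis unfolding eq using False by simp
      qed
    qed (simp add: levy_density_def)
  qed
  also have "\<dots> = ennreal (48 * C * ?c) + ennreal (0 - (- (3 * ?c / \<alpha>) * 1 powr (- \<alpha>)))"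
  proof (subst nn_integral_add)
    have "(\<integral>\<^sup>+x. ennreal (3 * ?c * x powr (- 1 - \<alpha>)) * indicator {1..} x \<partial>lborel) = ennreal (0 - (- (3 * ?c / \<alpha>) * 1 powr (- \<alpha>)))"
    proof (rule nn_integral_FTC_atLeast)
      show "((\<lambda>x. - (3 * ?c / \<alpha>) * x powr (- \<alpha>)) \<longlongrightarrow> 0) at_top"
        using tendsto_mult_right_zero[OF tendsto_neg_powr[OF _ filterlim_ident], of "- \<alpha>" "- (3 * ?c / \<alpha>)"] \<alpha> by simp
      fix x :: real assume "1 \<le> x"
      then show "((\<lambda>x. - (3 * ?c / \<alpha>) * x powr (- \<alpha>)) has_real_derivative 3 * ?c * x powr (- 1 - \<alpha>)) (at x)"
        using \<alpha> by (auto intro!: derivative_eq_intros simp: powr_diff powr_minus_divide)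
    qed (use c in auto)
    moreover have "(\<integral>\<^sup>+x. ennreal (48 * C * ?c) * indicator {0..1::real} x \<partial>lborel) = ennreal (48 * C * ?c)"
      by (subst nn_integral_cmult_indicator) auto
    ultimately show "(\<integral>\<^sup>+x. ennreal (48 * C * ?c) * indicator {0..1::real} x \<partial>lborel) + (\<integral>\<^sup>+x. ennreal (3 * ?c * x powr (- 1 - \<alpha>)) * indicator {1..} x \<partial>lborel) =
       ennreal (48 * C * ?c) + ennreal (0 - (- (3 * ?c / \<alpha>) * 1 powr (- \<alpha>)))" by simp
  qed measurable
  also have "\<dots> < \<infinity>" by simp
  finally show ?thesis .
qed

lemma intensity_upper_finite:
  assumes j: "2 \<le> j"
  shows "\<exists>B. \<forall>r. intensity (upper_weight j) r \<le> ennreal B"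
proof -
  define B where "B = (\<integral>\<^sup>+x. (\<integral>\<^sup>+p. ennreal (levy_density \<alpha> x * (x + 2) * tall x (Y p)) \<partial>E) \<partial>lborel)"
  have "intensity (upper_weight j) r \<le> B" for r
    unfolding intensity_def B_def
  proof (intro nn_integral_mono ennreal_leI)
    fix x p
    show "levy_density \<alpha> x * upper_weight j x r (Y p) \<le> levy_density \<alpha> x * (x + 2) * tall x (Y p)"
    proof (cases "0 < x")
      case True
      have "upper_weight j x r (Y p) \<le> (x + 2) * tall x (Y p)"
        using upper_weight_eq_0[OF j, of r x "Y p"] upper_weight_bounds(2)[of j x r "Y p"] j True by (auto simp: tall_def not_le)
      from mult_left_mono[OF this levy_density_nonneg[OF \<alpha>, of x]] show ?thesis by (simp add: mult.assoc)
    qed (simp add: levy_density_def)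
  qed
  moreover have "B < top" using tall_integral unfolding B_def by (simp add: infinity_ennreal_def)
  ultimately show ?thesis by (intro exI[of _ "enn2real B"]) (simp add: ennreal_enn2real)
qed

lemma total_intensity_swap:
  assumes w [measurable]: "(\<lambda>(p, x, r). w x r (Y p)) \<in> borel_measurable (E \<Otimes>\<^sub>M (borel \<Otimes>\<^sub>M borel))"
  shows "(\<integral>\<^sup>+r. intensity w r \<partial>lborel) = (\<integral>\<^sup>+z. ennreal (levy_density \<alpha> (fst (snd z)) * w (fst (snd z)) (snd (snd z)) (Y (fst z))) \<partial>(E \<Otimes>\<^sub>M (lborel \<Otimes>\<^sub>M lborel)))"
    and "(\<integral>\<^sup>+r. intensity w r \<partial>lborel) = (\<integral>\<^sup>+p. (\<integral>\<^sup>+x. (\<integral>\<^sup>+r. ennreal (levy_density \<alpha> x * w x r (Y p)) \<partial>lborel) \<partial>lborel) \<partial>E)"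
proof -
  have [measurable]: "(\<lambda>z. w (X z) (R z) (Y (P z))) \<in> borel_measurable N"
    if [measurable]: "X \<in> borel_measurable N" "R \<in> borel_measurable N" "P \<in> N \<rightarrow>\<^sub>M E" for X R P and N :: "'n measure"
    using measurable_compose[OF _ w, of "\<lambda>z. (P z, X z, R z)" N] by simp
  interpret PE: pair_sigma_finite E "lborel :: real measure" by standard
  have sf: "sigma_finite_measure (lborel \<Otimes>\<^sub>M lborel :: (real \<times> real) measure)"
    unfolding lborel_prod by (rule sigma_finite_lborel)
  have "(\<integral>\<^sup>+z. ennreal (levy_density \<alpha> (fst (snd z)) * w (fst (snd z)) (snd (snd z)) (Y (fst z))) \<partial>(E \<Otimes>\<^sub>M (lborel \<Otimes>\<^sub>M lborel)))
    = (\<integral>\<^sup>+p. (\<integral>\<^sup>+y. ennreal (levy_density \<alpha> (fst y) * w (fst y) (snd y) (Y p)) \<partial>(lborel \<Otimes>\<^sub>M lborel)) \<partial>E)"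
    by (subst sigma_finite_measure.nn_integral_fst[OF sf, symmetric]) auto
  also have "\<dots> = (\<integral>\<^sup>+p. (\<integral>\<^sup>+x. (\<integral>\<^sup>+r. ennreal (levy_density \<alpha> x * w x r (Y p)) \<partial>lborel) \<partial>lborel) \<partial>E)"
    by (intro nn_integral_cong) (subst lborel.nn_integral_fst[symmetric], auto)
  finally have 1: "(\<integral>\<^sup>+z. ennreal (levy_density \<alpha> (fst (snd z)) * w (fst (snd z)) (snd (snd z)) (Y (fst z))) \<partial>(E \<Otimes>\<^sub>M (lborel \<Otimes>\<^sub>M lborel)))
    = (\<integral>\<^sup>+p. (\<integral>\<^sup>+x. (\<integral>\<^sup>+r. ennreal (levy_density \<alpha> x * w x r (Y p)) \<partial>lborel) \<partial>lborel) \<partial>E)" .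
  have "(\<integral>\<^sup>+r. intensity w r \<partial>lborel) = (\<integral>\<^sup>+x. (\<integral>\<^sup>+r. (\<integral>\<^sup>+p. ennreal (levy_density \<alpha> x * w x r (Y p)) \<partial>E) \<partial>lborel) \<partial>lborel)"
    unfolding intensity_def by (rule lborel_pair.Fubini') measurable
  also have "\<dots> = (\<integral>\<^sup>+x. (\<integral>\<^sup>+p. (\<integral>\<^sup>+r. ennreal (levy_density \<alpha> x * w x r (Y p)) \<partial>lborel) \<partial>E) \<partial>lborel)"
    by (intro nn_integral_cong PE.Fubini') measurable
  also have "\<dots> = (\<integral>\<^sup>+p. (\<integral>\<^sup>+x. (\<integral>\<^sup>+r. ennreal (levy_density \<alpha> x * w x r (Y p)) \<partial>lborel) \<partial>lborel) \<partial>E)"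
    by (rule PE.Fubini') measurable
  finally show 2: "(\<integral>\<^sup>+r. intensity w r \<partial>lborel) = (\<integral>\<^sup>+p. (\<integral>\<^sup>+x. (\<integral>\<^sup>+r. ennreal (levy_density \<alpha> x * w x r (Y p)) \<partial>lborel) \<partial>lborel) \<partial>E)" .
  then show "(\<integral>\<^sup>+r. intensity w r \<partial>lborel) = (\<integral>\<^sup>+z. ennreal (levy_density \<alpha> (fst (snd z)) * w (fst (snd z)) (snd (snd z)) (Y (fst z))) \<partial>(E \<Otimes>\<^sub>M (lborel \<Otimes>\<^sub>M lborel)))"
    unfolding 1 .
qed

lemma weight_measurable [measurable (raw)]:
  assumes "0 < j" and X: "X \<in> borel_measurable M" "R \<in> borel_measurable M" and P: "P \<in> M \<rightarrow>\<^sub>M E"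
  shows "(\<lambda>\<omega>. upper_weight j (X \<omega>) (R \<omega>) (Y (P \<omega>))) \<in> borel_measurable M"
    and "(\<lambda>\<omega>. lower_weight j (X \<omega>) (R \<omega>) (Y (P \<omega>))) \<in> borel_measurable M"
  using measurable_compose[OF P Y_measurable]
  by (rule upper_weight_measurable[OF \<open>0 < j\<close> X], rule lower_weight_measurable[OF \<open>0 < j\<close> X])

lemma upper_weight_joint: "0 < j \<Longrightarrow> (\<lambda>(p, x, r). upper_weight j x r (Y p)) \<in> borel_measurable (E \<Otimes>\<^sub>M (borel \<Otimes>\<^sub>M borel))"
  and lower_weight_joint: "0 < j \<Longrightarrow> (\<lambda>(p, x, r). lower_weight j x r (Y p)) \<in> borel_measurable (E \<Otimes>\<^sub>M (borel \<Otimes>\<^sub>M borel))"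
  unfolding case_prod_beta by measurable

text \<open>
  The reverse Fatou lemma, with the envelope \<open>tall\<close>; the levels at which an upper weight is positive
  lie in an interval of length \<open>x + 2\<close>.
\<close>

lemma limsup_upper_intensity:
  "limsup (\<lambda>j. \<integral>\<^sup>+r. intensity (upper_weight (real j + 2)) r \<partial>lborel) \<le> ennreal (1 / Gamma (1 - \<alpha>))"
proof -
  let ?N = "E \<Otimes>\<^sub>M (lborel \<Otimes>\<^sub>M lborel) :: ('e \<times> real \<times> real) measure"
  let ?u = "\<lambda>j z. ennreal (levy_density \<alpha> (fst (snd z)) * upper_weight (real j + 2) (fst (snd z)) (snd (snd z)) (Y (fst z)))"
  let ?d = "\<lambda>z. ennreal (levy_density \<alpha> (fst (snd z)) * (indicator {- 1..fst (snd z) + 1} (snd (snd z)) * tall (fst (snd z)) (Y (fst z))))"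
  have sf: "sigma_finite_measure (lborel \<Otimes>\<^sub>M lborel :: (real \<times> real) measure)"
    unfolding lborel_prod by (rule sigma_finite_lborel)
  interpret PE: pair_sigma_finite E "lborel :: real measure" by standard
  have ind [measurable]: "(\<lambda>\<omega>. indicator {- 1..X \<omega> + 1} (R \<omega>) :: real) \<in> borel_measurable N"
    if [measurable]: "X \<in> borel_measurable N" "R \<in> borel_measurable N" for X R :: "'n \<Rightarrow> real" and N
    unfolding indicator_def atLeastAtMost_iff by measurable
  have eq: "(\<integral>\<^sup>+r. intensity (upper_weight (real j + 2)) r \<partial>lborel) = integral\<^sup>N ?N (?u j)" for j
    by (rule total_intensity_swap(1)[OF upper_weight_joint]) simp
  have "limsup (\<lambda>j. integral\<^sup>N ?N (?u j)) \<le> (\<integral>\<^sup>+z. limsup (\<lambda>j. ?u j z) \<partial>?N)"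
  proof (rule nn_integral_limsup[where w = ?d])
    show "?u j \<in> borel_measurable ?N" for j by measurable
    show "?d \<in> borel_measurable ?N" by measurable
    show "AE z in ?N. ?u j z \<le> ?d z" for j
    proof (rule AE_I2, rule ennreal_leI)
      fix z :: "'e \<times> real \<times> real"
      obtain p x r where z: "z = (p, x, r)" by (cases z) auto
      show "levy_density \<alpha> (fst (snd z)) * upper_weight (real j + 2) (fst (snd z)) (snd (snd z)) (Y (fst z)) \<le>
        levy_density \<alpha> (fst (snd z)) * (indicator {- 1..fst (snd z) + 1} (snd (snd z)) * tall (fst (snd z)) (Y (fst z)))"
      proof (cases "0 < x")
        case True
        have "upper_weight (real j + 2) x r (Y p) \<le> indicator {- 1..x + 1} r * tall x (Y p)"
          using upper_weight_eq_0[of "real j + 2" r x "Y p"] upper_weight_bounds(2)[of "real j + 2" x r "Y p"] True by (auto simp: tall_def indicator_def not_le)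
        then show ?thesis unfolding z fst_conv snd_conv by (intro mult_left_mono levy_density_nonneg[OF \<alpha>])
      qed (simp add: z levy_density_def)
    qed
    have "integral\<^sup>N ?N ?d = (\<integral>\<^sup>+p. (\<integral>\<^sup>+y. ?d (p, y) \<partial>(lborel \<Otimes>\<^sub>M lborel)) \<partial>E)"
      by (subst sigma_finite_measure.nn_integral_fst[OF sf, symmetric]) auto
    also have "\<dots> = (\<integral>\<^sup>+p. (\<integral>\<^sup>+x. (\<integral>\<^sup>+r. ?d (p, x, r) \<partial>lborel) \<partial>lborel) \<partial>E)"
      by (intro nn_integral_cong) (subst lborel.nn_integral_fst[symmetric], auto)
    also have "\<dots> = (\<integral>\<^sup>+p. (\<integral>\<^sup>+x. ennreal (levy_density \<alpha> x * (x + 2) * tall x (Y p)) \<partial>lborel) \<partial>E)"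
    proof (intro nn_integral_cong)
      fix p x
      show "(\<integral>\<^sup>+r. ?d (p, x, r) \<partial>lborel) = ennreal (levy_density \<alpha> x * (x + 2) * tall x (Y p))"
      proof (cases "0 < x")
        case True
        have nn: "0 \<le> levy_density \<alpha> x * tall x (Y p)" using levy_density_nonneg[OF \<alpha>] by (simp add: tall_def)
        have "(\<integral>\<^sup>+r. ?d (p, x, r) \<partial>lborel) = (\<integral>\<^sup>+r. ennreal (levy_density \<alpha> x * tall x (Y p)) * indicator {- 1..x + 1} r \<partial>lborel)"
          by (intro nn_integral_cong) (auto simp: indicator_def)
        also have "\<dots> = ennreal (levy_density \<alpha> x * tall x (Y p)) * ennreal (x + 2)"
          using True by (subst nn_integral_cmult_indicator) (auto simp: add.commute)
        also have "\<dots> = ennreal (levy_density \<alpha> x * (x + 2) * tall x (Y p))"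
          by (subst ennreal_mult'[OF nn, symmetric]) (simp add: mult_ac)
        finally show ?thesis .
      qed (simp add: levy_density_def)
    qed
    also have "\<dots> = (\<integral>\<^sup>+x. (\<integral>\<^sup>+p. ennreal (levy_density \<alpha> x * (x + 2) * tall x (Y p)) \<partial>E) \<partial>lborel)"
      by (rule PE.Fubini'[symmetric]) measurable
    also have "\<dots> < \<infinity>" by (rule tall_integral)
    finally show "integral\<^sup>N ?N ?d < \<infinity>" .
  qed
  also have "(\<integral>\<^sup>+z. limsup (\<lambda>j. ?u j z) \<partial>?N) = (\<integral>\<^sup>+p. (\<integral>\<^sup>+y. limsup (\<lambda>j. ?u j (p, y)) \<partial>(lborel \<Otimes>\<^sub>M lborel)) \<partial>E)"
    by (subst sigma_finite_measure.nn_integral_fst[OF sf, symmetric]) auto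
  also have "\<dots> = (\<integral>\<^sup>+p. (\<integral>\<^sup>+x. (\<integral>\<^sup>+r. limsup (\<lambda>j. ?u j (p, x, r)) \<partial>lborel) \<partial>lborel) \<partial>E)"
    by (intro nn_integral_cong) (subst lborel.nn_integral_fst[symmetric], auto)
  also have "\<dots> \<le> (\<integral>\<^sup>+p. (\<integral>\<^sup>+x. (\<integral>\<^sup>+r. ennreal (levy_density \<alpha> x) * indicator {1..} (x * pbar (Y p) (r / x)) \<partial>lborel) \<partial>lborel) \<partial>E)"
  proof (rule nn_integral_mono_AE, rule eventually_mono[OF AE_path], intro nn_integral_mono)
    fix p x r assume p: "excursion_path (Y p)"
    show "limsup (\<lambda>j. ?u j (p, x, r)) \<le> ennreal (levy_density \<alpha> x) * indicator {1..} (x * pbar (Y p) (r / x))"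
    proof (cases "0 < x")
      case True
      show ?thesis
      proof (cases "1 \<le> x * pbar (Y p) (r / x)")
        case True
        have "?u j (p, x, r) \<le> ennreal (levy_density \<alpha> x)" for j
          using mult_left_mono[OF upper_weight_bounds(2)[of "real j + 2" x r "Y p"] levy_density_nonneg[OF \<alpha>, of x]] by (intro ennreal_leI) simp
        then have "limsup (\<lambda>j. ?u j (p, x, r)) \<le> ennreal (levy_density \<alpha> x)" by (intro Limsup_bounded) auto
        then show ?thesis using True by simp
      next
        case False
        then have "\<not> (r \<in> {0..x} \<and> 1 \<le> x * Y p (r / x))" using True by (auto simp: pbar_eq[OF p] indicator_def)
        from upper_weight_vanishes[OF p True this]
        have "\<forall>\<^sub>F j in sequentially. upper_weight (real j + 2) x r (Y p) = 0"
          by (rule eventually_compose_filterlim) (intro filterlim_tendsto_add_at_top[OF tendsto_const filterlim_real_sequentially, of 2, unfolded add.commute[of 2]])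
        then have "\<forall>\<^sub>F j in sequentially. ?u j (p, x, r) = 0" by eventually_elim simp
        then have "(\<lambda>j. ?u j (p, x, r)) \<longlonglongrightarrow> 0" by (rule tendsto_eventually)
        then have "limsup (\<lambda>j. ?u j (p, x, r)) = 0" by (intro lim_imp_Limsup) auto
        then show ?thesis by simp
      qed
    qed (simp add: levy_density_def Limsup_const)
  qed
  also have "\<dots> = ennreal (1 / Gamma (1 - \<alpha>))" by (rule total_intensity) simp
  finally show ?thesis unfolding eq .
qed

lemma liminf_lower_intensity:
  "ennreal (1 / Gamma (1 - \<alpha>)) \<le> liminf (\<lambda>j. \<integral>\<^sup>+r. intensity (lower_weight (real j + 2)) r \<partial>lborel)"
proof -
  let ?N = "E \<Otimes>\<^sub>M (lborel \<Otimes>\<^sub>M lborel) :: ('e \<times> real \<times> real) measure"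
  let ?u = "\<lambda>j z. ennreal (levy_density \<alpha> (fst (snd z)) * lower_weight (real j + 2) (fst (snd z)) (snd (snd z)) (Y (fst z)))"
  have sf: "sigma_finite_measure (lborel \<Otimes>\<^sub>M lborel :: (real \<times> real) measure)"
    unfolding lborel_prod by (rule sigma_finite_lborel)
  have eq: "(\<integral>\<^sup>+r. intensity (lower_weight (real j + 2)) r \<partial>lborel) = integral\<^sup>N ?N (?u j)" for j
    by (rule total_intensity_swap(1)[OF lower_weight_joint]) simp
  have "ennreal (1 / Gamma (1 - \<alpha>)) = (\<integral>\<^sup>+p. (\<integral>\<^sup>+x. (\<integral>\<^sup>+r. ennreal (levy_density \<alpha> x) * indicator {1<..} (x * pbar (Y p) (r / x)) \<partial>lborel) \<partial>lborel) \<partial>E)"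
    by (rule total_intensity[symmetric]) simp
  also have "\<dots> \<le> (\<integral>\<^sup>+p. (\<integral>\<^sup>+x. (\<integral>\<^sup>+r. liminf (\<lambda>j. ?u j (p, x, r)) \<partial>lborel) \<partial>lborel) \<partial>E)"
  proof (rule nn_integral_mono_AE, rule eventually_mono[OF AE_path], intro nn_integral_mono)
    fix p x r assume p: "excursion_path (Y p)"
    show "ennreal (levy_density \<alpha> x) * indicator {1<..} (x * pbar (Y p) (r / x)) \<le> liminf (\<lambda>j. ?u j (p, x, r))"
    proof (cases "0 < x \<and> 1 < x * pbar (Y p) (r / x)")
      case True
      then have rx: "r / x \<in> {0..1}" "1 < x * Y p (r / x)"
        by (cases "r / x \<in> {0..1}"; simp add: pbar_eq[OF p])+
      moreover have "r \<noteq> 0" "r \<noteq> x" using rx True p by (auto simp: excursion_path_def)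
      ultimately have r: "0 < r" "r < x" using True by (auto simp: field_simps)
      from lower_weight_saturates[OF p r rx(2)]
      have "\<forall>\<^sub>F j in sequentially. lower_weight (real j + 2) x r (Y p) = 1"
        by (rule eventually_compose_filterlim) (intro filterlim_tendsto_add_at_top[OF tendsto_const filterlim_real_sequentially, of 2, unfolded add.commute[of 2]])
      then have "\<forall>\<^sub>F j in sequentially. ?u j (p, x, r) = ennreal (levy_density \<alpha> x)" by eventually_elim simp
      then have "(\<lambda>j. ?u j (p, x, r)) \<longlonglongrightarrow> ennreal (levy_density \<alpha> x)" by (rule tendsto_eventually)
      then have "liminf (\<lambda>j. ?u j (p, x, r)) = ennreal (levy_density \<alpha> x)" by (intro lim_imp_Liminf) auto
      then show ?thesis by (auto simp: indicator_def)
    next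
      case False
      then show ?thesis by (auto simp: indicator_def levy_density_def)
    qed
  qed
  also have "\<dots> = (\<integral>\<^sup>+p. (\<integral>\<^sup>+y. liminf (\<lambda>j. ?u j (p, y)) \<partial>(lborel \<Otimes>\<^sub>M lborel)) \<partial>E)"
    by (intro nn_integral_cong) (subst lborel.nn_integral_fst[symmetric], auto)
  also have "\<dots> = (\<integral>\<^sup>+z. liminf (\<lambda>j. ?u j z) \<partial>?N)"
    by (subst sigma_finite_measure.nn_integral_fst[OF sf, symmetric]) auto
  also have "\<dots> \<le> liminf (\<lambda>j. integral\<^sup>N ?N (?u j))"
    by (rule nn_integral_liminf) measurable
  finally show ?thesis unfolding eq .
qed

lemma intensity_lower_finite:
  assumes j: "0 < j"
  shows "\<exists>B. \<forall>r. intensity (lower_weight j) r \<le> ennreal B" and "(\<integral>\<^sup>+r. intensity (lower_weight j) r \<partial>lborel) < \<infinity>"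
proof -
  define K where "K = levy_const \<alpha> * (1 / j) powr (- 2 - \<alpha>)"
  have K: "0 \<le> K" unfolding K_def using levy_const_pos[OF \<alpha>] by simp
  have bd: "intensity (lower_weight j) r \<le> ennreal (K * (j + 1)) * indicator {0..j + 1} r" for r
  proof -
    have bnd: "levy_density \<alpha> x * lower_weight j x r (Y p) \<le> K * indicator {0..j + 1} x * indicator {0..j + 1} r" for x p
    proof (cases "lower_weight j x r (Y p) = 0")
      case False
      then have c: "clip (j * x - 1) \<noteq> 0" "clip (j + 1 - x) \<noteq> 0" "clip (j * r) \<noteq> 0" "clip (j * (x - r)) \<noteq> 0"
        by (auto simp: lower_weight_def)
      then have "0 < j * x - 1" "0 < j + 1 - x" "0 < j * r" "0 < j * (x - r)"
        by (meson clip_eq_0 not_le)+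
      then have x: "1 / j \<le> x" "x \<le> j + 1" "0 \<le> r" "r \<le> j + 1" using j by (auto simp: field_simps zero_less_mult_iff)
      then have x0: "0 < x" using j by (meson divide_pos_pos less_le_trans zero_less_one)
      have "x powr (- 2 - \<alpha>) \<le> (1 / j) powr (- 2 - \<alpha>)" using x j \<alpha> by (intro powr_mono2') auto
      then have "levy_density \<alpha> x \<le> K" unfolding levy_density_eq K_def using x0 levy_const_pos[OF \<alpha>] by (simp add: mult_left_mono)
      then have "levy_density \<alpha> x * lower_weight j x r (Y p) \<le> K * 1"
        using K lower_weight_bounds[OF j] by (intro mult_mono) auto
      then show ?thesis using x x0 by simp
    qed (use K in simp)
    have "intensity (lower_weight j) r \<le> (\<integral>\<^sup>+x. (\<integral>\<^sup>+p. ennreal (K * indicator {0..j + 1} x * indicator {0..j + 1} r) \<partial>E) \<partial>lborel)"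
      unfolding intensity_def by (intro nn_integral_mono ennreal_leI bnd)
    also have "\<dots> = (\<integral>\<^sup>+x. ennreal (K * indicator {0..j + 1} r) * indicator {0..j + 1} x \<partial>lborel)"
      by (intro nn_integral_cong) (auto simp: emeasure_space_1 indicator_def)
    also have "\<dots> = ennreal (K * indicator {0..j + 1} r) * ennreal (j + 1)"
      using j by (subst nn_integral_cmult_indicator) auto
    also have "\<dots> = ennreal (K * (j + 1)) * indicator {0..j + 1} r"
      by (auto simp: indicator_def ennreal_mult'[OF K] simp del: ennreal_plus)
    finally show ?thesis .
  qed
  show "\<exists>B. \<forall>r. intensity (lower_weight j) r \<le> ennreal B"
    by (intro exI[of _ "K * (j + 1)"] allI order_trans[OF bd]) (simp add: indicator_def)
  have "(\<integral>\<^sup>+r. intensity (lower_weight j) r \<partial>lborel) \<le> (\<integral>\<^sup>+r. ennreal (K * (j + 1)) * indicator {0..j + 1} r \<partial>lborel)"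
    by (intro nn_integral_mono bd)
  also have "\<dots> = ennreal (K * (j + 1)) * ennreal (j + 1)"
    using j by (subst nn_integral_cmult_indicator) auto
  also have "\<dots> < \<infinity>" by (simp add: ennreal_mult_less_top)
  finally show "(\<integral>\<^sup>+r. intensity (lower_weight j) r \<partial>lborel) < \<infinity>" .
qed

end


section \<open>Products over sampled increments\<close>

text \<open>
  The integral over the last variable, given the others, only meets the last factor and is at most
  \<open>1\<close>.
\<close>

lemma iterated_product_le_one:
  fixes g :: "real \<Rightarrow> real \<Rightarrow> ennreal"
  assumes \<mu>: "prob_space \<mu>" "sets \<mu> = sets borel"
    and g [measurable]: "(\<lambda>(x, z). g x z) \<in> borel_measurable (borel \<Otimes>\<^sub>M borel)"
    and le: "\<And>z. (\<integral>\<^sup>+x. g x z \<partial>\<mu>) \<le> 1"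
  shows "(\<integral>\<^sup>+x. (\<Prod>k<m. g (x k) (\<Sum>j<k. x j)) \<partial>(\<Pi>\<^sub>M k\<in>{..<m::nat}. \<mu>)) \<le> 1"
proof (induction m)
  case 0
  interpret product_prob_space "\<lambda>_::nat. \<mu>" "{}" using \<mu>(1) by (intro product_prob_spaceI)
  show ?case by (simp add: emeasure_space_1)
next
  case (Suc m)
  interpret product_sigma_finite "\<lambda>_::nat. \<mu>"
    using \<mu>(1) by (intro product_sigma_finite.intro prob_space_imp_sigma_finite)
  have [measurable_cong]: "sets \<mu> = sets borel" by fact
  have gm [measurable]: "(\<lambda>z. g (A z) (B z)) \<in> borel_measurable N"
    if [measurable]: "A \<in> borel_measurable N" "B \<in> borel_measurable N" for A B :: "'n \<Rightarrow> real" and N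
    using measurable_compose[OF measurable_Pair[OF that] g] by simp
  have comp: "(\<lambda>x. x k) \<in> borel_measurable (\<Pi>\<^sub>M k\<in>I. \<mu>)" if "k \<in> I" for k :: nat and I
    using measurable_component_singleton[OF that, of "\<lambda>_. \<mu>"] \<mu>(2) by (simp cong: measurable_cong_sets)
  have pm: "(\<lambda>x. \<Prod>k<j. g (x k) (\<Sum>j<k. x j)) \<in> borel_measurable (\<Pi>\<^sub>M k\<in>I. \<mu>)" if "{..<j} \<subseteq> I" for I and j :: nat
    using that by (intro borel_measurable_prod_ennreal gm borel_measurable_sum comp) auto
  have "(\<integral>\<^sup>+x. (\<Prod>k<Suc m. g (x k) (\<Sum>j<k. x j)) \<partial>(\<Pi>\<^sub>M k\<in>{..<Suc m}. \<mu>)) =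
    (\<integral>\<^sup>+x. (\<integral>\<^sup>+y. (\<Prod>k<Suc m. g ((x(m := y)) k) (\<Sum>j<k. (x(m := y)) j)) \<partial>\<mu>) \<partial>(\<Pi>\<^sub>M k\<in>{..<m}. \<mu>))"
    unfolding lessThan_Suc by (rule product_nn_integral_insert) (use pm[of "Suc m"] in \<open>auto simp: lessThan_Suc\<close>)
  also have "\<dots> = (\<integral>\<^sup>+x. (\<integral>\<^sup>+y. (\<Prod>k<m. g (x k) (\<Sum>j<k. x j)) * g y (\<Sum>j<m. x j) \<partial>\<mu>) \<partial>(\<Pi>\<^sub>M k\<in>{..<m}. \<mu>))"
  proof (intro nn_integral_cong)
    fix x y
    have "(\<Prod>k<m. g ((x(m := y)) k) (\<Sum>j<k. (x(m := y)) j)) = (\<Prod>k<m. g (x k) (\<Sum>j<k. x j))"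
      by (intro prod.cong refl arg_cong2[where f = g] sum.cong) auto
    moreover have "(\<Sum>j<m. (x(m := y)) j) = (\<Sum>j<m. x j)" by (intro sum.cong) auto
    ultimately show "(\<Prod>k<Suc m. g ((x(m := y)) k) (\<Sum>j<k. (x(m := y)) j)) = (\<Prod>k<m. g (x k) (\<Sum>j<k. x j)) * g y (\<Sum>j<m. x j)"
      by simp
  qed
  also have "\<dots> = (\<integral>\<^sup>+x. (\<Prod>k<m. g (x k) (\<Sum>j<k. x j)) * (\<integral>\<^sup>+y. g y (\<Sum>j<m. x j) \<partial>\<mu>) \<partial>(\<Pi>\<^sub>M k\<in>{..<m}. \<mu>))"
    by (intro nn_integral_cong nn_integral_cmult) measurable
  also have "\<dots> \<le> (\<integral>\<^sup>+x. (\<Prod>k<m. g (x k) (\<Sum>j<k. x j)) * 1 \<partial>(\<Pi>\<^sub>M k\<in>{..<m}. \<mu>))"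
    by (intro nn_integral_mono mult_left_mono le) simp
  also have "\<dots> \<le> 1" using Suc by simp
  finally show ?case .
qed

locale stable_levy = prob_space M for M :: "'w measure" +
  fixes \<alpha> :: real and X :: "real \<Rightarrow> 'w \<Rightarrow> real"
  assumes \<alpha>: "0 < \<alpha>" "\<alpha> < 1" and levy: "levy_process M X"
    and laplace: "has_laplace_exponent M X (stable_exponent \<alpha>)"
begin

lemma X_measurable [measurable]: "0 \<le> t \<Longrightarrow> X t \<in> borel_measurable M"
  using levy by (simp add: levy_process_def)

lemma AE_start: "AE \<omega> in M. X 0 \<omega> = 0" and AE_cadlag: "AE \<omega> in M. cadlag (\<lambda>t. X t \<omega>)"
  using levy by (auto simp: levy_process_def)

lemma X_sampled_measurable [measurable]:
  "0 < t \<Longrightarrow> X (real (Suc k) * t / real m) \<in> borel_measurable M"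
  "0 < t \<Longrightarrow> X (real k * t / real m) \<in> borel_measurable M"
  by (intro X_measurable; simp)+

text \<open>The absolute value makes this a family of probability measures indexed by all reals.\<close>

definition increment_law :: "real \<Rightarrow> real measure" where
  "increment_law s = distr M borel (X \<bar>s\<bar>)"

lemma increment_law_sets [simp, measurable_cong]: "sets (increment_law s) = sets borel"
  by (simp add: increment_law_def)

lemma increment_law_prob: "prob_space (increment_law s)"
  unfolding increment_law_def by (intro prob_space_distr) simp

lemma increment_law_laplace:
  "0 < s \<Longrightarrow> 0 \<le> \<eta> \<Longrightarrow> has_bochner_integral (increment_law s) (\<lambda>x. exp (- \<eta> * x)) (exp (s * stable_exponent \<alpha> \<eta>))"
  using laplace unfolding has_laplace_exponent_def increment_law_def
  by (intro has_bochner_integral_distr) auto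

lemmas increment_law_vague = levy_vague_convergence[OF \<alpha> increment_law_sets increment_law_laplace]

text \<open>
  The increments over the cells of the grid are i.i.d., and the position of the process is the sum
  of the previous increments.
\<close>

lemma sampled_product_le_one:
  fixes g :: "real \<Rightarrow> real \<Rightarrow> ennreal"
  assumes t: "0 < t" and m: "0 < m"
    and g: "(\<lambda>(x, z). g x z) \<in> borel_measurable (borel \<Otimes>\<^sub>M borel)"
    and le: "\<And>z. (\<integral>\<^sup>+x. g x z \<partial>increment_law (t / m)) \<le> 1"
  shows "(\<integral>\<^sup>+\<omega>. (\<Prod>k<m. g (X (real (Suc k) * t / m) \<omega> - X (real k * t / m) \<omega>) (X (real k * t / m) \<omega>)) \<partial>M) \<le> 1"
proof -
  define D where "D k \<omega> = X (real (Suc k) * t / m) \<omega> - X (real k * t / m) \<omega>" for k \<omega>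
  have Dm [measurable]: "D k \<in> borel_measurable M" for k
    unfolding D_def[abs_def] by (intro borel_measurable_diff X_sampled_measurable t)
  have "indep_vars (\<lambda>_. borel) (\<lambda>i \<omega>. X (real (Suc i) * t / m) \<omega> - X (real i * t / m) \<omega>) {..<m}"
    using levy t unfolding levy_process_def
    by (elim conjE allE[of _ "\<lambda>i. real i * t / m"] allE[of _ m] impE) (auto intro!: monoI divide_right_mono mult_right_mono)
  then have ind: "indep_vars (\<lambda>_. borel) D {..<m}" unfolding D_def[abs_def] .
  have law: "distr M borel (D k) = increment_law (t / m)" for k
  proof -
    have "real (Suc k) * t / m = real k * t / m + t / m" by (simp add: distrib_right add_divide_distrib)
    then have "distr M borel (D k) = distr M borel (\<lambda>\<omega>. X (real k * t / m + t / m) \<omega> - X (real k * t / m) \<omega>)"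
      by (simp add: D_def[abs_def])
    also have "\<dots> = distr M borel (X (t / m))"
      using levy t unfolding levy_process_def by auto
    finally show ?thesis using t by (simp add: increment_law_def)
  qed
  have joint: "distr M (\<Pi>\<^sub>M k\<in>{..<m}. borel) (\<lambda>\<omega>. \<lambda>k\<in>{..<m}. D k \<omega>) = (\<Pi>\<^sub>M k\<in>{..<m}. increment_law (t / m))"
    using indep_vars_iff_distr_eq_PiM'[where I = "{..<m}" and M' = "\<lambda>_. borel" and X = D] ind m law by auto
  have gm: "(\<lambda>z. g (A z) (B z)) \<in> borel_measurable N"
    if "A \<in> borel_measurable N" "B \<in> borel_measurable N" for A B :: "'n \<Rightarrow> real" and N
    using measurable_compose[OF measurable_Pair[OF that] g] by simp
  have "(\<integral>\<^sup>+\<omega>. (\<Prod>k<m. g (D k \<omega>) (X (real k * t / m) \<omega>)) \<partial>M) = (\<integral>\<^sup>+\<omega>. (\<Prod>k<m. g (D k \<omega>) (\<Sum>j<k. D j \<omega>)) \<partial>M)"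
  proof (rule nn_integral_cong_AE, rule eventually_mono[OF AE_start])
    fix \<omega> assume "X 0 \<omega> = 0"
    then have "X (real k * t / m) \<omega> = (\<Sum>j<k. D j \<omega>)" for k
      unfolding D_def by (subst sum_lessThan_telescope) simp
    then show "(\<Prod>k<m. g (D k \<omega>) (X (real k * t / m) \<omega>)) = (\<Prod>k<m. g (D k \<omega>) (\<Sum>j<k. D j \<omega>))" by simp
  qed
  also have "\<dots> = (\<integral>\<^sup>+x. (\<Prod>k<m. g (x k) (\<Sum>j<k. x j)) \<partial>distr M (\<Pi>\<^sub>M k\<in>{..<m}. borel) (\<lambda>\<omega>. \<lambda>k\<in>{..<m}. D k \<omega>))"
  proof -
    have "(\<integral>\<^sup>+x. (\<Prod>k<m. g (x k) (\<Sum>j<k. x j)) \<partial>distr M (\<Pi>\<^sub>M k\<in>{..<m}. borel) (\<lambda>\<omega>. \<lambda>k\<in>{..<m}. D k \<omega>))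
      = (\<integral>\<^sup>+\<omega>. (\<Prod>k<m. g ((\<lambda>k\<in>{..<m}. D k \<omega>) k) (\<Sum>j<k. (\<lambda>k\<in>{..<m}. D k \<omega>) j)) \<partial>M)"
    proof (rule nn_integral_distr)
      show "(\<lambda>\<omega>. \<lambda>k\<in>{..<m}. D k \<omega>) \<in> M \<rightarrow>\<^sub>M (\<Pi>\<^sub>M k\<in>{..<m}. borel)" by measurable
      show "(\<lambda>x. \<Prod>k<m. g (x k) (\<Sum>j<k. x j)) \<in> borel_measurable (distr M (\<Pi>\<^sub>M k\<in>{..<m}. borel) (\<lambda>\<omega>. \<lambda>k\<in>{..<m}. D k \<omega>))"
        unfolding measurable_distr_eq1 by (intro borel_measurable_prod_ennreal gm borel_measurable_sum measurable_component_singleton) auto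
    qed
    also have "\<dots> = (\<integral>\<^sup>+\<omega>. (\<Prod>k<m. g (D k \<omega>) (\<Sum>j<k. D j \<omega>)) \<partial>M)"
      by (intro nn_integral_cong prod.cong refl arg_cong2[where f = g] sum.cong) auto
    finally show ?thesis ..
  qed
  also have "\<dots> \<le> 1"
    unfolding joint by (rule iterated_product_le_one[OF increment_law_prob increment_law_sets g le])
  finally show ?thesis unfolding D_def .
qed

definition compensator :: "(real \<Rightarrow> real \<Rightarrow> real) \<Rightarrow> real \<Rightarrow> real" where
  "compensator \<phi> z = (LINT x|lborel. \<phi> x z * levy_density \<alpha> x)"

end

text \<open>
  Continuous bounded weights of jumps: \<open>\<phi> x z\<close> belongs to a jump of size \<open>x\<close> that starts from \<open>z\<close>.
\<close>

locale jump_weight = stable_levy +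
  fixes \<phi> :: "real \<Rightarrow> real \<Rightarrow> real" and a b :: real
  assumes ab: "0 < a" "a \<le> b"
    and \<phi>_bounds: "\<And>x z. 0 \<le> \<phi> x z" "\<And>x z. \<phi> x z \<le> 1"
    and \<phi>_support: "\<And>x z. x \<notin> {a..b} \<Longrightarrow> \<phi> x z = 0"
    and \<phi>_tendsto: "\<And>x z A B. A \<longlonglongrightarrow> x \<Longrightarrow> B \<longlonglongrightarrow> z \<Longrightarrow> (\<lambda>n. \<phi> (A n) (B n)) \<longlonglongrightarrow> \<phi> x z"
begin

lemma \<phi>_continuous: "continuous_on UNIV (\<lambda>(x, z). \<phi> x z)"
  unfolding continuous_on_sequentially
proof safe
  fix x z :: real and s :: "nat \<Rightarrow> real \<times> real" assume "s \<longlonglongrightarrow> (x, z)"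
  then show "((\<lambda>(x, z). \<phi> x z) \<circ> s) \<longlonglongrightarrow> \<phi> x z"
    using \<phi>_tendsto[OF tendsto_fst[of s "(x, z)"] tendsto_snd[of s "(x, z)"]] by (simp add: o_def case_prod_beta)
qed

lemma \<phi>_measurable [measurable]: "(\<lambda>(x, z). \<phi> x z) \<in> borel_measurable (borel \<Otimes>\<^sub>M borel)"
  using borel_measurable_continuous_onI[OF \<phi>_continuous] by (simp add: borel_prod)

lemma \<phi>_measurable' [measurable (raw)]:
  assumes "A \<in> borel_measurable N" "B \<in> borel_measurable N"
  shows "(\<lambda>\<omega>. \<phi> (A \<omega>) (B \<omega>)) \<in> borel_measurable N"
  using measurable_compose[OF measurable_Pair[OF assms] \<phi>_measurable] by simp

lemma \<phi>_continuous_x: "continuous_on UNIV (\<lambda>x. \<phi> x z)"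
  unfolding continuous_on_sequentially by (auto simp: o_def intro: \<phi>_tendsto)

lemma \<phi>_uniform:
  assumes Z: "Z \<longlonglongrightarrow> z" and e: "0 < e"
  shows "\<forall>\<^sub>F n in sequentially. \<forall>x. \<bar>\<phi> x (Z n) - \<phi> x z\<bar> \<le> e"
proof -
  have "compact ({a..b} \<times> {z - 1..z + 1})" by (intro compact_Times compact_Icc)
  from compact_uniformly_continuous[OF continuous_on_subset[OF \<phi>_continuous] this]
  have "uniformly_continuous_on ({a..b} \<times> {z - 1..z + 1}) (\<lambda>(x, z). \<phi> x z)" by simp
  then obtain d where d: "0 < d" "\<And>p q. p \<in> {a..b} \<times> {z - 1..z + 1} \<Longrightarrow> q \<in> {a..b} \<times> {z - 1..z + 1} \<Longrightarrow> dist q p < d \<Longrightarrow>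
     dist ((\<lambda>(x, z). \<phi> x z) q) ((\<lambda>(x, z). \<phi> x z) p) < e"
    using e unfolding uniformly_continuous_on_def by meson
  have "\<forall>\<^sub>F n in sequentially. dist (Z n) z < min d 1" using tendstoD[OF Z, of "min d 1"] d by simp
  then show ?thesis
  proof eventually_elim
    case (elim n)
    show ?case
    proof
      fix x show "\<bar>\<phi> x (Z n) - \<phi> x z\<bar> \<le> e"
      proof (cases "x \<in> {a..b}")
        case True
        have "dist (x, Z n) (x, z) < d" using elim by (simp add: dist_Pair_Pair)
        then have "dist (\<phi> x (Z n)) (\<phi> x z) < e"
          using d(2)[of "(x, z)" "(x, Z n)"] True elim by (auto simp: dist_real_def abs_less_iff)
        then show ?thesis by (simp add: dist_real_def)
      qed (use e \<phi>_support in auto)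
    qed
  qed
qed

text \<open>
  A continuous majorant of the weights that does not depend on the starting point; its rates, which
  converge, bound theirs uniformly.
\<close>

definition bump :: "real \<Rightarrow> real" where
  "bump x = clip (2 * x / a - 1) * clip (b + 1 - x)"

lemma bump_ge: "x \<in> {a..b} \<Longrightarrow> bump x = 1"
  using ab unfolding bump_def by (auto simp: clip_eq_1 field_simps)

lemma bump_nonneg: "0 \<le> bump x" unfolding bump_def by simp

lemma bump_support: "x \<notin> {a/2..b+1} \<Longrightarrow> bump x = 0"
  using ab unfolding bump_def by (auto simp: clip_eq_0 field_simps not_le)

lemma bump_continuous: "continuous_on UNIV bump"
  unfolding bump_def[abs_def] using ab by (intro continuous_intros continuous_on_compose2[OF continuous_on_clip]) auto

lemma bump_measurable [measurable]: "bump \<in> borel_measurable borel"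
  by (rule borel_measurable_continuous_onI[OF bump_continuous])

definition rate :: "real \<Rightarrow> real \<Rightarrow> real" where
  "rate s z = (LINT x|increment_law s. \<phi> x z) / s"

lemma \<phi>_integrable: "integrable (increment_law s) (\<lambda>x. \<phi> x z)"
proof -
  interpret inc: prob_space "increment_law s" by (rule increment_law_prob)
  show ?thesis using \<phi>_bounds by (intro inc.integrable_const_bound[of _ 1]) (auto intro!: AE_I2)
qed

lemma bump_integrable: "integrable (increment_law s) bump"
proof -
  interpret inc: prob_space "increment_law s" by (rule increment_law_prob)
  show ?thesis using bump_nonneg
    by (intro inc.integrable_const_bound[of _ 1]) (auto intro!: AE_I2 mult_le_one simp: bump_def)
qed

lemma rate_nonneg: "0 \<le> s \<Longrightarrow> 0 \<le> rate s z"
  unfolding rate_def using \<phi>_bounds by (intro divide_nonneg_nonneg integral_nonneg_AE) auto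

lemma rate_measurable [measurable]: "rate s \<in> borel_measurable borel"
proof -
  interpret inc: prob_space "increment_law s" by (rule increment_law_prob)
  show ?thesis unfolding rate_def[abs_def] by measurable
qed

lemma bump_rate_bounded:
  "\<exists>K\<ge>0. \<forall>\<^sub>F s in at_right 0. (LINT x|increment_law s. bump x) / s \<le> K"
proof -
  have lim: "((\<lambda>s. (LINT x|increment_law s. bump x) / s) \<longlongrightarrow> (LINT x|lborel. bump x * levy_density \<alpha> x)) (at_right 0)"
    by (rule increment_law_vague[OF _ _ bump_continuous, of "a/2" "b+1"]) (use ab bump_support in auto)
  define K where "K = (LINT x|lborel. bump x * levy_density \<alpha> x) + 1"
  have "\<forall>\<^sub>F s in at_right 0. (LINT x|increment_law s. bump x) / s < K"
    by (rule order_tendstoD(2)[OF lim]) (simp add: K_def)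
  moreover have "0 \<le> K" unfolding K_def using bump_nonneg levy_density_nonneg[OF \<alpha>] by (intro add_nonneg_nonneg integral_nonneg_AE) auto
  ultimately show ?thesis by (intro exI[of _ K]) (auto elim: eventually_mono)
qed

lemma rate_bounded:
  "\<exists>K\<ge>0. \<forall>\<^sub>F s in at_right 0. \<forall>z. rate s z \<le> K"
proof -
  obtain K where K: "0 \<le> K" "\<forall>\<^sub>F s in at_right 0. (LINT x|increment_law s. bump x) / s \<le> K"
    using bump_rate_bounded by blast
  have "\<forall>\<^sub>F s in at_right 0. \<forall>z. rate s z \<le> K"
    using K(2) eventually_at_right_less[of 0]
  proof eventually_elim
    case (elim s)
    show ?case
    proof
      fix z
      have "(LINT x|increment_law s. \<phi> x z) \<le> (LINT x|increment_law s. bump x)"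
      proof (intro integral_mono \<phi>_integrable bump_integrable)
        fix x show "\<phi> x z \<le> bump x"
          using \<phi>_bounds(2)[of x z] \<phi>_support[of x z] bump_ge[of x] bump_nonneg[of x] by (cases "x \<in> {a..b}") auto
      qed
      then have "rate s z \<le> (LINT x|increment_law s. bump x) / s" unfolding rate_def using elim by (intro divide_right_mono) auto
      then show "rate s z \<le> K" using elim by simp
    qed
  qed
  with K(1) show ?thesis by blast
qed

text \<open>
  Both the time step and the starting point vary. The weights are uniformly continuous in the
  starting point, so moving it changes the rate by a small multiple of the bounded rate of \<open>bump\<close>.
\<close>

lemma rate_tendsto:
  assumes S: "filterlim S (at_right 0) sequentially" and Z: "Z \<longlonglongrightarrow> z"
  shows "(\<lambda>n. rate (S n) (Z n)) \<longlonglongrightarrow> compensator \<phi> z"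
proof -
  have fix_z: "(\<lambda>n. rate (S n) z) \<longlonglongrightarrow> compensator \<phi> z"
    unfolding rate_def compensator_def
    by (rule filterlim_compose[OF increment_law_vague[OF _ _ \<phi>_continuous_x, of a b] S]) (use ab \<phi>_support in auto)
  obtain K where K: "0 \<le> K" "\<forall>\<^sub>F s in at_right 0. (LINT x|increment_law s. bump x) / s \<le> K"
    using bump_rate_bounded by blast
  have pos: "\<forall>\<^sub>F n in sequentially. 0 < S n"
    using eventually_compose_filterlim[OF eventually_at_right_less S] .
  have "(\<lambda>n. rate (S n) (Z n) - rate (S n) z) \<longlonglongrightarrow> 0"
  proof (rule tendstoI)
    fix e :: real assume e: "0 < e"
    define e' where "e' = e / (2 * (K + 1))"
    have "0 < K + 1" using K by simp
    then have "e' * (K + 1) = e / 2" "0 < e'" unfolding e'_def using e by (simp_all add: field_simps)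
    then have e': "0 < e'" "e' * (K + 1) < e" using e by simp_all
    show "\<forall>\<^sub>F n in sequentially. dist (rate (S n) (Z n) - rate (S n) z) 0 < e"
      using \<phi>_uniform[OF Z e'(1)] eventually_compose_filterlim[OF K(2) S] pos
    proof eventually_elim
      case (elim n)
      have pt: "\<bar>\<phi> x (Z n) - \<phi> x z\<bar> \<le> e' * bump x" for x
        using elim(1) \<phi>_support[of x] bump_ge[of x] bump_nonneg[of x] e' by (cases "x \<in> {a..b}") auto
      have "\<bar>(LINT x|increment_law (S n). \<phi> x (Z n)) - (LINT x|increment_law (S n). \<phi> x z)\<bar> = \<bar>LINT x|increment_law (S n). \<phi> x (Z n) - \<phi> x z\<bar>"
        by (subst Bochner_Integration.integral_diff) (auto intro: \<phi>_integrable)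
      also have "\<dots> \<le> (LINT x|increment_law (S n). e' * bump x)"
        by (rule order_trans[OF integral_abs_bound], rule integral_mono) (use pt in \<open>auto intro!: \<phi>_integrable bump_integrable\<close>)
      also have "\<dots> = e' * (LINT x|increment_law (S n). bump x)" by simp
      finally have "\<bar>(LINT x|increment_law (S n). \<phi> x (Z n)) - (LINT x|increment_law (S n). \<phi> x z)\<bar> / S n \<le> e' * (LINT x|increment_law (S n). bump x) / S n"
        using elim by (intro divide_right_mono) auto
      then have "\<bar>rate (S n) (Z n) - rate (S n) z\<bar> \<le> e' * ((LINT x|increment_law (S n). bump x) / S n)"
        unfolding rate_def using elim(3) by (simp add: abs_divide diff_divide_distrib[symmetric])
      also have "\<dots> \<le> e' * (K + 1)" using elim e' by (intro mult_left_mono) auto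
      also have "\<dots> < e" by (rule e')
      finally show ?case by (simp add: dist_real_def)
    qed
  qed
  from tendsto_add[OF this fix_z] show ?thesis by simp
qed

lemma grid_step_filterlim: "0 < t \<Longrightarrow> filterlim (\<lambda>m. t / real (Suc m)) (at_right 0) sequentially"
proof -
  assume t: "0 < t"
  have "(\<lambda>m. t / real (Suc m)) \<longlonglongrightarrow> 0"
    using tendsto_mult_right_zero[OF LIMSEQ_inverse_real_of_nat, of t] by (simp add: divide_inverse)
  then show ?thesis using t by (simp add: tendsto_imp_filterlim_at_right)
qed

lemma compensator_continuous: "continuous_on UNIV (compensator \<phi>)"
  unfolding continuous_on_sequentially
proof safe
  fix z :: real and Z assume Z: "Z \<longlonglongrightarrow> z"
  show "(compensator \<phi> \<circ> Z) \<longlonglongrightarrow> compensator \<phi> z"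
  proof (rule tendstoI)
    fix e :: real assume e: "0 < e"
    define I where "I = (LINT x|lborel. bump x * levy_density \<alpha> x)"
    have li: "integrable lborel (\<lambda>x. f x * levy_density \<alpha> x)" if f: "f \<in> borel_measurable borel" "\<And>x. \<bar>f x\<bar> \<le> indicator {a/2..b+1} x" for f
    proof (rule Bochner_Integration.integrable_bound)
      show "integrable lborel (\<lambda>x. indicator {a/2..b+1} x *\<^sub>R levy_density \<alpha> x)"
      proof (rule borel_integrable_compact)
        show "continuous_on {a/2..b+1} (levy_density \<alpha>)"
        proof (rule continuous_on_eq)
          show "continuous_on {a/2..b+1} (\<lambda>x. (\<alpha> * (1 + \<alpha>) / (Gamma (1 - \<alpha>) * Gamma (1 + \<alpha>) * 2 powr \<alpha>)) * x powr (- 2 - \<alpha>))"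
            by (intro continuous_on_mult continuous_on_const continuous_on_powr continuous_on_id) (use ab in auto)
        qed (use ab in \<open>auto simp: levy_density_def\<close>)
      qed simp
      show "AE x in lborel. norm (f x * levy_density \<alpha> x) \<le> norm (indicator {a/2..b+1} x *\<^sub>R levy_density \<alpha> x)"
        using f(2) levy_density_nonneg[OF \<alpha>] by (auto simp: abs_mult intro!: mult_right_mono)
    qed (use f in measurable)
    have i\<phi>: "integrable lborel (\<lambda>x. \<phi> x z * levy_density \<alpha> x)" for z
      using \<phi>_bounds \<phi>_support ab by (intro li) (auto simp: indicator_def abs_of_nonneg)
    have ib: "integrable lborel (\<lambda>x. bump x * levy_density \<alpha> x)"
    proof (rule li[OF bump_measurable])
      fix x show "\<bar>bump x\<bar> \<le> indicator {a/2..b+1} x"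
        using bump_support[of x] bump_nonneg[of x] by (cases "x \<in> {a/2..b+1}") (auto simp: bump_def mult_le_one)
    qed
    have I: "0 \<le> I" unfolding I_def using bump_nonneg levy_density_nonneg[OF \<alpha>] by (intro integral_nonneg_AE) auto
    define e' where "e' = e / (2 * (I + 1))"
    have "0 < I + 1" using I by simp
    then have "e' * (I + 1) = e / 2" "0 < e'" unfolding e'_def using e by (simp_all add: field_simps)
    then have e': "0 < e'" "e' * I < e" using e by (simp_all add: distrib_left)
    show "\<forall>\<^sub>F n in sequentially. dist ((compensator \<phi> \<circ> Z) n) (compensator \<phi> z) < e"
      using \<phi>_uniform[OF Z e'(1)]
    proof eventually_elim
      case (elim n)
      have pt: "\<bar>\<phi> x (Z n) * levy_density \<alpha> x - \<phi> x z * levy_density \<alpha> x\<bar> \<le> e' * (bump x * levy_density \<alpha> x)" for x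
      proof -
        have "\<bar>\<phi> x (Z n) - \<phi> x z\<bar> \<le> e' * bump x"
          using elim(1) \<phi>_support[of x] bump_ge[of x] bump_nonneg[of x] e' by (cases "x \<in> {a..b}") auto
        from mult_right_mono[OF this levy_density_nonneg[OF \<alpha>, of x]] show ?thesis
          using levy_density_nonneg[OF \<alpha>, of x] by (simp add: abs_mult mult.assoc flip: left_diff_distrib)
      qed
      have "\<bar>compensator \<phi> (Z n) - compensator \<phi> z\<bar> = \<bar>LINT x|lborel. \<phi> x (Z n) * levy_density \<alpha> x - \<phi> x z * levy_density \<alpha> x\<bar>"
        unfolding compensator_def by (subst Bochner_Integration.integral_diff) (auto intro: i\<phi>)
      also have "\<dots> \<le> (LINT x|lborel. e' * (bump x * levy_density \<alpha> x))"
        by (rule order_trans[OF integral_abs_bound], rule integral_mono) (use pt in \<open>auto intro!: i\<phi> ib\<close>)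
      also have "\<dots> = e' * I" by (simp add: I_def)
      finally show ?case using e' by (simp add: dist_real_def)
    qed
  qed
qed

end


section \<open>Integrating out the marks\<close>

definition path_of :: "(real \<Rightarrow> 'w \<Rightarrow> real) \<Rightarrow> 'w \<Rightarrow> real \<Rightarrow> real" where
  "path_of Y \<omega> = (\<lambda>s\<in>{0..1}. Y s \<omega>)"

lemma path_of_measurable [measurable]: "standard_besq_bridge M \<delta> Y \<Longrightarrow> path_of Y \<in> M \<rightarrow>\<^sub>M path_space"
  unfolding path_of_def[abs_def] standard_besq_bridge_def by (intro measurable_restrict) auto

lemma strict_mono_on_enumeration:
  fixes ts :: "real list"
  assumes "sorted_wrt (<) ts" "set ts \<subseteq> {0<..<1}"
  defines "t \<equiv> \<lambda>i. if i = 0 then 0 else if i \<le> length ts then ts ! (i - 1) else 1"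
  shows "strict_mono_on {..Suc (length ts)} t"
proof (rule strict_mono_onI)
  fix i j assume ij: "i \<in> {..Suc (length ts)}" "j \<in> {..Suc (length ts)}" "i < j"
  have in01: "0 < ts ! k \<and> ts ! k < 1" if "k < length ts" for k
    using nth_mem[OF that] assms(2) by auto
  show "t i < t j"
  proof (cases "j \<le> length ts")
    case True
    then show ?thesis using ij in01[of "j - 1"] sorted_wrt_nth_less[OF assms(1), of "i - 1" "j - 1"]
      by (cases "i = 0") (auto simp: t_def)
  next
    case False
    then have "j = Suc (length ts)" using ij by auto
    then show ?thesis using ij in01[of "i - 1"] by (auto simp: t_def)
  qed
qed

text \<open>
  The right side does not depend on the process: the values at interior times have the prescribed
  densities, and those at the times \<open>0\<close> and \<open>1\<close> vanish. Hence all standard bridges have the same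
  law.
\<close>

lemma bridge_cylinder:
  assumes M: "prob_space M" and Y: "standard_besq_bridge M \<delta> Y"
    and J: "finite J" "J \<subseteq> {0..1}" and A: "\<And>s. s \<in> J \<Longrightarrow> A s \<in> sets borel"
  defines "ts \<equiv> sorted_list_of_set (J \<inter> {0<..<1})"
  defines "n \<equiv> length ts"
  defines "t \<equiv> \<lambda>i. if i = 0 then 0 else if i \<le> length ts then ts ! (i - 1) else 1"
  shows "emeasure (distr M path_space (path_of Y)) (prod_emb {0..1} (\<lambda>_. borel) J (Pi\<^sub>E J A)) =
    (if (0 \<in> J \<longrightarrow> 0 \<in> A 0) \<and> (1 \<in> J \<longrightarrow> 0 \<in> A 1)
     then emeasure (density (\<Pi>\<^sub>M i\<in>{1..n}. besq_reference \<delta>) (\<lambda>x. ennreal (besq_bridge_density \<delta> n t x))) (Pi\<^sub>E {1..n} (\<lambda>i. A (t i)))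
     else 0)" (is "?L = ?R")
proof -
  interpret prob_space M by fact
  have setts: "set ts = J \<inter> {0<..<1}" unfolding ts_def using J by simp
  have smon: "strict_mono_on {..Suc n} t"
    unfolding t_def n_def by (rule strict_mono_on_enumeration) (auto simp: ts_def strict_sorted_list_of_set J)
  have t0: "t 0 = 0" "t (Suc n) = 1" by (auto simp: t_def n_def)
  have tin: "t i \<in> J" "t i \<in> {0..1}" if "i \<in> {1..n}" for i
  proof -
    have "ts ! (i - 1) \<in> set ts" using that by (intro nth_mem) (auto simp: n_def)
    then show "t i \<in> J" using that setts by (auto simp: t_def n_def)
    then show "t i \<in> {0..1}" using J by auto
  qed
  have cover: "s \<in> t ` {1..n}" if s: "s \<in> J" "s \<noteq> 0" "s \<noteq> 1" for s
  proof -
    have "s \<in> set ts" using s J setts by (force simp: less_le)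
    then obtain k where "k < length ts" "s = ts ! k" by (auto simp: in_set_conv_nth)
    then show ?thesis by (intro image_eqI[of _ _ "Suc k"]) (auto simp: t_def n_def)
  qed
  have Ym [measurable]: "Y s \<in> borel_measurable M" if "s \<in> {0..1}" for s
    using Y that by (auto simp: standard_besq_bridge_def)
  have ends: "AE \<omega> in M. Y 0 \<omega> = 0 \<and> Y 1 \<omega> = 0"
    using Y unfolding standard_besq_bridge_def by (auto elim: eventually_mono)
  have cyl: "prod_emb {0..1} (\<lambda>_. borel :: real measure) J (Pi\<^sub>E J A) \<in> sets path_space"
    using J A by (intro sets_PiM_I) auto
  have S: "{\<omega> \<in> space M. \<forall>s\<in>J. Y s \<omega> \<in> A s} \<in> sets M"
  proof -
    have "{\<omega> \<in> space M. Y s \<omega> \<in> A s} \<in> sets M" if "s \<in> J" for s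
      using Ym[of s] A[OF that] that J by (auto intro: measurable_sets_Collect)
    then show ?thesis using J by (intro sets.sets_Collect_finite_All) auto
  qed
  have T: "{\<omega> \<in> space M. \<forall>i\<in>{1..n}. Y (t i) \<omega> \<in> A (t i)} \<in> sets M"
  proof -
    have "{\<omega> \<in> space M. Y (t i) \<omega> \<in> A (t i)} \<in> sets M" if "i \<in> {1..n}" for i
      using Ym[OF tin(2)[OF that]] A[OF tin(1)[OF that]] by (auto intro: measurable_sets_Collect)
    then show ?thesis by (intro sets.sets_Collect_finite_All) auto
  qed
  have "?L = emeasure M (path_of Y -` prod_emb {0..1} (\<lambda>_. borel) J (Pi\<^sub>E J A) \<inter> space M)"
    using Y cyl by (intro emeasure_distr) auto
  also have "path_of Y -` prod_emb {0..1} (\<lambda>_. borel) J (Pi\<^sub>E J A) \<inter> space M = {\<omega> \<in> space M. \<forall>s\<in>J. Y s \<omega> \<in> A s}"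
    using J by (auto simp: prod_emb_def path_of_def space_PiM PiE_iff subset_iff)
  also have "emeasure M {\<omega> \<in> space M. \<forall>s\<in>J. Y s \<omega> \<in> A s} = ?R"
  proof (cases "(0 \<in> J \<longrightarrow> 0 \<in> A 0) \<and> (1 \<in> J \<longrightarrow> 0 \<in> A 1)")
    case True
    have "emeasure M {\<omega> \<in> space M. \<forall>s\<in>J. Y s \<omega> \<in> A s} = emeasure M {\<omega> \<in> space M. \<forall>i\<in>{1..n}. Y (t i) \<omega> \<in> A (t i)}"
    proof (rule emeasure_eq_AE[OF _ S T], rule eventually_mono[OF ends])
      fix \<omega> assume \<omega>: "Y 0 \<omega> = 0 \<and> Y 1 \<omega> = 0"
      have "(\<forall>s\<in>J. Y s \<omega> \<in> A s) \<longleftrightarrow> (\<forall>i\<in>{1..n}. Y (t i) \<omega> \<in> A (t i))"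
      proof
        assume r: "\<forall>i\<in>{1..n}. Y (t i) \<omega> \<in> A (t i)"
        show "\<forall>s\<in>J. Y s \<omega> \<in> A s"
        proof
          fix s assume "s \<in> J"
          then show "Y s \<omega> \<in> A s" using True \<omega> r cover[of s] by (cases "s = 0"; cases "s = 1") auto
        qed
      qed (use tin in blast)
      then show "(\<omega> \<in> {\<omega> \<in> space M. \<forall>s\<in>J. Y s \<omega> \<in> A s}) = (\<omega> \<in> {\<omega> \<in> space M. \<forall>i\<in>{1..n}. Y (t i) \<omega> \<in> A (t i)})" by auto
    qed
    also have "\<dots> = emeasure (distr M (\<Pi>\<^sub>M i\<in>{1..n}. borel) (\<lambda>\<omega>. \<lambda>i\<in>{1..n}. Y (t i) \<omega>)) (Pi\<^sub>E {1..n} (\<lambda>i. A (t i)))"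
    proof (subst emeasure_distr)
      show "(\<lambda>\<omega>. \<lambda>i\<in>{1..n}. Y (t i) \<omega>) \<in> M \<rightarrow>\<^sub>M (\<Pi>\<^sub>M i\<in>{1..n}. borel)"
        by (intro measurable_restrict Ym tin)
      show "Pi\<^sub>E {1..n} (\<lambda>i. A (t i)) \<in> sets (\<Pi>\<^sub>M i\<in>{1..n}. borel)"
        using A tin by (intro sets_PiM_I_finite) auto
      show "emeasure M {\<omega> \<in> space M. \<forall>i\<in>{1..n}. Y (t i) \<omega> \<in> A (t i)} = emeasure M ((\<lambda>\<omega>. \<lambda>i\<in>{1..n}. Y (t i) \<omega>) -` Pi\<^sub>E {1..n} (\<lambda>i. A (t i)) \<inter> space M)"
        by (rule arg_cong[where f = "emeasure M"]) (auto simp: PiE_iff)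
    qed
    also have "distr M (\<Pi>\<^sub>M i\<in>{1..n}. borel) (\<lambda>\<omega>. \<lambda>i\<in>{1..n}. Y (t i) \<omega>) = density (\<Pi>\<^sub>M i\<in>{1..n}. besq_reference \<delta>) (\<lambda>x. ennreal (besq_bridge_density \<delta> n t x))"
      using Y unfolding standard_besq_bridge_def by (elim conjE allE[of _ n] allE[of _ t] impE) (use t0 smon in auto)
    finally show ?thesis using True by simp
  next
    case False
    have "emeasure M {\<omega> \<in> space M. \<forall>s\<in>J. Y s \<omega> \<in> A s} = emeasure M {}"
    proof (rule emeasure_eq_AE[OF _ S], rule eventually_mono[OF ends])
      fix \<omega> assume "Y 0 \<omega> = 0 \<and> Y 1 \<omega> = 0"
      then show "(\<omega> \<in> {\<omega> \<in> space M. \<forall>s\<in>J. Y s \<omega> \<in> A s}) = (\<omega> \<in> {})" using False by force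
    qed simp
    then show ?thesis using False by auto
  qed
  finally show ?thesis .
qed

lemma bridge_law_unique:
  assumes "prob_space M" "standard_besq_bridge M \<delta> Y" "prob_space M'" "standard_besq_bridge M' \<delta> Y'"
  shows "distr M path_space (path_of Y) = distr M' path_space (path_of Y')"
proof (rule measure_eqI_PiM_infinite)
  show "finite_measure (distr M path_space (path_of Y))"
    using prob_space.prob_space_distr[OF assms(1) path_of_measurable[OF assms(2)]]
    by (simp add: prob_space.finite_measure)
qed (auto simp: bridge_cylinder[OF assms(1,2)] bridge_cylinder[OF assms(3,4)])

lemma excursion_law_of_excursion:
  assumes M: "prob_space M" and \<alpha>: "0 < \<alpha>" "\<alpha> < 1" and Y: "standard_besq_excursion M \<alpha> Y"
  shows "excursion_law M \<alpha> (path_of Y)"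
proof -
  interpret prob_space M by fact
  have Y: "standard_besq_bridge M (4 + 2 * \<alpha>) Y" using Y by (simp add: standard_besq_excursion_def)
  have d: "0 < 4 + 2 * \<alpha>" "(4 + 2 * \<alpha>) / 2 = 2 + \<alpha>" "2 + \<alpha> + \<alpha> = 2 + 2 * \<alpha>" using \<alpha> by auto
  show ?thesis
  proof
    show "path_of Y \<in> M \<rightarrow>\<^sub>M path_space" by (rule path_of_measurable[OF Y])
    have "AE \<omega> in M. continuous_on {0..1} (\<lambda>s. Y s \<omega>) \<and> (\<forall>s\<in>{0..1}. 0 \<le> Y s \<omega>) \<and> Y 0 \<omega> = 0 \<and> Y 1 \<omega> = 0"
      using Y by (simp add: standard_besq_bridge_def)
    then show "AE p in M. excursion_path (path_of Y p)"
    proof eventually_elim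
      case (elim \<omega>)
      have "continuous_on {0..1} (path_of Y \<omega>)"
        by (rule continuous_on_eq[OF conjunct1[OF elim]]) (simp add: path_of_def)
      then show ?case using elim by (auto simp: excursion_path_def path_of_def)
    qed
    show "(\<integral>\<^sup>+p. ennreal (path_of Y p u powr \<alpha>) \<partial>M) = ennreal (Gamma (2 + 2 * \<alpha>) / Gamma (2 + \<alpha>) * (2 * u * (1 - u)) powr \<alpha>)"
      if "0 < u" "u < 1" for u
      using bridge_marginal_moment[OF Y d(1) that, of \<alpha>] that \<alpha> d by (simp add: path_of_def)
    obtain C where C: "0 \<le> C" "\<And>u. 0 < u \<Longrightarrow> emeasure M {\<omega> \<in> space M. \<exists>d\<in>unit_dyadics. u \<le> Y d \<omega>} \<le> ennreal (C / u^4)"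
      using bridge_maximal_inequality[OF M d(1) Y] by blast
    have "path_of Y p d = Y d p" if "d \<in> unit_dyadics" for p d
      using that unit_dyadics_subset by (auto simp: path_of_def)
    then show "\<exists>C\<ge>0. \<forall>u>0. emeasure M {p \<in> space M. \<exists>d\<in>unit_dyadics. u \<le> path_of Y p d} \<le> ennreal (C / u^4)"
      using C by (intro exI[of _ C]) (simp cong: bex_cong)
  qed (use \<alpha> in auto)
qed

text \<open>
  An upper expectation. Random variables such as suprema over sets of jumps enter only through
  measurable majorants, so that their own measurability is never at issue.
\<close>

definition outer_le_one :: "'w measure \<Rightarrow> ('w \<Rightarrow> real) \<Rightarrow> bool" where
  "outer_le_one M f \<longleftrightarrow> (\<exists>Q\<in>borel_measurable M. (\<integral>\<^sup>+\<omega>. Q \<omega> \<partial>M) \<le> 1 \<and> (AE \<omega> in M. ennreal (f \<omega>) \<le> Q \<omega>))"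

lemma outer_le_one_markov:
  assumes f: "outer_le_one M f"
  obtains B where "B \<in> sets M" "emeasure M B \<le> ennreal (exp (- u))" "AE \<omega> in M. \<omega> \<notin> B \<longrightarrow> f \<omega> < exp u"
proof -
  obtain Q where Q [measurable]: "Q \<in> borel_measurable M" and le: "(\<integral>\<^sup>+\<omega>. Q \<omega> \<partial>M) \<le> 1" and dom: "AE \<omega> in M. ennreal (f \<omega>) \<le> Q \<omega>"
    using f by (auto simp: outer_le_one_def)
  define B where "B = {\<omega> \<in> space M. 1 \<le> ennreal (exp (- u)) * Q \<omega>}"
  show ?thesis
  proof (rule that)
    show "B \<in> sets M" unfolding B_def by measurable
    have "emeasure M B \<le> ennreal (exp (- u)) * (\<integral>\<^sup>+\<omega>. Q \<omega> * indicator (space M) \<omega> \<partial>M)"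
      unfolding B_def by (rule order_trans[OF _ nn_integral_Markov_inequality]) (auto intro!: emeasure_mono simp: mult.commute)
    also have "(\<integral>\<^sup>+\<omega>. Q \<omega> * indicator (space M) \<omega> \<partial>M) = (\<integral>\<^sup>+\<omega>. Q \<omega> \<partial>M)" by (intro nn_integral_cong) auto
    also have "ennreal (exp (- u)) * \<dots> \<le> ennreal (exp (- u)) * 1" by (intro mult_left_mono le) auto
    finally show "emeasure M B \<le> ennreal (exp (- u))" by simp
    show "AE \<omega> in M. \<omega> \<notin> B \<longrightarrow> f \<omega> < exp u"
      using dom AE_space
    proof eventually_elim
      case (elim \<omega>)
      show ?case
      proof (rule impI, rule ccontr)
        assume "\<omega> \<notin> B" "\<not> f \<omega> < exp u"
        then have "exp (- u) * exp u \<le> exp (- u) * f \<omega>" by (intro mult_left_mono) auto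
        then have "1 \<le> exp (- u) * f \<omega>" by (simp add: mult_exp_exp)
        then have "1 \<le> ennreal (exp (- u)) * ennreal (f \<omega>)" by (simp add: ennreal_mult'[symmetric] flip: ennreal_1)
        also have "\<dots> \<le> ennreal (exp (- u)) * Q \<omega>" by (intro mult_left_mono elim) auto
        finally show False using \<open>\<omega> \<notin> B\<close> elim by (simp add: B_def)
      qed
    qed
  qed
qed

text \<open>Fatou's lemma for upper expectations.\<close>

lemma outer_le_one_liminf:
  assumes f: "\<And>n. outer_le_one M (f n)" and le: "AE \<omega> in M. \<forall>\<^sub>F n in sequentially. g \<omega> \<le> f n \<omega>"
  shows "outer_le_one M g"
proof -
  obtain Q where Q [measurable]: "\<And>n. Q n \<in> borel_measurable M" and le1: "\<And>n. (\<integral>\<^sup>+\<omega>. Q n \<omega> \<partial>M) \<le> 1" and dom: "\<And>n. AE \<omega> in M. ennreal (f n \<omega>) \<le> Q n \<omega>"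
    using f unfolding outer_le_one_def by metis
  have "(\<integral>\<^sup>+\<omega>. liminf (\<lambda>n. Q n \<omega>) \<partial>M) \<le> liminf (\<lambda>n. \<integral>\<^sup>+\<omega>. Q n \<omega> \<partial>M)"
    by (rule nn_integral_liminf) measurable
  also have "\<dots> \<le> 1" using le1 by (intro Liminf_le) auto
  finally have 1: "(\<integral>\<^sup>+\<omega>. liminf (\<lambda>n. Q n \<omega>) \<partial>M) \<le> 1" .
  have "AE \<omega> in M. \<forall>n. ennreal (f n \<omega>) \<le> Q n \<omega>" using dom by (simp add: AE_all_countable)
  with le have 2: "AE \<omega> in M. ennreal (g \<omega>) \<le> liminf (\<lambda>n. Q n \<omega>)"
  proof eventually_elim
    case (elim \<omega>)
    show ?case using elim(1)
    proof (intro Liminf_bounded, eventually_elim)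
      case (elim n)
      then show ?case using \<open>\<forall>n. ennreal (f n \<omega>) \<le> Q n \<omega>\<close> by (meson ennreal_leI order_trans)
    qed
  qed
  show ?thesis unfolding outer_le_one_def using 1 2 by (intro bexI[of _ "\<lambda>\<omega>. liminf (\<lambda>n. Q n \<omega>)"]) auto
qed


locale marked_levy = stable_levy M \<alpha> X for M :: "'w measure" and \<alpha> X +
  fixes \<tau> :: "nat \<Rightarrow> 'w \<Rightarrow> real" and e :: "nat \<Rightarrow> real \<Rightarrow> 'w \<Rightarrow> real"
  assumes \<tau>_measurable: "\<And>n. \<tau> n \<in> borel_measurable (process_algebra M {0..} X)"
    and enumeration: "AE \<omega> in M. \<forall>t\<ge>0. 0 < jump (\<lambda>u. X u \<omega>) t \<longrightarrow> (\<exists>!n. \<tau> n \<omega> = t)"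
    and excursions: "\<And>n. standard_besq_excursion M \<alpha> (e n)"
    and excursions_indep: "indep_vars (\<lambda>_. path_space) (\<lambda>n \<omega>. \<lambda>s\<in>{0..1}. e n s \<omega>) UNIV"
    and excursions_indep_X: "indep_set (sets (process_algebra M {0..} X))
          (sets (process_algebra M (UNIV \<times> {0..1}) (\<lambda>(n, s). e n s)))"
begin

abbreviation XA :: "'w measure" where "XA \<equiv> process_algebra M {0..} X"

lemma space_XA [simp]: "space XA = space M" by (simp add: process_algebra_def)

lemma X_XA: "0 \<le> t \<Longrightarrow> X t \<in> borel_measurable XA"
proof -
  assume t: "0 \<le> t"
  have "(\<lambda>\<omega>. \<lambda>i\<in>{0..}. X i \<omega>) \<in> XA \<rightarrow>\<^sub>M (\<Pi>\<^sub>M i\<in>{0..}. borel)"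
    unfolding process_algebra_def by (rule measurable_vimage_algebra1) (auto simp: space_PiM)
  from measurable_compose[OF this measurable_component_singleton[of t]] t show ?thesis by simp
qed

lemma id_XA [measurable]: "(\<lambda>\<omega>. \<omega>) \<in> M \<rightarrow>\<^sub>M XA"
  unfolding process_algebra_def
  by (rule measurable_vimage_algebra2) (auto intro!: measurable_restrict)

lemma XA_M: "f \<in> XA \<rightarrow>\<^sub>M N \<Longrightarrow> f \<in> M \<rightarrow>\<^sub>M N"
  using measurable_compose[OF id_XA] by auto

abbreviation mark :: "nat \<Rightarrow> 'w \<Rightarrow> real \<Rightarrow> real" where "mark n \<equiv> path_of (e n)"

lemma bridge: "standard_besq_bridge M (4 + 2 * \<alpha>) (e n)"
  using excursions[of n] by (simp add: standard_besq_excursion_def)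

lemma mark_measurable [measurable]: "mark n \<in> M \<rightarrow>\<^sub>M path_space"
  by (rule path_of_measurable[OF bridge])

lemma mark_law: "distr M path_space (mark n) = distr M path_space (mark 0)"
  by (rule bridge_law_unique[OF prob_space_axioms bridge prob_space_axioms bridge])

lemma excursion_law_path: "excursion_law M \<alpha> (mark n)"
  by (rule excursion_law_of_excursion[OF prob_space_axioms \<alpha> excursions])

sublocale excursion_law M \<alpha> "mark 0"
  by (rule excursion_law_path)

lemma AE_paths: "AE \<omega> in M. \<forall>n. excursion_path (mark n \<omega>)"
  using excursion_law.AE_path[OF excursion_law_path] by (simp add: AE_all_countable)

lemma paths_joint_law:
  defines "PP N \<equiv> \<Pi>\<^sub>M n\<in>{..<N}. path_space" and "V N \<equiv> \<lambda>\<omega>. \<lambda>n\<in>{..<N::nat}. mark n \<omega>"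
  shows "distr M XA (\<lambda>\<omega>. \<omega>) \<Otimes>\<^sub>M distr M (PP N) (V N) = distr M (XA \<Otimes>\<^sub>M PP N) (\<lambda>\<omega>. (\<omega>, V N \<omega>))"
proof -
  let ?EA = "process_algebra M (UNIV \<times> {0..1}) (\<lambda>(n, s). e n s)"
  have VM: "V N \<in> M \<rightarrow>\<^sub>M PP N" unfolding V_def PP_def by measurable
  have all: "(\<lambda>\<omega>. \<lambda>i\<in>UNIV \<times> {0..1}. (case i of (n, s) \<Rightarrow> e n s) \<omega>) \<in> ?EA \<rightarrow>\<^sub>M (\<Pi>\<^sub>M i\<in>UNIV \<times> {0..1}. borel)"
    unfolding process_algebra_def by (rule measurable_vimage_algebra1) (auto simp: space_PiM)
  have en: "e n s \<in> borel_measurable ?EA" if "s \<in> {0..1}" for n s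
    using measurable_compose[OF all measurable_component_singleton[of "(n, s)"]] that by simp
  have VE: "V N \<in> ?EA \<rightarrow>\<^sub>M PP N"
    unfolding V_def PP_def path_of_def by (intro measurable_restrict en)
  have sp: "space ?EA = space M" by (simp add: process_algebra_def)
  interpret D1: prob_space "distr M XA (\<lambda>\<omega>. \<omega>)" by (rule prob_space_distr[OF id_XA])
  interpret D2: prob_space "distr M (PP N) (V N)" by (rule prob_space_distr[OF VM])
  show ?thesis
  proof (rule pair_measure_eqI)
    fix A B assume "A \<in> sets (distr M XA (\<lambda>\<omega>. \<omega>))" "B \<in> sets (distr M (PP N) (V N))"
    then have A: "A \<in> sets XA" and B: "B \<in> sets (PP N)" by auto
    have As: "A \<subseteq> space M" using sets.sets_into_space[OF A] by simp
    have AM: "A \<in> sets M" using measurable_sets[OF id_XA A] As by (simp add: Int_absorb2)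
    have BE: "V N -` B \<inter> space M \<in> sets ?EA" using measurable_sets[OF VE B] sp by simp
    have BM: "V N -` B \<inter> space M \<in> sets M" by (rule measurable_sets[OF VM B])
    have eq: "(\<lambda>\<omega>. (\<omega>, V N \<omega>)) -` (A \<times> B) \<inter> space M = A \<inter> (V N -` B \<inter> space M)" by auto
    have "emeasure (distr M (XA \<Otimes>\<^sub>M PP N) (\<lambda>\<omega>. (\<omega>, V N \<omega>))) (A \<times> B) = emeasure M (A \<inter> (V N -` B \<inter> space M))"
      unfolding eq[symmetric] using A B id_XA VM by (intro emeasure_distr) auto
    also have "\<dots> = emeasure M A * emeasure M (V N -` B \<inter> space M)"
      using indep_setD[OF excursions_indep_X A BE] by (simp add: emeasure_eq_measure ennreal_mult)
    also have "emeasure M A = emeasure (distr M XA (\<lambda>\<omega>. \<omega>)) A"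
      using As by (subst emeasure_distr[OF id_XA A]) (simp add: Int_absorb2)
    also have "emeasure M (V N -` B \<inter> space M) = emeasure (distr M (PP N) (V N)) B"
      by (rule emeasure_distr[OF VM B, symmetric])
    finally show "emeasure (distr M XA (\<lambda>\<omega>. \<omega>)) A * emeasure (distr M (PP N) (V N)) B = emeasure (distr M (XA \<Otimes>\<^sub>M PP N) (\<lambda>\<omega>. (\<omega>, V N \<omega>))) (A \<times> B)" ..
  qed (auto intro: D1.sigma_finite_measure_axioms D2.sigma_finite_measure_axioms cong: sets_pair_measure_cong)
qed

text \<open>
  The marks are independent of \<open>X\<close>, and i.i.d.; given \<open>X\<close>, the quantities \<open>x n\<close> and \<open>r n\<close> are
  constants, and Fubini's theorem applies.
\<close>

lemma integrate_marks:
  fixes w :: "real \<Rightarrow> real \<Rightarrow> (real \<Rightarrow> real) \<Rightarrow> ennreal" and F :: "'w \<Rightarrow> ennreal"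
  assumes w: "(\<lambda>(x, r, p). w x r p) \<in> borel_measurable weight_space"
    and F: "F \<in> borel_measurable XA"
    and x: "\<And>n. x n \<in> borel_measurable XA" and r: "\<And>n. r n \<in> borel_measurable XA"
  shows "(\<integral>\<^sup>+\<omega>. F \<omega> * (\<Prod>n<N. w (x n \<omega>) (r n \<omega>) (mark n \<omega>)) \<partial>M) =
     (\<integral>\<^sup>+\<omega>. F \<omega> * (\<Prod>n<N. \<integral>\<^sup>+\<omega>'. w (x n \<omega>) (r n \<omega>) (mark 0 \<omega>') \<partial>M) \<partial>M)"
proof (cases "N = 0")
  case False
  have wm: "(\<lambda>z. w (A z) (B z) (P z)) \<in> borel_measurable K"
    if "A \<in> borel_measurable K" "B \<in> borel_measurable K" "P \<in> K \<rightarrow>\<^sub>M path_space" for A B P and K :: "'k measure"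
    using measurable_compose[OF measurable_Pair[OF that(1) measurable_Pair[OF that(2,3)]] w] by simp
  let ?PP = "\<Pi>\<^sub>M n\<in>{..<N}. path_space"
  let ?V = "\<lambda>\<omega>. \<lambda>n\<in>{..<N}. mark n \<omega>"
  let ?law = "distr M path_space (mark 0)"
  define h where "h z = F (fst z) * (\<Prod>n<N. w (x n (fst z)) (r n (fst z)) (snd z n))" for z
  have comp: "(\<lambda>v. v n) \<in> ?PP \<rightarrow>\<^sub>M path_space" if "n < N" for n
    using that by (intro measurable_component_singleton) auto
  have h [measurable]: "h \<in> borel_measurable (XA \<Otimes>\<^sub>M ?PP)"
  proof -
    have "(\<lambda>z. w (x n (fst z)) (r n (fst z)) (snd z n)) \<in> borel_measurable (XA \<Otimes>\<^sub>M ?PP)" if "n < N" for n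
      by (rule wm[OF measurable_compose[OF measurable_fst x] measurable_compose[OF measurable_fst r] measurable_compose[OF measurable_snd comp[OF that]]])
    then show ?thesis unfolding h_def[abs_def]
      by (intro borel_measurable_times_ennreal borel_measurable_prod_ennreal measurable_compose[OF measurable_fst F]) auto
  qed
  have law: "distr M ?PP ?V = (\<Pi>\<^sub>M n\<in>{..<N}. ?law)"
  proof -
    have "indep_vars (\<lambda>_. path_space) mark {..<N}"
      using indep_vars_subset[OF excursions_indep] by (auto simp: path_of_def[abs_def])
    then have "distr M ?PP ?V = (\<Pi>\<^sub>M n\<in>{..<N}. distr M path_space (mark n))"
      using indep_vars_iff_distr_eq_PiM'[where I = "{..<N}" and M' = "\<lambda>_. path_space" and X = mark] mark_measurable False
      by (auto simp: lessThan_empty_iff)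
    also have "\<dots> = (\<Pi>\<^sub>M n\<in>{..<N}. ?law)" by (intro PiM_cong refl mark_law)
    finally show ?thesis .
  qed
  interpret law: prob_space ?law by (rule prob_space_distr) measurable
  interpret product_sigma_finite "\<lambda>_::nat. ?law"
    by (intro product_sigma_finite.intro law.sigma_finite_measure_axioms)
  have joint: "distr M XA (\<lambda>\<omega>. \<omega>) \<Otimes>\<^sub>M distr M ?PP ?V = distr M (XA \<Otimes>\<^sub>M ?PP) (\<lambda>\<omega>. (\<omega>, ?V \<omega>))"
    by (rule paths_joint_law)
  have Vm: "?V \<in> M \<rightarrow>\<^sub>M ?PP" by measurable
  interpret V: prob_space "distr M ?PP ?V" by (rule prob_space_distr[OF Vm])
  have "(\<integral>\<^sup>+\<omega>. F \<omega> * (\<Prod>n<N. w (x n \<omega>) (r n \<omega>) (mark n \<omega>)) \<partial>M) = (\<integral>\<^sup>+\<omega>. h (\<omega>, ?V \<omega>) \<partial>M)"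
    unfolding h_def by (intro nn_integral_cong arg_cong2[where f = "(*)"] prod.cong) auto
  also have "\<dots> = (\<integral>\<^sup>+z. h z \<partial>distr M (XA \<Otimes>\<^sub>M ?PP) (\<lambda>\<omega>. (\<omega>, ?V \<omega>)))"
    using h by (subst nn_integral_distr) (auto intro: measurable_Pair Vm id_XA simp: measurable_distr_eq1)
  also have "\<dots> = (\<integral>\<^sup>+\<omega>. (\<integral>\<^sup>+v. h (\<omega>, v) \<partial>distr M ?PP ?V) \<partial>distr M XA (\<lambda>\<omega>. \<omega>))"
    unfolding joint[symmetric] using h by (intro V.nn_integral_fst[symmetric]) (simp cong: measurable_cong_sets)
  also have "\<dots> = (\<integral>\<^sup>+\<omega>. F \<omega> * (\<Prod>n<N. \<integral>\<^sup>+\<omega>'. w (x n \<omega>) (r n \<omega>) (mark 0 \<omega>') \<partial>M) \<partial>distr M XA (\<lambda>\<omega>. \<omega>))"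
  proof (intro nn_integral_cong)
    fix \<omega> assume \<omega>: "\<omega> \<in> space (distr M XA (\<lambda>\<omega>. \<omega>))"
    have wp: "(\<lambda>p. w (x n \<omega>) (r n \<omega>) p) \<in> borel_measurable path_space" for n
      by (intro wm) auto
    have wl: "(\<lambda>p. w (x n \<omega>) (r n \<omega>) p) \<in> borel_measurable ?law" for n
      unfolding measurable_distr_eq1 by (rule wp)
    have wv: "(\<lambda>v. w (x n \<omega>) (r n \<omega>) (v n)) \<in> borel_measurable (\<Pi>\<^sub>M n\<in>{..<N}. ?law)" if "n < N" for n
      by (rule measurable_compose[OF measurable_component_singleton[of n "{..<N}" "\<lambda>_. ?law"] wl]) (use that in simp)
    have "(\<integral>\<^sup>+v. h (\<omega>, v) \<partial>distr M ?PP ?V) = F \<omega> * (\<integral>\<^sup>+v. (\<Prod>n<N. w (x n \<omega>) (r n \<omega>) (v n)) \<partial>(\<Pi>\<^sub>M n\<in>{..<N}. ?law))"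
      unfolding h_def law fst_conv snd_conv
      by (intro nn_integral_cmult borel_measurable_prod_ennreal wv) auto
    also have "\<dots> = F \<omega> * (\<Prod>n<N. \<integral>\<^sup>+p. w (x n \<omega>) (r n \<omega>) p \<partial>?law)"
      by (subst product_nn_integral_prod) (auto intro: wl wp)
    also have "\<dots> = F \<omega> * (\<Prod>n<N. \<integral>\<^sup>+\<omega>'. w (x n \<omega>) (r n \<omega>) (mark 0 \<omega>') \<partial>M)"
      by (simp only: nn_integral_distr[OF mark_measurable wl])
    finally show "(\<integral>\<^sup>+v. h (\<omega>, v) \<partial>distr M ?PP ?V) = F \<omega> * (\<Prod>n<N. \<integral>\<^sup>+\<omega>'. w (x n \<omega>) (r n \<omega>) (mark 0 \<omega>') \<partial>M)" .
  qed
  also have "\<dots> = (\<integral>\<^sup>+\<omega>. F \<omega> * (\<Prod>n<N. \<integral>\<^sup>+\<omega>'. w (x n \<omega>) (r n \<omega>) (mark 0 \<omega>') \<partial>M) \<partial>M)"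
  proof (rule nn_integral_distr[OF id_XA])
    have "(\<lambda>\<omega>. \<integral>\<^sup>+\<omega>'. w (x n \<omega>) (r n \<omega>) (mark 0 \<omega>') \<partial>M) \<in> borel_measurable XA" for n
    proof (rule borel_measurable_nn_integral)
      show "case_prod (\<lambda>\<omega> \<omega>'. w (x n \<omega>) (r n \<omega>) (mark 0 \<omega>')) \<in> borel_measurable (XA \<Otimes>\<^sub>M M)"
        unfolding case_prod_beta
        by (intro wm measurable_compose[OF measurable_fst x] measurable_compose[OF measurable_fst r] measurable_compose[OF measurable_snd mark_measurable])
    qed
    then show "(\<lambda>\<omega>. F \<omega> * (\<Prod>n<N. \<integral>\<^sup>+\<omega>'. w (x n \<omega>) (r n \<omega>) (mark 0 \<omega>') \<partial>M)) \<in> borel_measurable (distr M XA (\<lambda>\<omega>. \<omega>))"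
      unfolding measurable_distr_eq1 by (intro borel_measurable_times_ennreal F borel_measurable_prod_ennreal)
  qed
  finally show ?thesis .
qed simp

text \<open>
  Together with \<open>jump_value\<close>: limits along a grid, which show that position and size of the jumps
  are functions of the path of \<open>X\<close>.
\<close>

definition left_value :: "nat \<Rightarrow> 'w \<Rightarrow> real" where
  "left_value n \<omega> = lim (\<lambda>m. X (real (cell 1 m (\<tau> n \<omega>)) * 1 / m) \<omega>)"

definition jump_value :: "real \<Rightarrow> nat \<Rightarrow> 'w \<Rightarrow> real" where
  "jump_value t n \<omega> = (if \<tau> n \<omega> \<in> {0<..t} then lim (\<lambda>m. X (real (Suc (cell 1 m (\<tau> n \<omega>))) * 1 / m) \<omega>) - left_value n \<omega> else 0)"

lemma left_value_XA: "left_value n \<in> borel_measurable XA"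
  and jump_value_XA: "jump_value t n \<in> borel_measurable XA"
proof -
  note [measurable] = \<tau>_measurable
  have c [measurable]: "(\<lambda>\<omega>. cell 1 m (\<tau> n \<omega>)) \<in> XA \<rightarrow>\<^sub>M count_space UNIV" for m
    unfolding cell_def by measurable
  have [measurable]: "(\<lambda>\<omega>. X (real (cell 1 m (\<tau> n \<omega>)) * 1 / m) \<omega>) \<in> borel_measurable XA" for m
    by (rule measurable_compose_countable[OF X_XA c]) simp
  have [measurable]: "(\<lambda>\<omega>. X (real (Suc (cell 1 m (\<tau> n \<omega>))) * 1 / m) \<omega>) \<in> borel_measurable XA" for m
    by (rule measurable_compose_countable[OF X_XA c]) simp
  show l [measurable]: "left_value n \<in> borel_measurable XA" unfolding left_value_def[abs_def] by measurable
  show "jump_value t n \<in> borel_measurable XA" unfolding jump_value_def[abs_def] by measurable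
qed

lemma left_value_eq:
  assumes "cadlag (\<lambda>t. X t \<omega>)" "0 < \<tau> n \<omega>"
  shows "left_value n \<omega> = left_limit (\<lambda>t. X t \<omega>) (\<tau> n \<omega>)"
  unfolding left_value_def by (rule limI) (rule cadlag_cell_limits(1)[OF assms(1) zero_less_one assms(2)])

lemma jump_value_eq:
  assumes "cadlag (\<lambda>t. X t \<omega>)"
  shows "jump_value t n \<omega> = (if \<tau> n \<omega> \<in> {0<..t} then jump (\<lambda>t. X t \<omega>) (\<tau> n \<omega>) else 0)"
proof (cases "\<tau> n \<omega> \<in> {0<..t}")
  case True
  have "lim (\<lambda>m. X (real (Suc (cell 1 m (\<tau> n \<omega>))) * 1 / m) \<omega>) = X (\<tau> n \<omega>) \<omega>"
    by (rule limI) (rule cadlag_cell_limits(2)[OF assms zero_less_one], use True in auto)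
  then show ?thesis using True left_value_eq[OF assms] by (simp add: jump_value_def jump_def)
qed (auto simp: jump_value_def)

text \<open>
  The bound \<open>a\<close> on the size of the jumps makes this a finite sum. Weights are applied to the size of
  the jump, the level relative to its start and its unit excursion.
\<close>

definition marked_sum :: "(real \<Rightarrow> real \<Rightarrow> (real \<Rightarrow> real) \<Rightarrow> real) \<Rightarrow> real \<Rightarrow> real \<Rightarrow> real \<Rightarrow> 'w \<Rightarrow> real" where
  "marked_sum w a t y \<omega> = (\<Sum>n | \<tau> n \<omega> \<in> {0<..t} \<and> a \<le> jump (\<lambda>u. X u \<omega>) (\<tau> n \<omega>).
     w (jump (\<lambda>u. X u \<omega>) (\<tau> n \<omega>)) (y - left_limit (\<lambda>u. X u \<omega>) (\<tau> n \<omega>)) (mark n \<omega>))"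

lemma marked_jumps:
  assumes cad: "cadlag (\<lambda>t. X t \<omega>)" and enum: "\<forall>t\<ge>0. 0 < jump (\<lambda>u. X u \<omega>) t \<longrightarrow> (\<exists>!n. \<tau> n \<omega> = t)" and a: "0 < a"
  shows "bij_betw (\<lambda>n. \<tau> n \<omega>) {n. \<tau> n \<omega> \<in> {0<..t} \<and> a \<le> jump (\<lambda>u. X u \<omega>) (\<tau> n \<omega>)} {s. s \<in> {0<..t} \<and> a \<le> jump (\<lambda>u. X u \<omega>) s}"
    and "finite {n. \<tau> n \<omega> \<in> {0<..t} \<and> a \<le> jump (\<lambda>u. X u \<omega>) (\<tau> n \<omega>)}"
proof -
  let ?I = "{n. \<tau> n \<omega> \<in> {0<..t} \<and> a \<le> jump (\<lambda>u. X u \<omega>) (\<tau> n \<omega>)}" and ?J = "{s. s \<in> {0<..t} \<and> a \<le> jump (\<lambda>u. X u \<omega>) s}"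
  show b: "bij_betw (\<lambda>n. \<tau> n \<omega>) ?I ?J"
  proof (rule bij_betw_imageI)
    show "inj_on (\<lambda>n. \<tau> n \<omega>) ?I"
    proof (rule inj_onI)
      fix m n assume mn: "m \<in> ?I" "n \<in> ?I" "\<tau> m \<omega> = \<tau> n \<omega>"
      then have "0 \<le> \<tau> n \<omega>" "0 < jump (\<lambda>u. X u \<omega>) (\<tau> n \<omega>)" using a by auto
      then have "\<exists>!k. \<tau> k \<omega> = \<tau> n \<omega>" using enum by blast
      then show "m = n" using mn(3) by auto
    qed
    show "(\<lambda>n. \<tau> n \<omega>) ` ?I = ?J"
    proof (intro equalityI subsetI)
      fix s assume s: "s \<in> ?J"
      then have "\<exists>!k. \<tau> k \<omega> = s" using enum a by auto
      then obtain k where "\<tau> k \<omega> = s" by blast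
      then show "s \<in> (\<lambda>n. \<tau> n \<omega>) ` ?I" using s by auto
    qed auto
  qed
  have "finite ?J"
    by (rule finite_subset[OF _ cadlag_finite_large_jumps[OF cad a, of t]]) auto
  then show "finite ?I" using bij_betw_finite[OF b] by simp
qed

end


section \<open>An exponential inequality for sums over marked jumps\<close>

lemma exp_le_chord:
  assumes "0 \<le> u" "u \<le> (1::real)"
  shows "exp (\<theta> * u) \<le> 1 + (exp \<theta> - 1) * u"
proof -
  have "exp ((1 - u) *\<^sub>R 0 + u *\<^sub>R \<theta>) \<le> (1 - u) * exp 0 + u * exp \<theta>"
    by (rule convex_onD[OF exp_convex]) (use assms in auto)
  then show ?thesis by (simp add: algebra_simps)
qed

lemma eventually_prod_lessThan:
  fixes f :: "nat \<Rightarrow> 'a::comm_monoid_mult"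
  assumes "finite I" "\<And>n. n \<notin> I \<Longrightarrow> f n = 1"
  shows "\<forall>\<^sub>F N in sequentially. (\<Prod>n<N. f n) = (\<Prod>n\<in>I. f n)"
proof -
  obtain N0 where N0: "I \<subseteq> {..<N0}" using assms(1) finite_nat_iff_bounded by blast
  show ?thesis
    using eventually_ge_at_top[of N0]
  proof eventually_elim
    case (elim N)
    then have "I \<subseteq> {..<N}" using N0 by auto
    then show ?case using assms by (intro prod.mono_neutral_right) auto
  qed
qed

context marked_levy
begin

definition mean_weight :: "(real \<Rightarrow> real \<Rightarrow> (real \<Rightarrow> real) \<Rightarrow> real) \<Rightarrow> real \<Rightarrow> real \<Rightarrow> real" where
  "mean_weight w x r = (LINT \<omega>|M. w x r (mark 0 \<omega>))"

text \<open>
  The compensator of \<open>marked_sum w a t y\<close>, for weights that vanish for jumps smaller than \<open>a\<close>.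
\<close>

definition predicted :: "(real \<Rightarrow> real \<Rightarrow> (real \<Rightarrow> real) \<Rightarrow> real) \<Rightarrow> real \<Rightarrow> real \<Rightarrow> 'w \<Rightarrow> real" where
  "predicted w t y \<omega> = (LINT s|lborel. indicator {0<..t} s * compensator (\<lambda>x z. mean_weight w x (y - z)) (X s \<omega>))"

lemma jump_weight_mean_weight:
  assumes ab: "0 < a" "a \<le> b"
    and w_bounds: "\<And>x r p. 0 \<le> w x r p" "\<And>x r p. w x r p \<le> 1"
    and w_meas: "(\<lambda>(x, r, p). w x r p) \<in> borel_measurable weight_space"
    and w_supp: "\<And>x r p. x \<notin> {a..b} \<Longrightarrow> w x r p = 0"
    and w_cont: "\<And>p A B x r. excursion_path p \<Longrightarrow> A \<longlonglongrightarrow> x \<Longrightarrow> B \<longlonglongrightarrow> r \<Longrightarrow> (\<lambda>n. w (A n) (B n) p) \<longlonglongrightarrow> w x r p"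
  shows "jump_weight M \<alpha> X (\<lambda>x z. mean_weight w x (y - z)) a b"
    and "(\<lambda>\<omega>. w x r (mark 0 \<omega>)) \<in> borel_measurable M"
    and "integrable M (\<lambda>\<omega>. w x r (mark 0 \<omega>))"
proof -
  show m: "(\<lambda>\<omega>. w x r (mark 0 \<omega>)) \<in> borel_measurable M" for x r
    using measurable_compose[OF measurable_Pair[OF measurable_const measurable_Pair[OF measurable_const mark_measurable]] w_meas] by simp
  show i: "integrable M (\<lambda>\<omega>. w x r (mark 0 \<omega>))" for x r
    using w_bounds by (intro integrable_const_bound[of _ 1] m) (auto intro!: AE_I2)
  show "jump_weight M \<alpha> X (\<lambda>x z. mean_weight w x (y - z)) a b"
  proof
    show "0 \<le> mean_weight w x (y - z)" for x z
      unfolding mean_weight_def using w_bounds by (intro integral_nonneg_AE) auto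
    show "mean_weight w x (y - z) \<le> 1" for x z
    proof -
      have "(LINT \<omega>|M. w x (y - z) (mark 0 \<omega>)) \<le> (LINT \<omega>|M. 1)"
        by (intro integral_mono i) (use w_bounds in auto)
      then show ?thesis by (simp add: mean_weight_def prob_space)
    qed
    show "mean_weight w x (y - z) = 0" if "x \<notin> {a..b}" for x z
      using w_supp[OF that] by (simp add: mean_weight_def)
    show "(\<lambda>n. mean_weight w (A n) (y - B n)) \<longlonglongrightarrow> mean_weight w x (y - z)" if A: "A \<longlonglongrightarrow> x" and B: "B \<longlonglongrightarrow> z" for A B x z
      unfolding mean_weight_def
    proof (rule integral_dominated_convergence[where w = "\<lambda>_. 1"])
      have "(\<lambda>n. y - B n) \<longlonglongrightarrow> y - z" by (intro tendsto_intros B)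
      then show "AE \<omega> in M. (\<lambda>n. w (A n) (y - B n) (mark 0 \<omega>)) \<longlonglongrightarrow> w x (y - z) (mark 0 \<omega>)"
        using AE_path by (auto elim!: eventually_mono intro!: w_cont A)
    qed (use w_bounds in \<open>auto intro!: m\<close>)
  qed (use ab in auto)
qed

text \<open>
  Let \<open>c = exp \<theta> - 1\<close>. For weights that depend only on \<open>X\<close>, the product of \<open>1 + c \<phi>\<close> over the jumps,
  times \<open>exp (- c A)\<close>, has mean at most \<open>1\<close>, by discretisation. By convexity \<open>exp (\<theta> w) \<le> 1 + c w\<close>
  for \<open>0 \<le> w \<le> 1\<close>; so the marked sum is covered by integrating out the marks, which replaces \<open>w\<close> by
  its mean \<open>\<phi>\<close>.
\<close>

lemma exponential_inequality:
  assumes ab: "0 < a" "a \<le> b" and t: "0 < t"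
    and w_bounds: "\<And>x r p. 0 \<le> w x r p" "\<And>x r p. w x r p \<le> 1"
    and w_meas: "(\<lambda>(x, r, p). w x r p) \<in> borel_measurable weight_space"
    and w_supp: "\<And>x r p. x \<notin> {a..b} \<Longrightarrow> w x r p = 0"
    and w_cont: "\<And>p A B x r. excursion_path p \<Longrightarrow> A \<longlonglongrightarrow> x \<Longrightarrow> B \<longlonglongrightarrow> r \<Longrightarrow> (\<lambda>n. w (A n) (B n) p) \<longlonglongrightarrow> w x r p"
  shows "outer_le_one M (\<lambda>\<omega>. exp (\<theta> * marked_sum w a t y \<omega> - (exp \<theta> - 1) * predicted w t y \<omega>))"
proof -
  note jw = jump_weight_mean_weight[OF ab w_bounds w_meas w_supp w_cont]
  define c where "c = exp \<theta> - 1"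
  define \<phi> where "\<phi> x z = mean_weight w x (y - z)" for x z
  have c: "-1 < c" by (simp add: c_def)
  interpret J: jump_weight M \<alpha> X \<phi> a b
    unfolding \<phi>_def[abs_def] by (rule jw(1))
  have fac: "0 \<le> 1 + c * \<phi> x z" "1 + c * \<phi> x z \<le> 1 + \<bar>c\<bar>" for x z
  proof -
    have "\<bar>c * \<phi> x z\<bar> \<le> \<bar>c\<bar> * 1" unfolding abs_mult using J.\<phi>_bounds[of x z] by (intro mult_left_mono) auto
    then show "1 + c * \<phi> x z \<le> 1 + \<bar>c\<bar>" by linarith
    show "0 \<le> 1 + c * \<phi> x z"
    proof (cases "0 \<le> c")
      case False
      then have "c * 1 \<le> c * \<phi> x z" using J.\<phi>_bounds[of x z] by (intro mult_left_mono_neg) auto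
      then show ?thesis using c by simp
    qed (use J.\<phi>_bounds[of x z] in auto)
  qed
  \<comment> \<open>The discretised density \<open>D m\<close> has mean at most \<open>1\<close> because \<open>1 + v \<le> exp v\<close>.\<close>
  define A where "A m \<omega> = (\<Sum>k<m. t / m * J.rate (t / m) (X (real k * t / m) \<omega>))" for m \<omega>
  define P where "P m \<omega> = (\<Prod>k<m. 1 + c * \<phi> (X (real (Suc k) * t / m) \<omega> - X (real k * t / m) \<omega>) (X (real k * t / m) \<omega>))" for m \<omega>
  define D where "D m \<omega> = ennreal (P m \<omega> * exp (- c * A m \<omega>))" for m \<omega>
  have Xm: "X (real k * t / real m) \<in> borel_measurable XA" for k m using t by (intro X_XA) simp
  have A_XA: "A m \<in> borel_measurable XA" for m
    unfolding A_def[abs_def] by (intro borel_measurable_sum borel_measurable_times borel_measurable_const measurable_compose[OF Xm J.rate_measurable])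
  have P_M [measurable]: "P m \<in> borel_measurable M" for m
    unfolding P_def[abs_def] using X_sampled_measurable[OF t] by measurable
  have A_M [measurable]: "A m \<in> borel_measurable M" for m by (rule XA_M[OF A_XA])
  have D_M [measurable]: "D m \<in> borel_measurable M" for m unfolding D_def[abs_def] by measurable
  have D1: "(\<integral>\<^sup>+\<omega>. D m \<omega> \<partial>M) \<le> 1" if m: "0 < m" for m
  proof -
    define g where "g x z = ennreal ((1 + c * \<phi> x z) * exp (- c * (t / m * J.rate (t / m) z)))" for x z
    have [measurable]: "J.rate (t / m) \<in> borel_measurable borel" by (rule J.rate_measurable)
    have gm: "(\<lambda>(x, z). g x z) \<in> borel_measurable (borel \<Otimes>\<^sub>M borel)" unfolding g_def case_prod_beta by measurable
    have gle: "(\<integral>\<^sup>+x. g x z \<partial>increment_law (t / m)) \<le> 1" for z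
    proof -
      interpret inc: prob_space "increment_law (t / m)" by (rule increment_law_prob)
      have int: "integrable (increment_law (t / m)) (\<lambda>x. 1 + c * \<phi> x z)" using J.\<phi>_integrable by auto
      have "(\<integral>\<^sup>+x. g x z \<partial>increment_law (t / m)) = ennreal (exp (- c * (t / m * J.rate (t / m) z))) * (\<integral>\<^sup>+x. ennreal (1 + c * \<phi> x z) \<partial>increment_law (t / m))"
        unfolding g_def by (subst nn_integral_cmult[symmetric]) (auto intro!: nn_integral_cong simp: ennreal_mult'[OF fac(1)] mult.commute)
      also have "(\<integral>\<^sup>+x. ennreal (1 + c * \<phi> x z) \<partial>increment_law (t / m)) = ennreal (1 + c * (LINT x|increment_law (t / m). \<phi> x z))"
        using fac J.\<phi>_integrable int by (subst nn_integral_eq_integral) (auto simp: inc.prob_space)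
      also have "(LINT x|increment_law (t / m). \<phi> x z) = t / m * J.rate (t / m) z" using t m by (simp add: J.rate_def)
      also have "ennreal (exp (- c * (t / m * J.rate (t / m) z))) * ennreal (1 + c * (t / m * J.rate (t / m) z)) =
          ennreal (exp (- c * (t / m * J.rate (t / m) z)) * (1 + c * (t / m * J.rate (t / m) z)))"
        by (rule ennreal_mult'[symmetric]) simp
      also have "\<dots> \<le> ennreal (exp (- (c * (t / m * J.rate (t / m) z))) * exp (c * (t / m * J.rate (t / m) z)))"
        by (intro ennreal_leI) (simp add: exp_ge_add_one_self)
      also have "\<dots> = 1" by (simp add: mult_exp_exp)
      finally show ?thesis .
    qed
    have "D m \<omega> = (\<Prod>k<m. g (X (real (Suc k) * t / m) \<omega> - X (real k * t / m) \<omega>) (X (real k * t / m) \<omega>))" for \<omega>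
      unfolding D_def P_def A_def g_def using fac
      by (subst prod_ennreal) (auto simp: prod.distrib sum_distrib_left exp_sum)
    then show ?thesis using sampled_product_le_one[OF t m gm gle] by simp
  qed
  obtain K where K: "0 \<le> K" "\<forall>\<^sub>F s in at_right 0. \<forall>z. J.rate s z \<le> K" using J.rate_bounded by blast
  from eventually_compose_filterlim[OF K(2) J.grid_step_filterlim[OF t]]
  obtain m0 where m0': "\<And>m z. m0 \<le> m \<Longrightarrow> J.rate (t / real (Suc m)) z \<le> K" by (auto simp: eventually_sequentially)
  have m0: "J.rate (t / real m) z \<le> K" if "Suc m0 \<le> m" for m z using m0'[of "m - 1" z] that by simp
  define Ainf where "Ainf \<omega> = predicted w t y \<omega>" for \<omega>
  have A_lim: "(\<lambda>m. A m \<omega>) \<longlonglongrightarrow> Ainf \<omega>" if cad: "cadlag (\<lambda>t. X t \<omega>)" for \<omega>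
  proof -
    define F where "F m z = (if Suc m0 \<le> m then J.rate (t / real m) z else 0)" for m z
    have "(\<lambda>m. \<Sum>k<m. t / m * F m (X (real k * t / m) \<omega>)) \<longlonglongrightarrow> (LINT s|lborel. indicator {0<..t} s * compensator \<phi> (X s \<omega>))"
    proof (rule cadlag_step_integral_limit(1)[OF cad t _ J.compensator_continuous])
      show "(\<lambda>m. F m (Z m)) \<longlonglongrightarrow> compensator \<phi> z" if Z: "Z \<longlonglongrightarrow> z" for Z z
      proof -
        have "(\<lambda>m. J.rate (t / real (Suc m)) (Z (Suc m))) \<longlonglongrightarrow> compensator \<phi> z"
          by (rule J.rate_tendsto[OF J.grid_step_filterlim[OF t] LIMSEQ_Suc[OF Z]])
        then have "(\<lambda>m. J.rate (t / real m) (Z m)) \<longlonglongrightarrow> compensator \<phi> z" by (rule LIMSEQ_imp_Suc)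
        then show ?thesis
          by (rule Lim_transform_eventually) (auto simp: F_def eventually_sequentially intro!: exI[of _ "Suc m0"])
      qed
      show "\<bar>F m z\<bar> \<le> K" for m z using K m0 J.rate_nonneg[of "t / real m" z] t by (auto simp: F_def)
    qed
    moreover have "\<forall>\<^sub>F m in sequentially. (\<Sum>k<m. t / m * F m (X (real k * t / m) \<omega>)) = A m \<omega>"
      using eventually_ge_at_top[of "Suc m0"] by eventually_elim (simp add: A_def F_def)
    ultimately show ?thesis unfolding Ainf_def predicted_def \<phi>_def by (rule Lim_transform_eventually)
  qed
  have A_bounds: "0 \<le> Ainf \<omega>" "Ainf \<omega> \<le> t * K" if cad: "cadlag (\<lambda>t. X t \<omega>)" for \<omega>
  proof -
    show "0 \<le> Ainf \<omega>"
      using t J.rate_nonneg by (intro LIMSEQ_le_const[OF A_lim[OF cad]]) (auto simp: A_def intro!: sum_nonneg)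
    have "A m \<omega> \<le> t * K" if "Suc m0 \<le> m" for m
    proof -
      have "A m \<omega> \<le> (\<Sum>k<m. t / m * K)" unfolding A_def using m0[OF that] t by (intro sum_mono mult_left_mono) auto
      then show ?thesis using that by simp
    qed
    then show "Ainf \<omega> \<le> t * K" by (intro LIMSEQ_le_const2[OF A_lim[OF cad]]) auto
  qed
  define Pinf where "Pinf \<omega> = (\<Prod>s | s \<in> {0<..t} \<and> a \<le> jump (\<lambda>u. X u \<omega>) s. 1 + c * \<phi> (jump (\<lambda>u. X u \<omega>) s) (left_limit (\<lambda>u. X u \<omega>) s))" for \<omega>
  have P_lim: "(\<lambda>m. P m \<omega>) \<longlonglongrightarrow> Pinf \<omega>" if cad: "cadlag (\<lambda>t. X t \<omega>)" for \<omega>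
    unfolding P_def Pinf_def
    by (rule cadlag_prod_over_grid[OF cad t ab(1)]) (use J.\<phi>_support in \<open>auto intro!: tendsto_intros J.\<phi>_tendsto\<close>)
  define Dinf where "Dinf \<omega> = liminf (\<lambda>m. D (Suc m) \<omega>)" for \<omega>
  have Dinf_M [measurable]: "Dinf \<in> borel_measurable M" unfolding Dinf_def[abs_def] by measurable
  have Dinf1: "(\<integral>\<^sup>+\<omega>. Dinf \<omega> \<partial>M) \<le> 1"
  proof -
    have "(\<integral>\<^sup>+\<omega>. Dinf \<omega> \<partial>M) \<le> liminf (\<lambda>m. \<integral>\<^sup>+\<omega>. D (Suc m) \<omega> \<partial>M)"
      unfolding Dinf_def by (rule nn_integral_liminf) measurable
    also have "\<dots> \<le> 1" using D1 by (intro Liminf_le) auto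
    finally show ?thesis .
  qed
  have Dinf_eq: "Dinf \<omega> = ennreal (exp (- c * Ainf \<omega>)) * ennreal (Pinf \<omega>)" if cad: "cadlag (\<lambda>t. X t \<omega>)" for \<omega>
  proof -
    have "(\<lambda>m. P m \<omega> * exp (- c * A m \<omega>)) \<longlonglongrightarrow> Pinf \<omega> * exp (- c * Ainf \<omega>)"
      by (intro tendsto_intros P_lim[OF cad] A_lim[OF cad])
    then have "(\<lambda>m. D (Suc m) \<omega>) \<longlonglongrightarrow> ennreal (Pinf \<omega> * exp (- c * Ainf \<omega>))"
      unfolding D_def by (intro tendsto_ennrealI LIMSEQ_Suc)
    then have "Dinf \<omega> = ennreal (Pinf \<omega> * exp (- c * Ainf \<omega>))"
      unfolding Dinf_def by (intro lim_imp_Liminf) auto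
    then show ?thesis unfolding mult.commute[of "Pinf \<omega>"] ennreal_mult'[OF exp_ge_zero] .
  qed
  \<comment> \<open>The factor \<open>exp (- c A)\<close> as a function of the path of \<open>X\<close>, as is needed for
    integrating out the marks; the truncation changes it on a null set only.\<close>
  define F where "F \<omega> = ennreal (exp (- c * max 0 (min (t * K) (lim (\<lambda>m. A m \<omega>)))))" for \<omega>
  have F_XA [measurable]: "F \<in> borel_measurable XA"
    unfolding F_def[abs_def] using A_XA by measurable
  have F_M [measurable]: "F \<in> borel_measurable M" by (rule XA_M[OF F_XA])
  have F_eq: "F \<omega> = ennreal (exp (- c * Ainf \<omega>))" if cad: "cadlag (\<lambda>t. X t \<omega>)" for \<omega>
    unfolding F_def using A_bounds[OF cad] limI[OF A_lim[OF cad]] by simp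
  have F_le: "F \<omega> \<le> ennreal (exp (\<bar>c\<bar> * (t * K)))" for \<omega>
  proof -
    have "- c * max 0 (min (t * K) (lim (\<lambda>m. A m \<omega>))) \<le> \<bar>c\<bar> * max 0 (min (t * K) (lim (\<lambda>m. A m \<omega>)))"
      by (intro mult_right_mono) auto
    also have "\<dots> \<le> \<bar>c\<bar> * (t * K)" using t K by (intro mult_left_mono) auto
    finally show ?thesis unfolding F_def by (intro ennreal_leI) simp
  qed
  define x r where "x = jump_value t" and "r n \<omega> = y - left_value n \<omega>" for n \<omega>
  have xr [measurable]: "x n \<in> borel_measurable XA" "r n \<in> borel_measurable XA" for n
    unfolding x_def r_def[abs_def] using jump_value_XA left_value_XA by measurable
  \<comment> \<open>Finitely many marks are integrated out at a time. Indices that do not list a jump of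
    the right size have weight \<open>0\<close> and contribute the factor \<open>1\<close>.\<close>
  define U where "U N \<omega> = F \<omega> * (\<Prod>n<N. ennreal (exp (\<theta> * w (x n \<omega>) (r n \<omega>) (mark n \<omega>))))" for N \<omega>
  define V where "V N \<omega> = F \<omega> * (\<Prod>n<N. ennreal (1 + c * mean_weight w (x n \<omega>) (r n \<omega>)))" for N \<omega>
  have mw_fac: "0 \<le> 1 + c * mean_weight w u v" "1 + c * mean_weight w u v \<le> 1 + \<bar>c\<bar>" for u v
    using fac[of u "y - v"] by (auto simp: \<phi>_def)
  have w_xrm: "(\<lambda>\<omega>. w (x n \<omega>) (r n \<omega>) (mark n \<omega>)) \<in> borel_measurable M" for n
    using measurable_compose[OF measurable_Pair[OF XA_M[OF xr(1)] measurable_Pair[OF XA_M[OF xr(2)] mark_measurable]] w_meas] by simp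
  have U_M [measurable]: "U N \<in> borel_measurable M" for N unfolding U_def[abs_def] using w_xrm by measurable
  have mw_M [measurable]: "(\<lambda>\<omega>. mean_weight w (x n \<omega>) (r n \<omega>)) \<in> borel_measurable M" for n
  proof -
    have "(\<lambda>\<omega>. \<phi> (x n \<omega>) (y - r n \<omega>)) \<in> borel_measurable XA" by measurable
    then show ?thesis by (intro XA_M) (simp add: \<phi>_def)
  qed
  have V_M [measurable]: "V N \<in> borel_measurable M" for N unfolding V_def[abs_def] by measurable
  have UV: "(\<integral>\<^sup>+\<omega>. U N \<omega> \<partial>M) \<le> (\<integral>\<^sup>+\<omega>. V N \<omega> \<partial>M)" for N
  proof -
    have "(\<lambda>(x, r, p). ennreal (exp (\<theta> * w x r p))) \<in> borel_measurable weight_space"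
      using w_meas unfolding case_prod_beta by measurable
    from integrate_marks[OF this F_XA xr, where N = N]
    have "(\<integral>\<^sup>+\<omega>. U N \<omega> \<partial>M) = (\<integral>\<^sup>+\<omega>. F \<omega> * (\<Prod>n<N. \<integral>\<^sup>+\<omega>'. ennreal (exp (\<theta> * w (x n \<omega>) (r n \<omega>) (mark 0 \<omega>'))) \<partial>M) \<partial>M)"
      unfolding U_def .
    also have "\<dots> \<le> (\<integral>\<^sup>+\<omega>. V N \<omega> \<partial>M)"
      unfolding V_def
    proof (intro nn_integral_mono mult_left_mono prod_mono_ennreal)
      fix \<omega> n
      have "(\<integral>\<^sup>+\<omega>'. ennreal (exp (\<theta> * w (x n \<omega>) (r n \<omega>) (mark 0 \<omega>'))) \<partial>M) \<le> (\<integral>\<^sup>+\<omega>'. ennreal (1 + c * w (x n \<omega>) (r n \<omega>) (mark 0 \<omega>')) \<partial>M)"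
        unfolding c_def by (intro nn_integral_mono ennreal_leI exp_le_chord w_bounds)
      also have "\<dots> = ennreal (LINT \<omega>'|M. 1 + c * w (x n \<omega>) (r n \<omega>) (mark 0 \<omega>'))"
      proof (rule nn_integral_eq_integral)
        show "integrable M (\<lambda>\<omega>'. 1 + c * w (x n \<omega>) (r n \<omega>) (mark 0 \<omega>'))"
          by (intro Bochner_Integration.integrable_add integrable_mult_right jw(3)) simp
        have "0 \<le> 1 + c * w x r p" for x r p
          unfolding c_def by (rule order_trans[OF exp_ge_zero exp_le_chord[OF w_bounds]])
        then show "AE \<omega>' in M. 0 \<le> 1 + c * w (x n \<omega>) (r n \<omega>) (mark 0 \<omega>')" by simp
      qed
      also have "(LINT \<omega>'|M. 1 + c * w (x n \<omega>) (r n \<omega>) (mark 0 \<omega>')) = 1 + c * mean_weight w (x n \<omega>) (r n \<omega>)"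
        by (subst Bochner_Integration.integral_add) (auto intro!: integrable_mult_right jw(3) simp: mean_weight_def prob_space)
      finally show "(\<integral>\<^sup>+\<omega>'. ennreal (exp (\<theta> * w (x n \<omega>) (r n \<omega>) (mark 0 \<omega>'))) \<partial>M) \<le> ennreal (1 + c * mean_weight w (x n \<omega>) (r n \<omega>))" .
    qed auto
    finally show ?thesis .
  qed
  have idx: "finite {n. \<tau> n \<omega> \<in> {0<..t} \<and> a \<le> jump (\<lambda>u. X u \<omega>) (\<tau> n \<omega>)}"
      "\<And>n. n \<notin> {n. \<tau> n \<omega> \<in> {0<..t} \<and> a \<le> jump (\<lambda>u. X u \<omega>) (\<tau> n \<omega>)} \<Longrightarrow> x n \<omega> \<notin> {a..b}"
      "\<And>n. n \<in> {n. \<tau> n \<omega> \<in> {0<..t} \<and> a \<le> jump (\<lambda>u. X u \<omega>) (\<tau> n \<omega>)} \<Longrightarrow> x n \<omega> = jump (\<lambda>u. X u \<omega>) (\<tau> n \<omega>) \<and> r n \<omega> = y - left_limit (\<lambda>u. X u \<omega>) (\<tau> n \<omega>)"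
    if cad: "cadlag (\<lambda>t. X t \<omega>)" and enum: "\<forall>t\<ge>0. 0 < jump (\<lambda>u. X u \<omega>) t \<longrightarrow> (\<exists>!n. \<tau> n \<omega> = t)" for \<omega>
  proof -
    show "finite {n. \<tau> n \<omega> \<in> {0<..t} \<and> a \<le> jump (\<lambda>u. X u \<omega>) (\<tau> n \<omega>)}" by (rule marked_jumps(2)[OF cad enum ab(1)])
    show "\<And>n. n \<notin> {n. \<tau> n \<omega> \<in> {0<..t} \<and> a \<le> jump (\<lambda>u. X u \<omega>) (\<tau> n \<omega>)} \<Longrightarrow> x n \<omega> \<notin> {a..b}"
      unfolding x_def jump_value_eq[OF cad] using ab by auto
    show "\<And>n. n \<in> {n. \<tau> n \<omega> \<in> {0<..t} \<and> a \<le> jump (\<lambda>u. X u \<omega>) (\<tau> n \<omega>)} \<Longrightarrow> x n \<omega> = jump (\<lambda>u. X u \<omega>) (\<tau> n \<omega>) \<and> r n \<omega> = y - left_limit (\<lambda>u. X u \<omega>) (\<tau> n \<omega>)"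
      unfolding x_def r_def jump_value_eq[OF cad] using left_value_eq[OF cad] by auto
  qed
  have V_lim: "(\<forall>\<^sub>F N in sequentially. V N \<omega> = Dinf \<omega>) \<and> (\<forall>N. V N \<omega> \<le> F \<omega> + Dinf \<omega>)"
    if cad: "cadlag (\<lambda>t. X t \<omega>)" and enum: "\<forall>t\<ge>0. 0 < jump (\<lambda>u. X u \<omega>) t \<longrightarrow> (\<exists>!n. \<tau> n \<omega> = t)" for \<omega>
  proof -
    let ?I = "{n. \<tau> n \<omega> \<in> {0<..t} \<and> a \<le> jump (\<lambda>u. X u \<omega>) (\<tau> n \<omega>)}"
    note I = idx[OF cad enum]
    define f where "f n = 1 + c * mean_weight w (x n \<omega>) (r n \<omega>)" for n
    have f1: "f n = 1" if "n \<notin> ?I" for n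
      using I(2)[OF that] w_supp by (simp add: f_def mean_weight_def)
    have f0: "0 \<le> f n" for n unfolding f_def by (rule mw_fac)
    have "Pinf \<omega> = (\<Prod>n\<in>?I. 1 + c * \<phi> (jump (\<lambda>u. X u \<omega>) (\<tau> n \<omega>)) (left_limit (\<lambda>u. X u \<omega>) (\<tau> n \<omega>)))"
      unfolding Pinf_def by (rule prod.reindex_bij_betw[OF marked_jumps(1)[OF cad enum ab(1)], symmetric])
    also have "\<dots> = (\<Prod>n\<in>?I. f n)" using I(3) by (intro prod.cong) (auto simp: f_def \<phi>_def)
    finally have Pf: "Pinf \<omega> = (\<Prod>n\<in>?I. f n)" .
    have Vf: "V N \<omega> = F \<omega> * ennreal (\<Prod>n<N. f n)" for N
      unfolding V_def f_def[symmetric] using f0 by (simp add: prod_ennreal)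
    have Df: "Dinf \<omega> = F \<omega> * ennreal (Pinf \<omega>)" unfolding Dinf_eq[OF cad] F_eq[OF cad] ..
    have "\<forall>\<^sub>F N in sequentially. V N \<omega> = Dinf \<omega>"
    proof -
      have "\<forall>\<^sub>F N in sequentially. (\<Prod>n<N. f n) = (\<Prod>n\<in>?I. f n)"
        by (rule eventually_prod_lessThan[OF I(1)]) (rule f1)
      then show ?thesis by eventually_elim (simp add: Vf Df Pf)
    qed
    moreover have "V N \<omega> \<le> F \<omega> + Dinf \<omega>" for N
    proof -
      have eqN: "(\<Prod>n<N. f n) = (\<Prod>n\<in>{..<N} \<inter> ?I. f n)" using f1 by (intro prod.mono_neutral_right) auto
      have "(\<Prod>n<N. f n) \<le> 1 + (\<Prod>n\<in>?I. f n)"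
      proof (cases "0 \<le> c")
        case True
        have "1 \<le> f n" for n using True J.\<phi>_bounds(1)[of "x n \<omega>" "y - r n \<omega>"] by (simp add: f_def \<phi>_def)
        then have "(\<Prod>n\<in>{..<N} \<inter> ?I. f n) \<le> (\<Prod>n\<in>?I. f n)" using f0 by (intro prod_mono2 I(1)) auto
        then show ?thesis unfolding eqN by simp
      next
        case False
        have "f n \<le> 1" for n using False J.\<phi>_bounds(1)[of "x n \<omega>" "y - r n \<omega>"] by (simp add: f_def \<phi>_def mult_nonpos_nonneg)
        then have "(\<Prod>n<N. f n) \<le> 1" using f0 by (intro prod_le_1) auto
        moreover have "0 \<le> (\<Prod>n\<in>?I. f n)" using f0 by (intro prod_nonneg) auto
        ultimately show ?thesis by simp
      qed
      then have "V N \<omega> \<le> F \<omega> * ennreal (1 + Pinf \<omega>)" unfolding Vf Pf by (intro mult_left_mono ennreal_leI) auto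
      also have "\<dots> = F \<omega> + Dinf \<omega>" unfolding Df Pf using f0 by (subst ennreal_plus) (auto simp: distrib_left prod_nonneg)
      finally show ?thesis .
    qed
    ultimately show ?thesis by blast
  qed
  have V_int: "(\<lambda>N. \<integral>\<^sup>+\<omega>. V N \<omega> \<partial>M) \<longlonglongrightarrow> (\<integral>\<^sup>+\<omega>. Dinf \<omega> \<partial>M)"
  proof (rule nn_integral_dominated_convergence[where w = "\<lambda>\<omega>. F \<omega> + Dinf \<omega>"])
    show "AE \<omega> in M. V N \<omega> \<le> F \<omega> + Dinf \<omega>" for N
      using AE_cadlag enumeration by eventually_elim (use V_lim in blast)
    show "AE \<omega> in M. (\<lambda>N. V N \<omega>) \<longlonglongrightarrow> Dinf \<omega>"
      using AE_cadlag enumeration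
    proof eventually_elim
      case (elim \<omega>)
      show ?case by (rule tendsto_eventually) (use V_lim[OF elim] in blast)
    qed
    have "(\<integral>\<^sup>+\<omega>. F \<omega> \<partial>M) \<le> (\<integral>\<^sup>+\<omega>. ennreal (exp (\<bar>c\<bar> * (t * K))) \<partial>M)" by (intro nn_integral_mono F_le)
    also have "\<dots> < \<infinity>" by (simp add: emeasure_space_1)
    finally show "(\<integral>\<^sup>+\<omega>. F \<omega> + Dinf \<omega> \<partial>M) < \<infinity>"
      using Dinf1 by (subst nn_integral_add) (auto simp: top_unique less_top intro: le_less_trans)
  qed measurable
  define Q where "Q \<omega> = liminf (\<lambda>N. U N \<omega>)" for \<omega>
  have Q_M: "Q \<in> borel_measurable M" unfolding Q_def[abs_def] by measurable
  have "(\<integral>\<^sup>+\<omega>. Q \<omega> \<partial>M) \<le> liminf (\<lambda>N. \<integral>\<^sup>+\<omega>. U N \<omega> \<partial>M)"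
    unfolding Q_def by (rule nn_integral_liminf) measurable
  also have "\<dots> \<le> liminf (\<lambda>N. \<integral>\<^sup>+\<omega>. V N \<omega> \<partial>M)" using UV by (intro Liminf_mono) auto
  also have "\<dots> = (\<integral>\<^sup>+\<omega>. Dinf \<omega> \<partial>M)" using V_int by (intro lim_imp_Liminf) auto
  also have "\<dots> \<le> 1" by (rule Dinf1)
  finally have Q1: "(\<integral>\<^sup>+\<omega>. Q \<omega> \<partial>M) \<le> 1" .
  have "AE \<omega> in M. ennreal (exp (\<theta> * marked_sum w a t y \<omega> - (exp \<theta> - 1) * predicted w t y \<omega>)) \<le> Q \<omega>"
    using AE_cadlag enumeration
  proof eventually_elim
    case (elim \<omega>)
    let ?I = "{n. \<tau> n \<omega> \<in> {0<..t} \<and> a \<le> jump (\<lambda>u. X u \<omega>) (\<tau> n \<omega>)}"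
    note I = idx[OF elim]
    define f where "f n = exp (\<theta> * w (x n \<omega>) (r n \<omega>) (mark n \<omega>))" for n
    have f1: "f n = 1" if "n \<notin> ?I" for n using I(2)[OF that] w_supp by (simp add: f_def)
    have "(\<Prod>n\<in>?I. f n) = exp (\<theta> * marked_sum w a t y \<omega>)"
      unfolding f_def exp_sum[OF I(1), symmetric] marked_sum_def sum_distrib_left using I(3) by (intro arg_cong[where f = exp] sum.cong) auto
    moreover have "\<forall>\<^sub>F N in sequentially. (\<Prod>n<N. f n) = (\<Prod>n\<in>?I. f n)"
      by (rule eventually_prod_lessThan[OF I(1)]) (rule f1)
    ultimately have "\<forall>\<^sub>F N in sequentially. (\<Prod>n<N. f n) = exp (\<theta> * marked_sum w a t y \<omega>)" by simp
    then have "\<forall>\<^sub>F N in sequentially. U N \<omega> = ennreal (exp (\<theta> * marked_sum w a t y \<omega> - (exp \<theta> - 1) * predicted w t y \<omega>))"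
    proof eventually_elim
      case (elim N)
      have "U N \<omega> = F \<omega> * ennreal (\<Prod>n<N. f n)" unfolding U_def f_def by (simp add: prod_ennreal)
      also have "\<dots> = ennreal (exp (- c * Ainf \<omega>) * exp (\<theta> * marked_sum w a t y \<omega>))"
        unfolding F_eq[OF \<open>cadlag (\<lambda>t. X t \<omega>)\<close>] elim by (simp add: ennreal_mult'[symmetric])
      also have "exp (- c * Ainf \<omega>) * exp (\<theta> * marked_sum w a t y \<omega>) = exp (\<theta> * marked_sum w a t y \<omega> - (exp \<theta> - 1) * predicted w t y \<omega>)"
        by (simp add: mult_exp_exp c_def Ainf_def algebra_simps)
      finally show ?case .
    qed
    then have "(\<lambda>N. U N \<omega>) \<longlonglongrightarrow> ennreal (exp (\<theta> * marked_sum w a t y \<omega> - (exp \<theta> - 1) * predicted w t y \<omega>))"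
      by (rule tendsto_eventually)
    then have "Q \<omega> = ennreal (exp (\<theta> * marked_sum w a t y \<omega> - (exp \<theta> - 1) * predicted w t y \<omega>))"
      unfolding Q_def by (intro lim_imp_Liminf) auto
    then show ?case by simp
  qed
  then show ?thesis unfolding outer_le_one_def using Q1 Q_M by blast
qed

end


section \<open>Occupation densities of a cadlag path\<close>

lemma cadlag_compose_measurable:
  fixes g :: "real \<Rightarrow> real"
  assumes f: "cadlag f" and t: "0 \<le> t" and g [measurable]: "g \<in> borel_measurable borel"
  shows "(\<lambda>s. indicator {0..t} s * g (f s)) \<in> borel_measurable lborel"
proof (cases "t = 0")
  case True
  then have "(\<lambda>s. indicator {0..t} s * g (f s)) = (\<lambda>s. indicator {0} s * g (f 0))" by (auto simp: indicator_def)
  then show ?thesis by simp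
next
  case False
  then have t: "0 < t" using t by simp
  have fm [measurable]: "(\<lambda>s. indicator {0<..t} s * f s) \<in> borel_measurable lborel"
  proof (rule borel_measurable_LIMSEQ_real)
    show "(\<lambda>s. indicator {0<..t} s * f (real (Suc (cell t (Suc m) s)) * t / Suc m)) \<in> borel_measurable lborel" for m
      using grid_step_integral(2)[OF t, of "Suc m" "\<lambda>k. f (real (Suc k) * t / Suc m)"] by simp
    show "(\<lambda>m. indicator {0<..t} s * f (real (Suc (cell t (Suc m) s)) * t / Suc m)) \<longlonglongrightarrow> indicator {0<..t} s * f s" for s
    proof (cases "s \<in> {0<..t}")
      case True
      then show ?thesis using LIMSEQ_Suc[OF cadlag_cell_limits(2)[OF f t, of s]] by (intro tendsto_mult_left) auto
    qed simp
  qed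
  have "(\<lambda>s. indicator {0..t} s * g (f s)) = (\<lambda>s. indicator {0} s * g (f 0) + indicator {0<..t} s * g (indicator {0<..t} s * f s))"
    using t by (auto simp: indicator_def)
  then show ?thesis by simp
qed

lemma cadlag_compose_integrable:
  fixes g :: "real \<Rightarrow> real"
  assumes f: "cadlag f" and t: "0 \<le> t" and g: "g \<in> borel_measurable borel" and B: "\<And>z. \<bar>g z\<bar> \<le> B"
  shows "integrable lborel (\<lambda>s. indicator {0..t} s * g (f s))"
proof (rule Bochner_Integration.integrable_bound)
  show "integrable lborel (\<lambda>s. indicator {0..t} s * B)"
    using emeasure_lborel_Icc[OF t] by (intro integrable_mult_left integrable_real_indicator) auto
  have "0 \<le> B" using order_trans[OF abs_ge_zero B] .
  then show "AE s in lborel. norm (indicator {0..t} s * g (f s)) \<le> norm (indicator {0..t} s * B)"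
    using B by (auto simp: indicator_def)
qed (rule cadlag_compose_measurable[OF f t g])

lemma integral_drop_zero:
  fixes h :: "real \<Rightarrow> real"
  assumes "(\<lambda>s. indicator {0..t} s * h s) \<in> borel_measurable lborel"
  shows "(LINT s|lborel. indicator {0<..t} s * h s) = (LINT s|lborel. indicator {0..t} s * h s)"
proof (rule integral_cong_AE)
  have eq: "(\<lambda>s. indicator {0<..t} s * h s) = (\<lambda>s. indicator {0<..t} s * (indicator {0..t} s * h s))"
    by (auto simp: indicator_def)
  show "(\<lambda>s. indicator {0<..t} s * h s) \<in> borel_measurable lborel"
    unfolding eq using assms by measurable
  show "AE s in lborel. indicator {0<..t} s * h s = indicator {0..t} s * h s"
    using AE_lborel_singleton[of "0::real"] by eventually_elim (auto simp: indicator_def)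
qed fact

text \<open>
  Turns the occupation formula, which only determines integrals over levels, into statements about
  every single level.
\<close>

lemma nonneg_from_local_integrals:
  fixes g :: "real \<Rightarrow> real"
  assumes g: "continuous_on UNIV g" and d: "0 < d"
    and int: "\<And>r. 0 < r \<Longrightarrow> r < d \<Longrightarrow> \<exists>v\<ge>0. has_bochner_integral lborel (\<lambda>z. indicator (ball y r) z * g z) v"
  shows "0 \<le> g y"
proof (rule ccontr)
  assume "\<not> 0 \<le> g y"
  then have neg: "g y < 0" by simp
  have "isCont g y" using g by (simp add: continuous_on_eq_continuous_at)
  then have "\<forall>\<^sub>F z in nhds y. g z < g y / 2"
    using neg order_tendstoD(2)[of g "g y" "nhds y" "g y / 2"] unfolding continuous_at filterlim_at
    by (simp add: isCont_def tendsto_at_iff_tendsto_nhds)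
  then obtain e where e: "0 < e" "\<And>z. dist z y < e \<Longrightarrow> g z < g y / 2"
    unfolding eventually_nhds_metric by blast
  define r where "r = min e d / 2"
  have r: "0 < r" "r < d" "r < e" using e d by (auto simp: r_def)
  obtain v where v: "0 \<le> v" "has_bochner_integral lborel (\<lambda>z. indicator (ball y r) z * g z) v" using int[OF r(1,2)] by blast
  have b: "has_bochner_integral lborel (\<lambda>z. indicator (ball y r) z *\<^sub>R (g y / 2)) (measure lborel (ball y r) *\<^sub>R (g y / 2))"
    by (intro has_bochner_integral_indicator) (use r in \<open>auto simp: ball_eq_greaterThanLessThan\<close>)
  have b: "has_bochner_integral lborel (\<lambda>z. indicator (ball y r) z * (g y / 2)) (measure lborel (ball y r) * (g y / 2))" using b by simp
  have "(LINT z|lborel. indicator (ball y r) z * g z) \<le> (LINT z|lborel. indicator (ball y r) z * (g y / 2))"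
  proof (rule integral_mono)
    fix z show "indicator (ball y r) z * g z \<le> indicator (ball y r) z * (g y / 2)"
      using e(2)[of z] r by (auto simp: indicator_def dist_commute)
  qed (use v b in \<open>auto simp: has_bochner_integral_iff\<close>)
  then have "v \<le> measure lborel (ball y r) * (g y / 2)"
    using has_bochner_integral_integral_eq[OF v(2)] has_bochner_integral_integral_eq[OF b] by simp
  also have "\<dots> < 0" using r neg by (simp add: ball_eq_greaterThanLessThan mult_pos_neg)
  finally show False using v by simp
qed

locale occupation_density =
  fixes f :: "real \<Rightarrow> real" and L :: "real \<Rightarrow> real \<Rightarrow> real"
  assumes cad: "cadlag f" and L_cont: "continuous_on (UNIV \<times> {0..}) (\<lambda>(y, t). L y t)"
    and occ: "\<And>g T. g \<in> borel_measurable borel \<Longrightarrow> bounded (range g) \<Longrightarrow> 0 \<le> T \<Longrightarrow>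
      has_bochner_integral lborel (\<lambda>y. g y * L y T) (LINT t:{0..T}|lborel. g (f t))"
begin

lemma L_continuous_y: "0 \<le> t \<Longrightarrow> continuous_on UNIV (\<lambda>y. L y t)"
  using continuous_on_compose2[OF L_cont, of UNIV "\<lambda>y. (y, t)"] by (auto simp: continuous_on_Pair)

lemma occ_ball: "0 \<le> T \<Longrightarrow> has_bochner_integral lborel (\<lambda>z. indicator (ball y r) z * L z T) (LINT t|lborel. indicator {0..T} t * indicator (ball y r) (f t))"
proof -
  assume T: "0 \<le> T"
  have "bounded (range (indicator (ball y r) :: real \<Rightarrow> real))"
    unfolding bounded_iff by (intro exI[of _ 1]) (auto simp: indicator_def)
  from occ[OF _ this T] show ?thesis by (simp add: set_lebesgue_integral_def borel_measurable_indicator)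
qed

lemma L_nonneg: "0 \<le> t \<Longrightarrow> 0 \<le> L y t"
proof (rule nonneg_from_local_integrals[OF L_continuous_y zero_less_one])
  fix r :: real
  assume "0 \<le> t"
  then show "\<exists>v\<ge>0. has_bochner_integral lborel (\<lambda>z. indicator (ball y r) z * L z t) v"
    by (intro exI[of _ "LINT s|lborel. indicator {0..t} s * indicator (ball y r) (f s)"] conjI occ_ball integral_nonneg_AE) auto
qed

lemma L_eq_0:
  assumes t: "0 \<le> t" and d: "0 < d" and zero: "\<And>r. 0 < r \<Longrightarrow> r < d \<Longrightarrow> (LINT s|lborel. indicator {0..t} s * indicator (ball y r) (f s) :: real) = 0"
  shows "L y t = 0"
proof -
  have "0 \<le> - L y t"
  proof (rule nonneg_from_local_integrals[where g = "\<lambda>y. - L y t", OF _ d])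
    show "continuous_on UNIV (\<lambda>y. - L y t)" using t by (intro continuous_intros L_continuous_y) auto
    fix r assume "0 < r" "r < d"
    then show "\<exists>v\<ge>0. has_bochner_integral lborel (\<lambda>z. indicator (ball y r) z * - L z t) v"
      using has_bochner_integral_minus[OF occ_ball[OF t, of y r]] zero by (intro exI[of _ 0]) auto
  qed
  then show ?thesis using L_nonneg[OF t, of y] by simp
qed

lemma L_outside:
  assumes t: "0 \<le> t" and K: "\<And>s. s \<in> {0..t} \<Longrightarrow> \<bar>f s\<bar> \<le> K" and y: "K < \<bar>y\<bar>"
  shows "L y t = 0"
proof (rule L_eq_0[OF t])
  show "0 < \<bar>y\<bar> - K" using y by simp
  fix r assume r: "0 < r" "r < \<bar>y\<bar> - K"
  have "indicator {0..t} s * indicator (ball y r) (f s) = (0::real)" for s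
    using K[of s] r by (auto simp: indicator_def dist_real_def)
  then have "(\<lambda>s. indicator {0..t} s * indicator (ball y r) (f s) :: real) = (\<lambda>_. 0)" by (rule ext)
  then show "(LINT s|lborel. indicator {0..t} s * indicator (ball y r) (f s) :: real) = 0" by simp
qed

lemma L_start: "L y 0 = 0"
proof (rule L_eq_0[OF order_refl zero_less_one])
  fix r :: real
  have "(LINT s|lborel. indicator {0..0} s * indicator (ball y r) (f s) :: real) = (LINT s|lborel. indicator {0::real} s * indicator (ball y r) (f 0))"
    by (intro Bochner_Integration.integral_cong) (auto simp: indicator_def)
  then show "(LINT s|lborel. indicator {0..0} s * indicator (ball y r) (f s) :: real) = 0" by simp
qed

lemma L_uniform:
  assumes T: "0 \<le> T" and e: "0 < e"
  obtains d where "0 < d" "\<And>y y' t t'. \<lbrakk>t \<in> {0..T}; t' \<in> {0..T}; \<bar>y - y'\<bar> < d; \<bar>t - t'\<bar> < d\<rbrakk> \<Longrightarrow> \<bar>L y t - L y' t'\<bar> < e"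
proof -
  obtain K where K: "\<And>s. s \<in> {0..T} \<Longrightarrow> \<bar>f s\<bar> \<le> K" using cadlag_bounded[OF cad] by blast
  have out: "L y t = 0" if "t \<in> {0..T}" "K < \<bar>y\<bar>" for y t
    by (rule L_outside[of t K]) (use that K in auto)
  have "compact ({- K - 1..K + 1} \<times> {0..T})" by (intro compact_Times compact_Icc)
  then have "uniformly_continuous_on ({- K - 1..K + 1} \<times> {0..T}) (\<lambda>(y, t). L y t)"
    by (intro compact_uniformly_continuous continuous_on_subset[OF L_cont]) auto
  then obtain d where d: "0 < d" "\<And>p q. p \<in> {- K - 1..K + 1} \<times> {0..T} \<Longrightarrow> q \<in> {- K - 1..K + 1} \<times> {0..T} \<Longrightarrow> dist q p < d \<Longrightarrow>
     dist ((\<lambda>(y, t). L y t) q) ((\<lambda>(y, t). L y t) p) < e"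
    using e unfolding uniformly_continuous_on_def by meson
  define d' where "d' = min 1 (d / 2)"
  show ?thesis
  proof (rule that[of d'])
    show "0 < d'" using d by (simp add: d'_def)
    fix y y' t t' assume a: "t \<in> {0..T}" "t' \<in> {0..T}" "\<bar>y - y'\<bar> < d'" "\<bar>t - t'\<bar> < d'"
    show "\<bar>L y t - L y' t'\<bar> < e"
    proof (cases "\<bar>y\<bar> \<le> K + 1 \<and> \<bar>y'\<bar> \<le> K + 1")
      case True
      have "dist (y, t) (y', t') \<le> \<bar>y - y'\<bar> + \<bar>t - t'\<bar>"
        unfolding dist_Pair_Pair dist_real_def by (rule order_trans[OF sqrt_sum_squares_le_sum_abs]) auto
      also have "\<dots> < d" using a by (auto simp: d'_def)
      finally show ?thesis using d(2)[of "(y', t')" "(y, t)"] True a by (auto simp: dist_real_def abs_le_iff)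
    next
      case False
      then have "K < \<bar>y\<bar>" "K < \<bar>y'\<bar>" using a by (auto simp: d'_def)
      then show ?thesis using out a e by simp
    qed
  qed
qed

lemma L_bounded:
  assumes T: "0 \<le> T"
  obtains B where "0 \<le> B" "\<And>y. L y T \<le> B"
proof -
  obtain K where K: "\<And>s. s \<in> {0..T} \<Longrightarrow> \<bar>f s\<bar> \<le> K" using cadlag_bounded[OF cad] by blast
  have "compact ((\<lambda>y. L y T) ` {- K..K})"
    by (intro compact_continuous_image continuous_on_subset[OF L_continuous_y[OF T]]) auto
  then obtain B where B: "\<And>y. y \<in> {- K..K} \<Longrightarrow> \<bar>L y T\<bar> \<le> B"
    using that compact_imp_bounded[of "(\<lambda>y. L y T) ` {- K..K}"] by (fastforce simp: bounded_iff)
  show ?thesis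
  proof (rule that[of "max B 0"])
    fix y show "L y T \<le> max B 0"
    proof (cases "y \<in> {- K..K}")
      case False
      then have "L y T = 0" by (intro L_outside[OF T K]) auto
      then show ?thesis by simp
    qed (use B[of y] in auto)
  qed simp
qed

text \<open>
  By the occupation formula the time integral is an average of \<open>L\<close> over levels \<open>y' - h r\<close> with
  weight \<open>G r\<close>. Levels with bounded \<open>r\<close> are close to \<open>y\<close>, uniformly in \<open>y\<close>; the others have little
  weight.
\<close>

lemma approximate_identity:
  fixes G :: "real \<Rightarrow> real"
  assumes T: "0 \<le> T" and G: "integrable lborel G" "\<And>r. 0 \<le> G r" "\<And>r. G r \<le> C" and e: "0 < e"
  shows "\<exists>h0>0. \<forall>h y y'. 0 < h \<longrightarrow> h < h0 \<longrightarrow> \<bar>y - y'\<bar> \<le> h \<longrightarrow>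
     \<bar>(LINT s|lborel. indicator {0..T} s * (G ((y' - f s) / h) / h)) - (LINT r|lborel. G r) * L y T\<bar> \<le> e"
proof -
  have [measurable]: "G \<in> borel_measurable borel" using borel_measurable_integrable[OF G(1)] by simp
  obtain B where B: "0 \<le> B" "\<And>y. L y T \<le> B" using L_bounded[OF T] by blast
  define I where "I = (LINT r|lborel. G r)"
  have I0: "0 \<le> I" unfolding I_def using G(2) by (intro integral_nonneg_AE) auto
  define e1 where "e1 = e / (2 * (I + 1))"
  have "e1 * (I + 1) = e / 2" "0 < e1" using I0 e by (auto simp: e1_def field_simps)
  then have e1: "0 < e1" "e1 * I \<le> e / 2" by (auto simp: distrib_left)
  obtain d where d: "0 < d" "\<And>y y'. \<bar>y - y'\<bar> < d \<Longrightarrow> \<bar>L y T - L y' T\<bar> < e1"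
    using L_uniform[OF T e1(1)] T by (metis abs_zero atLeastAtMost_iff diff_self order_refl)
  have "(\<lambda>n. LINT r|lborel. indicator {r. real n < \<bar>r\<bar>} r * G r) \<longlonglongrightarrow> (LINT (r::real)|lborel. (0::real))"
  proof (rule integral_dominated_convergence[where w = G])
    show "AE r in lborel. (\<lambda>n. indicator {r. real n < \<bar>r\<bar>} r * G r) \<longlonglongrightarrow> 0"
    proof (rule AE_I2, rule tendsto_eventually)
      fix r :: real
      obtain n0 :: nat where "\<bar>r\<bar> \<le> n0" using real_arch_simple by blast
      then show "\<forall>\<^sub>F n in sequentially. indicator {r. real n < \<bar>r\<bar>} r * G r = 0"
        by (intro eventually_sequentiallyI[of n0]) (auto simp: indicator_def)
    qed
  qed (use G in \<open>auto simp: indicator_def\<close>)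
  then have "(\<lambda>n. LINT r|lborel. indicator {r. real n < \<bar>r\<bar>} r * G r) \<longlonglongrightarrow> 0" by simp
  moreover have "0 < e / (2 * (B + 1))" using e B by simp
  ultimately have "\<forall>\<^sub>F n in sequentially. (LINT r|lborel. indicator {r. real n < \<bar>r\<bar>} r * G r) < e / (2 * (B + 1))"
    by (rule order_tendstoD)
  then obtain R :: nat where R: "(LINT r|lborel. indicator {r. real R < \<bar>r\<bar>} r * G r) < e / (2 * (B + 1))"
    by (auto simp: eventually_sequentially)
  define h0 where "h0 = d / (real R + 2)"
  show ?thesis
  proof (intro exI[of _ h0] conjI allI impI)
    show "0 < h0" using d by (simp add: h0_def)
    fix h y y' assume h: "0 < h" "h < h0" and yy: "\<bar>y - y'\<bar> \<le> h"
    have hd: "h * (real R + 2) < d" using h by (simp add: h0_def field_simps)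
    have bd: "bounded (range (\<lambda>z. G ((y' - z) / h) / h))"
      using G h unfolding bounded_iff by (intro exI[of _ "C / h"]) (auto simp: divide_right_mono)
    have "has_bochner_integral lborel (\<lambda>z. G ((y' - z) / h) / h * L z T) (LINT s:{0..T}|lborel. G ((y' - f s) / h) / h)"
      by (rule occ[OF _ bd T]) measurable
    then have 1: "has_bochner_integral lborel (\<lambda>z. G ((y' - z) / h) / h * L z T) (LINT s|lborel. indicator {0..T} s * (G ((y' - f s) / h) / h))"
      by (simp add: set_lebesgue_integral_def)
    have "has_bochner_integral lborel (\<lambda>r. G ((y' - (y' + (- h) * r)) / h) / h * L (y' + (- h) * r) T) ((LINT s|lborel. indicator {0..T} s * (G ((y' - f s) / h) / h)) /\<^sub>R \<bar>- h\<bar>)"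
      using h by (intro lborel_has_bochner_integral_real_affine_iff[THEN iffD1, OF _ 1]) auto
    then have "has_bochner_integral lborel (\<lambda>r. h * (G r / h * L (y' - h * r) T)) (h * ((LINT s|lborel. indicator {0..T} s * (G ((y' - f s) / h) / h)) / h))"
      using h by (intro has_bochner_integral_mult_right) (simp add: divide_simps mult.commute)
    then have 2: "has_bochner_integral lborel (\<lambda>r. G r * L (y' - h * r) T) (LINT s|lborel. indicator {0..T} s * (G ((y' - f s) / h) / h))"
      using h by simp
    have 3: "has_bochner_integral lborel (\<lambda>r. G r * L y T) (I * L y T)"
      unfolding I_def by (intro has_bochner_integral_mult_left has_bochner_integral_integrable G)
    have diff: "has_bochner_integral lborel (\<lambda>r. G r * L (y' - h * r) T - G r * L y T) ((LINT s|lborel. indicator {0..T} s * (G ((y' - f s) / h) / h)) - I * L y T)"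
      by (rule has_bochner_integral_diff[OF 2 3])
    have tail: "integrable lborel (\<lambda>r. indicator {r. real R < \<bar>r\<bar>} r * G r)"
      by (rule Bochner_Integration.integrable_bound[OF G(1)]) (auto simp: indicator_def)
    have "\<bar>(LINT s|lborel. indicator {0..T} s * (G ((y' - f s) / h) / h)) - I * L y T\<bar> = \<bar>LINT r|lborel. G r * L (y' - h * r) T - G r * L y T\<bar>"
      using has_bochner_integral_integral_eq[OF diff] by simp
    also have "\<dots> \<le> (LINT r|lborel. e1 * G r + (B + 1) * (indicator {r. real R < \<bar>r\<bar>} r * G r))"
    proof (rule order_trans[OF integral_abs_bound], rule integral_mono)
      show "integrable lborel (\<lambda>r. \<bar>G r * L (y' - h * r) T - G r * L y T\<bar>)"
        using diff by (auto simp: has_bochner_integral_iff)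
      show "integrable lborel (\<lambda>r. e1 * G r + (B + 1) * (indicator {r. real R < \<bar>r\<bar>} r * G r))"
        using G tail by auto
      fix r :: real
      have eq: "\<bar>G r * L (y' - h * r) T - G r * L y T\<bar> = G r * \<bar>L (y' - h * r) T - L y T\<bar>"
        using G(2)[of r] by (simp add: abs_mult flip: right_diff_distrib)
      show "\<bar>G r * L (y' - h * r) T - G r * L y T\<bar> \<le> e1 * G r + (B + 1) * (indicator {r. real R < \<bar>r\<bar>} r * G r)"
      proof (cases "real R < \<bar>r\<bar>")
        case True
        have "\<bar>L (y' - h * r) T - L y T\<bar> \<le> B + 1"
          using B(2)[of "y' - h * r"] B(2)[of y] L_nonneg[OF T, of "y' - h * r"] L_nonneg[OF T, of y] by linarith
        then have "G r * \<bar>L (y' - h * r) T - L y T\<bar> \<le> G r * (B + 1)" using G(2) by (rule mult_left_mono)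
        also have "\<dots> \<le> e1 * G r + (B + 1) * G r" using e1 G(2)[of r] by (simp add: mult.commute)
        finally show ?thesis unfolding eq using True by simp
      next
        case False
        have "\<bar>(y' - h * r) - y\<bar> \<le> h + h * \<bar>r\<bar>"
          using yy h by (auto simp: abs_le_iff abs_mult) (smt (verit) mult_minus_right mult_left_mono abs_ge_self abs_ge_minus_self)+
        also have "\<dots> \<le> h * (real R + 2)" using False h by (simp add: algebra_simps) (smt (verit) mult_left_mono)
        also note hd
        finally have "\<bar>L (y' - h * r) T - L y T\<bar> \<le> e1" using d(2) by (meson less_imp_le)
        then have "G r * \<bar>L (y' - h * r) T - L y T\<bar> \<le> G r * e1" using G(2) by (rule mult_left_mono)
        then show ?thesis unfolding eq using False by (simp add: mult.commute)
      qed
    qed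
    also have "\<dots> = e1 * I + (B + 1) * (LINT r|lborel. indicator {r. real R < \<bar>r\<bar>} r * G r)"
      using G tail by (subst Bochner_Integration.integral_add) (auto simp: I_def)
    also have "\<dots> \<le> e / 2 + (B + 1) * (e / (2 * (B + 1)))" using e1 R B by (intro add_mono mult_left_mono) auto
    also have "\<dots> = e" using B by (simp add: field_simps)
    finally show "\<bar>(LINT s|lborel. indicator {0..T} s * (G ((y' - f s) / h) / h)) - (LINT r|lborel. G r) * L y T\<bar> \<le> e" unfolding I_def .
  qed
qed

end


section \<open>Scaling of the intensities\<close>

context excursion_law
begin

text \<open>
  The intensity is finite for the weights of interest, and \<open>profile\<close> is then the same function with
  real values.
\<close>

definition profile :: "(real \<Rightarrow> real \<Rightarrow> (real \<Rightarrow> real) \<Rightarrow> real) \<Rightarrow> real \<Rightarrow> real" where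
  "profile w r = enn2real (intensity w r)"

lemma joint_measurable:
  assumes w: "(\<lambda>(x, r, p). w x r p) \<in> borel_measurable weight_space"
    and m: "X \<in> borel_measurable N" "R \<in> borel_measurable N" "P \<in> N \<rightarrow>\<^sub>M E"
  shows "(\<lambda>z. w (X z) (R z) (Y (P z))) \<in> borel_measurable N"
  using measurable_compose[OF measurable_Pair[OF m(1) measurable_Pair[OF m(2) measurable_compose[OF m(3) Y_measurable]]] w] by simp

lemma intensity_measurable:
  assumes w: "(\<lambda>(x, r, p). w x r p) \<in> borel_measurable weight_space"
  shows "intensity w \<in> borel_measurable borel"
proof -
  note [measurable (raw)] = joint_measurable[OF w]
  show ?thesis unfolding intensity_def[abs_def] by measurable
qed

lemma profile_measurable:
  assumes w: "(\<lambda>(x, r, p). w x r p) \<in> borel_measurable weight_space"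
  shows "profile w \<in> borel_measurable borel"
  unfolding profile_def[abs_def] using intensity_measurable[OF w] by measurable

lemma profile_nonneg: "0 \<le> profile w r" by (simp add: profile_def)

lemma profile_integral:
  assumes w: "(\<lambda>(x, r, p). w x r p) \<in> borel_measurable weight_space"
    and fin: "\<And>r. intensity w r < \<infinity>" and total: "(\<integral>\<^sup>+r. intensity w r \<partial>lborel) < \<infinity>"
  shows "integrable lborel (profile w)" and "ennreal (LINT r|lborel. profile w r) = (\<integral>\<^sup>+r. intensity w r \<partial>lborel)"
proof -
  have m: "profile w \<in> borel_measurable lborel" using profile_measurable[OF w] by simp
  have eq: "(\<integral>\<^sup>+r. ennreal (profile w r) \<partial>lborel) = (\<integral>\<^sup>+r. intensity w r \<partial>lborel)"
    unfolding profile_def using fin by (intro nn_integral_cong) (simp add: less_top)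
  show i: "integrable lborel (profile w)"
    using m total eq by (intro integrableI_nonneg) (auto simp: profile_nonneg)
  show "ennreal (LINT r|lborel. profile w r) = (\<integral>\<^sup>+r. intensity w r \<partial>lborel)"
    using nn_integral_eq_integral[OF i] eq by (simp add: profile_nonneg)
qed

lemma levy_density_scale:
  assumes h: "0 < h"
  shows "levy_density \<alpha> (h * x) = h powr (- 2 - \<alpha>) * levy_density \<alpha> x"
proof (cases "0 < x")
  case True
  then show ?thesis using h by (simp add: levy_density_eq powr_mult zero_less_mult_iff)
next
  case False
  then have "\<not> 0 < h * x" using h by (simp add: zero_less_mult_iff)
  then show ?thesis using False by (simp add: levy_density_eq)
qed

text \<open>
  The Levy density is homogeneous of degree \<open>-2 - \<alpha>\<close>, and the substitution \<open>x = h x'\<close> contributes a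
  factor \<open>h\<close>.
\<close>

lemma intensity_scale:
  assumes h: "0 < h" and w: "(\<lambda>(x, r, p). w x r p) \<in> borel_measurable weight_space"
  shows "intensity (\<lambda>x r. w (x / h) (r / h)) r = ennreal (h powr (- 1 - \<alpha>)) * intensity w (r / h)"
proof -
  note [measurable (raw)] = joint_measurable[OF w]
  define F where "F x = (\<integral>\<^sup>+p. ennreal (levy_density \<alpha> x * w (x / h) (r / h) (Y p)) \<partial>E)" for x
  have [measurable]: "F \<in> borel_measurable borel" unfolding F_def[abs_def] by measurable
  have "(\<integral>\<^sup>+x. F x \<partial>lborel) = ennreal \<bar>h\<bar> * (\<integral>\<^sup>+x. F (0 + h * x) \<partial>lborel)"
    by (rule nn_integral_real_affine) (use h in auto)
  also have "(\<integral>\<^sup>+x. F (0 + h * x) \<partial>lborel) = (\<integral>\<^sup>+x. ennreal (h powr (- 2 - \<alpha>)) * (\<integral>\<^sup>+p. ennreal (levy_density \<alpha> x * w x (r / h) (Y p)) \<partial>E) \<partial>lborel)"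
  proof (intro nn_integral_cong)
    fix x
    have "F (0 + h * x) = (\<integral>\<^sup>+p. ennreal (h powr (- 2 - \<alpha>)) * ennreal (levy_density \<alpha> x * w x (r / h) (Y p)) \<partial>E)"
      unfolding F_def using h by (intro nn_integral_cong) (simp add: levy_density_scale ennreal_mult'[symmetric] mult.assoc)
    then show "F (0 + h * x) = ennreal (h powr (- 2 - \<alpha>)) * (\<integral>\<^sup>+p. ennreal (levy_density \<alpha> x * w x (r / h) (Y p)) \<partial>E)"
      by (subst (asm) nn_integral_cmult) measurable
  qed
  also have "\<dots> = ennreal (h powr (- 2 - \<alpha>)) * intensity w (r / h)"
    unfolding intensity_def by (rule nn_integral_cmult) measurable
  also have "ennreal \<bar>h\<bar> * (ennreal (h powr (- 2 - \<alpha>)) * intensity w (r / h)) = ennreal (h * h powr (- 2 - \<alpha>)) * intensity w (r / h)"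
    using h by (simp add: ennreal_mult mult.assoc)
  also have "h * h powr (- 2 - \<alpha>) = h powr (- 1 - \<alpha>)" using h powr_add[of h 1 "- 2 - \<alpha>"] by simp
  finally show ?thesis unfolding intensity_def F_def by simp
qed

lemma profile_scale:
  assumes h: "0 < h" and w: "(\<lambda>(x, r, p). w x r p) \<in> borel_measurable weight_space"
  shows "profile (\<lambda>x r. w (x / h) (r / h)) r = h powr (- 1 - \<alpha>) * profile w (r / h)"
  unfolding profile_def intensity_scale[OF assms] by (simp add: enn2real_mult)

lemma intensity_mono:
  assumes "\<And>x p. 0 < x \<Longrightarrow> w x r p \<le> w' x r p"
  shows "intensity w r \<le> intensity w' r"
  unfolding intensity_def
proof (intro nn_integral_mono ennreal_leI)
  fix x p
  show "levy_density \<alpha> x * w x r (Y p) \<le> levy_density \<alpha> x * w' x r (Y p)"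
  proof (cases "0 < x")
    case True
    then show ?thesis using assms levy_density_nonneg[OF \<alpha>, of x] by (intro mult_left_mono) auto
  qed (simp add: levy_density_def)
qed

lemma profile_mono:
  assumes "\<And>x p. 0 < x \<Longrightarrow> w x r p \<le> w' x r p" and "intensity w' r < \<infinity>"
  shows "profile w r \<le> profile w' r"
  unfolding profile_def
proof (rule enn2real_mono)
  show "intensity w r \<le> intensity w' r" by (rule intensity_mono) (rule assms(1))
qed (use assms(2) in simp)

end

lemma upper_weight_joint': "0 < j \<Longrightarrow> (\<lambda>(x, r, p). upper_weight j x r p) \<in> borel_measurable weight_space"
  and lower_weight_joint': "0 < j \<Longrightarrow> (\<lambda>(x, r, p). lower_weight j x r p) \<in> borel_measurable weight_space"
  unfolding case_prod_beta by measurable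

context excursion_law
begin

lemma chord_slopes:
  "(\<lambda>j. (real j + 2) * (exp (1 / (real j + 2)) - 1)) \<longlonglongrightarrow> 1"
  "(\<lambda>j. (real j + 2) * (1 - exp (- (1 / (real j + 2))))) \<longlonglongrightarrow> 1"
  by real_asymp+

text \<open>
  The exponential inequality with \<open>\<theta> = 1 / j\<close> or \<open>\<theta> = - 1 / j\<close> loses the factor \<open>(exp \<theta> - 1) / \<theta>\<close>,
  which tends to \<open>1\<close>. For large \<open>j\<close> this loss and the one caused by the weights are both small.
\<close>

lemma sharp_profiles:
  assumes d: "0 < d"
  obtains j :: nat where "2 \<le> j" "integrable lborel (profile (upper_weight j))"
    "Gamma (1 - \<alpha>) * (j * (exp (1 / j) - 1)) * (LINT r|lborel. profile (upper_weight j) r) \<le> 1 + d"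
    "1 - d \<le> Gamma (1 - \<alpha>) * (j * (1 - exp (- (1 / j)))) * (LINT r|lborel. profile (lower_weight j) r)"
proof -
  have G: "0 < Gamma (1 - \<alpha>)" using \<alpha> by (intro Gamma_real_pos) auto
  define d' where "d' = min (d / 3) (1 / 2)"
  have d': "0 < d'" "d' \<le> d / 3" "d' < 1" using d by (auto simp: d'_def)
  have "limsup (\<lambda>j. \<integral>\<^sup>+r. intensity (upper_weight (real j + 2)) r \<partial>lborel) < ennreal ((1 + d') / Gamma (1 - \<alpha>))"
    using G d' by (intro le_less_trans[OF limsup_upper_intensity] ennreal_lessI) (auto simp: divide_strict_right_mono)
  then have 1: "\<forall>\<^sub>F j in sequentially. (\<integral>\<^sup>+r. intensity (upper_weight (real j + 2)) r \<partial>lborel) < ennreal ((1 + d') / Gamma (1 - \<alpha>))"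
    by (rule Limsup_lessD)
  have "ennreal ((1 - d') / Gamma (1 - \<alpha>)) < liminf (\<lambda>j. \<integral>\<^sup>+r. intensity (lower_weight (real j + 2)) r \<partial>lborel)"
    using G d' by (intro less_le_trans[OF _ liminf_lower_intensity] ennreal_lessI) (auto simp: divide_strict_right_mono)
  then have 2: "\<forall>\<^sub>F j in sequentially. ennreal ((1 - d') / Gamma (1 - \<alpha>)) < (\<integral>\<^sup>+r. intensity (lower_weight (real j + 2)) r \<partial>lborel)"
    by (rule less_LiminfD)
  have 3: "\<forall>\<^sub>F j in sequentially. (real j + 2) * (exp (1 / (real j + 2)) - 1) < 1 + d'"
    using order_tendstoD(2)[OF chord_slopes(1), of "1 + d'"] d' by simp
  have 4: "\<forall>\<^sub>F j in sequentially. 1 - d' < (real j + 2) * (1 - exp (- (1 / (real j + 2))))"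
    using order_tendstoD(1)[OF chord_slopes(2), of "1 - d'"] d' by simp
  obtain i where i: "(\<integral>\<^sup>+r. intensity (upper_weight (real i + 2)) r \<partial>lborel) < ennreal ((1 + d') / Gamma (1 - \<alpha>))"
     "ennreal ((1 - d') / Gamma (1 - \<alpha>)) < (\<integral>\<^sup>+r. intensity (lower_weight (real i + 2)) r \<partial>lborel)"
     "(real i + 2) * (exp (1 / (real i + 2)) - 1) < 1 + d'" "1 - d' < (real i + 2) * (1 - exp (- (1 / (real i + 2))))"
    using eventually_conj[OF eventually_conj[OF 1 2] eventually_conj[OF 3 4]] unfolding eventually_sequentially by blast
  let ?j = "real i + 2"
  let ?U = "LINT r|lborel. profile (upper_weight ?j) r" and ?V = "LINT r|lborel. profile (lower_weight ?j) r"
  have fU: "intensity (upper_weight ?j) r < \<infinity>" and fV: "intensity (lower_weight ?j) r < \<infinity>" for r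
  proof -
    obtain A where "\<forall>r. intensity (upper_weight ?j) r \<le> ennreal A" using intensity_upper_finite[of ?j] by auto
    then show "intensity (upper_weight ?j) r < \<infinity>" by (auto intro: le_less_trans)
    obtain B where "\<forall>r. intensity (lower_weight ?j) r \<le> ennreal B" using intensity_lower_finite(1)[of ?j] by auto
    then show "intensity (lower_weight ?j) r < \<infinity>" by (auto intro: le_less_trans)
  qed
  have tU: "(\<integral>\<^sup>+r. intensity (upper_weight ?j) r \<partial>lborel) < \<infinity>" using i(1) by (rule less_trans) simp
  have tV: "(\<integral>\<^sup>+r. intensity (lower_weight ?j) r \<partial>lborel) < \<infinity>" by (rule intensity_lower_finite(2)) simp
  have U0: "0 \<le> ?U" and V0: "0 \<le> ?V" by (auto intro!: integral_nonneg_AE simp: profile_nonneg)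
  note U = profile_integral[OF upper_weight_joint' fU tU, simplified] and V = profile_integral[OF lower_weight_joint' fV tV, simplified]
  have "?U < (1 + d') / Gamma (1 - \<alpha>)" using i(1) U(2)[symmetric] U0 by (simp add: ennreal_less_iff)
  then have U1: "Gamma (1 - \<alpha>) * ?U \<le> 1 + d'" using G by (simp add: field_simps)
  have "(1 - d') / Gamma (1 - \<alpha>) < ?V" using i(2) V(2)[symmetric] d' G by (simp add: ennreal_less_iff)
  then have V1: "1 - d' \<le> Gamma (1 - \<alpha>) * ?V" using G by (simp add: field_simps)
  show ?thesis
  proof (rule that[of "i + 2"])
    show "integrable lborel (profile (upper_weight (real (i + 2))))" using U(1) by (simp add: add.commute)
    have "(1 + d') * (1 + d') = 1 + d' * (2 + d')" by (simp add: algebra_simps)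
    also have "d' * (2 + d') \<le> d' * 3" using d' by (intro mult_left_mono) auto
    also have "d' * 3 \<le> d" using d' by simp
    finally have D: "(1 + d') * (1 + d') \<le> 1 + d" by simp
    have "(?j * (exp (1 / ?j) - 1)) * (Gamma (1 - \<alpha>) * ?U) \<le> (1 + d') * (1 + d')"
      using i(3) U1 U0 G d' by (intro mult_mono) auto
    then show "Gamma (1 - \<alpha>) * (real (i + 2) * (exp (1 / real (i + 2)) - 1)) * (LINT r|lborel. profile (upper_weight (real (i + 2))) r) \<le> 1 + d"
      using D by (simp add: add.commute mult_ac)
    have "(1 - d') * (1 - d') = 1 - 2 * d' + d' * d'" by (simp add: algebra_simps)
    moreover have "0 \<le> d' * d'" by (rule zero_le_square)
    ultimately have "1 - d \<le> (1 - d') * (1 - d')" using d' by linarith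
    also have "\<dots> \<le> (?j * (1 - exp (- (1 / ?j)))) * (Gamma (1 - \<alpha>) * ?V)"
      using i(4) V1 V0 G d' by (intro mult_mono) auto
    finally show "1 - d \<le> Gamma (1 - \<alpha>) * (real (i + 2) * (1 - exp (- (1 / real (i + 2))))) * (LINT r|lborel. profile (lower_weight (real (i + 2))) r)"
      by (simp add: add.commute mult_ac)
  qed simp
qed

end

context marked_levy
begin

text \<open>
  Tonelli's theorem; if the intensity is infinite, both sides are \<open>0\<close> by convention.
\<close>

lemma compensator_mean_weight:
  assumes w_bounds: "\<And>x r p. 0 \<le> w x r p" "\<And>x r p. w x r p \<le> 1"
    and w_meas: "(\<lambda>(x, r, p). w x r p) \<in> borel_measurable weight_space"
  shows "compensator (\<lambda>x z. mean_weight w x (y - z)) z = profile w (y - z)"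
proof -
  note [measurable (raw)] = joint_measurable[OF w_meas]
  have i: "integrable M (\<lambda>\<omega>. w x r (mark 0 \<omega>))" for x r
    using w_bounds by (intro integrable_const_bound[of _ 1]) (auto intro!: AE_I2)
  have mw: "0 \<le> mean_weight w x r" for x r
    unfolding mean_weight_def using w_bounds by (intro integral_nonneg_AE) auto
  have [measurable]: "(\<lambda>x. mean_weight w x r) \<in> borel_measurable borel" for r
    unfolding mean_weight_def by measurable
  have inner: "ennreal (mean_weight w x r * levy_density \<alpha> x) = (\<integral>\<^sup>+\<omega>. ennreal (levy_density \<alpha> x * w x r (mark 0 \<omega>)) \<partial>M)" for x r
  proof -
    have "(\<integral>\<^sup>+\<omega>. ennreal (levy_density \<alpha> x * w x r (mark 0 \<omega>)) \<partial>M) = ennreal (LINT \<omega>|M. levy_density \<alpha> x * w x r (mark 0 \<omega>))"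
      using w_bounds levy_density_nonneg[OF \<alpha>, of x] i by (intro nn_integral_eq_integral) auto
    then show ?thesis by (simp add: mean_weight_def mult.commute)
  qed
  have "compensator (\<lambda>x z. mean_weight w x (y - z)) z = enn2real (\<integral>\<^sup>+x. ennreal (mean_weight w x (y - z) * levy_density \<alpha> x) \<partial>lborel)"
    unfolding compensator_def using mw levy_density_nonneg[OF \<alpha>]
    by (intro integral_eq_nn_integral) (auto simp: levy_density_eq)
  then show ?thesis by (simp add: profile_def intensity_def inner)
qed

end

definition smoothed :: "(real \<Rightarrow> real) \<Rightarrow> real \<Rightarrow> real \<Rightarrow> real \<Rightarrow> (real \<Rightarrow> real) \<Rightarrow> real" where
  "smoothed G h y t f = (LINT s|lborel. indicator {0..t} s * (G ((y - f s) / h) / h))"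


section \<open>Concentration around the compensator\<close>

context marked_levy
begin

lemma profile_bounded:
  "1 \<le> j \<Longrightarrow> \<exists>C. \<forall>r. profile (lower_weight j) r \<le> C"
  "2 \<le> j \<Longrightarrow> \<exists>C. \<forall>r. profile (upper_weight j) r \<le> C"
  "2 \<le> j \<Longrightarrow> intensity (upper_weight j) r < \<infinity>"
proof -
  assume "1 \<le> j"
  then obtain B where "\<forall>r. intensity (lower_weight j) r \<le> ennreal B" using intensity_lower_finite(1)[of j] by auto
  then show "\<exists>C. \<forall>r. profile (lower_weight j) r \<le> C"
    unfolding profile_def by (intro exI[of _ "enn2real (ennreal B)"] allI enn2real_mono) auto
next
  assume "2 \<le> j"
  then obtain B where B: "\<forall>r. intensity (upper_weight j) r \<le> ennreal B" using intensity_upper_finite[of j] by auto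
  then show "\<exists>C. \<forall>r. profile (upper_weight j) r \<le> C"
    unfolding profile_def by (intro exI[of _ "enn2real (ennreal B)"] allI enn2real_mono) auto
  show "intensity (upper_weight j) r < \<infinity>" using B by (auto intro: le_less_trans)
qed

lemma smoothed_from_zero:
  assumes cad: "cadlag f" and t: "0 \<le> t" and h: "0 < h" and G: "G \<in> borel_measurable borel"
  shows "(LINT s|lborel. indicator {0<..t} s * (h powr (- 1 - \<alpha>) * G ((y - f s) / h))) = h powr (- \<alpha>) * smoothed G h y t f"
proof -
  note [measurable] = G
  have hp: "h powr (- 1 - \<alpha>) = h powr (- \<alpha>) / h" proof -
    have "- 1 - \<alpha> = - \<alpha> - 1" by simp
    then show ?thesis using h by (simp only: powr_diff powr_one less_imp_le)
  qed
  have "(LINT s|lborel. indicator {0<..t} s * (h powr (- 1 - \<alpha>) * G ((y - f s) / h))) =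
      (LINT s|lborel. indicator {0..t} s * (h powr (- 1 - \<alpha>) * G ((y - f s) / h)))"
    by (intro integral_drop_zero cadlag_compose_measurable[OF cad t]) measurable
  also have "\<dots> = (LINT s|lborel. h powr (- \<alpha>) * (indicator {0..t} s * (G ((y - f s) / h) / h)))"
    unfolding hp by (intro Bochner_Integration.integral_cong) auto
  finally show ?thesis unfolding smoothed_def by simp
qed

text \<open>
  Markov's inequality for the exponential inequality with \<open>\<theta> = - 1 / j\<close>.
\<close>

lemma lower_concentration:
  assumes j: "1 \<le> j" and h: "0 < h" and t: "0 < t"
  obtains B where "B \<in> sets M" "emeasure M B \<le> ennreal (exp (- u))"
    "AE \<omega> in M. \<omega> \<notin> B \<longrightarrow> j * (1 - exp (- (1 / j))) * (h powr (- \<alpha>) * smoothed (profile (lower_weight j)) h y t (\<lambda>s. X s \<omega>)) - j * u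
       \<le> marked_sum (\<lambda>x r. lower_weight j (x / h) (r / h)) (h / j) t y \<omega>"
proof -
  let ?w = "\<lambda>x r. lower_weight j (x / h) (r / h)"
  let ?P = "\<lambda>\<omega>. h powr (- \<alpha>) * smoothed (profile (lower_weight j)) h y t (\<lambda>s. X s \<omega>)"
  have j0: "0 < j" using j by simp
  have m: "(\<lambda>(x, r, p). ?w x r p) \<in> borel_measurable weight_space"
    unfolding case_prod_beta using j0 by measurable
  have "1 / j \<le> j + 1" using j by (simp add: field_simps) (use mult_mono[of 1 j 1 j] in linarith)
  then have ab: "0 < h / j" "h / j \<le> (j + 1) * h" using h j0 mult_right_mono[of "1 / j" "j + 1" h] by auto
  have "outer_le_one M (\<lambda>\<omega>. exp (- (1 / j) * marked_sum ?w (h / j) t y \<omega> - (exp (- (1 / j)) - 1) * predicted ?w t y \<omega>))"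
  proof (rule exponential_inequality[OF ab t _ _ m])
    show "?w x r p = 0" if "x \<notin> {h / j..(j + 1) * h}" for x r p
    proof -
      have "j * (x / h) - 1 \<le> 0 \<or> j + 1 - x / h \<le> 0" using that h j0 by (auto simp: field_simps not_le)
      then show ?thesis by (auto simp: lower_weight_def clip_eq_0)
    qed
    show "(\<lambda>n. ?w (A n) (B n) p) \<longlonglongrightarrow> ?w x r p" if "excursion_path p" "A \<longlonglongrightarrow> x" "B \<longlonglongrightarrow> r" for p A B x r
      using h by (intro lower_weight_tendsto j0 that tendsto_intros) auto
  qed (use j0 lower_weight_bounds in auto)
  from outer_le_one_markov[OF this, of u] obtain B where B: "B \<in> sets M" "emeasure M B \<le> ennreal (exp (- u))"
    and lt: "AE \<omega> in M. \<omega> \<notin> B \<longrightarrow> exp (- (1 / j) * marked_sum ?w (h / j) t y \<omega> - (exp (- (1 / j)) - 1) * predicted ?w t y \<omega>) < exp u"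
    by blast
  show ?thesis
  proof (rule that[OF B])
    show "AE \<omega> in M. \<omega> \<notin> B \<longrightarrow> j * (1 - exp (- (1 / j))) * ?P \<omega> - j * u \<le> marked_sum ?w (h / j) t y \<omega>"
      using lt AE_cadlag
    proof eventually_elim
      case (elim \<omega>)
      show ?case
      proof
        assume "\<omega> \<notin> B"
        have "predicted ?w t y \<omega> = ?P \<omega>"
          unfolding predicted_def
            compensator_mean_weight[where w = ?w, OF lower_weight_bounds(1)[OF j0] lower_weight_bounds(2)[OF j0] m]
            profile_scale[OF h lower_weight_joint'[OF j0]]
          using smoothed_from_zero[OF elim(2) _ h profile_measurable[OF lower_weight_joint'[OF j0]]] t by simp
        then have "- (1 / j) * marked_sum ?w (h / j) t y \<omega> - (exp (- (1 / j)) - 1) * ?P \<omega> < u"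
          using elim(1) \<open>\<omega> \<notin> B\<close> by simp
        then have "j * (- (1 / j) * marked_sum ?w (h / j) t y \<omega> - (exp (- (1 / j)) - 1) * ?P \<omega>) \<le> j * u"
          using j0 by (intro mult_left_mono) auto
        moreover have "j * (- (1 / j) * marked_sum ?w (h / j) t y \<omega> - (exp (- (1 / j)) - 1) * ?P \<omega>)
           = j * (1 - exp (- (1 / j))) * ?P \<omega> - marked_sum ?w (h / j) t y \<omega>"
          using j0 by (simp add: algebra_simps)
        ultimately show "j * (1 - exp (- (1 / j))) * ?P \<omega> - j * u \<le> marked_sum ?w (h / j) t y \<omega>" by linarith
      qed
    qed
  qed
qed

text \<open>
  Markov's inequality with \<open>\<theta> = 1 / j\<close>. The upper weight has no reason to vanish for small or large
  jumps, so the exponential inequality is used for truncated weights and passed to the limit. The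
  sum over all jumps could be infinite; hence the bound is stated for all finite sets of jumps.
\<close>

lemma upper_concentration:
  assumes j: "2 \<le> j" and h: "0 < h" and t: "0 < t"
  obtains B where "B \<in> sets M" "emeasure M B \<le> ennreal (exp (- u))"
    "AE \<omega> in M. \<omega> \<notin> B \<longrightarrow> (\<forall>F. finite F \<longrightarrow> F \<subseteq> {n. \<tau> n \<omega> \<in> {0<..t} \<and> 0 < jump (\<lambda>s. X s \<omega>) (\<tau> n \<omega>)} \<longrightarrow>
       (\<Sum>n\<in>F. upper_weight j (jump (\<lambda>s. X s \<omega>) (\<tau> n \<omega>) / h) ((y - left_limit (\<lambda>s. X s \<omega>) (\<tau> n \<omega>)) / h) (mark n \<omega>))
       \<le> j * (exp (1 / j) - 1) * (h powr (- \<alpha>) * smoothed (profile (upper_weight j)) h y t (\<lambda>s. X s \<omega>)) + j * u)"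
proof -
  let ?W = "\<lambda>x r. upper_weight j (x / h) (r / h)"
  let ?P = "\<lambda>\<omega>. h powr (- \<alpha>) * smoothed (profile (upper_weight j)) h y t (\<lambda>s. X s \<omega>)"
  let ?J = "\<lambda>\<omega>. {n. \<tau> n \<omega> \<in> {0<..t} \<and> 0 < jump (\<lambda>s. X s \<omega>) (\<tau> n \<omega>)}"
  let ?S = "\<lambda>F \<omega>. \<Sum>n\<in>F. ?W (jump (\<lambda>s. X s \<omega>) (\<tau> n \<omega>)) (y - left_limit (\<lambda>s. X s \<omega>) (\<tau> n \<omega>)) (mark n \<omega>)"
  have j0: "0 < j" using j by simp
  have c0: "0 \<le> exp (1 / j) - 1" using j0 by simp
  \<comment> \<open>Truncated to sizes between \<open>h / (m + 1)\<close> and \<open>(m + 2) h\<close>.\<close>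
  define w where "w m x r p = clip (real (Suc m) * (x / h) - 1) * clip (real (Suc m) + 1 - x / h) * ?W x r p" for m x r p
  have w_bounds: "0 \<le> w m x r p" "w m x r p \<le> 1" "w m x r p \<le> ?W x r p" for m x r p
    unfolding w_def using upper_weight_bounds[OF j0, of "x / h" "r / h" p]
    by (auto intro!: mult_le_one mult_left_le_one_le)
  have m: "(\<lambda>(x, r, p). w m x r p) \<in> borel_measurable weight_space" for m
    unfolding case_prod_beta w_def using j0 by measurable
  define f where "f m \<omega> = exp ((1 / j) * marked_sum (w m) (h / real (Suc m)) t y \<omega> - (exp (1 / j) - 1) * predicted (w m) t y \<omega>)" for m \<omega>
  have out: "outer_le_one M (f m)" for m
    unfolding f_def
  proof (rule exponential_inequality[OF _ _ t _ _ m])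
    show "0 < h / real (Suc m)" using h by simp
    have "1 / real (Suc m) \<le> real (Suc m) + 1" by (simp add: divide_le_eq algebra_simps)
    from mult_right_mono[OF this, of h] show "h / real (Suc m) \<le> (real (Suc m) + 1) * h" using h by simp
    show "w m x r p = 0" if "x \<notin> {h / real (Suc m)..(real (Suc m) + 1) * h}" for x r p
    proof -
      have "real (Suc m) * (x / h) - 1 \<le> 0 \<or> real (Suc m) + 1 - x / h \<le> 0" using that h by (auto simp: field_simps not_le)
      then show ?thesis by (auto simp: w_def clip_eq_0)
    qed
    show "(\<lambda>n. w m (A n) (B n) p) \<longlonglongrightarrow> w m x r p" if "excursion_path p" "A \<longlonglongrightarrow> x" "B \<longlonglongrightarrow> r" for p A B x r
      unfolding w_def using h by (intro upper_weight_tendsto tendsto_clip j0 that tendsto_intros) auto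
  qed (use w_bounds in auto)
  \<comment> \<open>By Markov's inequality for \<open>g\<close> the bound is violated by some finite set of jumps with
    probability at most \<open>exp (- u)\<close>. A fixed finite set is not affected by the truncation
    when \<open>m\<close> is large.\<close>
  define g where "g \<omega> = (if \<exists>F. finite F \<and> F \<subseteq> ?J \<omega> \<and> (exp (1 / j) - 1) * ?P \<omega> + u \<le> (1 / j) * ?S F \<omega> then exp u else 0)" for \<omega>
  have "outer_le_one M g"
  proof (rule outer_le_one_liminf[OF out])
    show "AE \<omega> in M. \<forall>\<^sub>F m in sequentially. g \<omega> \<le> f m \<omega>"
      using AE_cadlag enumeration
    proof eventually_elim
      case (elim \<omega>)
      let ?f = "\<lambda>s. X s \<omega>"
      have pred: "predicted (w m) t y \<omega> \<le> ?P \<omega>" for m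
      proof -
        obtain C where C: "\<And>r. profile (upper_weight j) r \<le> C" using profile_bounded(2)[OF j] by blast
        have Wm: "profile (upper_weight j) \<in> borel_measurable borel" by (rule profile_measurable[OF upper_weight_joint'[OF j0]])
        note [measurable] = Wm
        have fin: "intensity ?W r < \<infinity>" for r
          unfolding intensity_scale[OF h upper_weight_joint'[OF j0]] using profile_bounded(3)[OF j] by (simp add: ennreal_mult_less_top)
        have int: "integrable lborel (\<lambda>s. indicator {0..t} s * (h powr (- 1 - \<alpha>) * profile (upper_weight j) ((y - X s \<omega>) / h)))"
        proof (rule cadlag_compose_integrable[OF elim(1), where B = "h powr (- 1 - \<alpha>) * C"])
          show "0 \<le> t" using t by simp
          show "(\<lambda>z. h powr (- 1 - \<alpha>) * profile (upper_weight j) ((y - z) / h)) \<in> borel_measurable borel" by measurable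
          show "\<bar>h powr (- 1 - \<alpha>) * profile (upper_weight j) ((y - z) / h)\<bar> \<le> h powr (- 1 - \<alpha>) * C" for z
            using C[of "(y - z) / h"] by (auto simp: profile_nonneg abs_mult intro!: mult_left_mono)
        qed
        have int: "integrable lborel (\<lambda>s. indicator {0<..t} s * (h powr (- 1 - \<alpha>) * profile (upper_weight j) ((y - X s \<omega>) / h)))"
        proof -
          have "(\<lambda>s. indicator {0<..t} s * (h powr (- 1 - \<alpha>) * profile (upper_weight j) ((y - X s \<omega>) / h)))
             = (\<lambda>s. indicator {0<..t} s *\<^sub>R (indicator {0..t} s * (h powr (- 1 - \<alpha>) * profile (upper_weight j) ((y - X s \<omega>) / h))))"
            by (auto simp: indicator_def)
          then show ?thesis using integrable_mult_indicator[OF _ int, of "{0<..t}"] by simp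
        qed
        have "predicted (w m) t y \<omega> \<le> (LINT s|lborel. indicator {0<..t} s * (h powr (- 1 - \<alpha>) * profile (upper_weight j) ((y - X s \<omega>) / h)))"
          unfolding predicted_def compensator_mean_weight[where w = "w m", OF w_bounds(1,2) m]
        proof (rule integral_mono'[OF int])
          fix s
          have "profile (w m) (y - X s \<omega>) \<le> profile ?W (y - X s \<omega>)" by (rule profile_mono[OF w_bounds(3) fin])
          then show "indicator {0<..t} s * profile (w m) (y - X s \<omega>) \<le> indicator {0<..t} s * (h powr (- 1 - \<alpha>) * profile (upper_weight j) ((y - X s \<omega>) / h))"
            unfolding profile_scale[OF h upper_weight_joint'[OF j0]] by (intro mult_left_mono) auto
        qed (auto simp: profile_nonneg)
        also have "\<dots> = ?P \<omega>" using t by (intro smoothed_from_zero[OF elim(1) _ h Wm]) auto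
        finally show ?thesis .
      qed
      show ?case
      proof (cases "\<exists>F. finite F \<and> F \<subseteq> ?J \<omega> \<and> (exp (1 / j) - 1) * ?P \<omega> + u \<le> (1 / j) * ?S F \<omega>")
        case True
        then obtain F where F: "finite F" "F \<subseteq> ?J \<omega>" "(exp (1 / j) - 1) * ?P \<omega> + u \<le> (1 / j) * ?S F \<omega>" by blast
        have "\<forall>\<^sub>F m in sequentially. \<forall>n\<in>F. 2 \<le> real (Suc m) * (jump ?f (\<tau> n \<omega>) / h) \<and> jump ?f (\<tau> n \<omega>) / h \<le> real (Suc m)"
          unfolding eventually_ball_finite_distrib[OF F(1)]
        proof
          fix n assume "n \<in> F"
          then have "0 < jump ?f (\<tau> n \<omega>) / h" using F h by auto
          moreover have lim: "filterlim (\<lambda>m. real (Suc m)) at_top sequentially" by real_asymp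
          ultimately have "filterlim (\<lambda>m. real (Suc m) * (jump ?f (\<tau> n \<omega>) / h)) at_top sequentially"
            by (intro filterlim_at_top_mult_tendsto_pos[OF tendsto_const])
          with lim
          show "\<forall>\<^sub>F m in sequentially. 2 \<le> real (Suc m) * (jump ?f (\<tau> n \<omega>) / h) \<and> jump ?f (\<tau> n \<omega>) / h \<le> real (Suc m)"
            unfolding filterlim_at_top by (intro eventually_conj) blast+
        qed
        then show ?thesis
        proof eventually_elim
          case (elim m)
          have "?S F \<omega> = (\<Sum>n\<in>F. w m (jump ?f (\<tau> n \<omega>)) (y - left_limit ?f (\<tau> n \<omega>)) (mark n \<omega>))"
          proof (rule sum.cong[OF refl])
            fix n assume "n \<in> F"
            then have "clip (real (Suc m) * (jump ?f (\<tau> n \<omega>) / h) - 1) = 1" "clip (real (Suc m) + 1 - jump ?f (\<tau> n \<omega>) / h) = 1"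
              using elim by (auto intro!: clip_eq_1 simp del: of_nat_Suc)
            then show "?W (jump ?f (\<tau> n \<omega>)) (y - left_limit ?f (\<tau> n \<omega>)) (mark n \<omega>) = w m (jump ?f (\<tau> n \<omega>)) (y - left_limit ?f (\<tau> n \<omega>)) (mark n \<omega>)"
              unfolding w_def by simp
          qed
          also have "\<dots> \<le> marked_sum (w m) (h / real (Suc m)) t y \<omega>"
            unfolding marked_sum_def
          proof (rule sum_mono2)
            show "finite {n. \<tau> n \<omega> \<in> {0<..t} \<and> h / real (Suc m) \<le> jump ?f (\<tau> n \<omega>)}"
              by (rule marked_jumps(2)[OF \<open>cadlag ?f\<close> \<open>\<forall>t\<ge>0. _ t\<close>]) (use h in auto)
            have "h / real (Suc m) \<le> jump ?f (\<tau> n \<omega>)" if "n \<in> F" for n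
            proof -
              have "1 \<le> real (Suc m) * (jump ?f (\<tau> n \<omega>) / h)" using elim that by force
              then show ?thesis using h by (simp add: field_simps del: of_nat_Suc)
            qed
            then show "F \<subseteq> {n. \<tau> n \<omega> \<in> {0<..t} \<and> h / real (Suc m) \<le> jump ?f (\<tau> n \<omega>)}" using F(2) by auto
          qed (use w_bounds in auto)
          finally have "(1 / j) * ?S F \<omega> \<le> (1 / j) * marked_sum (w m) (h / real (Suc m)) t y \<omega>" using j0 by (intro mult_left_mono) auto
          moreover have "(exp (1 / j) - 1) * predicted (w m) t y \<omega> \<le> (exp (1 / j) - 1) * ?P \<omega>" by (rule mult_left_mono[OF pred c0])
          ultimately have "u \<le> (1 / j) * marked_sum (w m) (h / real (Suc m)) t y \<omega> - (exp (1 / j) - 1) * predicted (w m) t y \<omega>"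
            using F(3) by linarith
          then show "g \<omega> \<le> f m \<omega>" unfolding g_def f_def by auto
        qed
      qed (auto simp: g_def f_def)
    qed
  qed
  from outer_le_one_markov[OF this, of u] obtain B where B: "B \<in> sets M" "emeasure M B \<le> ennreal (exp (- u))"
    and lt: "AE \<omega> in M. \<omega> \<notin> B \<longrightarrow> g \<omega> < exp u" by blast
  show ?thesis
  proof (rule that[OF B])
    show "AE \<omega> in M. \<omega> \<notin> B \<longrightarrow> (\<forall>F. finite F \<longrightarrow> F \<subseteq> ?J \<omega> \<longrightarrow> ?S F \<omega> \<le> j * (exp (1 / j) - 1) * ?P \<omega> + j * u)"
      using lt
    proof eventually_elim
      case (elim \<omega>)
      show ?case
      proof (intro impI allI)
        fix F assume F: "\<omega> \<notin> B" "finite F" "F \<subseteq> ?J \<omega>"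
        have "\<not> (\<exists>F. finite F \<and> F \<subseteq> ?J \<omega> \<and> (exp (1 / j) - 1) * ?P \<omega> + u \<le> (1 / j) * ?S F \<omega>)"
        proof
          assume "\<exists>F. finite F \<and> F \<subseteq> ?J \<omega> \<and> (exp (1 / j) - 1) * ?P \<omega> + u \<le> (1 / j) * ?S F \<omega>"
          then have "g \<omega> = exp u" unfolding g_def by (rule if_P)
          then show False using elim F(1) by simp
        qed
        then have "\<not> (exp (1 / j) - 1) * ?P \<omega> + u \<le> (1 / j) * ?S F \<omega>" using F(2,3) by blast
        then have "(1 / j) * ?S F \<omega> \<le> (exp (1 / j) - 1) * ?P \<omega> + u" by simp
        then have "j * ((1 / j) * ?S F \<omega>) \<le> j * ((exp (1 / j) - 1) * ?P \<omega> + u)" using j0 by (intro mult_left_mono) auto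
        then show "?S F \<omega> \<le> j * (exp (1 / j) - 1) * ?P \<omega> + j * u" using j0 by (simp add: algebra_simps)
      qed
    qed
  qed
qed

end


section \<open>Counts between weighted sums, on all levels at once\<close>

lemma emeasure_count_space_le:
  assumes "\<And>F. finite F \<Longrightarrow> F \<subseteq> N \<Longrightarrow> real (card F) \<le> c"
  shows "enn2ereal (emeasure (count_space UNIV) N) \<le> ereal c"
proof (cases "finite N")
  case True
  then show ?thesis using assms[OF True order_refl] by (simp add: ennreal_of_nat_eq_real_of_nat)
next
  case False
  obtain F where "finite F" "F \<subseteq> N" "card F = Suc (nat \<lceil>c\<rceil>)" using infinite_arbitrarily_large[OF False] by blast
  with assms[of F] have False by (simp add: of_nat_ceiling) linarith
  then show ?thesis ..
qed

lemma emeasure_count_space_ge: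
  assumes "finite F" "F \<subseteq> N" "c \<le> real (card F)"
  shows "ereal c \<le> enn2ereal (emeasure (count_space UNIV) N)"
proof -
  have "emeasure (count_space UNIV) F \<le> emeasure (count_space UNIV) N" using assms by (intro emeasure_mono) auto
  then have "ennreal (real (card F)) \<le> emeasure (count_space UNIV) N" using assms by (simp add: ennreal_of_nat_eq_real_of_nat)
  then have "enn2ereal (ennreal (real (card F))) \<le> enn2ereal (emeasure (count_space UNIV) N)" by (simp add: less_eq_ennreal.rep_eq)
  then show ?thesis using assms(3) by (simp add: enn2ereal_ennreal order_trans[of "ereal c" "ereal (real (card F))"])
qed

context marked_levy
begin

definition marked_path :: "(real \<Rightarrow> real \<Rightarrow> 'w \<Rightarrow> real) \<Rightarrow> 'w \<Rightarrow> bool" where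
  "marked_path Z \<omega> \<longleftrightarrow> cadlag (\<lambda>u. X u \<omega>) \<and> (\<forall>t\<ge>0. 0 < jump (\<lambda>u. X u \<omega>) t \<longrightarrow> (\<exists>!n. \<tau> n \<omega> = t)) \<and> (\<forall>n. excursion_path (mark n \<omega>)) \<and>
     (\<forall>t\<ge>0. \<forall>s. let x = jump (\<lambda>u. X u \<omega>) t in
           (s \<notin> {0<..<x} \<longrightarrow> Z t s \<omega> = 0) \<and>
           (s \<in> {0<..<x} \<longrightarrow> (\<forall>n. \<tau> n \<omega> = t \<longrightarrow> Z t s \<omega> = x * e n (s / x) \<omega>)))"

lemma counted_jump:
  assumes mp: "marked_path Z \<omega>" and h: "0 < h" and s: "0 \<le> s" "h \<le> Z s (y - left_limit (\<lambda>u. X u \<omega>) s) \<omega>"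
  obtains n where "\<tau> n \<omega> = s" "0 < s" "0 < y - left_limit (\<lambda>u. X u \<omega>) s" "y - left_limit (\<lambda>u. X u \<omega>) s < jump (\<lambda>u. X u \<omega>) s"
    "h \<le> jump (\<lambda>u. X u \<omega>) s * mark n \<omega> ((y - left_limit (\<lambda>u. X u \<omega>) s) / jump (\<lambda>u. X u \<omega>) s)"
proof -
  let ?x = "jump (\<lambda>u. X u \<omega>) s" and ?r = "y - left_limit (\<lambda>u. X u \<omega>) s"
  have m: "?r \<notin> {0<..<?x} \<Longrightarrow> Z s ?r \<omega> = 0" "\<And>n. ?r \<in> {0<..<?x} \<Longrightarrow> \<tau> n \<omega> = s \<Longrightarrow> Z s ?r \<omega> = ?x * e n (?r / ?x) \<omega>"
    using mp s(1) unfolding marked_path_def Let_def by blast+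
  have r: "?r \<in> {0<..<?x}" using m(1) s h by (metis not_le)
  then have x: "0 < ?x" by auto
  then obtain n where n: "\<tau> n \<omega> = s" using mp s(1) unfolding marked_path_def by blast
  show ?thesis
  proof (rule that[OF n])
    show "0 < s" using x s(1) by (cases "s = 0") (auto simp: jump_def left_limit_def)
    have "?r / ?x \<in> {0..1}" using r by auto
    then show "h \<le> ?x * mark n \<omega> (?r / ?x)" using m(2)[OF r n] s(2) by (simp add: path_of_def)
  qed (use r in auto)
qed

text \<open>
  Every counted jump has upper weight \<open>1\<close> at each level \<open>y'\<close> close to \<open>y\<close>, so the number of counted
  jumps is a sum of upper weights at \<open>y'\<close>.
\<close>

lemma mass_count_upper:
  assumes mp: "marked_path Z \<omega>" and h: "0 < h" and j: "0 < j" and y: "\<bar>y - y'\<bar> \<le> h / j"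
    and bound: "\<And>F. finite F \<Longrightarrow> F \<subseteq> {n. \<tau> n \<omega> \<in> {0<..t} \<and> 0 < jump (\<lambda>s. X s \<omega>) (\<tau> n \<omega>)} \<Longrightarrow>
       (\<Sum>n\<in>F. upper_weight j (jump (\<lambda>s. X s \<omega>) (\<tau> n \<omega>) / h) ((y' - left_limit (\<lambda>s. X s \<omega>) (\<tau> n \<omega>)) / h) (mark n \<omega>)) \<le> c"
  shows "mass_count X Z h y t \<omega> \<le> ereal c"
  unfolding mass_count_def
proof (rule emeasure_count_space_le)
  let ?l = "left_limit (\<lambda>u. X u \<omega>)" and ?x = "jump (\<lambda>u. X u \<omega>)"
  fix F assume F: "finite F" "F \<subseteq> {s \<in> {0..t}. h \<le> Z s (y - ?l s) \<omega>}"
  have "\<exists>n. \<tau> n \<omega> = s \<and> 0 < s \<and> 0 < y - ?l s \<and> y - ?l s < ?x s \<and> h \<le> ?x s * mark n \<omega> ((y - ?l s) / ?x s)" if s: "s \<in> F" for s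
  proof -
    have "0 \<le> s" "h \<le> Z s (y - ?l s) \<omega>" using F s by auto
    from counted_jump[OF mp h this] show ?thesis by metis
  qed
  then obtain n where n: "\<And>s. s \<in> F \<Longrightarrow> \<tau> (n s) \<omega> = s \<and> 0 < s \<and> 0 < y - ?l s \<and> y - ?l s < ?x s \<and> h \<le> ?x s * mark (n s) \<omega> ((y - ?l s) / ?x s)"
    by metis
  have inj: "inj_on n F" by (rule inj_onI) (metis n)
  have one: "upper_weight j (?x s / h) ((y' - ?l s) / h) (mark (n s) \<omega>) = 1" if s: "s \<in> F" for s
  proof (rule upper_weight_eq_1[OF j])
    note n = n[OF s]
    have x: "0 < ?x s" using n by linarith
    show "excursion_path (mark (n s) \<omega>)" using mp by (simp add: marked_path_def)
    show "(y - ?l s) / ?x s \<in> {0..1}" using n x by auto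
    have "?x s / h * ((y - ?l s) / ?x s) - (y' - ?l s) / h = (y - y') / h" using x h by (simp add: field_simps)
    then show "\<bar>?x s / h * ((y - ?l s) / ?x s) - (y' - ?l s) / h\<bar> \<le> 1 / j" using y h j by (simp add: field_simps)
    show "1 \<le> ?x s / h * mark (n s) \<omega> ((y - ?l s) / ?x s)" using n h by (simp add: field_simps)
  qed
  have "real (card F) = (\<Sum>s\<in>F. upper_weight j (?x s / h) ((y' - ?l s) / h) (mark (n s) \<omega>))" using one by simp
  also have "\<dots> = (\<Sum>s\<in>F. upper_weight j (?x (\<tau> (n s) \<omega>) / h) ((y' - ?l (\<tau> (n s) \<omega>)) / h) (mark (n s) \<omega>))" using n by simp
  also have "\<dots> = (\<Sum>m\<in>n ` F. upper_weight j (?x (\<tau> m \<omega>) / h) ((y' - ?l (\<tau> m \<omega>)) / h) (mark m \<omega>))"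
    by (subst sum.reindex[OF inj]) simp
  also have "\<dots> \<le> c"
  proof (rule bound)
    show "n ` F \<subseteq> {n. \<tau> n \<omega> \<in> {0<..t} \<and> 0 < ?x (\<tau> n \<omega>)}"
    proof
      fix m assume "m \<in> n ` F"
      then obtain s where s: "s \<in> F" "m = n s" by blast
      then show "m \<in> {n. \<tau> n \<omega> \<in> {0<..t} \<and> 0 < ?x (\<tau> n \<omega>)}" using n[OF s(1)] F by auto
    qed
  qed (use F in simp)
  finally show "real (card F) \<le> c" .
qed

text \<open>
  A jump whose lower weight at \<open>y'\<close> is positive is counted at every level \<open>y\<close> close to \<open>y'\<close>.
\<close>

lemma mass_count_lower:
  assumes mp: "marked_path Z \<omega>" and h: "0 < h" and j: "0 < j" and y: "\<bar>y - y'\<bar> < h / j"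
  shows "ereal (marked_sum (\<lambda>x r. lower_weight j (x / h) (r / h)) (h / j) t y' \<omega>) \<le> mass_count X Z h y t \<omega>"
proof -
  let ?l = "left_limit (\<lambda>u. X u \<omega>)" and ?x = "jump (\<lambda>u. X u \<omega>)"
  let ?I = "{n. \<tau> n \<omega> \<in> {0<..t} \<and> h / j \<le> ?x (\<tau> n \<omega>)}"
  let ?w = "\<lambda>n. lower_weight j (?x (\<tau> n \<omega>) / h) ((y' - ?l (\<tau> n \<omega>)) / h) (mark n \<omega>)"
  have cad: "cadlag (\<lambda>u. X u \<omega>)" and en: "\<forall>t\<ge>0. 0 < ?x t \<longrightarrow> (\<exists>!n. \<tau> n \<omega> = t)" and ep: "\<And>n. excursion_path (mark n \<omega>)"
    and mk: "\<And>t s n. 0 \<le> t \<Longrightarrow> s \<in> {0<..<?x t} \<Longrightarrow> \<tau> n \<omega> = t \<Longrightarrow> Z t s \<omega> = ?x t * e n (s / ?x t) \<omega>"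
    using mp unfolding marked_path_def Let_def by blast+
  have hj: "0 < h / j" using h j by simp
  note b = marked_jumps[OF cad en hj, of t]
  define J where "J = {n \<in> ?I. 0 < ?w n}"
  have J2: "J \<subseteq> ?I" unfolding J_def by blast
  have J: "finite J" "J \<subseteq> ?I" using finite_subset[OF J2 b(2)] J2 by blast+
  have inj: "inj_on (\<lambda>n. \<tau> n \<omega>) J" using b(1) J(2) by (meson bij_betw_def inj_on_subset)
  have "marked_sum (\<lambda>x r. lower_weight j (x / h) (r / h)) (h / j) t y' \<omega> = (\<Sum>n\<in>J. ?w n)"
    unfolding marked_sum_def
  proof (rule sum.mono_neutral_right[OF b(2) J(2)])
    show "\<forall>n\<in>?I - J. ?w n = 0" using lower_weight_bounds(1)[OF j] by (auto simp: J_def not_less intro: antisym)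
  qed
  also have "\<dots> \<le> (\<Sum>n\<in>J. 1)" using lower_weight_bounds(2)[OF j] by (intro sum_mono) auto
  also have "\<dots> = real (card ((\<lambda>n. \<tau> n \<omega>) ` J))" using card_image[OF inj] by simp
  finally have le: "marked_sum (\<lambda>x r. lower_weight j (x / h) (r / h)) (h / j) t y' \<omega> \<le> real (card ((\<lambda>n. \<tau> n \<omega>) ` J))" .
  show ?thesis unfolding mass_count_def
  proof (rule emeasure_count_space_ge[OF _ _ le])
    show "(\<lambda>n. \<tau> n \<omega>) ` J \<subseteq> {s \<in> {0..t}. h \<le> Z s (y - ?l s) \<omega>}"
    proof safe
      fix n assume n: "n \<in> J"
      let ?s = "\<tau> n \<omega>"
      have s: "?s \<in> {0<..t}" "0 < ?w n" using n by (auto simp: J_def)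
      then show "?s \<in> {0..t}" by auto
      have "\<bar>(y - ?l ?s) / h - (y' - ?l ?s) / h\<bar> < 1 / j"
      proof -
        have "(y - ?l ?s) / h - (y' - ?l ?s) / h = (y - y') / h" by (simp add: diff_divide_distrib)
        then show ?thesis using y h j by (simp add: field_simps)
      qed
      note p = lower_weight_pos[OF j ep s(2) this]
      have r: "y - ?l ?s \<in> {0<..<?x ?s}" using p(3,4) h by (auto simp: zero_less_divide_iff divide_less_cancel)
      then have x: "0 < ?x ?s" "(y - ?l ?s) / ?x ?s \<in> {0..1}" by auto
      have "h \<le> ?x ?s * mark n \<omega> ((y - ?l ?s) / ?x ?s)" 
      proof -
        have "(y - ?l ?s) / h / (?x ?s / h) = (y - ?l ?s) / ?x ?s" using h by simp
        with p(5) h have "1 \<le> ?x ?s * mark n \<omega> ((y - ?l ?s) / ?x ?s) / h" by simp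
        then show ?thesis using h by (simp add: le_divide_eq)
      qed
      moreover have "Z ?s (y - ?l ?s) \<omega> = ?x ?s * mark n \<omega> ((y - ?l ?s) / ?x ?s)"
        using mk[OF _ r refl] s x(2) by (simp add: path_of_def)
      ultimately show "h \<le> Z ?s (y - ?l ?s) \<omega>" by simp
    qed
  qed (use J in simp)
qed

text \<open>
  The bounds of the two concentration lemmas at height \<open>h = 1 / k\<close>, with deviation \<open>u = 3 ln k\<close>.
\<close>

definition concentrated :: "real \<Rightarrow> nat \<Rightarrow> real \<Rightarrow> real \<Rightarrow> 'w \<Rightarrow> bool" where
  "concentrated j k y t \<omega> \<longleftrightarrow>
     (\<forall>F. finite F \<longrightarrow> F \<subseteq> {n. \<tau> n \<omega> \<in> {0<..t} \<and> 0 < jump (\<lambda>s. X s \<omega>) (\<tau> n \<omega>)} \<longrightarrow>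
       (\<Sum>n\<in>F. upper_weight j (jump (\<lambda>s. X s \<omega>) (\<tau> n \<omega>) / (1 / k)) ((y - left_limit (\<lambda>s. X s \<omega>) (\<tau> n \<omega>)) / (1 / k)) (mark n \<omega>))
       \<le> j * (exp (1 / j) - 1) * ((1 / k) powr (- \<alpha>) * smoothed (profile (upper_weight j)) (1 / k) y t (\<lambda>s. X s \<omega>)) + j * (3 * ln k)) \<and>
     j * (1 - exp (- (1 / j))) * ((1 / k) powr (- \<alpha>) * smoothed (profile (lower_weight j)) (1 / k) y t (\<lambda>s. X s \<omega>)) - j * (3 * ln k)
       \<le> marked_sum (\<lambda>x r. lower_weight j (x / (1 / k)) (r / (1 / k))) (1 / k / j) t y \<omega>"

lemma concentrated_outside_small_set:
  assumes j: "2 \<le> j" and k: "0 < k" and t: "0 < t"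
  shows "\<exists>B\<in>sets M. emeasure M B \<le> ennreal (2 / real k ^ 3) \<and> (AE \<omega> in M. \<omega> \<notin> B \<longrightarrow> concentrated j k y t \<omega>)"
proof -
  have h: "0 < 1 / real k" and j1: "1 \<le> j" using j k by auto
  have "exp (- (3 * ln (real k))) = inverse (exp (ln (real k)) ^ 3)" by (simp add: exp_minus flip: exp_of_nat_mult)
  then have ek: "exp (- (3 * ln (real k))) = 1 / real k ^ 3" using k by (simp add: divide_inverse)
  obtain A where A: "A \<in> sets M" "emeasure M A \<le> ennreal (1 / real k ^ 3)"
    "AE \<omega> in M. \<omega> \<notin> A \<longrightarrow> (\<forall>F. finite F \<longrightarrow> F \<subseteq> {n. \<tau> n \<omega> \<in> {0<..t} \<and> 0 < jump (\<lambda>s. X s \<omega>) (\<tau> n \<omega>)} \<longrightarrow>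
       (\<Sum>n\<in>F. upper_weight j (jump (\<lambda>s. X s \<omega>) (\<tau> n \<omega>) / (1 / k)) ((y - left_limit (\<lambda>s. X s \<omega>) (\<tau> n \<omega>)) / (1 / k)) (mark n \<omega>))
       \<le> j * (exp (1 / j) - 1) * ((1 / k) powr (- \<alpha>) * smoothed (profile (upper_weight j)) (1 / k) y t (\<lambda>s. X s \<omega>)) + j * (3 * ln k))"
    using upper_concentration[OF j h t, of "3 * ln (real k)" y] unfolding ek by blast
  obtain B where B: "B \<in> sets M" "emeasure M B \<le> ennreal (1 / real k ^ 3)"
    "AE \<omega> in M. \<omega> \<notin> B \<longrightarrow> j * (1 - exp (- (1 / j))) * ((1 / k) powr (- \<alpha>) * smoothed (profile (lower_weight j)) (1 / k) y t (\<lambda>s. X s \<omega>)) - j * (3 * ln k)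
       \<le> marked_sum (\<lambda>x r. lower_weight j (x / (1 / k)) (r / (1 / k))) (1 / k / j) t y \<omega>"
    using lower_concentration[OF j1 h t, of "3 * ln (real k)" y] unfolding ek by blast
  show ?thesis
  proof (intro bexI[of _ "A \<union> B"] conjI)
    have "emeasure M (A \<union> B) \<le> emeasure M A + emeasure M B" using A B by (intro emeasure_subadditive)
    also have "\<dots> \<le> ennreal (1 / real k ^ 3) + ennreal (1 / real k ^ 3)" using A B by (intro add_mono)
    also have "\<dots> = ennreal (2 / real k ^ 3)" by (subst ennreal_plus[symmetric]) (auto simp: add_divide_distrib[symmetric])
    finally show "emeasure M (A \<union> B) \<le> ennreal (2 / real k ^ 3)" .
    show "AE \<omega> in M. \<omega> \<notin> A \<union> B \<longrightarrow> concentrated j k y t \<omega>"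
      using A(3) B(3) by eventually_elim (simp add: concentrated_def)
  qed (use A B in simp)
qed

text \<open>
  The Borel-Cantelli lemma: the number of grid levels is of order \<open>k\<close>, and \<open>k / k\<^sup>3\<close> is
  summable.
\<close>

lemma concentrated_on_grids:
  assumes j: "2 \<le> j" and t: "0 < t"
  shows "AE \<omega> in M. \<forall>\<^sub>F k in sequentially. \<forall>i::int. \<bar>i\<bar> \<le> int (K * j * k) \<longrightarrow> concentrated (real j) k (i / (j * k)) t \<omega>"
proof -
  have j2: "2 \<le> real j" using j by simp
  define P where "P i k B \<longleftrightarrow> B \<in> sets M \<and> emeasure M B \<le> ennreal (2 / real (Suc k) ^ 3) \<and> (AE \<omega> in M. \<omega> \<notin> B \<longrightarrow> concentrated j (Suc k) (real_of_int i / (j * Suc k)) t \<omega>)" for i k B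
  have ex: "\<exists>B. P i k B" for i k
    using concentrated_outside_small_set[OF j2 zero_less_Suc t, of k "real_of_int i / (j * Suc k)"] unfolding P_def by blast
  define B where "B i k = (SOME B. P i k B)" for i k
  have "P i k (B i k)" for i k unfolding B_def by (rule someI_ex[OF ex])
  then have B: "\<And>i k. B i k \<in> sets M" "\<And>i k. emeasure M (B i k) \<le> ennreal (2 / real (Suc k) ^ 3)"
    "\<And>i k. AE \<omega> in M. \<omega> \<notin> B i k \<longrightarrow> concentrated j (Suc k) (real_of_int i / (j * Suc k)) t \<omega>"
    unfolding P_def by blast+
  define n where "n k = int (K * j * Suc k)" for k
  define A where "A k = (\<Union>i\<in>{- n k..n k}. B i k)" for k
  have A: "A k \<in> sets M" for k unfolding A_def using B(1) by (intro sets.finite_UN) auto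
  have mA: "measure M (A k) \<le> 2 * (2 * K * j + 1) * (1 / real (Suc k) ^ 2)" for k
  proof -
    have "measure M (A k) \<le> (\<Sum>i\<in>{- n k..n k}. measure M (B i k))"
      unfolding A_def using B(1) by (intro finite_measure_subadditive_finite) auto
    also have "\<dots> \<le> (\<Sum>i\<in>{- n k..n k}. 2 / real (Suc k) ^ 3)"
      using B(2) by (intro sum_mono) (simp add: emeasure_eq_measure)
    also have "\<dots> = (2 * real (K * j) * real (Suc k) + 1) * (2 / real (Suc k) ^ 3)"
      unfolding n_def by (simp add: algebra_simps)
    also have "\<dots> \<le> ((2 * real (K * j) + 1) * real (Suc k)) * (2 / real (Suc k) ^ 3)"
      by (intro mult_right_mono) (auto simp: algebra_simps)
    also have "\<dots> = 2 * (2 * real (K * j) + 1) * (1 / real (Suc k) ^ 2)"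
      by (simp add: power2_eq_square power3_eq_cube del: of_nat_Suc)
    also have "\<dots> = 2 * (2 * K * j + 1) * (1 / real (Suc k) ^ 2)" by simp
    finally show ?thesis .
  qed
  have "summable (\<lambda>k. measure M (A k))"
  proof (rule summable_comparison_test')
    show "summable (\<lambda>k. 2 * (2 * K * j + 1) * (1 / real (Suc k) ^ 2))"
      using inverse_power_summable[of 2, where ?'a = real] 
      by (intro summable_mult) (simp add: summable_Suc_iff[of "\<lambda>k. inverse (real k ^ 2)"] divide_inverse del: of_nat_Suc)
    show "norm (measure M (A k)) \<le> 2 * (2 * K * j + 1) * (1 / real (Suc k) ^ 2)" for k using mA by simp
  qed
  then have bc: "AE \<omega> in M. \<forall>\<^sub>F k in sequentially. \<omega> \<in> space M - A k"
    using A by (intro borel_cantelli_AE1) (auto simp: emeasure_eq_measure)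
  have "AE \<omega> in M. \<forall>i k. \<omega> \<notin> B i k \<longrightarrow> concentrated j (Suc k) (real_of_int i / (j * Suc k)) t \<omega>"
    using B(3) by (simp add: AE_all_countable)
  with bc show ?thesis
  proof eventually_elim
    case (elim \<omega>)
    from elim(1) have "\<forall>\<^sub>F k in sequentially. \<forall>i::int. \<bar>i\<bar> \<le> int (K * j * Suc k) \<longrightarrow> concentrated (real j) (Suc k) (i / (j * Suc k)) t \<omega>"
    proof eventually_elim
      case (elim k)
      show ?case
      proof (intro allI impI)
        fix i assume "\<bar>i\<bar> \<le> int (K * j * Suc k)"
        then have "i \<in> {- n k..n k}" unfolding n_def[symmetric] by auto
        then have "\<omega> \<notin> B i k" using elim unfolding A_def by blast
        then show "concentrated (real j) (Suc k) (i / (j * Suc k)) t \<omega>" using \<open>\<forall>i k. _ i k\<close> by simp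
      qed
    qed
    then show ?case by (rule eventually_sequentially_Suc[THEN iffD1])
  qed
qed

definition sandwiched :: "(real \<Rightarrow> real \<Rightarrow> 'w \<Rightarrow> real) \<Rightarrow> nat \<Rightarrow> nat \<Rightarrow> real \<Rightarrow> real \<Rightarrow> 'w \<Rightarrow> bool" where
  "sandwiched Z j k y t \<omega> \<longleftrightarrow> (\<exists>y'. \<bar>y - y'\<bar> \<le> 1 / k \<and>
     mass_count X Z (1 / k) y t \<omega> \<le> ereal (j * (exp (1 / j) - 1) * ((1 / k) powr (- \<alpha>) * smoothed (profile (upper_weight j)) (1 / k) y' t (\<lambda>s. X s \<omega>)) + j * (3 * ln k)) \<and>
     ereal (j * (1 - exp (- (1 / j))) * ((1 / k) powr (- \<alpha>) * smoothed (profile (lower_weight j)) (1 / k) y' t (\<lambda>s. X s \<omega>)) - j * (3 * ln k)) \<le> mass_count X Z (1 / k) y t \<omega>)"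

lemma sandwiched_eventually:
  assumes j: "2 \<le> j" and t: "0 < t" and mp: "AE \<omega> in M. marked_path Z \<omega>"
  shows "AE \<omega> in M. \<forall>\<^sub>F k in sequentially. \<forall>y. \<bar>y\<bar> \<le> real K \<longrightarrow> sandwiched Z j k y t \<omega>"
  using concentrated_on_grids[OF j t, of K] mp
proof eventually_elim
  case (elim \<omega>)
  from elim(1) eventually_gt_at_top[of 0] show ?case
  proof eventually_elim
    case (elim k)
    show ?case
    proof (intro allI impI)
      fix y :: real assume y: "\<bar>y\<bar> \<le> real K"
      have jk: "0 < real (j * k)" "0 < real j" "0 < 1 / real k" using j elim by auto
      \<comment> \<open>The grid level below \<open>y\<close>, at distance less than \<open>h / j\<close>.\<close>
      define i where "i = \<lfloor>y * real (j * k)\<rfloor>"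
      define y' where "y' = i / (real j * real k)"
      have "\<bar>y * real (j * k)\<bar> \<le> real K * real (j * k)" unfolding abs_mult using y by (intro mult_mono) auto
      then have i1: "- real (K * j * k) \<le> y * real (j * k)" "y * real (j * k) \<le> real (K * j * k)" by (auto simp: abs_le_iff mult.assoc)
      have "- int (K * j * k) \<le> i" unfolding i_def le_floor_iff using i1(1) by simp
      moreover have "i \<le> int (K * j * k)" unfolding i_def using i1(2) by linarith
      ultimately have "concentrated (real j) k y' t \<omega>" unfolding y'_def using elim(1) by (auto simp: abs_le_iff)
      note c = this[unfolded concentrated_def]
      have "of_int i \<le> y * real (j * k)" "y * real (j * k) < of_int i + 1" unfolding i_def by linarith+
      then have "y' \<le> y" "y < (of_int i + 1) / real (j * k)" unfolding y'_def using jk(1) by (simp_all add: pos_divide_le_eq pos_less_divide_eq)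
      moreover have "(of_int i + 1) / real (j * k) = y' + 1 / real (j * k)" unfolding y'_def by (simp add: add_divide_distrib)
      ultimately have yy: "\<bar>y - y'\<bar> < 1 / k / j" by (simp add: mult.commute)
      also have "1 / k / j \<le> 1 / k" using j jk by (simp add: field_simps)
      finally have "\<bar>y - y'\<bar> \<le> 1 / k" by simp
      then show "sandwiched Z j k y t \<omega>" unfolding sandwiched_def
      proof (intro exI[of _ y'] conjI)
        show "mass_count X Z (1 / k) y t \<omega> \<le> ereal (j * (exp (1 / j) - 1) * ((1 / k) powr (- \<alpha>) * smoothed (profile (upper_weight j)) (1 / k) y' t (\<lambda>s. X s \<omega>)) + j * (3 * ln k))"
          by (rule mass_count_upper[OF \<open>marked_path Z \<omega>\<close> jk(3,2) less_imp_le[OF yy]]) (use c in blast)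
        show "ereal (j * (1 - exp (- (1 / j))) * ((1 / k) powr (- \<alpha>) * smoothed (profile (lower_weight j)) (1 / k) y' t (\<lambda>s. X s \<omega>)) - j * (3 * ln k)) \<le> mass_count X Z (1 / k) y t \<omega>"
          by (rule order_trans[OF _ mass_count_lower[OF \<open>marked_path Z \<omega>\<close> jk(3,2) yy]]) (use c in simp)
      qed
    qed
  qed
qed

end


section \<open>From discrete scales and times to uniform convergence\<close>

lemma quarter_share: "0 < x \<Longrightarrow> \<epsilon> / (4 * x) * x = (\<epsilon> :: real) / 4"
  by simp

text \<open>
  Between \<open>1 / (k + 1)\<close> and \<open>1 / k\<close> the function \<open>n\<close> is enclosed by its values at the ends, and
  \<open>h powr \<alpha>\<close> changes by a factor that tends to \<open>1\<close>.
\<close>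

lemma continuous_scale_limit:
  fixes n :: "real \<Rightarrow> 'y \<Rightarrow> real" and l :: "'y \<Rightarrow> real"
  assumes \<alpha>: "0 < \<alpha>" and c: "0 \<le> c"
    and n: "\<And>h y. 0 \<le> n h y" "\<And>h h' y. 0 < h \<Longrightarrow> h \<le> h' \<Longrightarrow> n h' y \<le> n h y"
    and l: "\<And>y. 0 \<le> l y" "\<And>y. l y \<le> B"
    and lim: "\<And>e. 0 < e \<Longrightarrow> \<forall>\<^sub>F k in sequentially. \<forall>y. \<bar>c * (1 / real k) powr \<alpha> * n (1 / real k) y - l y\<bar> \<le> e"
    and e: "0 < e"
  shows "\<exists>h0>0. \<forall>h y. 0 < h \<longrightarrow> h < h0 \<longrightarrow> \<bar>c * h powr \<alpha> * n h y - l y\<bar> \<le> e"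
proof -
  define d where "d = e / (4 * (\<bar>B\<bar> + e + 1))"
  have d: "0 < d" "d * (\<bar>B\<bar> + e / 4) \<le> e / 4"
  proof -
    show "0 < d" using e by (simp add: d_def)
    have "d * (\<bar>B\<bar> + e / 4) \<le> d * (\<bar>B\<bar> + e + 1)" using \<open>0 < d\<close> e by (intro mult_left_mono) auto
    also have "\<dots> = e / 4"
unfolding d_def using e by (intro quarter_share) simp
    finally show "d * (\<bar>B\<bar> + e / 4) \<le> e / 4" .
  qed
  have "(\<lambda>k. (real (Suc k) / real k) powr \<alpha>) \<longlonglongrightarrow> 1 powr \<alpha>"
  proof (rule tendsto_powr)
    show "(\<lambda>k. real (Suc k) / real k) \<longlonglongrightarrow> 1" by real_asymp
  qed auto
  then have "\<forall>\<^sub>F k in sequentially. (real (Suc k) / real k) powr \<alpha> < 1 + d"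
    using d by (intro order_tendstoD(2)) auto
  moreover have "\<forall>\<^sub>F k in sequentially. \<forall>y. \<bar>c * (1 / real k) powr \<alpha> * n (1 / real k) y - l y\<bar> \<le> e / 4"
    using e by (intro lim) simp
  ultimately have "\<forall>\<^sub>F k in sequentially. 0 < k \<and> (real (Suc k) / real k) powr \<alpha> < 1 + d \<and>
      (\<forall>y. \<bar>c * (1 / real k) powr \<alpha> * n (1 / real k) y - l y\<bar> \<le> e / 4)"
    using eventually_gt_at_top[of 0] by eventually_elim auto
  then obtain k0 where k0: "\<And>k. k0 \<le> k \<Longrightarrow> 0 < k \<and> (real (Suc k) / real k) powr \<alpha> < 1 + d \<and>
      (\<forall>y. \<bar>c * (1 / real k) powr \<alpha> * n (1 / real k) y - l y\<bar> \<le> e / 4)"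
    unfolding eventually_sequentially by blast
  show ?thesis
  proof (intro exI[of _ "1 / (real k0 + 1)"] conjI allI impI)
    show "0 < 1 / (real k0 + 1)" by simp
    fix h y assume h: "0 < h" "h < 1 / (real k0 + 1)"
    define k where "k = nat \<lfloor>1 / h\<rfloor>"
    have "real k0 + 1 < 1 / h" using h by (simp add: field_simps)
    then have kk: "real k \<le> 1 / h" "1 / h < real k + 1" "k0 \<le> k" unfolding k_def by linarith+
    have k: "0 < k" "(real (Suc k) / real k) powr \<alpha> < 1 + d" "\<bar>c * (1 / real k) powr \<alpha> * n (1 / real k) y - l y\<bar> \<le> e / 4"
      "\<bar>c * (1 / real (Suc k)) powr \<alpha> * n (1 / real (Suc k)) y - l y\<bar> \<le> e / 4"
      using k0[OF kk(3)] k0[OF le_SucI[OF kk(3)]] by auto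
    define q where "q = (real (Suc k) / real k) powr \<alpha>"
    define u where "u = c * (1 / real (Suc k)) powr \<alpha> * n (1 / real (Suc k)) y"
    define v where "v = c * (1 / real k) powr \<alpha> * n (1 / real k) y"
    have q: "1 \<le> q" "q \<le> 1 + d" unfolding q_def using k \<alpha> by (auto intro!: ge_one_powr_ge_zero)
    have uv: "0 \<le> u" "0 \<le> v" unfolding u_def v_def using c n(1) by auto
    have uvl: "\<bar>u - l y\<bar> \<le> e / 4" "\<bar>v - l y\<bar> \<le> e / 4" using k by (auto simp: u_def v_def)
    have hk: "h \<le> 1 / real k" "1 / real (Suc k) \<le> h" using kk h k(1) by (auto simp: field_simps)
    have sc: "(1 / real k) powr \<alpha> = q * (1 / real (Suc k)) powr \<alpha>"
      unfolding q_def using k(1) by (subst powr_mult[symmetric]) (auto simp del: of_nat_Suc)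
    have "c * h powr \<alpha> * n h y \<le> c * (1 / real k) powr \<alpha> * n (1 / real (Suc k)) y"
      using c h hk \<alpha> n by (intro mult_mono powr_mono2) auto
    also have "\<dots> = q * u" unfolding sc u_def by simp
    finally have up: "c * h powr \<alpha> * n h y \<le> q * u" .
    have "q * u \<le> (1 + d) * u" using q uv by (intro mult_right_mono) auto
    moreover have "(1 + d) * u = u + d * u" by (simp add: algebra_simps)
    moreover have "u \<le> \<bar>B\<bar> + e / 4" using l(2)[of y] uvl by linarith
    then have "d * u \<le> d * (\<bar>B\<bar> + e / 4)" using d(1) by (intro mult_left_mono) auto
    ultimately have 1: "c * h powr \<alpha> * n h y \<le> l y + e" using up d(2) uvl by linarith
    have "v = q * (c * (1 / real (Suc k)) powr \<alpha> * n (1 / real k) y)" unfolding sc v_def by simp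
    also have "c * (1 / real (Suc k)) powr \<alpha> * n (1 / real k) y \<le> c * h powr \<alpha> * n h y"
      using c h hk \<alpha> n by (intro mult_mono powr_mono2) (auto simp del: of_nat_Suc)
    finally have lo: "v \<le> q * (c * h powr \<alpha> * n h y)" using q by (simp add: mult_left_mono)
    have "l y - e \<le> c * h powr \<alpha> * n h y"
    proof (rule ccontr)
      assume "\<not> l y - e \<le> c * h powr \<alpha> * n h y"
      then have a: "c * h powr \<alpha> * n h y < l y - e" by simp
      have a0: "0 \<le> c * h powr \<alpha> * n h y" using c n(1) by auto
      have "q * (c * h powr \<alpha> * n h y) \<le> (1 + d) * (c * h powr \<alpha> * n h y)" using q a0 by (intro mult_right_mono) auto
      moreover have "(1 + d) * (c * h powr \<alpha> * n h y) = c * h powr \<alpha> * n h y + d * (c * h powr \<alpha> * n h y)"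
        by (simp add: distrib_right)
      moreover have "c * h powr \<alpha> * n h y \<le> \<bar>B\<bar> + e / 4" using l(2)[of y] a e by linarith
      then have "d * (c * h powr \<alpha> * n h y) \<le> d * (\<bar>B\<bar> + e / 4)" using d(1) by (intro mult_left_mono) auto
      ultimately have "v \<le> c * h powr \<alpha> * n h y + e / 4" using lo d(2) by linarith
      then show False using a uvl e by linarith
    qed
    with 1 show "\<bar>c * h powr \<alpha> * n h y - l y\<bar> \<le> e" by linarith
  qed
qed

text \<open>Pointwise convergence of monotone functions to a continuous limit is locally uniform.\<close>

lemma uniform_in_time:
  fixes g :: "real \<Rightarrow> 'y \<Rightarrow> real \<Rightarrow> real" and l :: "'y \<Rightarrow> real \<Rightarrow> real"
  assumes T: "0 < T" and mono: "\<And>h y s t. 0 < h \<Longrightarrow> 0 \<le> s \<Longrightarrow> s \<le> t \<Longrightarrow> g h y s \<le> g h y t"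
    and l_uniform: "\<And>e. 0 < e \<Longrightarrow> \<exists>d>0. \<forall>y. \<forall>s\<in>{0..T + 1}. \<forall>t\<in>{0..T + 1}. \<bar>s - t\<bar> < d \<longrightarrow> \<bar>l y s - l y t\<bar> < e"
    and start: "\<And>h y. 0 < h \<Longrightarrow> g h y 0 = l y 0"
    and lim: "\<And>t e. t \<in> \<rat> \<Longrightarrow> 0 < t \<Longrightarrow> 0 < e \<Longrightarrow> \<exists>h0>0. \<forall>h y. 0 < h \<longrightarrow> h < h0 \<longrightarrow> \<bar>g h y t - l y t\<bar> \<le> e"
    and e: "0 < e"
  shows "\<exists>h0>0. \<forall>h y. \<forall>t\<in>{0..T}. 0 < h \<longrightarrow> h < h0 \<longrightarrow> \<bar>g h y t - l y t\<bar> \<le> e"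
proof -
  have e2: "0 < e / 2" using e by simp
  obtain d where d: "0 < d" "\<And>y s t. s \<in> {0..T + 1} \<Longrightarrow> t \<in> {0..T + 1} \<Longrightarrow> \<bar>s - t\<bar> < d \<Longrightarrow> \<bar>l y s - l y t\<bar> < e / 2"
    using l_uniform[OF e2] by blast
  \<comment> \<open>A grid of rational times that is finer than the modulus of continuity of the limit.\<close>
  obtain r where r: "r \<in> \<rat>" "0 < r" "r < min d 1" using Rats_dense_in_real[of 0 "min d 1"] d by auto
  define Q where "Q = nat \<lceil>T / r\<rceil>"
  have "\<exists>h0>0. \<forall>h y. 0 < h \<longrightarrow> h < h0 \<longrightarrow> \<bar>g h y (real q * r) - l y (real q * r)\<bar> \<le> e / 2" for q
  proof (cases "q = 0")
    case True
    then show ?thesis using start e by (intro exI[of _ 1]) auto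
  next
    case False
    then show ?thesis using r e2 by (intro lim) auto
  qed
  then obtain H where H: "\<And>q. 0 < H q" "\<And>q h y. 0 < h \<Longrightarrow> h < H q \<Longrightarrow> \<bar>g h y (real q * r) - l y (real q * r)\<bar> \<le> e / 2"
    by metis
  define h0 where "h0 = Min (H ` {..Q})"
  show ?thesis
  proof (intro exI[of _ h0] conjI allI impI ballI)
    show "0 < h0" unfolding h0_def using H(1) by (subst Min_gr_iff) auto
    fix h y t assume t: "t \<in> {0..T}" and h: "0 < h" "h < h0"
    have hq: "h < H q" if "q \<le> Q" for q using h(2) that unfolding h0_def by (subst (asm) Min_gr_iff) auto
    define a where "a = nat \<lfloor>t / r\<rfloor>"
    define b where "b = nat \<lceil>t / r\<rceil>"
    have tr: "0 \<le> t / r" "t / r \<le> T / r" using t r by (auto simp: divide_right_mono)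
    have "b \<le> Q" unfolding b_def Q_def using tr by (intro nat_mono ceiling_mono)
    moreover have ab: "real a \<le> t / r" "t / r < real a + 1" "t / r \<le> real b" "real b < t / r + 1" using tr(1) by (simp_all add: a_def b_def) linarith+
    ultimately have aQ: "a \<le> Q" "b \<le> Q" by linarith+
    have ab': "real a * r \<le> t" "t < real a * r + r" "t \<le> real b * r" "real b * r < t + r"
      using ab r(2) by (simp_all add: field_simps)
    have "g h y (real a * r) \<le> g h y t" "g h y t \<le> g h y (real b * r)"
      using ab' h t r by (auto intro!: mono)
    moreover have "\<bar>g h y (real a * r) - l y (real a * r)\<bar> \<le> e / 2" "\<bar>g h y (real b * r) - l y (real b * r)\<bar> \<le> e / 2"
      using H(2) h hq aQ by auto
    moreover have "\<bar>l y (real a * r) - l y t\<bar> < e / 2" "\<bar>l y (real b * r) - l y t\<bar> < e / 2"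
      using d(2)[of "real a * r" t y] d(2)[of "real b * r" t y] ab' r t by (auto simp: abs_less_iff)
    ultimately show "\<bar>g h y t - l y t\<bar> \<le> e" by linarith
  qed
qed

lemma mass_count_antimono:
  assumes "h \<le> h'" "t \<le> t'"
  shows "mass_count X Z h' y t \<omega> \<le> mass_count X Z h y t' \<omega>"
proof -
  have "emeasure (count_space UNIV) {s \<in> {0..t}. h' \<le> Z s (y - left_limit (\<lambda>u. X u \<omega>) s) \<omega>}
     \<le> emeasure (count_space UNIV) {s \<in> {0..t'}. h \<le> Z s (y - left_limit (\<lambda>u. X u \<omega>) s) \<omega>}"
    using assms by (intro emeasure_mono) auto
  then show ?thesis unfolding mass_count_def by (simp add: less_eq_ennreal.rep_eq)
qed

lemma mass_count_nonneg: "0 \<le> mass_count X Z h y t \<omega>"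
  unfolding mass_count_def by (rule enn2ereal_nonneg)

context marked_levy
begin

text \<open>
  A counted jump passes over the level \<open>y\<close>, so \<open>y\<close> lies between two values of the path or its left
  limits; there is no jump at time \<open>0\<close>.
\<close>

lemma mass_count_outside:
  assumes mp: "marked_path Z \<omega>" and h: "0 < h" and K: "\<And>s. s \<in> {0..t} \<Longrightarrow> \<bar>X s \<omega>\<bar> \<le> K" and y: "t \<le> 0 \<or> K < \<bar>y\<bar>"
  shows "mass_count X Z h y t \<omega> = 0"
proof -
  let ?l = "left_limit (\<lambda>u. X u \<omega>)"
  have "\<not> h \<le> Z s (y - ?l s) \<omega>" if s: "s \<in> {0..t}" for s
  proof
    assume a: "h \<le> Z s (y - ?l s) \<omega>"
    have s0: "0 \<le> s" using s by simp
    obtain n where n: "0 < s" "0 < y - ?l s" "y - ?l s < jump (\<lambda>u. X u \<omega>) s"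
      by (rule counted_jump[OF mp h s0 a]) blast
    have "cadlag (\<lambda>u. X u \<omega>)" using mp by (simp add: marked_path_def)
    then have lim: "((\<lambda>u. X u \<omega>) \<longlongrightarrow> ?l s) (at_left s)" using n(1) by (rule cadlag_left_limit)
    have "\<forall>\<^sub>F u in at_left s. - K \<le> X u \<omega>"
      using eventually_at_left_real[OF n(1)] 
    proof eventually_elim
      case (elim u)
      then have "\<bar>X u \<omega>\<bar> \<le> K" using s by (intro K) auto
      then show ?case by (simp add: abs_le_iff)
    qed
    then have "- K \<le> ?l s" by (rule tendsto_lowerbound[OF lim]) simp
    moreover have "y < X s \<omega>" using n(3) by (simp add: jump_def)
    moreover have "X s \<omega> \<le> K" using K[OF s] by simp
    ultimately show False using y n s by auto
  qed
  then have "{s \<in> {0..t}. h \<le> Z s (y - ?l s) \<omega>} = {}" by blast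
  then show ?thesis unfolding mass_count_def by (simp only: emeasure_empty zero_ennreal.rep_eq)
qed

lemma lower_profile_integrable: "1 \<le> j \<Longrightarrow> integrable lborel (profile (lower_weight j))"
proof -
  assume j: "1 \<le> j"
  then obtain B where B: "\<forall>r. intensity (lower_weight j) r \<le> ennreal B" using intensity_lower_finite(1)[of j] by auto
  show ?thesis
  proof (rule profile_integral(1))
    show "(\<lambda>(x, r, p). lower_weight j x r p) \<in> borel_measurable weight_space"
      using j by (intro lower_weight_joint') simp
    show "intensity (lower_weight j) r < \<infinity>" for r using B by (auto intro: le_less_trans)
    show "(\<integral>\<^sup>+r. intensity (lower_weight j) r \<partial>lborel) < \<infinity>" using j by (intro intensity_lower_finite(2)) simp
  qed
qed

text \<open>
  Between the bounds of \<open>sandwiched\<close>, the integrals of the profiles against the path are close to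
  multiples of the local time, by \<open>approximate_identity\<close>. The multiples are close to \<open>1\<close>, and the
  term \<open>3 j ln k\<close> disappears after division by \<open>k powr \<alpha>\<close>.
\<close>

lemma limit_along_reciprocals:
  assumes mp: "marked_path Z \<omega>" and t: "0 < t" and od: "occupation_density (\<lambda>s. X s \<omega>) l"
    and sw: "\<And>j K. 2 \<le> j \<Longrightarrow> \<forall>\<^sub>F k in sequentially. \<forall>y. \<bar>y\<bar> \<le> real K \<longrightarrow> sandwiched Z j k y t \<omega>"
    and \<epsilon>: "0 < \<epsilon>"
  shows "\<forall>\<^sub>F k in sequentially. \<forall>y. mass_count X Z (1 / real k) y t \<omega> < \<infinity> \<and>
     \<bar>Gamma (1 - \<alpha>) * (1 / real k) powr \<alpha> * real_of_ereal (mass_count X Z (1 / real k) y t \<omega>) - l y t\<bar> \<le> \<epsilon>"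
proof -
  interpret occupation_density "\<lambda>s. X s \<omega>" l by (rule od)
  have t0: "0 \<le> t" using t by simp
  have Gam: "0 < Gamma (1 - \<alpha>)" using \<alpha> by (intro Gamma_real_pos) auto
  obtain K0 where "\<And>s. s \<in> {0..t} \<Longrightarrow> \<bar>X s \<omega>\<bar> \<le> K0" using cadlag_bounded[OF cad] by blast
  moreover obtain K :: nat where "K0 \<le> real K" using real_arch_simple by blast
  ultimately have K: "\<And>s. s \<in> {0..t} \<Longrightarrow> \<bar>X s \<omega>\<bar> \<le> real K" by (meson order_trans)
  obtain B where B: "0 \<le> B" "\<And>y. l y t \<le> B" using L_bounded[OF t0] by blast
  define d where "d = \<epsilon> / (4 * (B + 1))"
  have d: "0 < d" "d * (B + 1) = \<epsilon> / 4"
    unfolding d_def using quarter_share[of "B + 1" \<epsilon>] \<epsilon> B(1) by simp_all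
  have dl: "d * l y t \<le> \<epsilon> / 4" for y
    using mult_left_mono[of "l y t" "B + 1" d] B(2)[of y] d by simp
  obtain j where j: "2 \<le> j" and intU: "integrable lborel (profile (upper_weight (real j)))"
    and cU: "Gamma (1 - \<alpha>) * (j * (exp (1 / j) - 1)) * (LINT r|lborel. profile (upper_weight j) r) \<le> 1 + d"
    and cL: "1 - d \<le> Gamma (1 - \<alpha>) * (j * (1 - exp (- (1 / j)))) * (LINT r|lborel. profile (lower_weight j) r)"
    using sharp_profiles[OF d(1)] by blast
  have j1: "1 \<le> real j" "2 \<le> real j" using j by auto
  define u where "u = Gamma (1 - \<alpha>) * (j * (exp (1 / j) - 1))"
  define v where "v = Gamma (1 - \<alpha>) * (j * (1 - exp (- (1 / j))))"
  have uv: "0 \<le> u" "0 \<le> v" using Gam by (auto simp: u_def v_def)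
  define d' where "d' = \<epsilon> / (4 * (u + v + 1))"
  have "(u + v + 1) * d' = \<epsilon> / 4" "0 < d'"
    unfolding d'_def using quarter_share[of "u + v + 1" \<epsilon>] uv \<epsilon> by (simp_all add: mult.commute)
  moreover have "u * d' \<le> (u + v + 1) * d'" "v * d' \<le> (u + v + 1) * d'"
    using uv \<open>0 < d'\<close> by (auto intro!: mult_right_mono)
  ultimately have d': "0 < d'" "u * d' \<le> \<epsilon> / 4" "v * d' \<le> \<epsilon> / 4" by linarith+
  let ?IU = "LINT r|lborel. profile (upper_weight j) r" and ?IL = "LINT r|lborel. profile (lower_weight j) r"
  let ?SU = "\<lambda>k y. smoothed (profile (upper_weight j)) (1 / real k) y t (\<lambda>s. X s \<omega>)"
  let ?SL = "\<lambda>k y. smoothed (profile (lower_weight j)) (1 / real k) y t (\<lambda>s. X s \<omega>)"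
  obtain CU where CU: "\<And>r. profile (upper_weight j) r \<le> CU" using profile_bounded(2)[OF j1(2)] by blast
  obtain CL where CL: "\<And>r. profile (lower_weight j) r \<le> CL" using profile_bounded(1)[OF j1(1)] by blast
  obtain hU where hU: "0 < hU" "\<And>h y y'. 0 < h \<Longrightarrow> h < hU \<Longrightarrow> \<bar>y - y'\<bar> \<le> h \<Longrightarrow>
      \<bar>smoothed (profile (upper_weight j)) h y' t (\<lambda>s. X s \<omega>) - ?IU * l y t\<bar> \<le> d'"
    using approximate_identity[OF t0 intU profile_nonneg CU d'(1)] unfolding smoothed_def by blast
  obtain hL where hL: "0 < hL" "\<And>h y y'. 0 < h \<Longrightarrow> h < hL \<Longrightarrow> \<bar>y - y'\<bar> \<le> h \<Longrightarrow>
      \<bar>smoothed (profile (lower_weight j)) h y' t (\<lambda>s. X s \<omega>) - ?IL * l y t\<bar> \<le> d'"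
    using approximate_identity[OF t0 lower_profile_integrable[OF j1(1)] profile_nonneg CL d'(1)] unfolding smoothed_def by blast
  have "(\<lambda>k. 1 / real k) \<longlonglongrightarrow> 0" by real_asymp
  then have small: "\<forall>\<^sub>F k in sequentially. 1 / real k < min hU hL" using hU hL by (intro order_tendstoD(2)) auto
  have "(\<lambda>k. (Gamma (1 - \<alpha>) * j * 3) * (ln (real k) * (1 / real k) powr \<alpha>)) \<longlonglongrightarrow> (Gamma (1 - \<alpha>) * j * 3) * 0"
    using \<alpha> by (intro tendsto_mult_left) real_asymp
  then have noise: "\<forall>\<^sub>F k in sequentially. (Gamma (1 - \<alpha>) * j * 3) * (ln (real k) * (1 / real k) powr \<alpha>) < \<epsilon> / 4"
    using \<epsilon> by (intro order_tendstoD(2)[of _ 0]) auto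
  show ?thesis
    using sw[OF j, of K] small noise eventually_gt_at_top[of 0]
  proof eventually_elim
    case (elim k)
    define h where "h = 1 / real k"
    have h: "0 < h" "h < hU" "h < hL" using elim by (auto simp: h_def)
    have hp: "0 < h powr \<alpha>" "h powr \<alpha> * h powr (- \<alpha>) = 1" using h by (auto simp: powr_minus)
    have no: "(Gamma (1 - \<alpha>) * h powr \<alpha>) * (j * (3 * ln k)) \<le> \<epsilon> / 4" using elim by (simp add: h_def mult_ac)
    show ?case
    proof
      fix y
      let ?N = "mass_count X Z (1 / real k) y t \<omega>"
      show "?N < \<infinity> \<and> \<bar>Gamma (1 - \<alpha>) * (1 / real k) powr \<alpha> * real_of_ereal ?N - l y t\<bar> \<le> \<epsilon>"
      proof (cases "\<bar>y\<bar> \<le> real K")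
        case False
        then have "?N = 0" "l y t = 0" using elim K by (auto intro!: mass_count_outside[OF mp, of _ _ K] L_outside[OF t0, of K])
        then show ?thesis using \<epsilon> by simp
      next
        case True
        then obtain y' where y': "\<bar>y - y'\<bar> \<le> h"
          and up: "?N \<le> ereal (j * (exp (1 / j) - 1) * (h powr (- \<alpha>) * ?SU k y') + j * (3 * ln k))"
          and lo: "ereal (j * (1 - exp (- (1 / j))) * (h powr (- \<alpha>) * ?SL k y') - j * (3 * ln k)) \<le> ?N"
          using elim unfolding sandwiched_def h_def by blast
        obtain n where n: "?N = ereal n" using up mass_count_nonneg[of X Z "1 / real k" y t \<omega>] by (cases ?N) auto
        have sU: "?SU k y' \<le> ?IU * l y t + d'" and sL: "?IL * l y t - d' \<le> ?SL k y'"
          using hU(2)[OF h(1,2) y'] hL(2)[OF h(1,3) y'] unfolding h_def by linarith+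
        define c where "c = Gamma (1 - \<alpha>) * h powr \<alpha>"
        have c: "0 \<le> c" using Gam by (simp add: c_def)
        have "c * n \<le> c * (j * (exp (1 / j) - 1) * (h powr (- \<alpha>) * ?SU k y') + j * (3 * ln k))"
          using up unfolding n by (intro mult_left_mono c) simp
        also have "\<dots> = u * (h powr \<alpha> * h powr (- \<alpha>)) * ?SU k y' + c * (j * (3 * ln k))"
          unfolding c_def u_def by (simp add: algebra_simps)
        also have "\<dots> \<le> u * (?IU * l y t + d') + \<epsilon> / 4"
          using mult_left_mono[OF sU uv(1)] no unfolding hp c_def by simp
        also have "\<dots> = u * ?IU * l y t + u * d' + \<epsilon> / 4" by (simp add: algebra_simps)
        also have "u * ?IU * l y t \<le> (1 + d) * l y t" using cU L_nonneg[OF t0] unfolding u_def by (intro mult_right_mono) auto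
        finally have 1: "c * n \<le> l y t + \<epsilon>" using dl[of y] d' \<epsilon> by (simp add: distrib_right)
        have "(1 - d) * l y t \<le> v * ?IL * l y t" using cL L_nonneg[OF t0] unfolding v_def by (intro mult_right_mono) auto
        moreover have "v * (?IL * l y t - d') \<le> v * ?SL k y'" by (rule mult_left_mono[OF sL uv(2)])
        moreover have "v * (?IL * l y t - d') = v * ?IL * l y t - v * d'" by (simp add: algebra_simps)
        ultimately have "l y t - \<epsilon> / 4 - \<epsilon> / 4 \<le> v * ?SL k y'" using dl[of y] d' by (simp add: left_diff_distrib)
        also have "v * ?SL k y' = v * (h powr \<alpha> * h powr (- \<alpha>)) * ?SL k y'" using hp by simp
        also have "\<dots> = c * (j * (1 - exp (- (1 / j))) * (h powr (- \<alpha>) * ?SL k y') - j * (3 * ln k)) + c * (j * (3 * ln k))"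
          unfolding c_def v_def by (simp add: algebra_simps)
        also have "\<dots> \<le> c * n + \<epsilon> / 4"
          using lo no unfolding n c_def[symmetric] by (intro add_mono mult_left_mono c) auto
        finally have 2: "l y t - \<epsilon> \<le> c * n" using \<epsilon> by linarith
        show ?thesis using 1 2 unfolding n c_def h_def by (auto simp: abs_le_iff)
      qed
    qed
  qed
qed

lemma uniform_limit_at_zero:
  assumes mp: "marked_path Z \<omega>" and od: "occupation_density (\<lambda>s. X s \<omega>) l"
    and sw: "\<And>j K t. 2 \<le> j \<Longrightarrow> t \<in> \<rat> \<Longrightarrow> 0 < t \<Longrightarrow> \<forall>\<^sub>F k in sequentially. \<forall>y. \<bar>y\<bar> \<le> real K \<longrightarrow> sandwiched Z j k y t \<omega>"
    and T: "0 < T"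
  shows "((\<lambda>h. SUP t\<in>{0..T}. SUP y. \<bar>ereal (Gamma (1 - \<alpha>) * h powr \<alpha>) * mass_count X Z h y t \<omega> - ereal (l y t)\<bar>) \<longlongrightarrow> 0) (at_right 0)"
proof -
  interpret occupation_density "\<lambda>s. X s \<omega>" l by (rule od)
  define n where "n h y t = real_of_ereal (mass_count X Z h y t \<omega>)" for h y t
  have Gam: "0 < Gamma (1 - \<alpha>)" using \<alpha> by (intro Gamma_real_pos) auto
  have fin: "mass_count X Z h y t \<omega> < \<infinity>" if h: "0 < h" for h y t
  proof -
    obtain t' where t': "t' \<in> \<rat>" "max t 0 < t'" "t' < max t 0 + 1" using Rats_dense_in_real[of "max t 0" "max t 0 + 1"] by auto
    then have t0: "0 < t'" "t \<le> t'" by auto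
    have "(\<lambda>k. 1 / real k) \<longlonglongrightarrow> 0" by real_asymp
    then have "\<forall>\<^sub>F k in sequentially. 1 / real k < h" using h by (rule order_tendstoD(2))
    moreover have "\<forall>\<^sub>F k in sequentially. \<forall>y. mass_count X Z (1 / real k) y t' \<omega> < \<infinity> \<and>
        \<bar>Gamma (1 - \<alpha>) * (1 / real k) powr \<alpha> * real_of_ereal (mass_count X Z (1 / real k) y t' \<omega>) - l y t'\<bar> \<le> 1"
      by (rule limit_along_reciprocals[OF mp t0(1) od sw]) (use t'(1) t0(1) in auto)
    ultimately have "\<forall>\<^sub>F k in sequentially. 1 / real k < h \<and> mass_count X Z (1 / real k) y t' \<omega> < \<infinity>"
      by eventually_elim blast
    then obtain k where "1 / real k < h" "mass_count X Z (1 / real k) y t' \<omega> < \<infinity>" by (auto simp: eventually_sequentially)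
    then show ?thesis using mass_count_antimono[of "1 / real k" h t t' X Z y \<omega>] t0 by (auto intro: le_less_trans)
  qed
  have n_eq: "mass_count X Z h y t \<omega> = ereal (n h y t)" if "0 < h" for h y t
    using fin[OF that, of y t] mass_count_nonneg[of X Z h y t \<omega>] unfolding n_def by (cases "mass_count X Z h y t \<omega>") auto
  have n0: "0 \<le> n h y t" for h y t unfolding n_def by (intro real_of_ereal_pos mass_count_nonneg)
  have n_mono: "n h' y t \<le> n h y t'" if "0 < h" "h \<le> h'" "t \<le> t'" for h h' t t' y
    using mass_count_antimono[OF that(2,3), of X Z y \<omega>] n_eq that by simp
  have main: "\<exists>h0>0. \<forall>h y. \<forall>t\<in>{0..T}. 0 < h \<longrightarrow> h < h0 \<longrightarrow> \<bar>Gamma (1 - \<alpha>) * h powr \<alpha> * n h y t - l y t\<bar> \<le> \<epsilon>" if \<epsilon>: "0 < \<epsilon>" for \<epsilon>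
  proof (rule uniform_in_time[OF T _ _ _ _ \<epsilon>])
    show "Gamma (1 - \<alpha>) * h powr \<alpha> * n h y s \<le> Gamma (1 - \<alpha>) * h powr \<alpha> * n h y t" if "0 < h" "s \<le> t" for h y s t
      using Gam n_mono[OF that(1) order_refl that(2)] by (intro mult_left_mono) auto
    show "\<exists>d>0. \<forall>y. \<forall>s\<in>{0..T + 1}. \<forall>t\<in>{0..T + 1}. \<bar>s - t\<bar> < d \<longrightarrow> \<bar>l y s - l y t\<bar> < \<epsilon>" if \<epsilon>: "0 < \<epsilon>" for \<epsilon>
    proof -
      obtain d where "0 < d" "\<And>y y' t t'. \<lbrakk>t \<in> {0..T + 1}; t' \<in> {0..T + 1}; \<bar>y - y'\<bar> < d; \<bar>t - t'\<bar> < d\<rbrakk> \<Longrightarrow> \<bar>l y t - l y' t'\<bar> < \<epsilon>"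
        using L_uniform[of "T + 1" \<epsilon>] T \<epsilon> by auto
      then show ?thesis by (intro exI[of _ d]) auto
    qed
    show "Gamma (1 - \<alpha>) * h powr \<alpha> * n h y 0 = l y 0" if "0 < h" for h y
      using mass_count_outside[OF mp that, of 0 "\<bar>X 0 \<omega>\<bar>" y] L_start[of y] by (simp add: n_def)
    fix t \<epsilon> :: real assume t: "t \<in> \<rat>" "0 < t" and \<epsilon>: "0 < \<epsilon>"
    obtain B where B: "\<And>y. l y t \<le> B" using L_bounded[of t] t by auto
    show "\<exists>h0>0. \<forall>h y. 0 < h \<longrightarrow> h < h0 \<longrightarrow> \<bar>Gamma (1 - \<alpha>) * h powr \<alpha> * n h y t - l y t\<bar> \<le> \<epsilon>"
    proof (rule continuous_scale_limit[OF \<alpha>(1) _ n0 _ _ B _ \<epsilon>])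
      show "0 \<le> l y t" for y using L_nonneg t by simp
      show "n h' y t \<le> n h y t" if "0 < h" "h \<le> h'" for h h' y by (rule n_mono[OF that order_refl])
      fix \<epsilon> :: real assume \<epsilon>: "0 < \<epsilon>"
      show "\<forall>\<^sub>F k in sequentially. \<forall>y. \<bar>Gamma (1 - \<alpha>) * (1 / real k) powr \<alpha> * n (1 / real k) y t - l y t\<bar> \<le> \<epsilon>"
      proof -
        have "\<forall>\<^sub>F k in sequentially. \<forall>y. mass_count X Z (1 / real k) y t \<omega> < \<infinity> \<and>
          \<bar>Gamma (1 - \<alpha>) * (1 / real k) powr \<alpha> * real_of_ereal (mass_count X Z (1 / real k) y t \<omega>) - l y t\<bar> \<le> \<epsilon>"
          by (rule limit_along_reciprocals[OF mp t(2) od sw \<epsilon>]) (use t in auto)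
        then show ?thesis unfolding n_def by eventually_elim blast
      qed
    qed (use Gam in simp)
  qed
  let ?S = "\<lambda>h. SUP t\<in>{0..T}. SUP y. \<bar>ereal (Gamma (1 - \<alpha>) * h powr \<alpha>) * mass_count X Z h y t \<omega> - ereal (l y t)\<bar>"
  show ?thesis
  proof (rule order_tendstoI)
    fix a :: ereal assume a: "a < 0"
    have "0 \<le> ?S h" for h
    proof -
      have "0 \<le> \<bar>ereal (Gamma (1 - \<alpha>) * h powr \<alpha>) * mass_count X Z h 0 0 \<omega> - ereal (l 0 0)\<bar>" by simp
      also have "\<dots> \<le> ?S h" using T by (intro SUP_upper2[of 0 _ "0::ereal"] SUP_upper2[of 0]) auto
      finally show ?thesis .
    qed
    then show "\<forall>\<^sub>F h in at_right 0. a < ?S h" using a by (intro always_eventually allI) (rule less_le_trans)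
  next
    fix a :: ereal assume "0 < a"
    then obtain \<epsilon> where \<epsilon>: "0 < \<epsilon>" "ereal \<epsilon> < a" using ereal_dense2[of 0 a] by auto
    obtain h0 where h0: "0 < h0" "\<And>h y t. t \<in> {0..T} \<Longrightarrow> 0 < h \<Longrightarrow> h < h0 \<Longrightarrow> \<bar>Gamma (1 - \<alpha>) * h powr \<alpha> * n h y t - l y t\<bar> \<le> \<epsilon>"
      using main[OF \<epsilon>(1)] by blast
    have "?S h \<le> ereal \<epsilon>" if h: "0 < h" "h < h0" for h
      using h0(2)[OF _ h] by (intro SUP_least) (simp add: n_eq[OF h(1)])
    then have "?S h < a" if "0 < h" "h < h0" for h using that \<epsilon>(2) by (blast intro: le_less_trans)
    then show "\<forall>\<^sub>F h in at_right 0. ?S h < a"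
      unfolding eventually_at_right_field using h0(1) by blast
  qed
qed

end

theorem theorem28:
  fixes M :: "'w measure" and \<alpha> :: real
    and X :: "real \<Rightarrow> 'w \<Rightarrow> real"
    and Z :: "real \<Rightarrow> real \<Rightarrow> 'w \<Rightarrow> real"
    and L :: "real \<Rightarrow> real \<Rightarrow> 'w \<Rightarrow> real"
  assumes "prob_space M"
    and "0 < \<alpha>" and "\<alpha> < 1"
    and "levy_process M X"
    and "no_negative_jumps M X"
    and "has_laplace_exponent M X (\<lambda>\<eta>. \<eta> powr (1 + \<alpha>) / (Gamma (1 + \<alpha>) * 2 powr \<alpha>))"
    and "besq_marking M \<alpha> X Z"
    and "jointly_continuous_local_times M X L"
  shows "AE \<omega> in M. \<forall>T>0.
    ((\<lambda>h. SUP t\<in>{0..T}. SUP y.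
        \<bar>ereal (Gamma (1 - \<alpha>) * h powr \<alpha>) * mass_count X Z h y t \<omega> - ereal (L y t \<omega>)\<bar>)
      \<longlongrightarrow> 0) (at_right 0)"
proof -
  obtain \<tau> e where \<tau>: "\<And>n. \<tau> n \<in> borel_measurable (process_algebra M {0..} X)"
    and enum: "AE \<omega> in M. \<forall>t\<ge>0. 0 < jump (\<lambda>u. X u \<omega>) t \<longrightarrow> (\<exists>!n::nat. \<tau> n \<omega> = t)"
    and exc: "\<And>n. standard_besq_excursion M \<alpha> (e n)"
    and ind: "prob_space.indep_vars M (\<lambda>_. path_space) (\<lambda>n \<omega>. \<lambda>s\<in>{0..1}. e n s \<omega>) UNIV"
    and indX: "prob_space.indep_set M (sets (process_algebra M {0..} X)) (sets (process_algebra M (UNIV \<times> {0..1}) (\<lambda>(n, s). e n s)))"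
    and marks: "AE \<omega> in M. \<forall>t\<ge>0. \<forall>s. let x = jump (\<lambda>u. X u \<omega>) t in
           (s \<notin> {0<..<x} \<longrightarrow> Z t s \<omega> = 0) \<and>
           (s \<in> {0<..<x} \<longrightarrow> (\<forall>n. \<tau> n \<omega> = t \<longrightarrow> Z t s \<omega> = x * e n (s / x) \<omega>))"
    using assms(7) unfolding besq_marking_def by blast
  interpret marked_levy M \<alpha> X \<tau> e
    by (intro marked_levy.intro stable_levy.intro stable_levy_axioms.intro marked_levy_axioms.intro) (fact assms \<tau> enum exc ind indX)+
  have mp: "AE \<omega> in M. marked_path Z \<omega>"
    using AE_cadlag enumeration AE_paths marks by eventually_elim (simp add: marked_path_def)
  have sw: "AE \<omega> in M. \<forall>j K. \<forall>q::rat. 2 \<le> j \<longrightarrow> 0 < q \<longrightarrow> (\<forall>\<^sub>F k in sequentially. \<forall>y. \<bar>y\<bar> \<le> real K \<longrightarrow> sandwiched Z j k y (of_rat q) \<omega>)"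
    using sandwiched_eventually[OF _ _ mp] by (simp add: AE_all_countable AE_impI)
  have od: "AE \<omega> in M. occupation_density (\<lambda>s. X s \<omega>) (\<lambda>y t. L y t \<omega>)"
    using AE_cadlag assms(8)[unfolded jointly_continuous_local_times_def, THEN conjunct2, THEN conjunct1]
      assms(8)[unfolded jointly_continuous_local_times_def, THEN conjunct2, THEN conjunct2]
    by eventually_elim (rule occupation_density.intro, auto)
  show ?thesis using mp sw od
  proof eventually_elim
    case (elim \<omega>)
    have "\<forall>\<^sub>F k in sequentially. \<forall>y. \<bar>y\<bar> \<le> real K \<longrightarrow> sandwiched Z j k y t \<omega>" if "2 \<le> j" "t \<in> \<rat>" "0 < t" for j K t
      using elim(2) that by (auto elim!: Rats_cases)
    then show ?case using uniform_limit_at_zero[OF elim(1,3)] by blast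
  qed
qed

end
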